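(* Let $R$ be a commutative ring, let $A$ be a (strongly commutative) DG $R$-algebra, and let $n$ be a positive integer. Assume that one of the following two cases holds: (a) $B=A[X_1,\ldots,X_n]$ is a polynomial extension of $A$, where $X_1,\ldots,X_n$ are variables of positive degrees; or (b) $A$ is a divided power DG $R$-algebra and $B=A\langle X_1,\ldots,X_n\rangle$ is a free extension of $A$ obtained by adjunction of variables $X_1,\ldots,X_n$ of positive degrees. In either case, if $N$ is a bounded below semifree DG $B$-module with $\operatorname{Ext}^i_B(N,N)=0$ for all $i>0$, then $N$ is naïvely liftable to $A$. Moreover, $N$ is a direct summand of a DG $B$-module that is liftable to $A$.
   Context: DG algebras. A DG $R$-algebra $A$ is a non-negatively graded $R$-algebra $A=\bigoplus_{n\ge 0}A_n$ with $ab=(-1)^{|a||b|}ba$ for homogeneous $a,b$ and $a^2=0$ when $|a|$ is odd, with an $R$-linear differential $d^A$ of degree $-1$, $(d^A)^2=0$, satisfying $d^A(ab)=d^A(a)b+(-1)^{|a|}a\,d^A(b)$. Divided powers. A graded $R$-algebra $U$ (graded commutative, i.e. $uv=(-1)^{|u||v|}vu$ for homogeneous $u,v\in U$ and $u^2=0$ when $|u|$ is odd) is a divided power algebra if to each $u\in U$ with $|u|$ positive and even there is associated a sequence $u^{(i)}\in U$ ($i\ge 0$) with: (1) $u^{(0)}=1$, $u^{(1)}=u$, $|u^{(i)}|=i|u|$; (2) $u^{(i)}u^{(j)}=\binom{i+j}{i}u^{(i+j)}$; (3) $(u+v)^{(i)}=\sum_j u^{(j)}v^{(i-j)}$; (4)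 for $i\ge 2$, $(vw)^{(i)}=0$ if $|v|,|w|$ are odd, and $(vw)^{(i)}=v^iw^{(i)}$ if $|v|$ is even and $|w|$ is even and positive; (5) $(u^{(i)})^{(j)}=\frac{(ij)!}{j!(i!)^j}u^{(ij)}$ for $i\ge1$, $j\ge 0$. A divided power DG $R$-algebra is a DG $R$-algebra whose underlying graded algebra is a divided power algebra. Extensions. For a cycle $t\in A$, the simple free extension $A\langle X\rangle$ is the DG $R$-algebra $\bigoplus_{m\ge 0}X^{(m)}A$ with $|X|=|t|+1$, $dX=t$, $X^{(0)}=1$, $X^{(1)}=X$, with the $X^{(m)}$ forming a free basis, where: if $|X|$ is odd, $X^{(m)}=0$ for $m\ge 2$ (so only $1,X$ are in the basis) and $d(a+Xb)=d^Aa+tb-Xd^Ab$; if $|X|$ is even, $X^{(m)}X^{(\ell)}=\binom{m+\ell}{m}X^{(m+\ell)}$ and $dX^{(m)}=X^{(m-1)}t$ for $m\ge 1$. The simple polynomial extension is $A[X]=\bigoplus_{m\ge 0}X^mA$ with ordinary powers, $|X|=|t|+1$ and $d(X^m)=mX^{m-1}t$ (with $X^2=0$ if $|X|$ is odd, by strong commutativity). The extensions $A\langle X_1,\ldots,X_n\rangle$ and $A[X_1,\ldots,X_n]$ are obtained by iterating: $A^{(0)}=A$, $A^{(i)}=A^{(i-1)}\langle X_i\rangle$ (resp. $A^{(i-1)}[X_i]$) with $dX_i$ a cycle in $A^{(i-1)}$, and $0<|X_1|\le\cdots\le|X_n|$. DG modules. All DG modules are right DG modules: graded modules $M=\bigoplus_{i\in\mathbb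 Z}M_i$ with differential of degree $-1$ satisfying $\partial(ma)=\partial(m)a+(-1)^{|m|}m\,d(a)$. $M$ is bounded below if $M_i=0$ for all $i\ll 0$. A DG $B$-module is semifree if it has a well-ordered subset $F$ that is a basis of the underlying graded $B$-module with $\partial(f)\in\sum_{e<f}eB$ for all $f\in F$. For $N$ semifree, $\operatorname{Ext}^i_B(N,L)=\operatorname{H}_{-i}(\operatorname{Hom}_B(N,L))$. Liftings. A DG $B$-module $N$ is liftable to $A$ if there is a DG $A$-module $M$ with $N\cong M\otimes^{\mathbf L}_AB$ in the derived category $\mathcal D(B)$. For a semifree DG $B$-module $N$ (with $B$ free as a graded $A$-module), let $N|_A$ be $N$ regarded as a DG $A$-module; $N$ is naïvely liftable to $A$ if the DG $B$-module epimorphism $\pi_N\colon N|_A\otimes_AB\to N$, $\pi_N(x\otimes b)=xb$, splits, i.e. there is a DG $B$-module homomorphism $\rho\colon N\to N|_A\otimes_AB$ with $\pi_N\rho=\operatorname{id}_N$. *)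

theory Defs
  imports "HOL-Algebra.Module" "HOL-Algebra.AbelCoset" "HOL-Algebra.Elementary_Groups"
    "HOL-Algebra.Free_Abelian_Groups"
begin

section \<open>Graded abelian groups\<close>

text \<open>The sign \<open>(-1)^k\<close> acting on an abelian group.\<close>

definition sg :: "('a, 'x) ring_scheme \<Rightarrow> 'k::semiring_parity \<Rightarrow> 'a \<Rightarrow> 'a" where
  "sg G k x = (if even k then x else \<ominus>\<^bsub>G\<^esub> x)"

definition decomposes :: "('a, 'x) ring_scheme \<Rightarrow> ('i \<Rightarrow> 'a set) \<Rightarrow> 'a \<Rightarrow> ('i \<Rightarrow> 'a) \<Rightarrow> bool" where
  "decomposes G C x c \<longleftrightarrow>
     (\<forall>i. c i \<in> C i) \<and> finite {i. c i \<noteq> \<zero>\<^bsub>G\<^esub>} \<and> x = (\<Oplus>\<^bsub>G\<^esub>i\<in>{i. c i \<noteq> \<zero>\<^bsub>G\<^esub>}. c i)"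

text \<open>\<open>G\<close> is the internal direct sum of the subgroups \<open>C i\<close>.\<close>

definition graded_by :: "('a, 'x) ring_scheme \<Rightarrow> ('i \<Rightarrow> 'a set) \<Rightarrow> bool" where
  "graded_by G C \<longleftrightarrow>
     (\<forall>i. additive_subgroup (C i) G) \<and> (\<forall>x\<in>carrier G. \<exists>!c. decomposes G C x c)"

text \<open>The additive map sending \<open>x\<close> of degree \<open>i\<close> to \<open>(-1)^i x\<close>; it gives the signs in formulas
  for elements that need not be homogeneous.\<close>

definition twist :: "('a, 'x) ring_scheme \<Rightarrow> ('i::semiring_parity \<Rightarrow> 'a set) \<Rightarrow> 'a \<Rightarrow> 'a" where
  "twist G C x =
     (let c = (THE c. decomposes G C x c) in \<Oplus>\<^bsub>G\<^esub>i\<in>{i. c i \<noteq> \<zero>\<^bsub>G\<^esub>}. sg G i (c i))"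


section \<open>DG algebras\<close>

record ('r, 'a) dg_alg = "('r, 'a) module" +
  agr :: "nat \<Rightarrow> 'a set"
  adiff :: "'a \<Rightarrow> 'a"

locale dg_algebra = module R A + ring A
  for R :: "('r, 'x) ring_scheme" (structure) and A :: "('r, 'a) dg_alg" (structure) +
  assumes smult_mult_left: "\<lbrakk>r \<in> carrier R; a \<in> carrier A; b \<in> carrier A\<rbrakk>
      \<Longrightarrow> (r \<odot>\<^bsub>A\<^esub> a) \<otimes>\<^bsub>A\<^esub> b = r \<odot>\<^bsub>A\<^esub> (a \<otimes>\<^bsub>A\<^esub> b)"
    and smult_mult_right: "\<lbrakk>r \<in> carrier R; a \<in> carrier A; b \<in> carrier A\<rbrakk>
      \<Longrightarrow> a \<otimes>\<^bsub>A\<^esub> (r \<odot>\<^bsub>A\<^esub> b) = r \<odot>\<^bsub>A\<^esub> (a \<otimes>\<^bsub>A\<^esub> b)"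
    and graded: "graded_by A (agr A)"
    and one_agr: "\<one>\<^bsub>A\<^esub> \<in> agr A 0"
    and mult_agr: "\<lbrakk>a \<in> agr A m; b \<in> agr A n\<rbrakk> \<Longrightarrow> a \<otimes>\<^bsub>A\<^esub> b \<in> agr A (m + n)"
    and smult_agr: "\<lbrakk>r \<in> carrier R; a \<in> agr A m\<rbrakk> \<Longrightarrow> r \<odot>\<^bsub>A\<^esub> a \<in> agr A m"
    and graded_comm: "\<lbrakk>a \<in> agr A m; b \<in> agr A n\<rbrakk> \<Longrightarrow> a \<otimes>\<^bsub>A\<^esub> b = sg A (m * n) (b \<otimes>\<^bsub>A\<^esub> a)"
    and odd_square: "\<lbrakk>a \<in> agr A m; odd m\<rbrakk> \<Longrightarrow> a \<otimes>\<^bsub>A\<^esub> a = \<zero>\<^bsub>A\<^esub>"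
    and adiff_closed: "a \<in> carrier A \<Longrightarrow> adiff A a \<in> carrier A"
    and adiff_add: "\<lbrakk>a \<in> carrier A; b \<in> carrier A\<rbrakk>
      \<Longrightarrow> adiff A (a \<oplus>\<^bsub>A\<^esub> b) = adiff A a \<oplus>\<^bsub>A\<^esub> adiff A b"
    and adiff_smult: "\<lbrakk>r \<in> carrier R; a \<in> carrier A\<rbrakk> \<Longrightarrow> adiff A (r \<odot>\<^bsub>A\<^esub> a) = r \<odot>\<^bsub>A\<^esub> adiff A a"
    and adiff_agr_Suc: "a \<in> agr A (Suc m) \<Longrightarrow> adiff A a \<in> agr A m"
    and adiff_agr_0: "a \<in> agr A 0 \<Longrightarrow> adiff A a = \<zero>\<^bsub>A\<^esub>"
    and adiff_adiff: "a \<in> carrier A \<Longrightarrow> adiff A (adiff A a) = \<zero>\<^bsub>A\<^esub>"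
    and adiff_mult: "\<lbrakk>a \<in> agr A m; b \<in> carrier A\<rbrakk>
      \<Longrightarrow> adiff A (a \<otimes>\<^bsub>A\<^esub> b) = adiff A a \<otimes>\<^bsub>A\<^esub> b \<oplus>\<^bsub>A\<^esub> sg A m (a \<otimes>\<^bsub>A\<^esub> adiff A b)"

text \<open>\<open>dp u i\<close> is the divided power \<open>u^(i)\<close>; it is constrained only for \<open>u\<close> homogeneous of
  positive even degree.\<close>

definition divided_powers :: "('r, 'a) dg_alg \<Rightarrow> ('a \<Rightarrow> nat \<Rightarrow> 'a) \<Rightarrow> bool" where
  "divided_powers U dp \<longleftrightarrow>
     (\<forall>n u. 0 < n \<and> even n \<and> u \<in> agr U n \<longrightarrow>
        dp u 0 = \<one>\<^bsub>U\<^esub> \<and> dp u 1 = u \<and> (\<forall>i. dp u i \<in> agr U (i * n))) \<and>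
     (\<forall>n u i j. 0 < n \<and> even n \<and> u \<in> agr U n \<longrightarrow>
        dp u i \<otimes>\<^bsub>U\<^esub> dp u j = add_pow U ((i + j) choose i) (dp u (i + j))) \<and>
     (\<forall>n u v i. 0 < n \<and> even n \<and> u \<in> agr U n \<and> v \<in> agr U n \<longrightarrow>
        dp (u \<oplus>\<^bsub>U\<^esub> v) i = (\<Oplus>\<^bsub>U\<^esub>j\<in>{..i}. dp u j \<otimes>\<^bsub>U\<^esub> dp v (i - j))) \<and>
     (\<forall>m n v w i. 2 \<le> i \<and> odd m \<and> odd n \<and> v \<in> agr U m \<and> w \<in> agr U n \<longrightarrow>
        dp (v \<otimes>\<^bsub>U\<^esub> w) i = \<zero>\<^bsub>U\<^esub>) \<and>
     (\<forall>m n v w i. 2 \<le> i \<and> even m \<and> even n \<and> 0 < n \<and> v \<in> agr U m \<and> w \<in> agr U n \<longrightarrow>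
        dp (v \<otimes>\<^bsub>U\<^esub> w) i = v [^]\<^bsub>U\<^esub> i \<otimes>\<^bsub>U\<^esub> dp w i) \<and>
     (\<forall>n u i j. 0 < n \<and> even n \<and> u \<in> agr U n \<and> 1 \<le> i \<longrightarrow>
        dp (dp u i) j = add_pow U (fact (i * j) div (fact j * fact i ^ j) :: nat) (dp u (i * j)))"

definition divided_power_dg_algebra :: "('r, 'x) ring_scheme \<Rightarrow> ('r, 'a) dg_alg \<Rightarrow> bool" where
  "divided_power_dg_algebra R A \<longleftrightarrow> dg_algebra R A \<and> (\<exists>dp. divided_powers A dp)"


section \<open>Polynomial and free extensions\<close>

definition dg_subalgebra :: "('r, 'x) ring_scheme \<Rightarrow> ('r, 'b) dg_alg \<Rightarrow> ('r, 'b) dg_alg \<Rightarrow> bool" where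
  "dg_subalgebra R A B \<longleftrightarrow>
     dg_algebra R A \<and> dg_algebra R B \<and> carrier A \<subseteq> carrier B \<and>
     \<one>\<^bsub>A\<^esub> = \<one>\<^bsub>B\<^esub> \<and> \<zero>\<^bsub>A\<^esub> = \<zero>\<^bsub>B\<^esub> \<and>
     (\<forall>a\<in>carrier A. \<forall>b\<in>carrier A. a \<oplus>\<^bsub>A\<^esub> b = a \<oplus>\<^bsub>B\<^esub> b \<and> a \<otimes>\<^bsub>A\<^esub> b = a \<otimes>\<^bsub>B\<^esub> b) \<and>
     (\<forall>r\<in>carrier R. \<forall>a\<in>carrier A. r \<odot>\<^bsub>A\<^esub> a = r \<odot>\<^bsub>B\<^esub> a) \<and>
     (\<forall>n. agr A n = carrier A \<inter> agr B n) \<and>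
     (\<forall>a\<in>carrier A. adiff A a = adiff B a)"

text \<open>\<open>B\<close> is the direct sum of the right \<open>A\<close>-modules \<open>p m \<cdot> A\<close> for \<open>m \<in> I\<close>, each free on \<open>p m\<close>.\<close>

definition free_right_basis ::
  "('r, 'b) dg_alg \<Rightarrow> ('r, 'b) dg_alg \<Rightarrow> (nat \<Rightarrow> 'b) \<Rightarrow> nat set \<Rightarrow> bool" where
  "free_right_basis A B p I \<longleftrightarrow>
     (\<forall>y\<in>carrier B. \<exists>!c. (\<forall>m. c m \<in> carrier A) \<and> (\<forall>m. m \<notin> I \<longrightarrow> c m = \<zero>\<^bsub>A\<^esub>) \<and>
        finite {m. c m \<noteq> \<zero>\<^bsub>A\<^esub>} \<and> y = (\<Oplus>\<^bsub>B\<^esub>m\<in>{m. c m \<noteq> \<zero>\<^bsub>A\<^esub>}. p m \<otimes>\<^bsub>B\<^esub> c m))"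

text \<open>\<open>B\<close> arises from its DG subalgebra \<open>A\<close> by adjoining \<open>X\<close> of degree \<open>e = |t| + 1\<close> with \<open>dX = t\<close>
  a cycle of \<open>A\<close>, with \<open>p m\<close> as \<open>m\<close>-th power of \<open>X\<close>. For odd \<open>e\<close> the rule
  \<open>d(a + Xb) = da + tb - X db\<close> is the Leibniz rule of \<open>B\<close>, and so is the formula for \<open>d(X^m)\<close> in a
  polynomial extension with \<open>e\<close> even; for divided powers \<open>d(X^(m))\<close> has to be prescribed.\<close>

definition adjunction ::
  "('r, 'x) ring_scheme \<Rightarrow> ('r, 'b) dg_alg \<Rightarrow> 'b \<Rightarrow> nat \<Rightarrow> (nat \<Rightarrow> 'b) \<Rightarrow> ('r, 'b) dg_alg \<Rightarrow> bool" where
  "adjunction R A X e p B \<longleftrightarrow>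
     dg_subalgebra R A B \<and> 0 < e \<and> X \<in> agr B e \<and>
     adiff B X \<in> agr A (e - 1) \<and> adiff A (adiff B X) = \<zero>\<^bsub>A\<^esub> \<and>
     p 0 = \<one>\<^bsub>B\<^esub> \<and> p 1 = X \<and> (\<forall>m. p m \<in> agr B (m * e)) \<and>
     free_right_basis A B p (if even e then UNIV else {0, 1})"

definition simple_free_ext ::
  "('r, 'x) ring_scheme \<Rightarrow> ('r, 'b) dg_alg \<Rightarrow> 'b \<Rightarrow> nat \<Rightarrow> ('r, 'b) dg_alg \<Rightarrow> bool" where
  "simple_free_ext R A X e B \<longleftrightarrow>
     (\<exists>p. adjunction R A X e p B \<and>
        (if odd e then (\<forall>m\<ge>2. p m = \<zero>\<^bsub>B\<^esub>)
         else (\<forall>m l. p m \<otimes>\<^bsub>B\<^esub> p l = add_pow B ((m + l) choose m) (p (m + l))) \<and>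
              (\<forall>m\<ge>1. adiff B (p m) = p (m - 1) \<otimes>\<^bsub>B\<^esub> adiff B X)))"

definition simple_poly_ext ::
  "('r, 'x) ring_scheme \<Rightarrow> ('r, 'b) dg_alg \<Rightarrow> 'b \<Rightarrow> nat \<Rightarrow> ('r, 'b) dg_alg \<Rightarrow> bool" where
  "simple_poly_ext R A X e B \<longleftrightarrow>
     adjunction R A X e (\<lambda>m::nat. X [^]\<^bsub>B\<^esub> m) B \<and>
     (even e \<longrightarrow> (\<forall>m\<ge>1::nat. adiff B (X [^]\<^bsub>B\<^esub> m) = add_pow B m (X [^]\<^bsub>B\<^esub> (m - 1) \<otimes>\<^bsub>B\<^esub> adiff B X)))"

text \<open>Iterated extensions; the variables are \<open>X 0, \<dots>, X (n - 1)\<close> with degrees \<open>e 0 \<le> \<dots> \<le> e (n - 1)\<close>.\<close>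

definition iterated_ext ::
  "(('r, 'b) dg_alg \<Rightarrow> 'b \<Rightarrow> nat \<Rightarrow> ('r, 'b) dg_alg \<Rightarrow> bool) \<Rightarrow>
   ('r, 'b) dg_alg \<Rightarrow> nat \<Rightarrow> (nat \<Rightarrow> 'b) \<Rightarrow> (nat \<Rightarrow> nat) \<Rightarrow> ('r, 'b) dg_alg \<Rightarrow> bool" where
  "iterated_ext E A n X e B \<longleftrightarrow>
     (\<forall>i j. i \<le> j \<and> j < n \<longrightarrow> e i \<le> e j) \<and>
     (\<exists>C. C 0 = A \<and> C n = B \<and> (\<forall>i<n. E (C i) (X i) (e i) (C (Suc i))))"

definition free_extension ::
  "('r, 'x) ring_scheme \<Rightarrow> ('r, 'b) dg_alg \<Rightarrow> nat \<Rightarrow> (nat \<Rightarrow> 'b) \<Rightarrow> (nat \<Rightarrow> nat) \<Rightarrow> ('r, 'b) dg_alg \<Rightarrow> bool" where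
  "free_extension R = iterated_ext (simple_free_ext R)"

definition polynomial_extension ::
  "('r, 'x) ring_scheme \<Rightarrow> ('r, 'b) dg_alg \<Rightarrow> nat \<Rightarrow> (nat \<Rightarrow> 'b) \<Rightarrow> (nat \<Rightarrow> nat) \<Rightarrow> ('r, 'b) dg_alg \<Rightarrow> bool" where
  "polynomial_extension R = iterated_ext (simple_poly_ext R)"


section \<open>DG modules\<close>

text \<open>Right DG modules. As for \<open>module\<close> in HOL-Algebra, the multiplicative fields inherited from
  the ring record are not used. If \<open>A\<close> is a DG subalgebra of \<open>B\<close> and \<open>N\<close> is a DG \<open>B\<close>-module, then
  \<open>N\<close> restricted to \<open>A\<close> is the same record \<open>N\<close>.\<close>

record ('b, 'm) dg_mod = "'m ring" +
  act :: "'m \<Rightarrow> 'b \<Rightarrow> 'm"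
  mgr :: "int \<Rightarrow> 'm set"
  mdiff :: "'m \<Rightarrow> 'm"

locale dg_module = abelian_group M
  for B :: "('r, 'b) dg_alg" and M :: "('b, 'm) dg_mod" (structure) +
  assumes act_closed: "\<lbrakk>x \<in> carrier M; b \<in> carrier B\<rbrakk> \<Longrightarrow> act M x b \<in> carrier M"
    and act_add_left: "\<lbrakk>x \<in> carrier M; y \<in> carrier M; b \<in> carrier B\<rbrakk>
      \<Longrightarrow> act M (x \<oplus>\<^bsub>M\<^esub> y) b = act M x b \<oplus>\<^bsub>M\<^esub> act M y b"
    and act_add_right: "\<lbrakk>x \<in> carrier M; b \<in> carrier B; c \<in> carrier B\<rbrakk>
      \<Longrightarrow> act M x (b \<oplus>\<^bsub>B\<^esub> c) = act M x b \<oplus>\<^bsub>M\<^esub> act M x c"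
    and act_mult: "\<lbrakk>x \<in> carrier M; b \<in> carrier B; c \<in> carrier B\<rbrakk>
      \<Longrightarrow> act M x (b \<otimes>\<^bsub>B\<^esub> c) = act M (act M x b) c"
    and act_one: "x \<in> carrier M \<Longrightarrow> act M x \<one>\<^bsub>B\<^esub> = x"
    and graded: "graded_by M (mgr M)"
    and act_mgr: "\<lbrakk>x \<in> mgr M i; b \<in> agr B n\<rbrakk> \<Longrightarrow> act M x b \<in> mgr M (i + int n)"
    and mdiff_closed: "x \<in> carrier M \<Longrightarrow> mdiff M x \<in> carrier M"
    and mdiff_add: "\<lbrakk>x \<in> carrier M; y \<in> carrier M\<rbrakk>
      \<Longrightarrow> mdiff M (x \<oplus>\<^bsub>M\<^esub> y) = mdiff M x \<oplus>\<^bsub>M\<^esub> mdiff M y"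
    and mdiff_mgr: "x \<in> mgr M i \<Longrightarrow> mdiff M x \<in> mgr M (i - 1)"
    and mdiff_mdiff: "x \<in> carrier M \<Longrightarrow> mdiff M (mdiff M x) = \<zero>\<^bsub>M\<^esub>"
    and mdiff_act: "\<lbrakk>x \<in> mgr M i; b \<in> carrier B\<rbrakk>
      \<Longrightarrow> mdiff M (act M x b) = act M (mdiff M x) b \<oplus>\<^bsub>M\<^esub> sg M i (act M x (adiff B b))"

definition bounded_below :: "('b, 'm) dg_mod \<Rightarrow> bool" where
  "bounded_below M \<longleftrightarrow> (\<exists>k. \<forall>i<k. mgr M i = {\<zero>\<^bsub>M\<^esub>})"

definition right_span :: "('r, 'b) dg_alg \<Rightarrow> ('b, 'm) dg_mod \<Rightarrow> 'm set \<Rightarrow> 'm set" where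
  "right_span B M E =
     {\<Oplus>\<^bsub>M\<^esub>f\<in>S. act M f (c f) | S c. finite S \<and> S \<subseteq> E \<and> c \<in> S \<rightarrow> carrier B}"

definition right_independent :: "('r, 'b) dg_alg \<Rightarrow> ('b, 'm) dg_mod \<Rightarrow> 'm set \<Rightarrow> bool" where
  "right_independent B M E \<longleftrightarrow>
     (\<forall>S c. finite S \<and> S \<subseteq> E \<and> c \<in> S \<rightarrow> carrier B \<and> (\<Oplus>\<^bsub>M\<^esub>f\<in>S. act M f (c f)) = \<zero>\<^bsub>M\<^esub>
        \<longrightarrow> (\<forall>f\<in>S. c f = \<zero>\<^bsub>B\<^esub>))"

definition semifree :: "('r, 'b) dg_alg \<Rightarrow> ('b, 'm) dg_mod \<Rightarrow> bool" where
  "semifree B M \<longleftrightarrow>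
     dg_module B M \<and>
     (\<exists>F r. F \<subseteq> (\<Union>i. mgr M i) \<and> well_order_on F r \<and>
        right_independent B M F \<and> right_span B M F = carrier M \<and>
        (\<forall>f\<in>F. mdiff M f \<in> right_span B M {e \<in> F. (e, f) \<in> r \<and> e \<noteq> f}))"

definition dg_hom :: "('r, 'b) dg_alg \<Rightarrow> ('b, 'm) dg_mod \<Rightarrow> ('b, 'n) dg_mod \<Rightarrow> ('m \<Rightarrow> 'n) \<Rightarrow> bool" where
  "dg_hom B M N f \<longleftrightarrow>
     f \<in> carrier M \<rightarrow> carrier N \<and>
     (\<forall>x\<in>carrier M. \<forall>y\<in>carrier M. f (x \<oplus>\<^bsub>M\<^esub> y) = f x \<oplus>\<^bsub>N\<^esub> f y) \<and>
     (\<forall>x\<in>carrier M. \<forall>b\<in>carrier B. f (act M x b) = act N (f x) b) \<and>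
     (\<forall>i. f ` mgr M i \<subseteq> mgr N i) \<and>
     (\<forall>x\<in>carrier M. f (mdiff M x) = mdiff N (f x))"

definition dg_submodule :: "('b, 'm) dg_mod \<Rightarrow> 'm set \<Rightarrow> ('b, 'm) dg_mod" where
  "dg_submodule L S = L\<lparr>carrier := S, mgr := \<lambda>i. S \<inter> mgr L i\<rparr>"

text \<open>\<open>N\<close> is isomorphic to \<open>S\<close> for a decomposition \<open>L = S \<oplus> S'\<close> into DG submodules.\<close>

definition direct_summand :: "('r, 'b) dg_alg \<Rightarrow> ('b, 'n) dg_mod \<Rightarrow> ('b, 'm) dg_mod \<Rightarrow> bool" where
  "direct_summand B N L \<longleftrightarrow>
     (\<exists>S S'. S \<subseteq> carrier L \<and> S' \<subseteq> carrier L \<and>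
        dg_module B (dg_submodule L S) \<and> dg_module B (dg_submodule L S') \<and>
        S \<inter> S' = {\<zero>\<^bsub>L\<^esub>} \<and> carrier L = {x \<oplus>\<^bsub>L\<^esub> y | x y. x \<in> S \<and> y \<in> S'} \<and>
        (\<exists>f. dg_hom B N (dg_submodule L S) f \<and> bij_betw f (carrier N) S))"


section \<open>The Hom complex and Ext\<close>

text \<open>Homogeneous \<open>B\<close>-linear maps of degree \<open>p\<close>. As modules are right modules, linearity carries no sign.\<close>

definition Hom_deg :: "('r, 'b) dg_alg \<Rightarrow> ('b, 'm) dg_mod \<Rightarrow> ('b, 'n) dg_mod \<Rightarrow> int \<Rightarrow> ('m \<Rightarrow> 'n) set" where
  "Hom_deg B M N p =
     {f \<in> carrier M \<rightarrow>\<^sub>E carrier N.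
        (\<forall>x\<in>carrier M. \<forall>y\<in>carrier M. f (x \<oplus>\<^bsub>M\<^esub> y) = f x \<oplus>\<^bsub>N\<^esub> f y) \<and>
        (\<forall>x\<in>carrier M. \<forall>b\<in>carrier B. f (act M x b) = act N (f x) b) \<and>
        (\<forall>i. f ` mgr M i \<subseteq> mgr N (i + p))}"

definition Hom_group ::
  "('r, 'b) dg_alg \<Rightarrow> ('b, 'm) dg_mod \<Rightarrow> ('b, 'n) dg_mod \<Rightarrow> int \<Rightarrow> ('m \<Rightarrow> 'n) monoid" where
  "Hom_group B M N p =
     \<lparr>carrier = Hom_deg B M N p,
      monoid.mult = (\<lambda>f g. \<lambda>x\<in>carrier M. f x \<oplus>\<^bsub>N\<^esub> g x),
      one = (\<lambda>x\<in>carrier M. \<zero>\<^bsub>N\<^esub>)\<rparr>"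

definition Hom_diff :: "('b, 'm) dg_mod \<Rightarrow> ('b, 'n) dg_mod \<Rightarrow> int \<Rightarrow> ('m \<Rightarrow> 'n) \<Rightarrow> ('m \<Rightarrow> 'n)" where
  "Hom_diff M N p f = (\<lambda>x\<in>carrier M. mdiff N (f x) \<ominus>\<^bsub>N\<^esub> sg N p (f (mdiff M x)))"

definition Hom_cycles :: "('r, 'b) dg_alg \<Rightarrow> ('b, 'm) dg_mod \<Rightarrow> ('b, 'n) dg_mod \<Rightarrow> int \<Rightarrow> ('m \<Rightarrow> 'n) set" where
  "Hom_cycles B M N p =
     {f \<in> Hom_deg B M N p. Hom_diff M N p f = \<one>\<^bsub>Hom_group B M N (p - 1)\<^esub>}"

definition Hom_boundaries :: "('r, 'b) dg_alg \<Rightarrow> ('b, 'm) dg_mod \<Rightarrow> ('b, 'n) dg_mod \<Rightarrow> int \<Rightarrow> ('m \<Rightarrow> 'n) set" where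
  "Hom_boundaries B M N p = Hom_diff M N (p + 1) ` Hom_deg B M N (p + 1)"

definition Hom_homology ::
  "('r, 'b) dg_alg \<Rightarrow> ('b, 'm) dg_mod \<Rightarrow> ('b, 'n) dg_mod \<Rightarrow> int \<Rightarrow> ('m \<Rightarrow> 'n) set monoid" where
  "Hom_homology B M N p =
     (Hom_group B M N p)\<lparr>carrier := Hom_cycles B M N p\<rparr> Mod Hom_boundaries B M N p"

text \<open>This computes Ext for semifree first argument only.\<close>

definition Ext :: "('r, 'b) dg_alg \<Rightarrow> int \<Rightarrow> ('b, 'm) dg_mod \<Rightarrow> ('b, 'n) dg_mod \<Rightarrow> ('m \<Rightarrow> 'n) set monoid" where
  "Ext B i M N = Hom_homology B M N (- i)"


section \<open>Isomorphism in the derived category\<close>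

definition cycles :: "('b, 'm) dg_mod \<Rightarrow> int \<Rightarrow> 'm set" where
  "cycles M i = {x \<in> mgr M i. mdiff M x = \<zero>\<^bsub>M\<^esub>}"

definition boundaries :: "('b, 'm) dg_mod \<Rightarrow> int \<Rightarrow> 'm set" where
  "boundaries M i = mdiff M ` mgr M (i + 1)"

definition homology :: "('b, 'm) dg_mod \<Rightarrow> int \<Rightarrow> 'm set monoid" where
  "homology M i = (add_monoid M)\<lparr>carrier := cycles M i\<rparr> Mod boundaries M i"

definition homology_map :: "('b, 'n) dg_mod \<Rightarrow> int \<Rightarrow> ('m \<Rightarrow> 'n) \<Rightarrow> 'm set \<Rightarrow> 'n set" where
  "homology_map N i f U = boundaries N i <#>\<^bsub>add_monoid N\<^esub> (f ` U)"

definition quasi_iso :: "('r, 'b) dg_alg \<Rightarrow> ('b, 'm) dg_mod \<Rightarrow> ('b, 'n) dg_mod \<Rightarrow> ('m \<Rightarrow> 'n) \<Rightarrow> bool" where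
  "quasi_iso B M N f \<longleftrightarrow>
     dg_hom B M N f \<and> (\<forall>i. homology_map N i f \<in> iso (homology M i) (homology N i))"

definition homotopic ::
  "('r, 'b) dg_alg \<Rightarrow> ('b, 'm) dg_mod \<Rightarrow> ('b, 'n) dg_mod \<Rightarrow> ('m \<Rightarrow> 'n) \<Rightarrow> ('m \<Rightarrow> 'n) \<Rightarrow> bool" where
  "homotopic B M N f g \<longleftrightarrow>
     (\<exists>h\<in>Hom_deg B M N 1. \<forall>x\<in>carrier M. f x \<ominus>\<^bsub>N\<^esub> g x = mdiff N (h x) \<oplus>\<^bsub>N\<^esub> h (mdiff M x))"

text \<open>The derived category is the localization of the homotopy category at the quasi-isomorphisms,
  described by the calculus of fractions: a morphism \<open>X \<rightarrow> Y\<close> is represented by a roof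
  \<open>X \<leftarrow> Z \<rightarrow> Y\<close> whose left leg is a quasi-isomorphism. All apexes are taken on a type \<open>'z\<close>.\<close>

type_synonym ('b, 'z, 'x, 'y) roof = "('b, 'z) dg_mod \<times> ('z \<Rightarrow> 'x) \<times> ('z \<Rightarrow> 'y)"

fun is_roof ::
  "('r, 'b) dg_alg \<Rightarrow> ('b, 'x) dg_mod \<Rightarrow> ('b, 'y) dg_mod \<Rightarrow> ('b, 'z, 'x, 'y) roof \<Rightarrow> bool" where
  "is_roof B X Y (Z, s, f) \<longleftrightarrow> dg_module B Z \<and> quasi_iso B Z X s \<and> dg_hom B Z Y f"

text \<open>Two roofs represent the same morphism if they have a common refinement up to homotopy.\<close>

fun roof_equiv ::
  "('r, 'b) dg_alg \<Rightarrow> ('b, 'x) dg_mod \<Rightarrow> ('b, 'y) dg_mod \<Rightarrow>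
   ('b, 'z, 'x, 'y) roof \<Rightarrow> ('b, 'w, 'x, 'y) roof \<Rightarrow> bool" where
  "roof_equiv B X Y (Z, s, f) (Z', s', f') \<longleftrightarrow>
     (\<exists>(V :: ('b, 'z) dg_mod) u u'.
        dg_module B V \<and> dg_hom B V Z u \<and> dg_hom B V Z' u' \<and> quasi_iso B V X (s \<circ> u) \<and>
        homotopic B V X (s \<circ> u) (s' \<circ> u') \<and> homotopic B V Y (f \<circ> u) (f' \<circ> u'))"

text \<open>The last argument represents the composite of the first two roofs.\<close>

fun roof_comp ::
  "('r, 'b) dg_alg \<Rightarrow> ('b, 'x) dg_mod \<Rightarrow> ('b, 'y) dg_mod \<Rightarrow> ('b, 'v) dg_mod \<Rightarrow>
   ('b, 'z, 'x, 'y) roof \<Rightarrow> ('b, 'z, 'y, 'v) roof \<Rightarrow> ('b, 'z, 'x, 'v) roof \<Rightarrow> bool" where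
  "roof_comp B X Y V (Z, s, f) (W, t, g) (Q, s', g') \<longleftrightarrow>
     dg_module B Q \<and>
     (\<exists>q p. quasi_iso B Q Z q \<and> dg_hom B Q W p \<and> homotopic B Q Y (f \<circ> q) (t \<circ> p) \<and>
        s' = s \<circ> q \<and> g' = g \<circ> p)"

definition id_roof :: "('b, 'x) dg_mod \<Rightarrow> ('b, 'x, 'x, 'x) roof" where
  "id_roof X = (X, id, id)"

definition derived_iso ::
  "'z itself \<Rightarrow> ('r, 'b) dg_alg \<Rightarrow> ('b, 'x) dg_mod \<Rightarrow> ('b, 'y) dg_mod \<Rightarrow> bool" where
  "derived_iso _ B X Y \<longleftrightarrow>
     (\<exists>(\<phi> :: ('b, 'z, 'x, 'y) roof) (\<psi> :: ('b, 'z, 'y, 'x) roof) \<chi> \<omega>.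
        is_roof B X Y \<phi> \<and> is_roof B Y X \<psi> \<and>
        roof_comp B X Y X \<phi> \<psi> \<chi> \<and> roof_equiv B X X \<chi> (id_roof X) \<and>
        roof_comp B Y X Y \<psi> \<phi> \<omega> \<and> roof_equiv B Y Y \<omega> (id_roof Y))"


section \<open>Base change\<close>

text \<open>\<open>M \<otimes>\<^sub>A B\<close> for a DG \<open>A\<close>-module \<open>M\<close> and a DG subalgebra \<open>A\<close> of \<open>B\<close>: the free abelian group on
  pairs modulo the balancing relations.\<close>

definition tensor_free ::
  "('b, 'm) dg_mod \<Rightarrow> ('r, 'b) dg_alg \<Rightarrow> (('m \<times> 'b) \<Rightarrow>\<^sub>0 int) monoid" where
  "tensor_free M B = free_Abelian_group (carrier M \<times> carrier B)"

definition tensor_rels ::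
  "('r, 'b) dg_alg \<Rightarrow> ('b, 'm) dg_mod \<Rightarrow> ('r, 'b) dg_alg \<Rightarrow> (('m \<times> 'b) \<Rightarrow>\<^sub>0 int) set" where
  "tensor_rels A M B = generate (tensor_free M B)
     ({frag_of (x \<oplus>\<^bsub>M\<^esub> y, b) - frag_of (x, b) - frag_of (y, b) | x y b.
         x \<in> carrier M \<and> y \<in> carrier M \<and> b \<in> carrier B} \<union>
      {frag_of (x, b \<oplus>\<^bsub>B\<^esub> c) - frag_of (x, b) - frag_of (x, c) | x b c.
         x \<in> carrier M \<and> b \<in> carrier B \<and> c \<in> carrier B} \<union>
      {frag_of (act M x a, b) - frag_of (x, a \<otimes>\<^bsub>B\<^esub> b) | x a b.
         x \<in> carrier M \<and> a \<in> carrier A \<and> b \<in> carrier B})"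

text \<open>The map on cosets induced by the additive map with values \<open>h\<close> on the generators.\<close>

definition tensor_induced ::
  "('r, 'b) dg_alg \<Rightarrow> ('b, 'm) dg_mod \<Rightarrow> ('r, 'b) dg_alg \<Rightarrow> ('m \<times> 'b \<Rightarrow> ('m \<times> 'b) \<Rightarrow>\<^sub>0 int) \<Rightarrow>
   (('m \<times> 'b) \<Rightarrow>\<^sub>0 int) set \<Rightarrow> (('m \<times> 'b) \<Rightarrow>\<^sub>0 int) set" where
  "tensor_induced A M B h U = tensor_rels A M B <#>\<^bsub>tensor_free M B\<^esub> (frag_extend h ` U)"

definition tensor ::
  "('r, 'b) dg_alg \<Rightarrow> ('b, 'm) dg_mod \<Rightarrow> ('r, 'b) dg_alg \<Rightarrow> ('b, (('m \<times> 'b) \<Rightarrow>\<^sub>0 int) set) dg_mod" where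
  "tensor A M B =
     \<lparr>carrier = carrier (tensor_free M B Mod tensor_rels A M B),
      monoid.mult = undefined,
      one = undefined,
      ring.zero = \<one>\<^bsub>tensor_free M B Mod tensor_rels A M B\<^esub>,
      ring.add = monoid.mult (tensor_free M B Mod tensor_rels A M B),
      act = (\<lambda>U c. tensor_induced A M B (\<lambda>(x, b). frag_of (x, b \<otimes>\<^bsub>B\<^esub> c)) U),
      mgr = (\<lambda>k. {tensor_rels A M B #>\<^bsub>tensor_free M B\<^esub> u | u.
               Poly_Mapping.keys u \<subseteq> {(x, b). \<exists>i n. x \<in> mgr M i \<and> b \<in> agr B n \<and> i + int n = k}}),
      mdiff = tensor_induced A M B
        (\<lambda>(x, b). frag_of (mdiff M x, b) + frag_of (twist M (mgr M) x, adiff B b))\<rparr>"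

text \<open>The map \<open>\<pi>\<^sub>N\<close> from \<open>N \<otimes>\<^sub>A B\<close> to \<open>N\<close> with \<open>x \<otimes> b \<mapsto> xb\<close>.\<close>

definition frag_eval :: "('b, 'n) dg_mod \<Rightarrow> (('n \<times> 'b) \<Rightarrow>\<^sub>0 int) \<Rightarrow> 'n" where
  "frag_eval N u =
     (\<Oplus>\<^bsub>N\<^esub>k\<in>Poly_Mapping.keys u. add_pow N (Poly_Mapping.lookup u k) (act N (fst k) (snd k)))"

definition tensor_eval :: "('b, 'n) dg_mod \<Rightarrow> (('n \<times> 'b) \<Rightarrow>\<^sub>0 int) set \<Rightarrow> 'n" where
  "tensor_eval N U = the_elem (frag_eval N ` U)"


section \<open>Liftings\<close>

definition naively_liftable :: "('r, 'b) dg_alg \<Rightarrow> ('r, 'b) dg_alg \<Rightarrow> ('b, 'n) dg_mod \<Rightarrow> bool" where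
  "naively_liftable A B N \<longleftrightarrow>
     (\<exists>\<rho>. dg_hom B N (tensor A N B) \<rho> \<and> (\<forall>x\<in>carrier N. tensor_eval N (\<rho> x) = x))"

text \<open>The derived tensor product of \<open>M\<close> with \<open>B\<close> is \<open>P \<otimes>\<^sub>A B\<close> for a semifree resolution \<open>P \<rightarrow> M\<close>
  over \<open>A\<close>. The type arguments say where \<open>M\<close>, \<open>P\<close> and the apexes of roofs are taken; liftability with
  respect to any types implies liftability in the unrestricted sense.\<close>

definition liftable ::
  "'m itself \<Rightarrow> 'z itself \<Rightarrow> ('r, 'b) dg_alg \<Rightarrow> ('r, 'b) dg_alg \<Rightarrow> ('b, 'l) dg_mod \<Rightarrow> bool" where
  "liftable _ _ A B L \<longleftrightarrow>
     (\<exists>(M :: ('b, 'm) dg_mod) (P :: ('b, 'm) dg_mod) q.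
        dg_module A M \<and> semifree A P \<and> quasi_iso A P M q \<and>
        derived_iso TYPE('z) B L (tensor A P B))"

end

theory Submission
  imports Defs
begin

text \<open>It suffices to descend one variable at a time. Let \<open>C\<close> arise from \<open>A\<close> by adjoining \<open>X\<close>, and let
  \<open>B\<close> be the top of the tower. The iterated Hasse derivatives with respect to \<open>X\<close> filter
  \<open>N \<otimes>\<^sub>A B\<close> with subquotients shifts of \<open>N \<otimes>\<^sub>C B\<close> by multiples of \<open>|X|\<close>, the top quotient being the
  canonical map \<open>N \<otimes>\<^sub>A B \<rightarrow> N \<otimes>\<^sub>C B\<close>. As \<open>N \<otimes>\<^sub>A B\<close> is bounded below, the filtration is finite in each
  degree. If \<open>Hom\<^sub>B(N, N \<otimes>\<^sub>C B)\<close> has no homology in negative degrees, then a cycle of negative degree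
  with values in \<open>N \<otimes>\<^sub>A B\<close> can be pushed by boundaries into ever deeper parts of the filtration, so
  \<open>Hom\<^sub>B(N, N \<otimes>\<^sub>A B)\<close> has none either, and for the same reason every DG homomorphism
  \<open>N \<rightarrow> N \<otimes>\<^sub>C B\<close> lifts to \<open>N \<otimes>\<^sub>A B\<close>. Starting from \<open>N \<otimes>\<^sub>B B \<cong> N\<close>, where the hypothesis is the
  vanishing of \<open>Ext\<close>, the identity of \<open>N\<close> lifts step by step to a splitting of \<open>\<pi>\<^sub>N\<close>. Hence \<open>N\<close> is a
  direct summand of \<open>N \<otimes>\<^sub>A B\<close>, which is liftable because \<open>N\<close> is semifree over \<open>A\<close>.\<close>


section \<open>Additive maps and graded groups\<close>

text \<open>Hasse derivatives on \<open>N \<otimes> B\<close> are not \<open>B\<close>-linear, nor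
  are they compatible with the differential, as later variables may have differentials involving
  \<open>X\<close>. What behaves well is multiplication by the (divided) powers of 1 \<otimes> X - X
  \<otimes> 1: it acts between the two factors, so it commutes with the right action of
  \<open>B\<close>, and it commutes with the differential up to sign because dX lies in the smaller
  algebra and passes through the tensor sign. The derivatives are dual to these operators: applied
  after the operator of the same order they give the canonical map, they kill the images of
  operators of higher order, and a Taylor formula expands every element. Linearity on the
  subquotients is inherited from the operators. For even |X| duality and Taylor formula are binomial
  identities, one pair for ordinary and one for divided powers; for odd |X| only orders 0 and 1
  occur. As \<open>N\<close> is free, maps lift first without regard to differentials and are then
  corrected by homotopies. The one for step \<open>k\<close> factors through a map whose degree is
  lower by \<open>k\<close> times |X|, so the infinite sum is locally finite in a bounded below
  module.\<close>

definition additive_map :: "('a, 'x) ring_scheme \<Rightarrow> ('b, 'y) ring_scheme \<Rightarrow> ('a \<Rightarrow> 'b) \<Rightarrow> bool" where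
  "additive_map G H f \<longleftrightarrow>
     f \<in> carrier G \<rightarrow> carrier H \<and>
     (\<forall>x\<in>carrier G. \<forall>y\<in>carrier G. f (x \<oplus>\<^bsub>G\<^esub> y) = f x \<oplus>\<^bsub>H\<^esub> f y)"

lemma additive_mapI:
  assumes "\<And>x. x \<in> carrier G \<Longrightarrow> f x \<in> carrier H"
    and "\<And>x y. \<lbrakk>x \<in> carrier G; y \<in> carrier G\<rbrakk> \<Longrightarrow> f (x \<oplus>\<^bsub>G\<^esub> y) = f x \<oplus>\<^bsub>H\<^esub> f y"
  shows "additive_map G H f"
  using assms by (auto simp: additive_map_def)

lemma additive_map_closed: "additive_map G H f \<Longrightarrow> x \<in> carrier G \<Longrightarrow> f x \<in> carrier H"
  by (auto simp: additive_map_def)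

lemma additive_map_add:
  "additive_map G H f \<Longrightarrow> x \<in> carrier G \<Longrightarrow> y \<in> carrier G \<Longrightarrow> f (x \<oplus>\<^bsub>G\<^esub> y) = f x \<oplus>\<^bsub>H\<^esub> f y"
  by (auto simp: additive_map_def)

lemma additive_map_zero:
  assumes "abelian_group G" "abelian_group H" "additive_map G H f"
  shows "f \<zero>\<^bsub>G\<^esub> = \<zero>\<^bsub>H\<^esub>"
proof -
  interpret G: abelian_group G by fact
  interpret H: abelian_group H by fact
  have c: "f \<zero>\<^bsub>G\<^esub> \<in> carrier H" using assms(3) by (simp add: additive_map_closed)
  have "f (\<zero>\<^bsub>G\<^esub> \<oplus>\<^bsub>G\<^esub> \<zero>\<^bsub>G\<^esub>) = f \<zero>\<^bsub>G\<^esub> \<oplus>\<^bsub>H\<^esub> f \<zero>\<^bsub>G\<^esub>"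
    using assms(3) by (rule additive_map_add) auto
  then show ?thesis using c H.add.l_cancel_one[OF c c] by simp
qed

lemma additive_map_neg:
  assumes "abelian_group G" "abelian_group H" "additive_map G H f" "x \<in> carrier G"
  shows "f (\<ominus>\<^bsub>G\<^esub> x) = \<ominus>\<^bsub>H\<^esub> f x"
proof -
  interpret G: abelian_group G by fact
  interpret H: abelian_group H by fact
  have "f (\<ominus>\<^bsub>G\<^esub> x) \<oplus>\<^bsub>H\<^esub> f x = f (\<ominus>\<^bsub>G\<^esub> x \<oplus>\<^bsub>G\<^esub> x)"
    using assms by (simp add: additive_map_add)
  also have "\<dots> = \<zero>\<^bsub>H\<^esub>" using assms by (simp add: G.l_neg additive_map_zero)
  finally show ?thesis
    using assms by (metis G.a_inv_closed H.minus_equality additive_map_closed)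
qed

lemma additive_map_minus:
  assumes "abelian_group G" "abelian_group H" "additive_map G H f" "x \<in> carrier G" "y \<in> carrier G"
  shows "f (x \<ominus>\<^bsub>G\<^esub> y) = f x \<ominus>\<^bsub>H\<^esub> f y"
proof -
  interpret G: abelian_group G by fact
  interpret H: abelian_group H by fact
  show ?thesis
    using assms by (simp add: a_minus_def additive_map_add additive_map_neg)
qed

lemma additive_map_finsum:
  assumes "abelian_group G" "abelian_group H" "additive_map G H f"
    and "g \<in> K \<rightarrow> carrier G"
  shows "f (finsum G g K) = finsum H (\<lambda>i. f (g i)) K"
proof -
  interpret G: abelian_group G by fact
  interpret H: abelian_group H by fact
  show ?thesis using assms(4)
  proof (induction K rule: infinite_finite_induct)
    case (infinite K)
    then show ?case
      using assms by (simp add: additive_map_zero G.finsum_infinite H.finsum_infinite)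
  next
    case empty
    then show ?case using assms by (simp add: additive_map_zero)
  next
    case (insert k K)
    then have g: "g \<in> K \<rightarrow> carrier G" "g k \<in> carrier G" by auto
    moreover have "(\<lambda>i. f (g i)) \<in> K \<rightarrow> carrier H" "f (g k) \<in> carrier H"
      using g assms(3) by (auto intro: additive_map_closed)
    ultimately show ?case
      using insert assms(3) by (simp add: additive_map_add)
  qed
qed

lemma additive_map_comp:
  "additive_map G H f \<Longrightarrow> additive_map H K g \<Longrightarrow> additive_map G K (\<lambda>x. g (f x))"
  by (auto simp: additive_map_def Pi_iff)

lemma (in abelian_group) finsum_mono_neutral:
  assumes "finite T" "S \<subseteq> T" "\<And>i. i \<in> T - S \<Longrightarrow> f i = \<zero>" "f \<in> T \<rightarrow> carrier G"
  shows "finsum G f S = finsum G f T"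
  using assms by (intro add.finprod_mono_neutral_cong_left) auto

lemma (in abelian_group) add_minus_minus:
  assumes "x \<in> carrier G" "y \<in> carrier G" shows "x \<oplus> y \<ominus> x \<ominus> y = \<zero>"
proof -
  have "x \<oplus> y \<ominus> x \<ominus> y = (x \<oplus> y) \<oplus> \<ominus> (x \<oplus> y)"
    using assms by (simp add: a_minus_def minus_add a_assoc)
  then show ?thesis using assms by (simp add: r_neg)
qed

lemma (in abelian_group) minus_zero_eq:
  assumes "x \<in> carrier G" "y \<in> carrier G" "x \<ominus> y = \<zero>" shows "x = y"
proof -
  have "x = (x \<ominus> y) \<oplus> y" using assms(1,2) by (simp add: a_minus_def a_assoc l_neg)
  then show ?thesis using assms by simp
qed

text \<open>The rearrangement by which two graded maps with the same boundary have a cycle as their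
  difference.\<close>

lemma (in abelian_group) minus_eq_minus_swap:
  assumes "x \<in> carrier G" "y \<in> carrier G" "z \<in> carrier G" "w \<in> carrier G" "x \<ominus> y = z \<ominus> w"
  shows "z \<ominus> x = w \<ominus> y"
proof -
  have "z = (x \<ominus> y) \<oplus> w" using assms by (simp add: a_minus_def a_assoc l_neg)
  then have "z \<ominus> x = (x \<oplus> \<ominus> x) \<oplus> (w \<ominus> y)" using assms(1-4) by (simp add: a_minus_def a_ac)
  then show ?thesis using assms(1-4) by (simp add: r_neg)
qed

lemma (in abelian_group) finsum_neg:
  assumes "f \<in> S \<rightarrow> carrier G"
  shows "\<ominus> finsum G f S = (\<Oplus>i\<in>S. \<ominus> f i)"
  using assms
  by (intro additive_map_finsum[OF abelian_group_axioms abelian_group_axioms])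
     (auto simp: additive_map_def minus_add)

text \<open>Fubini for a finite rectangle. Irregular supports are extended by zero to a rectangle
  before it is applied.\<close>

lemma (in abelian_group) finsum_Sigma:
  assumes "finite I" "finite J" "\<And>i j. i \<in> I \<Longrightarrow> j \<in> J \<Longrightarrow> f i j \<in> carrier G"
  shows "(\<Oplus>i\<in>I. \<Oplus>j\<in>J. f i j) = finsum G (\<lambda>(i, j). f i j) (I \<times> J)"
  using assms(1,3)
proof (induction I)
  case empty
  show ?case by simp
next
  case (insert i I)
  have "finsum G (\<lambda>(i, j). f i j) (insert i I \<times> J) = finsum G (\<lambda>(i, j). f i j) (({i} \<times> J) \<union> (I \<times> J))"
    by (rule arg_cong[where f = "finsum G _"]) auto
  also have "\<dots> = finsum G (\<lambda>(i, j). f i j) ({i} \<times> J) \<oplus> finsum G (\<lambda>(i, j). f i j) (I \<times> J)"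
    using insert assms(2) by (intro finsum_Un_disjoint) auto
  also have "finsum G (\<lambda>(i, j). f i j) ({i} \<times> J) = (\<Oplus>j\<in>J. f i j)"
  proof -
    have "{i} \<times> J = Pair i ` J" by auto
    then show ?thesis using insert by (simp, subst finsum_reindex) (auto simp: inj_on_def)
  qed
  also have "(\<Oplus>j\<in>J. f i j) \<oplus> finsum G (\<lambda>(i, j). f i j) (I \<times> J) = (\<Oplus>i\<in>insert i I. \<Oplus>j\<in>J. f i j)"
    using insert by (subst finsum_insert) (auto intro!: finsum_closed)
  finally show ?case by simp
qed

section \<open>Signs, subgroups and decompositions into homogeneous components\<close>

context abelian_group begin

lemma sg_closed [simp]: "x \<in> carrier G \<Longrightarrow> sg G k x \<in> carrier G"
  by (simp add: sg_def)

lemma sg_zero [simp]: "sg G k \<zero> = \<zero>"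
  by (simp add: sg_def)

lemma sg_add: "x \<in> carrier G \<Longrightarrow> y \<in> carrier G \<Longrightarrow> sg G k (x \<oplus> y) = sg G k x \<oplus> sg G k y"
  by (simp add: sg_def minus_add)

lemma sg_sg: "x \<in> carrier G \<Longrightarrow> sg G k (sg G l x) = sg G (k + l) x"
  by (simp add: sg_def)

lemma sg_sg_self [simp]: "x \<in> carrier G \<Longrightarrow> sg G k (sg G k x) = x"
  by (simp add: sg_def)

lemma sg_commute: "sg G k (sg G l x) = sg G l (sg G k x)"
  by (simp add: sg_def)

lemma additive_map_sg: "additive_map G G (sg G k)"
  by (auto simp: additive_map_def sg_add)

end

lemma additive_map_sg_commute:
  assumes "abelian_group G" "abelian_group H" "additive_map G H f" "x \<in> carrier G"
  shows "f (sg G k x) = sg H k (f x)"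
  using assms by (simp add: sg_def additive_map_neg)

lemma sg_mem:
  assumes "additive_subgroup S G" "x \<in> S" shows "sg G k x \<in> S"
  using assms by (auto simp: sg_def additive_subgroup.a_inv_closed)

lemma additive_subgroup_add:
  "additive_subgroup S G \<Longrightarrow> x \<in> S \<Longrightarrow> y \<in> S \<Longrightarrow> x \<oplus>\<^bsub>G\<^esub> y \<in> S"
  by (rule additive_subgroup.a_closed)

lemma additive_subgroup_carrier: "additive_subgroup S G \<Longrightarrow> x \<in> S \<Longrightarrow> x \<in> carrier G"
  by (rule additive_subgroup.a_Hcarr)

lemma additive_subgroup_finsum:
  assumes "abelian_group G" "additive_subgroup S G" "f \<in> K \<rightarrow> S"
  shows "finsum G f K \<in> S"
proof -
  interpret G: abelian_group G by fact
  have sub: "S \<subseteq> carrier G" using assms(2) by (auto intro: additive_subgroup_carrier)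
  show ?thesis using assms(3)
  proof (induction K rule: infinite_finite_induct)
    case (infinite K)
    then show ?case using assms(2) by (simp add: G.finsum_infinite additive_subgroup.zero_closed)
  next
    case empty
    then show ?case using assms(2) by (simp add: additive_subgroup.zero_closed)
  next
    case (insert k K)
    then have "f \<in> K \<rightarrow> carrier G" "f k \<in> carrier G" using sub by auto
    then show ?case
      using insert assms(2) by (simp add: additive_subgroup.a_closed)
  qed
qed

lemma additive_subgroupI':
  assumes "abelian_group G" "S \<subseteq> carrier G" "\<zero>\<^bsub>G\<^esub> \<in> S"
    and "\<And>x y. x \<in> S \<Longrightarrow> y \<in> S \<Longrightarrow> x \<oplus>\<^bsub>G\<^esub> y \<in> S"
    and "\<And>x. x \<in> S \<Longrightarrow> \<ominus>\<^bsub>G\<^esub> x \<in> S"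
  shows "additive_subgroup S G"
proof -
  interpret G: abelian_group G by fact
  show ?thesis
    by (intro additive_subgroupI subgroup.intro) (use assms in \<open>auto simp: a_inv_def\<close>)
qed

text \<open>The sum may run over any finite set containing the support. Cancellation can shrink the
  support of a sum of two decompositions, and this freedom avoids computing it.\<close>

lemma decomposesI:
  assumes "abelian_group G" "\<And>i. additive_subgroup (C i) G"
    and "\<And>i. c i \<in> C i" "finite S" "\<And>i. i \<notin> S \<Longrightarrow> c i = \<zero>\<^bsub>G\<^esub>" "x = finsum G c S"
  shows "decomposes G C x c"
proof -
  interpret G: abelian_group G by fact
  have c: "c i \<in> carrier G" for i using assms(2,3) by (blast intro: additive_subgroup_carrier)
  have sub: "{i. c i \<noteq> \<zero>\<^bsub>G\<^esub>} \<subseteq> S" using assms(5) by auto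
  then have "finsum G c {i. c i \<noteq> \<zero>\<^bsub>G\<^esub>} = finsum G c S"
    using assms(4) c by (intro G.finsum_mono_neutral) auto
  then show ?thesis
    using assms sub by (auto simp: decomposes_def intro: finite_subset)
qed

lemma decomposes_finsum:
  assumes "abelian_group G" "\<And>i. additive_subgroup (C i) G" "decomposes G C x c"
    and "finite S" "{i. c i \<noteq> \<zero>\<^bsub>G\<^esub>} \<subseteq> S"
  shows "x = finsum G c S"
proof -
  interpret G: abelian_group G by fact
  have c: "c i \<in> carrier G" for i
    using assms(2,3) by (auto simp: decomposes_def intro: additive_subgroup_carrier)
  have "x = finsum G c {i. c i \<noteq> \<zero>\<^bsub>G\<^esub>}" using assms(3) by (simp add: decomposes_def)
  also have "\<dots> = finsum G c S"
    using assms(4,5) c by (intro G.finsum_mono_neutral) auto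
  finally show ?thesis .
qed

lemma decomposes_add:
  assumes "abelian_group G" "\<And>i. additive_subgroup (C i) G"
    and "decomposes G C x c" "decomposes G C y d"
  shows "decomposes G C (x \<oplus>\<^bsub>G\<^esub> y) (\<lambda>i. c i \<oplus>\<^bsub>G\<^esub> d i)"
proof -
  interpret G: abelian_group G by fact
  let ?S = "{i. c i \<noteq> \<zero>\<^bsub>G\<^esub>} \<union> {i. d i \<noteq> \<zero>\<^bsub>G\<^esub>}"
  have fin: "finite ?S" using assms(3,4) by (simp add: decomposes_def)
  have cC: "c i \<in> C i" "d i \<in> C i" for i using assms(3,4) by (auto simp: decomposes_def)
  have c: "c i \<in> carrier G" "d i \<in> carrier G" for i
    using assms(2) cC by (blast intro: additive_subgroup_carrier)+
  show ?thesis
  proof (rule decomposesI[OF assms(1,2) _ fin])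
    show "c i \<oplus>\<^bsub>G\<^esub> d i \<in> C i" for i using assms(2) cC by (simp add: additive_subgroup_add)
    show "x \<oplus>\<^bsub>G\<^esub> y = (\<Oplus>\<^bsub>G\<^esub>i\<in>?S. c i \<oplus>\<^bsub>G\<^esub> d i)"
      using fin c decomposes_finsum[OF assms(1,2,3) fin] decomposes_finsum[OF assms(1,2,4) fin]
      by (simp add: G.finsum_addf)
  qed (auto)
qed

lemma decomposes_homog:
  assumes "abelian_group G" "\<And>i. additive_subgroup (C i) G" "x \<in> C j"
  shows "decomposes G C x (\<lambda>i. if i = j then x else \<zero>\<^bsub>G\<^esub>)"
proof -
  interpret G: abelian_group G by fact
  have x: "x \<in> carrier G" using assms(2,3) by (blast intro: additive_subgroup_carrier)
  show ?thesis
    by (rule decomposesI[where S = "{j}"])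
       (use assms x in \<open>auto simp: additive_subgroup.zero_closed\<close>)
qed

text \<open>The homogeneous component as a total function, so that statements about degrees become
  equations between additive maps. It is meaningful only where the decomposition exists and is
  unique.\<close>

definition hcomp :: "('a, 'x) ring_scheme \<Rightarrow> ('i \<Rightarrow> 'a set) \<Rightarrow> 'i \<Rightarrow> 'a \<Rightarrow> 'a" where
  "hcomp G C i x = (THE c. decomposes G C x c) i"

locale graded_group = abelian_group G for G (structure) and C :: "'i \<Rightarrow> 'a set" +
  assumes graded_by: "graded_by G C"
begin

lemma homog_subgroup: "additive_subgroup (C i) G"
  using graded_by by (simp add: graded_by_def)

lemma homog_closed: "x \<in> C i \<Longrightarrow> x \<in> carrier G"
  by (rule additive_subgroup_carrier[OF homog_subgroup])

lemma homog_zero [simp]: "\<zero> \<in> C i"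
  by (rule additive_subgroup.zero_closed[OF homog_subgroup])

lemma homog_add: "x \<in> C i \<Longrightarrow> y \<in> C i \<Longrightarrow> x \<oplus> y \<in> C i"
  by (rule additive_subgroup_add[OF homog_subgroup])

lemma homog_neg: "x \<in> C i \<Longrightarrow> \<ominus> x \<in> C i"
  by (rule additive_subgroup.a_inv_closed[OF homog_subgroup])

lemma homog_sg: "x \<in> C i \<Longrightarrow> sg G k x \<in> C i"
  by (rule sg_mem[OF homog_subgroup])

lemma decomposes_hcomp: "x \<in> carrier G \<Longrightarrow> decomposes G C x (\<lambda>i. hcomp G C i x)"
  unfolding hcomp_def using graded_by theI'[of "decomposes G C x"] by (simp add: graded_by_def)

lemma hcomp_unique: "x \<in> carrier G \<Longrightarrow> decomposes G C x c \<Longrightarrow> hcomp G C i x = c i"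
  using graded_by the1_equality[of "decomposes G C x" c] by (auto simp: graded_by_def hcomp_def)

lemma hcomp_mem: "x \<in> carrier G \<Longrightarrow> hcomp G C i x \<in> C i"
  using decomposes_hcomp by (auto simp: decomposes_def)

lemma hcomp_closed [simp]: "x \<in> carrier G \<Longrightarrow> hcomp G C i x \<in> carrier G"
  by (rule homog_closed[OF hcomp_mem])

lemma finite_hcomp: "x \<in> carrier G \<Longrightarrow> finite {i. hcomp G C i x \<noteq> \<zero>}"
  using decomposes_hcomp by (auto simp: decomposes_def)

lemma hcomp_finsum: 
  "x \<in> carrier G \<Longrightarrow> finite S \<Longrightarrow> {i. hcomp G C i x \<noteq> \<zero>} \<subseteq> S \<Longrightarrow> (\<Oplus>i\<in>S. hcomp G C i x) = x"
  by (rule decomposes_finsum[OF abelian_group_axioms homog_subgroup decomposes_hcomp, symmetric])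

lemma hcomp_homog: "x \<in> C j \<Longrightarrow> hcomp G C i x = (if i = j then x else \<zero>)"
  by (rule hcomp_unique[OF homog_closed decomposes_homog[OF abelian_group_axioms homog_subgroup]])

lemma hcomp_add:
  "x \<in> carrier G \<Longrightarrow> y \<in> carrier G \<Longrightarrow> hcomp G C i (x \<oplus> y) = hcomp G C i x \<oplus> hcomp G C i y"
  by (rule hcomp_unique[OF _ decomposes_add[OF abelian_group_axioms homog_subgroup decomposes_hcomp decomposes_hcomp]]) auto

lemma additive_map_hcomp: "additive_map G G (hcomp G C i)"
  by (auto simp: additive_map_def hcomp_add)

text \<open>Turns membership in a degree into an equation. An additive map thus respects degrees as
  soon as it commutes with \<open>hcomp\<close>, and that can be tested on generators.\<close>

lemma hcomp_eq_selfD: "x \<in> carrier G \<Longrightarrow> hcomp G C i x = x \<Longrightarrow> x \<in> C i"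
  using hcomp_mem[of x i] by simp

text \<open>An element is the sum of its finitely many components; the empty sum is covered because
  zero is homogeneous.\<close>

lemma graded_induct [consumes 1, case_names homog add]:
  assumes "x \<in> carrier G"
    and "\<And>i x. x \<in> C i \<Longrightarrow> P x"
    and "\<And>x y. \<lbrakk>x \<in> carrier G; y \<in> carrier G; P x; P y\<rbrakk> \<Longrightarrow> P (x \<oplus> y)"
  shows "P x"
proof -
  have 0: "P \<zero>" using assms(2) homog_zero by blast
  have "P (\<Oplus>i\<in>S. hcomp G C i x)" if "finite S" for S
    using that
  proof (induction S)
    case empty
    show ?case using 0 by simp
  next
    case (insert i S)
    then show ?case
      using assms(1) by (auto intro!: assms(3) assms(2)[OF hcomp_mem] finsum_closed)
  qed
  then show ?thesis
    using hcomp_finsum[OF assms(1) finite_hcomp[OF assms(1)] order_refl] finite_hcomp[OF assms(1)]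
    by force
qed

lemma additive_map_eqI:
  assumes "additive_map G H f" "additive_map G H g" "\<And>i x. x \<in> C i \<Longrightarrow> f x = g x" "x \<in> carrier G"
  shows "f x = g x"
  using assms(4)
  by (induction rule: graded_induct) (use assms in \<open>auto simp: additive_map_def\<close>)

end

lemma twist_eq: "twist G C x = (\<Oplus>\<^bsub>G\<^esub>i\<in>{i. hcomp G C i x \<noteq> \<zero>\<^bsub>G\<^esub>}. sg G i (hcomp G C i x))"
  by (simp add: twist_def hcomp_def Let_def)

context graded_group begin

lemma twist_finsum:
  fixes x assumes "x \<in> carrier G" "finite S" "{i. hcomp G C i x \<noteq> \<zero>} \<subseteq> S"
  shows "(\<Oplus>i\<in>S. sg G (d i) (hcomp G C i x)) = (\<Oplus>i\<in>{i. hcomp G C i x \<noteq> \<zero>}. sg G (d i) (hcomp G C i x))"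
  using assms by (intro finsum_mono_neutral[symmetric]) auto

end

locale parity_graded_group = graded_group G C for G (structure) and C :: "'i::semiring_parity \<Rightarrow> 'a set"
begin

lemma twist_homog: 
  assumes "x \<in> C i" shows "twist G C x = sg G i x"
proof -
  have x: "x \<in> carrier G" using assms homog_closed by blast
  have "{j. hcomp G C j x \<noteq> \<zero>} \<subseteq> {i}" using assms by (auto simp: hcomp_homog split: if_splits)
  then have "twist G C x = (\<Oplus>j\<in>{i}. sg G j (hcomp G C j x))"
    unfolding twist_eq using x by (intro twist_finsum[symmetric]) auto
  then show ?thesis using assms x by (simp add: hcomp_homog)
qed

lemma twist_closed [simp]: "x \<in> carrier G \<Longrightarrow> twist G C x \<in> carrier G"
  unfolding twist_eq by (intro finsum_closed) auto

lemma twist_add: 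
  assumes "x \<in> carrier G" "y \<in> carrier G" 
  shows "twist G C (x \<oplus> y) = twist G C x \<oplus> twist G C y"
proof -
  let ?S = "{i. hcomp G C i x \<noteq> \<zero>} \<union> {i. hcomp G C i y \<noteq> \<zero>}"
  have fin: "finite ?S" using assms finite_hcomp by simp
  have "twist G C (x \<oplus> y) = (\<Oplus>i\<in>?S. sg G i (hcomp G C i (x \<oplus> y)))"
    unfolding twist_eq using assms fin by (intro twist_finsum[symmetric]) (auto simp: hcomp_add)
  also have "\<dots> = (\<Oplus>i\<in>?S. sg G i (hcomp G C i x)) \<oplus> (\<Oplus>i\<in>?S. sg G i (hcomp G C i y))"
    using assms by (subst finsum_addf[symmetric]) (auto simp: hcomp_add sg_add)
  also have "\<dots> = twist G C x \<oplus> twist G C y"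
    unfolding twist_eq using assms fin by (subst (1 2) twist_finsum) auto
  finally show ?thesis .
qed

lemma twist_mem: "x \<in> C i \<Longrightarrow> twist G C x \<in> C i"
  by (simp add: twist_homog homog_sg)

lemma twist_twist [simp]: "x \<in> carrier G \<Longrightarrow> twist G C (twist G C x) = x"
proof (induction rule: graded_induct)
  case (homog i x)
  then show ?case
    using twist_homog[OF homog_sg[OF homog, of i]] by (simp add: twist_homog[OF homog] homog_closed)
qed (simp add: twist_add)

lemma twist_zero [simp]: "twist G C \<zero> = \<zero>"
  using twist_homog[OF homog_zero] by simp

end

text \<open>The projections \<open>pr i\<close> force uniqueness of the decomposition.\<close>

lemma graded_byI:
  assumes ab: "abelian_group G" and sub: "\<And>i. additive_subgroup (C i) G"
    and pr: "\<And>i. additive_map G G (pr i)"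
      "\<And>i x. x \<in> C i \<Longrightarrow> pr i x = x"
      "\<And>i j x. x \<in> C j \<Longrightarrow> j \<noteq> i \<Longrightarrow> pr i x = \<zero>\<^bsub>G\<^esub>"
    and ex: "\<And>x. x \<in> carrier G \<Longrightarrow> \<exists>c. decomposes G C x c"
  shows "graded_by G C"
  unfolding graded_by_def
proof (intro conjI allI ballI sub)
  interpret G: abelian_group G by fact
  fix x assume x: "x \<in> carrier G"
  have "c i = pr i x" if c: "decomposes G C x c" for c i
  proof -
    have cC: "c j \<in> C j" for j using c by (auto simp: decomposes_def)
    have cc: "c j \<in> carrier G" for j using cC sub by (blast intro: additive_subgroup_carrier)
    let ?S = "insert i {i. c i \<noteq> \<zero>\<^bsub>G\<^esub>}"
    have fin: "finite ?S" using c by (simp add: decomposes_def)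
    have "pr i x = (\<Oplus>\<^bsub>G\<^esub>j\<in>?S. pr i (c j))"
      using decomposes_finsum[OF ab sub c fin] cc
      by (subst additive_map_finsum[OF ab ab pr(1), symmetric]) auto
    also have "\<dots> = (\<Oplus>\<^bsub>G\<^esub>j\<in>?S. if i = j then c j else \<zero>\<^bsub>G\<^esub>)"
    proof (intro G.finsum_cong' refl)
      show "pr i (c j) = (if i = j then c j else \<zero>\<^bsub>G\<^esub>)" for j
        using pr(2)[OF cC, of i] pr(3)[OF cC, of j i] by auto
    qed (use cc in auto)
    also have "\<dots> = c i" using fin cc by (subst G.finsum_singleton) auto
    finally show ?thesis by simp
  qed
  then show "\<exists>!c. decomposes G C x c"
    using ex[OF x] by (metis ext)
qed


section \<open>DG algebras and DG modules\<close>

sublocale dg_algebra \<subseteq> gr: parity_graded_group A "agr A"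
  by unfold_locales (rule graded)

sublocale dg_module \<subseteq> gr: parity_graded_group M "mgr M"
  by unfold_locales (rule graded)

text \<open>The \<open>n\<close>-fold iterate of \<open>twist\<close>: the sign with which an
  element, homogeneous or not, passes one of degree \<open>n\<close>.\<close>

definition twn :: "('a, 'x) ring_scheme \<Rightarrow> ('i::semiring_parity \<Rightarrow> 'a set) \<Rightarrow> nat \<Rightarrow> 'a \<Rightarrow> 'a" where
  "twn G C n x = (if even n then x else twist G C x)"

context parity_graded_group begin

lemma twn_closed [simp]: "x \<in> carrier G \<Longrightarrow> twn G C n x \<in> carrier G"
  by (simp add: twn_def)

lemma twn_twn [simp]: "x \<in> carrier G \<Longrightarrow> twn G C n (twn G C n x) = x"
  by (simp add: twn_def)

lemma twn_add: "x \<in> carrier G \<Longrightarrow> y \<in> carrier G \<Longrightarrow> twn G C n (x \<oplus> y) = twn G C n x \<oplus> twn G C n y"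
  by (simp add: twn_def twist_add)

lemma twn_zero [simp]: "twn G C n \<zero> = \<zero>"
  by (simp add: twn_def)

lemma twn_mem: "x \<in> C i \<Longrightarrow> twn G C n x \<in> C i"
  by (simp add: twn_def twist_mem)

lemma twn_homog: "x \<in> C i \<Longrightarrow> twn G C n x = sg G (of_nat n * i) x"
  by (auto simp: twn_def twist_homog sg_def)

end

context dg_algebra begin

lemma agr_closed: "a \<in> agr A n \<Longrightarrow> a \<in> carrier A"
  by (rule gr.homog_closed)

lemma additive_map_lmult: "a \<in> carrier A \<Longrightarrow> additive_map A A (\<lambda>x. a \<otimes>\<^bsub>A\<^esub> x)"
  by (auto simp: additive_map_def r_distr)

lemma additive_map_rmult: "a \<in> carrier A \<Longrightarrow> additive_map A A (\<lambda>x. x \<otimes>\<^bsub>A\<^esub> a)"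
  by (auto simp: additive_map_def l_distr)

lemma additive_map_adiff: "additive_map A A (adiff A)"
  by (auto simp: additive_map_def adiff_add adiff_closed)

lemma abelian_group_A: "abelian_group A" ..

lemma sg_lmult: "a \<in> carrier A \<Longrightarrow> b \<in> carrier A \<Longrightarrow> sg A k a \<otimes>\<^bsub>A\<^esub> b = sg A k (a \<otimes>\<^bsub>A\<^esub> b)"
  by (simp add: sg_def l_minus)

lemma sg_rmult: "a \<in> carrier A \<Longrightarrow> b \<in> carrier A \<Longrightarrow> a \<otimes>\<^bsub>A\<^esub> sg A k b = sg A k (a \<otimes>\<^bsub>A\<^esub> b)"
  by (simp add: sg_def r_minus)

text \<open>Both sides are additive in \<open>a\<close>, which reduces the claim to graded
  commutativity. The sign varies with the components of \<open>a\<close>, hence \<open>twn\<close>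
  instead of \<open>sg\<close>.\<close>

lemma mult_homog_right:
  assumes "a \<in> carrier A" "u \<in> agr A n"
  shows "a \<otimes>\<^bsub>A\<^esub> u = u \<otimes>\<^bsub>A\<^esub> twn A (agr A) n a"
  using assms(1)
proof (induction rule: gr.graded_induct)
  case (homog i a)
  then show ?case
    using graded_comm[OF homog assms(2)] agr_closed assms(2)
    by (simp add: gr.twn_homog sg_rmult mult.commute)
next
  case (add x y)
  then show ?case
    using agr_closed assms(2) by (simp add: l_distr r_distr gr.twn_add)
qed

lemma even_central: "a \<in> carrier A \<Longrightarrow> u \<in> agr A n \<Longrightarrow> even n \<Longrightarrow> a \<otimes>\<^bsub>A\<^esub> u = u \<otimes>\<^bsub>A\<^esub> a"
  by (simp add: mult_homog_right twn_def)

text \<open>Replacing the sign by \<open>twist\<close> frees the Leibniz rule from homogeneity, so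
  that it applies to the factors of arbitrary pure tensors.\<close>

lemma adiff_mult_general:
  assumes "a \<in> carrier A" "b \<in> carrier A"
  shows "adiff A (a \<otimes>\<^bsub>A\<^esub> b) = adiff A a \<otimes>\<^bsub>A\<^esub> b \<oplus>\<^bsub>A\<^esub> twist A (agr A) a \<otimes>\<^bsub>A\<^esub> adiff A b"
  using assms(1)
proof (induction rule: gr.graded_induct)
  case (homog i a)
  then show ?case
    using assms(2) agr_closed by (simp add: adiff_mult gr.twist_homog sg_lmult adiff_closed)
next
  case (add x y)
  then show ?case
    using assms(2) by (simp add: l_distr adiff_add adiff_closed gr.twist_add a_ac)
qed

lemma twist_mult:
  assumes "a \<in> carrier A" "b \<in> carrier A"
  shows "twist A (agr A) (a \<otimes>\<^bsub>A\<^esub> b) = twist A (agr A) a \<otimes>\<^bsub>A\<^esub> twist A (agr A) b"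
  using assms(1)
proof (induction rule: gr.graded_induct)
  case a: (homog i a)
  show ?case using assms(2)
  proof (induction rule: gr.graded_induct)
    case (homog j b)
    have "twist A (agr A) (a \<otimes>\<^bsub>A\<^esub> b) = sg A (i + j) (a \<otimes>\<^bsub>A\<^esub> b)"
      by (rule gr.twist_homog[OF mult_agr[OF a homog]])
    also have "\<dots> = sg A i (sg A j (a \<otimes>\<^bsub>A\<^esub> b))"
      using a homog agr_closed by (simp add: sg_sg)
    finally show ?case
      using a homog agr_closed
      by (simp add: gr.twist_homog sg_lmult sg_rmult) (auto simp: sg_def)
  next
    case (add x y)
    then show ?case using a agr_closed by (simp add: r_distr gr.twist_add)
  qed
next
  case (add x y)
  then show ?case using assms(2) by (simp add: l_distr gr.twist_add)
qed

lemma twist_one [simp]: "twist A (agr A) \<one>\<^bsub>A\<^esub> = \<one>\<^bsub>A\<^esub>"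
  using gr.twist_homog[OF one_agr] by (simp add: sg_def)

lemma twn_mult:
  assumes "a \<in> carrier A" "b \<in> carrier A"
  shows "twn A (agr A) n (a \<otimes>\<^bsub>A\<^esub> b) = twn A (agr A) n a \<otimes>\<^bsub>A\<^esub> twn A (agr A) n b"
  using assms by (simp add: twn_def twist_mult)

lemma adiff_one: "adiff A \<one>\<^bsub>A\<^esub> = \<zero>\<^bsub>A\<^esub>"
  by (rule adiff_agr_0[OF one_agr])

end

text \<open>The locale \<open>dg_module\<close> treats \<open>B\<close> as a bare record; here the
  laws of a DG algebra are added to it.\<close>

locale dg_module_over = B: dg_algebra R B + N: dg_module B N
  for R :: "('r, 'x) ring_scheme" and B :: "('r, 'b) dg_alg" and N :: "('b, 'n) dg_mod"
begin

abbreviation "tN \<equiv> twist N (mgr N)"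
abbreviation "tB \<equiv> twist B (agr B)"

lemma abN: "abelian_group N" ..
lemma abB: "abelian_group B" ..

lemma additive_map_act_left: "b \<in> carrier B \<Longrightarrow> additive_map N N (\<lambda>x. act N x b)"
  by (auto simp: additive_map_def N.act_closed N.act_add_left)

lemma additive_map_act_right: "x \<in> carrier N \<Longrightarrow> additive_map B N (\<lambda>b. act N x b)"
  by (auto simp: additive_map_def N.act_closed N.act_add_right)

lemma additive_map_mdiff: "additive_map N N (mdiff N)"
  by (auto simp: additive_map_def N.mdiff_closed N.mdiff_add)

lemma act_zero_left [simp]: "b \<in> carrier B \<Longrightarrow> act N \<zero>\<^bsub>N\<^esub> b = \<zero>\<^bsub>N\<^esub>"
  using additive_map_zero[OF abN abN additive_map_act_left] by simp

lemma act_zero_right [simp]: "x \<in> carrier N \<Longrightarrow> act N x \<zero>\<^bsub>B\<^esub> = \<zero>\<^bsub>N\<^esub>"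
  using additive_map_zero[OF abB abN additive_map_act_right] by simp

lemma act_sg_left: "x \<in> carrier N \<Longrightarrow> b \<in> carrier B \<Longrightarrow> act N (sg N k x) b = sg N k (act N x b)"
  by (rule additive_map_sg_commute[OF abN abN additive_map_act_left])

lemma act_sg_right: "x \<in> carrier N \<Longrightarrow> b \<in> carrier B \<Longrightarrow> act N x (sg B k b) = sg N k (act N x b)"
  by (rule additive_map_sg_commute[OF abB abN additive_map_act_right])

lemma mdiff_zero [simp]: "mdiff N \<zero>\<^bsub>N\<^esub> = \<zero>\<^bsub>N\<^esub>"
  by (rule additive_map_zero[OF abN abN additive_map_mdiff])

lemma mdiff_sg: "x \<in> carrier N \<Longrightarrow> mdiff N (sg N k x) = sg N k (mdiff N x)"
  by (rule additive_map_sg_commute[OF abN abN additive_map_mdiff])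

lemma mdiff_neg: "x \<in> carrier N \<Longrightarrow> mdiff N (\<ominus>\<^bsub>N\<^esub> x) = \<ominus>\<^bsub>N\<^esub> mdiff N x"
  by (rule additive_map_neg[OF abN abN additive_map_mdiff])

lemma mdiff_act_general:
  assumes "x \<in> carrier N" "b \<in> carrier B"
  shows "mdiff N (act N x b) = act N (mdiff N x) b \<oplus>\<^bsub>N\<^esub> act N (tN x) (adiff B b)"
  using assms(1)
proof (induction rule: N.gr.graded_induct)
  case (homog i a)
  then show ?case
    using assms(2) N.gr.homog_closed
    by (simp add: N.mdiff_act N.gr.twist_homog act_sg_left B.adiff_closed)
next
  case (add x y)
  then show ?case
    using assms(2)
    by (simp add: N.act_add_left N.mdiff_add B.adiff_closed N.mdiff_closed N.act_closed N.gr.twist_add N.a_ac)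
qed

lemma twist_act:
  assumes "x \<in> carrier N" "b \<in> carrier B"
  shows "tN (act N x b) = act N (tN x) (tB b)"
  using assms(1)
proof (induction rule: N.gr.graded_induct)
  case x: (homog i x)
  show ?case using assms(2)
  proof (induction rule: B.gr.graded_induct)
    case (homog j b)
    have "tN (act N x b) = sg N (i + int j) (act N x b)"
      by (rule N.gr.twist_homog[OF N.act_mgr[OF x homog]])
    also have "\<dots> = sg N i (sg N (int j) (act N x b))"
      using x homog B.agr_closed N.gr.homog_closed by (simp add: N.sg_sg N.act_closed)
    also have "sg N (int j) (act N x b) = sg N j (act N x b)" by (simp add: sg_def)
    finally show ?case
      using x homog B.agr_closed N.gr.homog_closed
      by (simp add: N.gr.twist_homog B.gr.twist_homog act_sg_left act_sg_right N.sg_commute[of j i])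
  next
    case (add y z)
    then show ?case using x N.gr.homog_closed
      by (simp add: N.act_add_right N.gr.twist_add N.act_closed B.gr.twist_add)
  qed
next
  case (add x y)
  then show ?case using assms(2)
    by (simp add: N.act_add_left N.gr.twist_add N.act_closed)
qed

text \<open>The differential changes the parity of the degree, whence the minus sign. It makes the
  mixed terms in the square of the tensor differential cancel.\<close>

lemma mdiff_twist:
  assumes "x \<in> carrier N"
  shows "mdiff N (tN x) = \<ominus>\<^bsub>N\<^esub> tN (mdiff N x)"
  using assms
proof (induction rule: N.gr.graded_induct)
  case (homog i x)
  then show ?case
    using N.gr.twist_homog[OF N.mdiff_mgr[OF homog]] N.gr.homog_closed
    by (auto simp: N.gr.twist_homog sg_def mdiff_neg N.mdiff_closed)
next
  case (add x y)
  then show ?case by (simp add: N.gr.twist_add N.mdiff_add N.mdiff_closed N.minus_add)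
qed

end

locale dg_sub = A: dg_algebra R A + B: dg_algebra R B
  for R :: "('r, 'x) ring_scheme" and A B :: "('r, 'b) dg_alg" +
  assumes sub: "dg_subalgebra R A B"
begin

lemma carrier_sub: "a \<in> carrier A \<Longrightarrow> a \<in> carrier B"
  using sub by (auto simp: dg_subalgebra_def)

lemma one_sub: "\<one>\<^bsub>A\<^esub> = \<one>\<^bsub>B\<^esub>" and zero_sub: "\<zero>\<^bsub>A\<^esub> = \<zero>\<^bsub>B\<^esub>"
  using sub by (auto simp: dg_subalgebra_def)

lemma add_sub: "a \<in> carrier A \<Longrightarrow> b \<in> carrier A \<Longrightarrow> a \<oplus>\<^bsub>A\<^esub> b = a \<oplus>\<^bsub>B\<^esub> b"
  and mult_sub: "a \<in> carrier A \<Longrightarrow> b \<in> carrier A \<Longrightarrow> a \<otimes>\<^bsub>A\<^esub> b = a \<otimes>\<^bsub>B\<^esub> b"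
  and agr_sub: "agr A n = carrier A \<inter> agr B n"
  and adiff_sub: "a \<in> carrier A \<Longrightarrow> adiff A a = adiff B a"
  using sub by (auto simp: dg_subalgebra_def)

lemma additive_map_incl: "additive_map A B (\<lambda>a. a)"
  by (auto simp: additive_map_def carrier_sub add_sub)

lemma abA: "abelian_group A" ..
lemma abB: "abelian_group B" ..

lemma neg_sub: "a \<in> carrier A \<Longrightarrow> \<ominus>\<^bsub>A\<^esub> a = \<ominus>\<^bsub>B\<^esub> a"
  by (rule additive_map_neg[OF abA abB additive_map_incl])

lemma sg_sub: "a \<in> carrier A \<Longrightarrow> sg A k a = sg B k a"
  by (simp add: sg_def neg_sub)

lemma twist_sub: "a \<in> carrier A \<Longrightarrow> twist A (agr A) a = twist B (agr B) a"
proof (induction rule: A.gr.graded_induct)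
  case (homog i x)
  then show ?case
    using A.gr.twist_homog[OF homog] B.gr.twist_homog[of x i] by (auto simp: agr_sub[of i] sg_sub)
next
  case (add x y)
  then show ?case
    using add_sub[OF A.gr.twist_closed[OF add(1)] A.gr.twist_closed[OF add(2)]]
      A.gr.twist_add[OF add(1,2)]
    by (simp add: B.gr.twist_add carrier_sub add_sub)
qed

lemma twn_sub: "a \<in> carrier A \<Longrightarrow> twn A (agr A) n a = twn B (agr B) n a"
  by (simp add: twn_def twist_sub)

lemma mult_closed_sub: "a \<in> carrier A \<Longrightarrow> b \<in> carrier A \<Longrightarrow> a \<otimes>\<^bsub>B\<^esub> b \<in> carrier A"
  using A.m_closed mult_sub by metis

lemma adiff_closed_sub: "a \<in> carrier A \<Longrightarrow> adiff B a \<in> carrier A"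
  using A.adiff_closed adiff_sub by metis

lemma twn_closed_sub: "a \<in> carrier A \<Longrightarrow> twn B (agr B) n a \<in> carrier A"
  using A.gr.twn_closed twn_sub by metis

lemma twist_closed_sub: "a \<in> carrier A \<Longrightarrow> twist B (agr B) a \<in> carrier A"
  using A.gr.twist_closed twist_sub by metis

lemma module_restrict:
  assumes "dg_module B M" shows "dg_module A M"
proof -
  interpret M: dg_module B M by fact
  show ?thesis
    by unfold_locales
       (auto simp: carrier_sub add_sub mult_sub agr_sub one_sub adiff_sub M.act_closed
          M.act_add_left M.act_add_right M.act_mult M.act_one M.graded M.act_mgr M.mdiff_closed
          M.mdiff_add M.mdiff_mgr M.mdiff_mdiff M.mdiff_act)
qed

end

lemma dg_subI: "dg_subalgebra R A B \<Longrightarrow> dg_sub R A B"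
  by (auto simp: dg_subalgebra_def dg_sub_def dg_sub_axioms_def)

lemma dg_subalgebra_refl: "dg_algebra R A \<Longrightarrow> dg_subalgebra R A A"
  using dg_algebra.agr_closed by (fastforce simp: dg_subalgebra_def)

lemma dg_subalgebra_trans:
  assumes "dg_subalgebra R A C" "dg_subalgebra R C B" shows "dg_subalgebra R A B"
  using assms unfolding dg_subalgebra_def by (auto simp: subset_iff)


section \<open>Base change\<close>

lemma decomposes_neg:
  assumes "abelian_group G" "\<And>i. additive_subgroup (C i) G" "decomposes G C x c"
  shows "decomposes G C (\<ominus>\<^bsub>G\<^esub> x) (\<lambda>i. \<ominus>\<^bsub>G\<^esub> c i)"
proof -
  interpret G: abelian_group G by fact
  have cC: "c i \<in> C i" for i using assms(3) by (auto simp: decomposes_def)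
  have c: "c i \<in> carrier G" for i
    using assms(2) cC by (blast intro: additive_subgroup_carrier)
  have x: "x = finsum G c {i. c i \<noteq> \<zero>\<^bsub>G\<^esub>}" using assms(3) by (auto simp: decomposes_def)
  show ?thesis
  proof (rule decomposesI[OF assms(1,2), where S = "{i. c i \<noteq> \<zero>\<^bsub>G\<^esub>}"])
    show "\<ominus>\<^bsub>G\<^esub> c i \<in> C i" for i by (rule additive_subgroup.a_inv_closed[OF assms(2) cC])
    show "\<ominus>\<^bsub>G\<^esub> x = (\<Oplus>\<^bsub>G\<^esub>i\<in>{i. c i \<noteq> \<zero>\<^bsub>G\<^esub>}. \<ominus>\<^bsub>G\<^esub> c i)"
      by (subst x, rule G.finsum_neg) (use c in auto)
  qed (use assms(3) in \<open>auto simp: decomposes_def\<close>)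
qed

text \<open>Additivity is phrased by subtraction to match the cases of
  \<open>frag_induction\<close>; zero, negatives and sums follow.\<close>

definition frag_additive :: "(('a \<Rightarrow>\<^sub>0 int) \<Rightarrow> ('c \<Rightarrow>\<^sub>0 int)) \<Rightarrow> bool" where
  "frag_additive f \<longleftrightarrow> (\<forall>u v. f (u - v) = f u - f v)"

lemma frag_additive_diff: "frag_additive f \<Longrightarrow> f (u - v) = f u - f v"
  by (simp add: frag_additive_def)

lemma frag_additive_zero: "frag_additive f \<Longrightarrow> f 0 = 0"
  using frag_additive_diff[of f 0 0] by simp

lemma frag_additive_minus: "frag_additive f \<Longrightarrow> f (- u) = - f u"
  using frag_additive_diff[of f 0 u] by (simp add: frag_additive_zero)

lemma frag_additive_add: "frag_additive f \<Longrightarrow> f (u + v) = f u + f v"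
  using frag_additive_diff[of f u "- v"] by (simp add: frag_additive_minus)

lemma frag_additive_sum: "frag_additive f \<Longrightarrow> f (sum g K) = (\<Sum>i\<in>K. f (g i))"
  by (induction K rule: infinite_finite_induct) (auto simp: frag_additive_zero frag_additive_add)

lemma frag_additive_extend [simp]: "frag_additive (frag_extend h)"
  by (simp add: frag_additive_def frag_extend_diff)

lemma frag_additive_id [simp]: "frag_additive (\<lambda>u. u)"
  by (simp add: frag_additive_def)

lemma frag_additive_zero_fun [simp]: "frag_additive (\<lambda>u. 0)"
  by (simp add: frag_additive_def)

lemma frag_additive_cmul: "frag_additive f \<Longrightarrow> frag_additive (\<lambda>u. frag_cmul c (f u))"
  by (simp add: frag_additive_def poly_mapping_eq_iff fun_eq_iff lookup_minus right_diff_distrib)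

definition fsg :: "'k::semiring_parity \<Rightarrow> ('a \<Rightarrow>\<^sub>0 int) \<Rightarrow> ('a \<Rightarrow>\<^sub>0 int)" where
  "fsg k u = (if even k then u else - u)"

text \<open>With \<open>H\<close> the group of tensor relations, congruence of two additive maps is
  tested on pure tensors. Taking for \<open>S\<close> the keys of a fixed degree allows signs that
  depend on this degree.\<close>

lemma frag_additive_agree:
  assumes "Poly_Mapping.keys u \<subseteq> S" "frag_additive f" "frag_additive g"
    and H: "0 \<in> H" "\<And>a b. a \<in> H \<Longrightarrow> b \<in> H \<Longrightarrow> a - b \<in> H"
    and "\<And>s. s \<in> S \<Longrightarrow> f (frag_of s) - g (frag_of s) \<in> H"
  shows "f u - g u \<in> H"
  using assms(1)
proof (induction u rule: frag_induction)
  case zero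
  then show ?case using assms by (simp add: frag_additive_zero)
next
  case (one x)
  then show ?case using assms by simp
next
  case (diff a b)
  have "f (a - b) - g (a - b) = (f a - g a) - (f b - g b)"
    using assms(2,3) by (simp add: frag_additive_diff)
  then show ?case using diff H(2) by metis
qed

lemma frag_additive_into:
  assumes "Poly_Mapping.keys u \<subseteq> S" "frag_additive f"
    and H: "0 \<in> H" "\<And>a b. a \<in> H \<Longrightarrow> b \<in> H \<Longrightarrow> a - b \<in> H"
    and "\<And>s. s \<in> S \<Longrightarrow> f (frag_of s) \<in> H"
  shows "f u \<in> H"
  using frag_additive_agree[OF assms(1,2) frag_additive_zero_fun H] assms(5) by simp

lemma fsg_diff: "fsg k (u - v) = fsg k u - fsg k v"
  by (simp add: fsg_def)

definition tcl :: "('r, 'b) dg_alg \<Rightarrow> ('b, 'm) dg_mod \<Rightarrow> ('r, 'b) dg_alg \<Rightarrow>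
    (('m \<times> 'b) \<Rightarrow>\<^sub>0 int) \<Rightarrow> (('m \<times> 'b) \<Rightarrow>\<^sub>0 int) set" where
  "tcl A M B u = tensor_rels A M B #>\<^bsub>tensor_free M B\<^esub> u"

text \<open>Only the relations of the target enter, so the same formula also describes maps between
  tensor products over different subalgebras.\<close>

definition tmap :: "('r, 'b) dg_alg \<Rightarrow> ('b, 'm) dg_mod \<Rightarrow> ('r, 'b) dg_alg \<Rightarrow>
    ((('m \<times> 'b) \<Rightarrow>\<^sub>0 int) \<Rightarrow> (('m \<times> 'b) \<Rightarrow>\<^sub>0 int)) \<Rightarrow>
    (('m \<times> 'b) \<Rightarrow>\<^sub>0 int) set \<Rightarrow> (('m \<times> 'b) \<Rightarrow>\<^sub>0 int) set" where
  "tmap A M B f U = tensor_rels A M B <#>\<^bsub>tensor_free M B\<^esub> (f ` U)"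

definition frags :: "('b, 'm) dg_mod \<Rightarrow> ('r, 'b) dg_alg \<Rightarrow> (('m \<times> 'b) \<Rightarrow>\<^sub>0 int) set" where
  "frags M B = {u. Poly_Mapping.keys u \<subseteq> carrier M \<times> carrier B}"

lemma frags_iff: "u \<in> frags M B \<longleftrightarrow> Poly_Mapping.keys u \<subseteq> carrier M \<times> carrier B"
  by (simp add: frags_def)

lemma frags_zero [simp]: "0 \<in> frags M B" by (simp add: frags_def)
lemma frags_diff: "u \<in> frags M B \<Longrightarrow> v \<in> frags M B \<Longrightarrow> u - v \<in> frags M B"
  using keys_diff[of u v] by (auto simp: frags_def)
lemma frags_add: "u \<in> frags M B \<Longrightarrow> v \<in> frags M B \<Longrightarrow> u + v \<in> frags M B"
  using keys_add[of u v] by (auto simp: frags_def)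
lemma frags_uminus [simp]: "- u \<in> frags M B \<longleftrightarrow> u \<in> frags M B" by (simp add: frags_def)
lemma frags_of [simp]: "frag_of (x, b) \<in> frags M B \<longleftrightarrow> x \<in> carrier M \<and> b \<in> carrier B"
  by (simp add: frags_def)
lemma frags_sum: "(\<And>i. i \<in> K \<Longrightarrow> f i \<in> frags M B) \<Longrightarrow> sum f K \<in> frags M B"
  by (induction K rule: infinite_finite_induct) (auto intro: frags_add)

lemma frags_into:
  assumes "u \<in> frags M B" "frag_additive f"
    and "\<And>x b. x \<in> carrier M \<Longrightarrow> b \<in> carrier B \<Longrightarrow> f (frag_of (x, b)) \<in> frags M' B'"
  shows "f u \<in> frags M' B'"
  by (rule frag_additive_into[of u "carrier M \<times> carrier B"])
     (use assms in \<open>auto intro: frags_diff simp: frags_iff[of u]\<close>)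

section \<open>Tensor relations and congruence of representatives\<close>

locale base_change = dg_sub R A B + dg_module_over R B N
  for R :: "('r, 'x) ring_scheme" and A B :: "('r, 'b) dg_alg" and N :: "('b, 'n) dg_mod"
begin

abbreviation "Rl \<equiv> tensor_rels A N B"
abbreviation "cl \<equiv> tcl A N B"
abbreviation "T \<equiv> tensor A N B"
abbreviation "FF \<equiv> frags N B"

definition rel_gens :: "(('n \<times> 'b) \<Rightarrow>\<^sub>0 int) set" where
  "rel_gens = {frag_of (x \<oplus>\<^bsub>N\<^esub> y, b) - frag_of (x, b) - frag_of (y, b) | x y b.
         x \<in> carrier N \<and> y \<in> carrier N \<and> b \<in> carrier B} \<union>
      {frag_of (x, b \<oplus>\<^bsub>B\<^esub> c) - frag_of (x, b) - frag_of (x, c) | x b c.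
         x \<in> carrier N \<and> b \<in> carrier B \<and> c \<in> carrier B} \<union>
      {frag_of (act N x a, b) - frag_of (x, a \<otimes>\<^bsub>B\<^esub> b) | x a b.
         x \<in> carrier N \<and> a \<in> carrier A \<and> b \<in> carrier B}"

lemma Rl_gen: "Rl = generate (tensor_free N B) rel_gens"
  by (simp add: tensor_rels_def rel_gens_def)

lemma rel_gens_FF: "rel_gens \<subseteq> FF"
  unfolding rel_gens_def
  by (auto intro!: frags_diff simp: N.act_closed carrier_sub)

lemma group_FF: "group (tensor_free N B)"
  by (simp add: tensor_free_def)

lemma carrier_FF: "carrier (tensor_free N B) = FF"
  by (auto simp: tensor_free_def frags_iff)

lemma subgroup_Rl: "subgroup Rl (tensor_free N B)"
  unfolding Rl_gen using rel_gens_FF carrier_FF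
  by (intro group.generate_is_subgroup[OF group_FF]) simp

lemma Rl_FF: "u \<in> Rl \<Longrightarrow> u \<in> FF"
  using subgroup.subset[OF subgroup_Rl] carrier_FF by blast

lemma Rl_zero [simp]: "0 \<in> Rl"
  using subgroup.one_closed[OF subgroup_Rl] by (simp add: tensor_free_def)

lemma Rl_add: "u \<in> Rl \<Longrightarrow> v \<in> Rl \<Longrightarrow> u + v \<in> Rl"
  using subgroup.m_closed[OF subgroup_Rl] by (simp add: tensor_free_def)

lemma Rl_uminus: "u \<in> Rl \<Longrightarrow> - u \<in> Rl"
  using subgroup.m_inv_closed[OF subgroup_Rl, of u] Rl_FF[of u] by (simp add: tensor_free_def frags_iff)

lemma Rl_diff: "u \<in> Rl \<Longrightarrow> v \<in> Rl \<Longrightarrow> u - v \<in> Rl"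
  using Rl_add[of u "- v"] Rl_uminus[of v] by simp

text \<open>The case \<open>diff\<close> covers both group operations, negation being subtraction
  from zero.\<close>

lemma Rl_induct [consumes 1, case_names zero add_left add_right balanced diff]:
  assumes "r \<in> Rl" "P 0"
    and "\<And>x y b. \<lbrakk>x \<in> carrier N; y \<in> carrier N; b \<in> carrier B\<rbrakk>
      \<Longrightarrow> P (frag_of (x \<oplus>\<^bsub>N\<^esub> y, b) - frag_of (x, b) - frag_of (y, b))"
    and "\<And>x b c. \<lbrakk>x \<in> carrier N; b \<in> carrier B; c \<in> carrier B\<rbrakk>
      \<Longrightarrow> P (frag_of (x, b \<oplus>\<^bsub>B\<^esub> c) - frag_of (x, b) - frag_of (x, c))"
    and "\<And>x a b. \<lbrakk>x \<in> carrier N; a \<in> carrier A; b \<in> carrier B\<rbrakk>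
      \<Longrightarrow> P (frag_of (act N x a, b) - frag_of (x, a \<otimes>\<^bsub>B\<^esub> b))"
    and diff: "\<And>u v. P u \<Longrightarrow> P v \<Longrightarrow> P (u - v)"
  shows "P r"
proof -
  have gens: "P g" if "g \<in> rel_gens" for g
    using that unfolding rel_gens_def
    by (elim UnE CollectE exE conjE) (simp_all add: assms(3-5))
  have neg: "P (- u)" if "P u" for u using diff[OF assms(2) that] by simp
  show ?thesis
    using assms(1) unfolding Rl_gen
  proof (induction rule: generate.induct)
    case one
    then show ?case using assms(2) by (simp add: tensor_free_def)
  next
    case (incl h)
    then show ?case by (rule gens)
  next
    case (inv h)
    then have "inv\<^bsub>tensor_free N B\<^esub> h = - h"
      using rel_gens_FF by (auto simp: tensor_free_def subset_iff frags_iff)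
    then show ?case using gens[OF inv] neg by simp
  next
    case (eng h1 h2)
    then show ?case using diff[of h1 "- h2"] neg[of h2] by (simp add: tensor_free_def)
  qed
qed

text \<open>Congruence modulo the tensor relations. Calculations are chains of congruences between
  representatives and are transferred to cosets by \<open>cl_eq_iff\<close>.\<close>

definition cg :: "(('n \<times> 'b) \<Rightarrow>\<^sub>0 int) \<Rightarrow> (('n \<times> 'b) \<Rightarrow>\<^sub>0 int) \<Rightarrow> bool" where
  "cg u v \<longleftrightarrow> u - v \<in> Rl"

lemma cg_refl [simp]: "cg u u" by (simp add: cg_def)
lemma cg_sym: "cg u v \<Longrightarrow> cg v u" using Rl_uminus[of "u - v"] by (simp add: cg_def)
lemma cg_trans [trans]: "cg u v \<Longrightarrow> cg v w \<Longrightarrow> cg u w"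
  using Rl_add[of "u - v" "v - w"] by (simp add: cg_def)
lemma cg_add: "cg u v \<Longrightarrow> cg u' v' \<Longrightarrow> cg (u + u') (v + v')"
  using Rl_add[of "u - v" "u' - v'"] by (simp add: cg_def algebra_simps)
lemma cg_uminus: "cg u v \<Longrightarrow> cg (- u) (- v)"
  using Rl_uminus[of "u - v"] by (simp add: cg_def)
lemma cg_diff: "cg u v \<Longrightarrow> cg u' v' \<Longrightarrow> cg (u - u') (v - v')"
  using cg_add[of u v "- u'" "- v'"] cg_uminus[of u' v'] by simp
lemma cg_fsg: "cg u v \<Longrightarrow> cg (fsg k u) (fsg k v)"
  by (simp add: fsg_def cg_uminus)
lemma cg_sum: "(\<And>i. i \<in> K \<Longrightarrow> cg (f i) (g i)) \<Longrightarrow> cg (sum f K) (sum g K)"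
  by (induction K rule: infinite_finite_induct) (auto intro: cg_add)
lemma cg_eq_trans [trans]: "u = v \<Longrightarrow> cg v w \<Longrightarrow> cg u w" "cg u v \<Longrightarrow> v = w \<Longrightarrow> cg u w" by auto

lemma cg_cmul: "cg u v \<Longrightarrow> cg (frag_cmul c u) (frag_cmul c v)"
proof -
  assume a: "cg u v"
  have "frag_cmul (int n) (u - v) \<in> Rl" for n
  proof (induction n)
    case (Suc n)
    then show ?case
      using Rl_add[OF Suc.IH] a by (simp add: cg_def frag_cmul_distrib add.commute)
  qed simp
  moreover have eq: "frag_cmul c (u - v) = frag_cmul c u - frag_cmul c v"
    by (rule frag_additive_diff[OF frag_additive_cmul[OF frag_additive_id]])
  ultimately show ?thesis
  proof (cases c rule: int_cases2)
    case (nonneg n)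
    then show ?thesis
      using \<open>\<And>n. frag_cmul (int n) (u - v) \<in> Rl\<close> eq
      unfolding cg_def by metis
  next
    case (nonpos n)
    then have "frag_cmul c (u - v) = - frag_cmul (int n) (u - v)" by simp
    then show ?thesis
      using Rl_uminus \<open>\<And>n. frag_cmul (int n) (u - v) \<in> Rl\<close> eq
      by (simp add: cg_def del: minus_frag_cmul)
  qed
qed

lemma cg_add_left:
  "x \<in> carrier N \<Longrightarrow> y \<in> carrier N \<Longrightarrow> b \<in> carrier B \<Longrightarrow>
   cg (frag_of (x \<oplus>\<^bsub>N\<^esub> y, b)) (frag_of (x, b) + frag_of (y, b))"
  unfolding cg_def Rl_gen rel_gens_def diff_diff_add[symmetric] by (rule generate.incl) blast

lemma cg_add_right:
  "x \<in> carrier N \<Longrightarrow> b \<in> carrier B \<Longrightarrow> c \<in> carrier B \<Longrightarrow>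
   cg (frag_of (x, b \<oplus>\<^bsub>B\<^esub> c)) (frag_of (x, b) + frag_of (x, c))"
  unfolding cg_def Rl_gen rel_gens_def diff_diff_add[symmetric] by (rule generate.incl) blast

lemma cg_balanced:
  "x \<in> carrier N \<Longrightarrow> a \<in> carrier A \<Longrightarrow> b \<in> carrier B \<Longrightarrow>
   cg (frag_of (act N x a, b)) (frag_of (x, a \<otimes>\<^bsub>B\<^esub> b))"
  unfolding cg_def Rl_gen rel_gens_def by (rule generate.incl) blast

lemma cg_zero_left: assumes "b \<in> carrier B" shows "cg (frag_of (\<zero>\<^bsub>N\<^esub>, b)) 0"
  using cg_uminus[OF cg_sym[OF cg_diff[OF cg_refl cg_add_left[of "\<zero>\<^bsub>N\<^esub>" "\<zero>\<^bsub>N\<^esub>" b], of "frag_of (\<zero>\<^bsub>N\<^esub>, b)"]]] assms by simp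

lemma cg_zero_right: assumes "x \<in> carrier N" shows "cg (frag_of (x, \<zero>\<^bsub>B\<^esub>)) 0"
  using cg_uminus[OF cg_sym[OF cg_diff[OF cg_refl cg_add_right[of x "\<zero>\<^bsub>B\<^esub>" "\<zero>\<^bsub>B\<^esub>"], of "frag_of (x, \<zero>\<^bsub>B\<^esub>)"]]] assms by simp

lemma cg_neg_left:
  assumes "x \<in> carrier N" "b \<in> carrier B" shows "cg (frag_of (\<ominus>\<^bsub>N\<^esub> x, b)) (- frag_of (x, b))"
proof -
  have "cg 0 (frag_of (\<zero>\<^bsub>N\<^esub>, b))" by (rule cg_sym[OF cg_zero_left[OF assms(2)]])
  also have "\<zero>\<^bsub>N\<^esub> = \<ominus>\<^bsub>N\<^esub> x \<oplus>\<^bsub>N\<^esub> x" using assms by (simp add: N.l_neg)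
  also have "cg (frag_of (\<ominus>\<^bsub>N\<^esub> x \<oplus>\<^bsub>N\<^esub> x, b)) (frag_of (\<ominus>\<^bsub>N\<^esub> x, b) + frag_of (x, b))"
    using assms by (intro cg_add_left) auto
  finally have "cg 0 (frag_of (\<ominus>\<^bsub>N\<^esub> x, b) + frag_of (x, b))" .
  from cg_diff[OF cg_sym[OF this] cg_refl[of "frag_of (x, b)"]] show ?thesis by simp
qed

lemma cg_neg_right:
  assumes "x \<in> carrier N" "b \<in> carrier B" shows "cg (frag_of (x, \<ominus>\<^bsub>B\<^esub> b)) (- frag_of (x, b))"
proof -
  have "cg 0 (frag_of (x, \<zero>\<^bsub>B\<^esub>))" by (rule cg_sym[OF cg_zero_right[OF assms(1)]])
  also have "\<zero>\<^bsub>B\<^esub> = \<ominus>\<^bsub>B\<^esub> b \<oplus>\<^bsub>B\<^esub> b" using assms by (simp add: B.l_neg)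
  also have "cg (frag_of (x, \<ominus>\<^bsub>B\<^esub> b \<oplus>\<^bsub>B\<^esub> b)) (frag_of (x, \<ominus>\<^bsub>B\<^esub> b) + frag_of (x, b))"
    using assms by (intro cg_add_right) auto
  finally have "cg 0 (frag_of (x, \<ominus>\<^bsub>B\<^esub> b) + frag_of (x, b))" .
  from cg_diff[OF cg_sym[OF this] cg_refl[of "frag_of (x, b)"]] show ?thesis by simp
qed

lemma cg_sg_left:
  "x \<in> carrier N \<Longrightarrow> b \<in> carrier B \<Longrightarrow> cg (frag_of (sg N k x, b)) (fsg k (frag_of (x, b)))"
  by (simp add: sg_def fsg_def cg_neg_left)

lemma cg_sg_right:
  "x \<in> carrier N \<Longrightarrow> b \<in> carrier B \<Longrightarrow> cg (frag_of (x, sg B k b)) (fsg k (frag_of (x, b)))"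
  by (simp add: sg_def fsg_def cg_neg_right)

lemma cg_agree:
  assumes "Poly_Mapping.keys u \<subseteq> S" "frag_additive f" "frag_additive g"
    and "\<And>s. s \<in> S \<Longrightarrow> cg (f (frag_of s)) (g (frag_of s))"
  shows "cg (f u) (g u)"
  using frag_additive_agree[OF assms(1-3) Rl_zero Rl_diff] assms(4) by (simp add: cg_def)

lemma cg_agree_FF:
  assumes "u \<in> FF" "frag_additive f" "frag_additive g"
    and "\<And>x b. x \<in> carrier N \<Longrightarrow> b \<in> carrier B \<Longrightarrow> cg (f (frag_of (x, b))) (g (frag_of (x, b)))"
  shows "cg (f u) (g u)"
  by (rule cg_agree[of u "carrier N \<times> carrier B"]) (use assms in \<open>auto simp: frags_iff\<close>)

subsection \<open>Cosets\<close>

lemma cl_set: "cl u = {r + u | r. r \<in> Rl}"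
  by (auto simp: tcl_def r_coset_def tensor_free_def)

lemma cl_eq_iff: "cl u = cl v \<longleftrightarrow> cg u v"
proof
  assume "cl u = cl v"
  moreover have "u \<in> cl u" by (auto simp: cl_set intro!: exI[of _ 0])
  ultimately obtain r where "r \<in> Rl" "u = r + v" by (auto simp: cl_set)
  then show "cg u v" by (simp add: cg_def)
next
  assume uv: "cg u v"
  have "cl u \<subseteq> cl v" if "cg u v" for u v
  proof
    fix w assume "w \<in> cl u"
    then obtain r where "r \<in> Rl" "w = r + u" by (auto simp: cl_set)
    then show "w \<in> cl v"
      using that Rl_add[of r "u - v"] by (auto simp: cl_set cg_def intro!: exI[of _ "r + (u - v)"])
  qed
  then show "cl u = cl v" using uv cg_sym by blast
qed

lemma carrier_T: "carrier T = cl ` FF"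
  by (auto simp: tensor_def FactGroup_def RCOSETS_def tcl_def carrier_FF)

lemma cl_closed: "u \<in> FF \<Longrightarrow> cl u \<in> carrier T"
  by (auto simp: carrier_T)

lemma T_cases: assumes "y \<in> carrier T" obtains u where "u \<in> FF" "y = cl u"
  using assms by (auto simp: carrier_T)

lemma T_zero: "\<zero>\<^bsub>T\<^esub> = cl 0"
  by (auto simp: tensor_def FactGroup_def cl_set)

lemma set_mult_cl: "cl u <#>\<^bsub>tensor_free N B\<^esub> cl v = cl (u + v)"
proof (intro equalityI subsetI)
  fix w assume "w \<in> cl u <#>\<^bsub>tensor_free N B\<^esub> cl v"
  then obtain r s where "r \<in> Rl" "s \<in> Rl" "w = (r + u) + (s + v)"
    by (auto simp: set_mult_def cl_set tensor_free_def)
  then show "w \<in> cl (u + v)"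
    using Rl_add[of r s] by (auto simp: cl_set algebra_simps intro!: exI[of _ "r + s"])
next
  fix w assume "w \<in> cl (u + v)"
  then obtain r where r: "r \<in> Rl" "w = (r + u) + v" by (auto simp: cl_set add.assoc)
  moreover have "r + u \<in> cl u" using r(1) by (auto simp: cl_set)
  moreover have "v \<in> cl v" by (auto simp: cl_set intro!: exI[of _ 0])
  ultimately show "w \<in> cl u <#>\<^bsub>tensor_free N B\<^esub> cl v"
    unfolding set_mult_def tensor_free_def by auto
qed

lemma T_add: "cl u \<oplus>\<^bsub>T\<^esub> cl v = cl (u + v)"
  by (simp add: tensor_def FactGroup_def set_mult_cl)

lemma abelian_group_T: "abelian_group T"
proof (rule abelian_groupI)
  fix x y assume "x \<in> carrier T" "y \<in> carrier T"
  then show "x \<oplus>\<^bsub>T\<^esub> y \<in> carrier T"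
    by (elim T_cases) (simp add: T_add cl_closed frags_add)
next
  fix x assume "x \<in> carrier T"
  then obtain u where u: "u \<in> FF" "x = cl u" by (rule T_cases)
  then show "\<exists>y\<in>carrier T. y \<oplus>\<^bsub>T\<^esub> x = \<zero>\<^bsub>T\<^esub>"
    by (intro bexI[of _ "cl (- u)"]) (auto simp: T_add T_zero intro!: cl_closed)
qed (auto elim!: T_cases simp: T_zero T_add algebra_simps intro!: cl_closed)

sublocale T: abelian_group T by (rule abelian_group_T)

lemma T_uminus: "u \<in> FF \<Longrightarrow> \<ominus>\<^bsub>T\<^esub> cl u = cl (- u)"
  by (rule T.minus_equality) (auto simp: T_add T_zero intro!: cl_closed)

lemma T_minus: "u \<in> FF \<Longrightarrow> v \<in> FF \<Longrightarrow> cl u \<ominus>\<^bsub>T\<^esub> cl v = cl (u - v)"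
  by (simp add: a_minus_def T_uminus T_add)

lemma T_sg: "u \<in> FF \<Longrightarrow> sg T k (cl u) = cl (fsg k u)"
  by (simp add: sg_def fsg_def T_uminus)

lemma T_finsum: 
  assumes "finite K" "\<And>i. i \<in> K \<Longrightarrow> f i \<in> FF"
  shows "finsum T (\<lambda>i. cl (f i)) K = cl (sum f K)"
  using assms
proof (induction K)
  case empty
  then show ?case by (simp add: T_zero)
next
  case (insert k K)
  then show ?case
    by (subst T.finsum_insert) (auto simp: T_add intro!: cl_closed)
qed

end

section \<open>Maps induced between tensor products over two subalgebras\<close>

locale two_base_changes = S: base_change R A B N + S': base_change R C B N
  for R :: "('r, 'x) ring_scheme" and A C B :: "('r, 'b) dg_alg" and N :: "('b, 'n) dg_mod"
begin

text \<open>The conditions under which a map of free abelian groups descends to cosets. No inclusion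
  between \<open>A\<close> and \<open>C\<close> is assumed; this permits \<open>A = C\<close> for
  endomorphisms, and the two interchanged for maps in the opposite direction.\<close>

definition resp where
  "resp f \<longleftrightarrow> frag_additive f \<and> (\<forall>u\<in>frags N B. f u \<in> frags N B) \<and>
     (\<forall>r\<in>tensor_rels A N B. f r \<in> tensor_rels C N B)"

lemma respI:
  assumes "frag_additive f"
    and "\<And>x b. x \<in> carrier N \<Longrightarrow> b \<in> carrier B \<Longrightarrow> f (frag_of (x, b)) \<in> frags N B"
    and "\<And>x y b. \<lbrakk>x \<in> carrier N; y \<in> carrier N; b \<in> carrier B\<rbrakk>
      \<Longrightarrow> S'.cg (f (frag_of (x \<oplus>\<^bsub>N\<^esub> y, b))) (f (frag_of (x, b)) + f (frag_of (y, b)))"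
    and "\<And>x b c. \<lbrakk>x \<in> carrier N; b \<in> carrier B; c \<in> carrier B\<rbrakk>
      \<Longrightarrow> S'.cg (f (frag_of (x, b \<oplus>\<^bsub>B\<^esub> c))) (f (frag_of (x, b)) + f (frag_of (x, c)))"
    and "\<And>x a b. \<lbrakk>x \<in> carrier N; a \<in> carrier A; b \<in> carrier B\<rbrakk>
      \<Longrightarrow> S'.cg (f (frag_of (act N x a, b))) (f (frag_of (x, a \<otimes>\<^bsub>B\<^esub> b)))"
  shows "resp f"
  unfolding resp_def
proof (intro conjI ballI)
  fix u :: "('n \<times> 'b) \<Rightarrow>\<^sub>0 int" assume "u \<in> frags N B"
  then show "f u \<in> frags N B" by (rule frags_into) (use assms(1,2) in auto)
next
  fix r assume "r \<in> tensor_rels A N B"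
  then show "f r \<in> tensor_rels C N B"
    by (induction rule: S.Rl_induct)
       (use assms(1,3-5) in \<open>auto simp: frag_additive_zero frag_additive_diff frag_additive_add S'.cg_def diff_diff_add intro: S'.Rl_diff\<close>)
qed fact

lemma tmap_cl:
  assumes "resp f" "u \<in> frags N B"
  shows "tmap C N B f (tcl A N B u) = tcl C N B (f u)"
proof -
  have add: "f (v + w) = f v + f w" for v w
    using assms(1) by (simp add: resp_def frag_additive_add)
  show ?thesis
  proof (intro equalityI subsetI)
    fix w assume "w \<in> tmap C N B f (tcl A N B u)"
    then obtain s r where "s \<in> tensor_rels C N B" "r \<in> tensor_rels A N B" "w = s + f (r + u)"
      by (auto simp: tmap_def set_mult_def S.cl_set tensor_free_def)
    then show "w \<in> tcl C N B (f u)"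
      using assms(1) S'.Rl_add[of s "f r"]
      by (auto simp: resp_def add add.assoc S'.cl_set intro!: exI[of _ "s + f r"])
  next
    fix w assume "w \<in> tcl C N B (f u)"
    then obtain r where "r \<in> tensor_rels C N B" "w = r + f u" by (auto simp: S'.cl_set)
    moreover have "u \<in> tcl A N B u" by (auto simp: S.cl_set intro!: exI[of _ 0])
    ultimately show "w \<in> tmap C N B f (tcl A N B u)"
      unfolding tmap_def set_mult_def tensor_free_def by auto
  qed
qed

lemma resp_FF: "resp f \<Longrightarrow> u \<in> frags N B \<Longrightarrow> f u \<in> frags N B"
  by (simp add: resp_def)

lemma additive_map_tmap:
  assumes "resp f" shows "additive_map S.T S'.T (tmap C N B f)"
proof (rule additive_mapI)
  fix x assume "x \<in> carrier S.T"
  then obtain u where "u \<in> frags N B" "x = tcl A N B u" by (rule S.T_cases)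
  then show "tmap C N B f x \<in> carrier S'.T"
    using assms by (simp add: tmap_cl resp_FF S'.cl_closed)
next
  fix x y assume "x \<in> carrier S.T" "y \<in> carrier S.T"
  then obtain u v where *: "u \<in> frags N B" "x = tcl A N B u" "v \<in> frags N B" "y = tcl A N B v"
    by (elim S.T_cases)
  then show "tmap C N B f (x \<oplus>\<^bsub>S.T\<^esub> y) = tmap C N B f x \<oplus>\<^bsub>S'.T\<^esub> tmap C N B f y"
    using assms frag_additive_add[of f u v]
    by (simp add: S.T_add S'.T_add tmap_cl frags_add resp_def)
qed

end

lemma (in base_change) two_self: "two_base_changes R A A B N"
  by (intro two_base_changes.intro base_change_axioms)


section \<open>The DG module structure of the tensor product\<close>

context base_change begin

definition "rmult c = frag_extend (\<lambda>(x, b). frag_of (x, b \<otimes>\<^bsub>B\<^esub> c))"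
definition "fdiff = frag_extend (\<lambda>(x, b). frag_of (mdiff N x, b) + frag_of (tN x, adiff B b))"
definition "homog_keys k = {(x, b). \<exists>i n. x \<in> mgr N i \<and> b \<in> agr B n \<and> i + int n = k}"

lemma frag_additive_rmult [simp]: "frag_additive (rmult c)"
  by (simp add: rmult_def)

lemma frag_additive_fdiff [simp]: "frag_additive fdiff"
  by (simp add: fdiff_def)

lemma rmult_diff: "rmult c (u - v) = rmult c u - rmult c v"
  by (rule frag_additive_diff) simp

lemma fdiff_diff: "fdiff (u - v) = fdiff u - fdiff v"
  by (rule frag_additive_diff) simp

lemmas frag_diffs = frag_additive_def rmult_diff fdiff_diff fsg_diff

lemma rmult_of [simp]: "rmult c (frag_of (x, b)) = frag_of (x, b \<otimes>\<^bsub>B\<^esub> c)"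
  by (simp add: rmult_def)

lemma fdiff_of [simp]: "fdiff (frag_of (x, b)) = frag_of (mdiff N x, b) + frag_of (tN x, adiff B b)"
  by (simp add: fdiff_def)

lemma resp_rmult:
  assumes "c \<in> carrier B" shows "two_base_changes.resp A A B N (rmult c)"
  by (rule two_base_changes.respI[OF two_self])
     (use assms in \<open>auto simp: cg_add_left cg_add_right B.l_distr cg_balanced B.m_assoc carrier_sub\<close>)

text \<open>The balancing relation is the substantial case. The Leibniz rule for the product of
  \<open>x\<close> and \<open>a\<close> leaves three terms, and in each the factor coming from
  \<open>a\<close> (\<open>a\<close> itself, its differential, its twist) is moved across the tensor
  sign. All three lie in \<open>A\<close> because \<open>A\<close> is closed under the differential
  and graded.\<close>

lemma resp_fdiff: "two_base_changes.resp A A B N fdiff"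
proof (rule two_base_changes.respI[OF two_self])
  fix x b assume "x \<in> carrier N" "b \<in> carrier B"
  then show "fdiff (frag_of (x, b)) \<in> FF"
    by (auto intro!: frags_add simp: N.mdiff_closed B.adiff_closed)
next
  fix x y b assume a: "x \<in> carrier N" "y \<in> carrier N" "b \<in> carrier B"
  have "cg (frag_of (mdiff N x \<oplus>\<^bsub>N\<^esub> mdiff N y, b) + frag_of (tN x \<oplus>\<^bsub>N\<^esub> tN y, adiff B b))
     ((frag_of (mdiff N x, b) + frag_of (mdiff N y, b)) + (frag_of (tN x, adiff B b) + frag_of (tN y, adiff B b)))"
    using a by (intro cg_add cg_add_left) (auto simp: N.mdiff_closed B.adiff_closed)
  then show "cg (fdiff (frag_of (x \<oplus>\<^bsub>N\<^esub> y, b))) (fdiff (frag_of (x, b)) + fdiff (frag_of (y, b)))"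
    using a by (simp add: N.mdiff_add N.gr.twist_add algebra_simps)
next
  fix x b c assume a: "x \<in> carrier N" "b \<in> carrier B" "c \<in> carrier B"
  have "cg (frag_of (mdiff N x, b \<oplus>\<^bsub>B\<^esub> c) + frag_of (tN x, adiff B b \<oplus>\<^bsub>B\<^esub> adiff B c))
     ((frag_of (mdiff N x, b) + frag_of (mdiff N x, c)) + (frag_of (tN x, adiff B b) + frag_of (tN x, adiff B c)))"
    using a by (intro cg_add cg_add_right) (auto simp: N.mdiff_closed B.adiff_closed)
  then show "cg (fdiff (frag_of (x, b \<oplus>\<^bsub>B\<^esub> c))) (fdiff (frag_of (x, b)) + fdiff (frag_of (x, c)))"
    using a by (simp add: B.adiff_add algebra_simps)
next
  fix x a b assume h: "x \<in> carrier N" "a \<in> carrier A" "b \<in> carrier B"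
  have aB: "a \<in> carrier B" "tB a \<in> carrier A" "adiff B a \<in> carrier A"
    using h carrier_sub twist_closed_sub adiff_closed_sub by auto
  have "cg (frag_of (act N (mdiff N x) a \<oplus>\<^bsub>N\<^esub> act N (tN x) (adiff B a), b) + frag_of (act N (tN x) (tB a), adiff B b))
    ((frag_of (act N (mdiff N x) a, b) + frag_of (act N (tN x) (adiff B a), b)) + frag_of (act N (tN x) (tB a), adiff B b))"
    using h aB by (intro cg_add cg_add_left) (auto simp: N.mdiff_closed B.adiff_closed N.act_closed)
  also have "cg \<dots> ((frag_of (mdiff N x, a \<otimes>\<^bsub>B\<^esub> b) + frag_of (tN x, adiff B a \<otimes>\<^bsub>B\<^esub> b)) + frag_of (tN x, tB a \<otimes>\<^bsub>B\<^esub> adiff B b))"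
    using h aB by (intro cg_add cg_balanced) (auto simp: N.mdiff_closed B.adiff_closed)
  also have "\<dots> = frag_of (mdiff N x, a \<otimes>\<^bsub>B\<^esub> b) + (frag_of (tN x, adiff B a \<otimes>\<^bsub>B\<^esub> b) + frag_of (tN x, tB a \<otimes>\<^bsub>B\<^esub> adiff B b))"
    by (simp add: add.assoc)
  also have "cg \<dots> (frag_of (mdiff N x, a \<otimes>\<^bsub>B\<^esub> b) + frag_of (tN x, adiff B a \<otimes>\<^bsub>B\<^esub> b \<oplus>\<^bsub>B\<^esub> tB a \<otimes>\<^bsub>B\<^esub> adiff B b))"
    using h aB by (intro cg_add cg_refl cg_sym[OF cg_add_right]) (auto simp: carrier_sub B.adiff_closed)
  finally show "cg (fdiff (frag_of (act N x a, b))) (fdiff (frag_of (x, a \<otimes>\<^bsub>B\<^esub> b)))"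
    using h aB by (simp add: mdiff_act_general twist_act B.adiff_mult_general)
qed simp

lemma act_T: "u \<in> FF \<Longrightarrow> c \<in> carrier B \<Longrightarrow> act T (cl u) c = cl (rmult c u)"
  using two_base_changes.tmap_cl[OF two_self resp_rmult]
  by (simp add: tensor_def tensor_induced_def tmap_def rmult_def)

lemma mdiff_T: "u \<in> FF \<Longrightarrow> mdiff T (cl u) = cl (fdiff u)"
  using two_base_changes.tmap_cl[OF two_self resp_fdiff]
  by (simp add: tensor_def tensor_induced_def tmap_def fdiff_def)

lemma mgr_T: "mgr T k = {cl u | u. Poly_Mapping.keys u \<subseteq> homog_keys k}"
  by (simp add: tensor_def tcl_def homog_keys_def)

lemma rmult_FF: "c \<in> carrier B \<Longrightarrow> u \<in> FF \<Longrightarrow> rmult c u \<in> FF"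
  by (rule two_base_changes.resp_FF[OF two_self resp_rmult])

lemma fdiff_FF: "u \<in> FF \<Longrightarrow> fdiff u \<in> FF"
  by (rule two_base_changes.resp_FF[OF two_self resp_fdiff])

lemma homog_keys_sub: "homog_keys k \<subseteq> carrier N \<times> carrier B"
  by (auto simp: homog_keys_def N.gr.homog_closed B.agr_closed)

lemma homog_keys_FF: "Poly_Mapping.keys u \<subseteq> homog_keys k \<Longrightarrow> u \<in> FF"
  using homog_keys_sub by (auto simp: frags_iff)

lemma mgr_T_cases:
  assumes "y \<in> mgr T k" obtains u where "Poly_Mapping.keys u \<subseteq> homog_keys k" "u \<in> FF" "y = cl u"
  using assms homog_keys_FF unfolding mgr_T by blast

lemma cl_mgr: "Poly_Mapping.keys u \<subseteq> homog_keys k \<Longrightarrow> cl u \<in> mgr T k"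
  by (auto simp: mgr_T)

lemma keys_diff_sub: "Poly_Mapping.keys u \<subseteq> S \<Longrightarrow> Poly_Mapping.keys v \<subseteq> S \<Longrightarrow> Poly_Mapping.keys (u - v) \<subseteq> S"
  using keys_diff[of u v] by blast

lemma keys_add_sub: "Poly_Mapping.keys u \<subseteq> S \<Longrightarrow> Poly_Mapping.keys v \<subseteq> S \<Longrightarrow> Poly_Mapping.keys (u + v) \<subseteq> S"
  using keys_add[of u v] by blast

lemma homog_subgroup_T: "additive_subgroup (mgr T k) T"
proof (rule additive_subgroupI'[OF abelian_group_T])
  show "mgr T k \<subseteq> carrier T" by (auto elim!: mgr_T_cases intro: cl_closed)
  show "\<zero>\<^bsub>T\<^esub> \<in> mgr T k" unfolding T_zero by (rule cl_mgr) simp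
  fix x assume "x \<in> mgr T k"
  then obtain u where u: "Poly_Mapping.keys u \<subseteq> homog_keys k" "u \<in> FF" "x = cl u" by (rule mgr_T_cases)
  then show "\<ominus>\<^bsub>T\<^esub> x \<in> mgr T k" by (simp add: T_uminus cl_mgr)
  fix y assume "y \<in> mgr T k"
  then obtain v where "Poly_Mapping.keys v \<subseteq> homog_keys k" "v \<in> FF" "y = cl v" by (rule mgr_T_cases)
  then show "x \<oplus>\<^bsub>T\<^esub> y \<in> mgr T k" using u by (simp add: T_add cl_mgr keys_add_sub)
qed

lemma frag_of_mgr: "x \<in> mgr N i \<Longrightarrow> b \<in> agr B n \<Longrightarrow> cl (frag_of (x, b)) \<in> mgr T (i + int n)"
  by (rule cl_mgr) (auto simp: homog_keys_def)

text \<open>Existence only: pure tensors of homogeneous elements are homogeneous, and they generate.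
  Uniqueness has to come from projections, since the relations might a priori mix degrees.\<close>

lemma T_decomposes: "y \<in> carrier T \<Longrightarrow> \<exists>c. decomposes T (mgr T) y c"
proof -
  have Dadd: "\<exists>c. decomposes T (mgr T) (y \<oplus>\<^bsub>T\<^esub> z) c"
    if "\<exists>c. decomposes T (mgr T) y c" "\<exists>c. decomposes T (mgr T) z c" for y z
    using that by (elim exE) (rule exI, rule decomposes_add[OF abelian_group_T homog_subgroup_T])
  have Dneg: "\<exists>c. decomposes T (mgr T) (\<ominus>\<^bsub>T\<^esub> y) c" if "\<exists>c. decomposes T (mgr T) y c" for y
    using that by (elim exE) (rule exI, rule decomposes_neg[OF abelian_group_T homog_subgroup_T])
  have gen: "\<exists>c. decomposes T (mgr T) (cl (frag_of (x, b))) c" if "x \<in> carrier N" "b \<in> carrier B" for x b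
    using that
  proof (induction arbitrary: b rule: N.gr.graded_induct)
    case x: (homog i x)
    show ?case using x(2)
    proof (induction rule: B.gr.graded_induct)
      case (homog n b)
      then show ?case using decomposes_homog[where C = "mgr T", OF abelian_group_T homog_subgroup_T frag_of_mgr] x by blast
    next
      case (add b c)
      then have "cl (frag_of (x, b \<oplus>\<^bsub>B\<^esub> c)) = cl (frag_of (x, b)) \<oplus>\<^bsub>T\<^esub> cl (frag_of (x, c))"
        using x N.gr.homog_closed by (simp add: T_add cl_eq_iff cg_add_right)
      then show ?case
        using Dadd[OF add.IH] by simp
    qed
  next
    case (add x y)
    then have "cl (frag_of (x \<oplus>\<^bsub>N\<^esub> y, b)) = cl (frag_of (x, b)) \<oplus>\<^bsub>T\<^esub> cl (frag_of (y, b))"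
      by (simp add: T_add cl_eq_iff cg_add_left)
    then show ?case
      using Dadd[OF add.IH[OF add.prems]] by simp
  qed
  have "Poly_Mapping.keys u \<subseteq> carrier N \<times> carrier B \<Longrightarrow> u \<in> FF \<and> (\<exists>c. decomposes T (mgr T) (cl u) c)" for u
  proof (induction u rule: frag_induction)
    case zero
    have "decomposes T (mgr T) (cl 0) (\<lambda>i. \<zero>\<^bsub>T\<^esub>)"
      using decomposes_homog[where C = "mgr T" and j = 0, OF abelian_group_T homog_subgroup_T
          additive_subgroup.zero_closed[OF homog_subgroup_T]] by (simp add: T_zero)
    then show ?case by auto
  next
    case (one s)
    then show ?case using gen by (cases s) auto
  next
    case (diff u v)
    then have "cl (u - v) = cl u \<oplus>\<^bsub>T\<^esub> (\<ominus>\<^bsub>T\<^esub> cl v)" by (simp add: T_uminus T_add)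
    then show ?case
      using diff Dadd[of "cl u"] Dneg[of "cl v"] by (simp add: frags_diff)
  qed
  then show "y \<in> carrier T \<Longrightarrow> \<exists>c. decomposes T (mgr T) y c"
    by (elim T_cases) (simp add: frags_iff)
qed

text \<open>The projection to degree \<open>k\<close> on representatives, as required by
  \<open>graded_byI\<close>. The sum runs over the support of \<open>b\<close> to stay finite, so it
  is additive in \<open>b\<close> only up to congruence.\<close>

definition "hproj k = frag_extend (\<lambda>(x, b).
  \<Sum>n\<in>{n. hcomp B (agr B) n b \<noteq> \<zero>\<^bsub>B\<^esub>}. frag_of (hcomp N (mgr N) (k - int n) x, hcomp B (agr B) n b))"

lemma frag_additive_hproj [simp]: "frag_additive (hproj k)"
  by (simp add: hproj_def)

text \<open>Additional indices contribute tensors with zero right factor. Elements with different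
  supports can thus be compared over the union of the supports.\<close>

lemma hproj_of:
  assumes "x \<in> carrier N" "b \<in> carrier B" "finite S" "{n. hcomp B (agr B) n b \<noteq> \<zero>\<^bsub>B\<^esub>} \<subseteq> S"
  shows "cg (hproj k (frag_of (x, b)))
     (\<Sum>n\<in>S. frag_of (hcomp N (mgr N) (k - int n) x, hcomp B (agr B) n b))"
proof -
  let ?Z = "{n. hcomp B (agr B) n b \<noteq> \<zero>\<^bsub>B\<^esub>}"
  let ?f = "\<lambda>n. frag_of (hcomp N (mgr N) (k - int n) x, hcomp B (agr B) n b)"
  have "sum ?f S = sum ?f ?Z + sum ?f (S - ?Z)"
    using sum.subset_diff[OF assms(4,3), of ?f] by (simp add: add.commute)
  also have "cg \<dots> (sum ?f ?Z + (\<Sum>n\<in>S - ?Z. 0))"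
    using assms(1) by (intro cg_add cg_refl cg_sum) (auto intro: cg_zero_right)
  finally show ?thesis by (simp add: hproj_def cg_sym)
qed

lemma hproj_add_left:
  assumes "x \<in> carrier N" "y \<in> carrier N" "b \<in> carrier B"
  shows "cg (hproj k (frag_of (x \<oplus>\<^bsub>N\<^esub> y, b))) (hproj k (frag_of (x, b)) + hproj k (frag_of (y, b)))"
proof -
  let ?h = "\<lambda>n. hcomp B (agr B) n b"
  have "cg (\<Sum>n | ?h n \<noteq> \<zero>\<^bsub>B\<^esub>. frag_of (hcomp N (mgr N) (k - int n) (x \<oplus>\<^bsub>N\<^esub> y), ?h n))
    (\<Sum>n | ?h n \<noteq> \<zero>\<^bsub>B\<^esub>. frag_of (hcomp N (mgr N) (k - int n) x, ?h n) + frag_of (hcomp N (mgr N) (k - int n) y, ?h n))"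
    using assms by (intro cg_sum) (auto simp: N.gr.hcomp_add intro!: cg_add_left)
  then show ?thesis by (simp add: hproj_def sum.distrib)
qed

lemma hproj_add_right:
  assumes "x \<in> carrier N" "b \<in> carrier B" "c \<in> carrier B"
  shows "cg (hproj k (frag_of (x, b \<oplus>\<^bsub>B\<^esub> c))) (hproj k (frag_of (x, b)) + hproj k (frag_of (x, c)))"
proof -
  let ?h = "\<lambda>n. hcomp B (agr B) n"
  let ?S = "{n. ?h n b \<noteq> \<zero>\<^bsub>B\<^esub>} \<union> {n. ?h n c \<noteq> \<zero>\<^bsub>B\<^esub>}"
  let ?x = "\<lambda>n. hcomp N (mgr N) (k - int n) x"
  have fin: "finite ?S" using assms by (simp add: B.gr.finite_hcomp)
  have "cg (hproj k (frag_of (x, b \<oplus>\<^bsub>B\<^esub> c))) (\<Sum>n\<in>?S. frag_of (?x n, ?h n (b \<oplus>\<^bsub>B\<^esub> c)))"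
    using assms fin by (intro hproj_of) (auto simp: B.gr.hcomp_add)
  also have "cg \<dots> (\<Sum>n\<in>?S. frag_of (?x n, ?h n b) + frag_of (?x n, ?h n c))"
    using assms by (intro cg_sum) (auto simp: B.gr.hcomp_add intro!: cg_add_right)
  also have "\<dots> = (\<Sum>n\<in>?S. frag_of (?x n, ?h n b)) + (\<Sum>n\<in>?S. frag_of (?x n, ?h n c))"
    by (rule sum.distrib)
  also have "cg \<dots> (hproj k (frag_of (x, b)) + hproj k (frag_of (x, c)))"
    using assms fin by (intro cg_add cg_sym[OF hproj_of]) auto
  finally show ?thesis .
qed

lemma hproj_homog:
  assumes "x \<in> mgr N i" "b \<in> agr B n"
  shows "cg (hproj k (frag_of (x, b))) (if i + int n = k then frag_of (x, b) else 0)"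
proof -
  have c: "x \<in> carrier N" "b \<in> carrier B" using assms N.gr.homog_closed B.agr_closed by auto
  have "cg (hproj k (frag_of (x, b))) (\<Sum>m\<in>{n}. frag_of (hcomp N (mgr N) (k - int m) x, hcomp B (agr B) m b))"
    using c assms by (intro hproj_of) (auto simp: B.gr.hcomp_homog split: if_splits)
  also have "cg \<dots> (if i + int n = k then frag_of (x, b) else 0)"
    using c assms cg_zero_left[of b]
    by (auto simp: B.gr.hcomp_homog[OF assms(2)] N.gr.hcomp_homog[OF assms(1)])
  finally show ?thesis .
qed

text \<open>For balancing, three nested graded inductions reduce to homogeneous \<open>x\<close>,
  \<open>a\<close> and \<open>b\<close>. There both sides of the relation have the same total degree
  and are kept or discarded together.\<close>

lemma resp_hproj: "two_base_changes.resp A A B N (hproj k)"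
proof (rule two_base_changes.respI[OF two_self])
  fix x b assume "x \<in> carrier N" "b \<in> carrier B"
  then show "hproj k (frag_of (x, b)) \<in> FF" by (auto simp: hproj_def intro!: frags_sum)
next
  fix x a b assume "x \<in> carrier N" "a \<in> carrier A" "b \<in> carrier B"
  then show "cg (hproj k (frag_of (act N x a, b))) (hproj k (frag_of (x, a \<otimes>\<^bsub>B\<^esub> b)))"
  proof (induction arbitrary: a b rule: N.gr.graded_induct)
    case x: (homog i x)
    have xc: "x \<in> carrier N" using x N.gr.homog_closed by auto
    show ?case using x(2,3)
    proof (induction arbitrary: b rule: A.gr.graded_induct)
      case a: (homog m a)
      have ac: "a \<in> carrier A" "a \<in> carrier B" "a \<in> agr B m"
        using a agr_sub[of m] carrier_sub by auto
      show ?case using a(2)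
      proof (induction rule: B.gr.graded_induct)
        case (homog n b)
        have "cg (hproj k (frag_of (act N x a, b))) (if i + int m + int n = k then frag_of (act N x a, b) else 0)"
          using N.act_mgr[OF x(1) ac(3)] homog by (rule hproj_homog)
        also have "cg \<dots> (if i + int (m + n) = k then frag_of (x, a \<otimes>\<^bsub>B\<^esub> b) else 0)"
          using xc ac homog B.agr_closed by (auto intro!: cg_balanced)
        also have "cg \<dots> (hproj k (frag_of (x, a \<otimes>\<^bsub>B\<^esub> b)))"
          by (rule cg_sym[OF hproj_homog[OF x(1) B.mult_agr[OF ac(3) homog]]])
        finally show ?case .
      next
        case (add b c)
        have "cg (hproj k (frag_of (act N x a, b \<oplus>\<^bsub>B\<^esub> c)))
           (hproj k (frag_of (act N x a, b)) + hproj k (frag_of (act N x a, c)))"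
          using xc ac add by (intro hproj_add_right) (auto simp: N.act_closed)
        also have "cg \<dots> (hproj k (frag_of (x, a \<otimes>\<^bsub>B\<^esub> b)) + hproj k (frag_of (x, a \<otimes>\<^bsub>B\<^esub> c)))"
          by (intro cg_add add)
        also have "cg \<dots> (hproj k (frag_of (x, a \<otimes>\<^bsub>B\<^esub> b \<oplus>\<^bsub>B\<^esub> a \<otimes>\<^bsub>B\<^esub> c)))"
          using xc ac add by (intro cg_sym[OF hproj_add_right]) auto
        finally show ?case using xc ac add by (simp add: B.r_distr)
      qed
    next
      case (add a a')
      have ac: "a \<in> carrier B" "a' \<in> carrier B" using add carrier_sub by auto
      have "cg (hproj k (frag_of (act N x a \<oplus>\<^bsub>N\<^esub> act N x a', b)))
         (hproj k (frag_of (act N x a, b)) + hproj k (frag_of (act N x a', b)))"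
        using xc ac add.prems by (intro hproj_add_left) (auto simp: N.act_closed)
      also have "cg \<dots> (hproj k (frag_of (x, a \<otimes>\<^bsub>B\<^esub> b)) + hproj k (frag_of (x, a' \<otimes>\<^bsub>B\<^esub> b)))"
        by (intro cg_add add)
      also have "cg \<dots> (hproj k (frag_of (x, a \<otimes>\<^bsub>B\<^esub> b \<oplus>\<^bsub>B\<^esub> a' \<otimes>\<^bsub>B\<^esub> b)))"
        using xc ac add.prems by (intro cg_sym[OF hproj_add_right]) auto
      finally show ?case using xc ac add by (simp add: B.l_distr N.act_add_right add_sub)
    qed
  next
    case (add x y)
    have ac: "a \<in> carrier B" using add carrier_sub by auto
    have "cg (hproj k (frag_of (act N x a \<oplus>\<^bsub>N\<^esub> act N y a, b)))
       (hproj k (frag_of (act N x a, b)) + hproj k (frag_of (act N y a, b)))"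
      using ac add by (intro hproj_add_left) (auto simp: N.act_closed)
    also have "cg \<dots> (hproj k (frag_of (x, a \<otimes>\<^bsub>B\<^esub> b)) + hproj k (frag_of (y, a \<otimes>\<^bsub>B\<^esub> b)))"
      by (intro cg_add add)
    also have "cg \<dots> (hproj k (frag_of (x \<oplus>\<^bsub>N\<^esub> y, a \<otimes>\<^bsub>B\<^esub> b)))"
      using ac add by (intro cg_sym[OF hproj_add_left]) auto
    finally show ?case using ac add by (simp add: N.act_add_left)
  qed
qed (auto simp: hproj_add_left hproj_add_right)

lemma graded_T: "graded_by T (mgr T)"
proof (rule graded_byI[OF abelian_group_T homog_subgroup_T, where pr = "\<lambda>k. tmap A N B (hproj k)"])
  have hp: "cg (hproj k u) (if j = k then u else 0)" if "Poly_Mapping.keys u \<subseteq> homog_keys j" for j k u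
  proof (rule cg_agree[OF that frag_additive_hproj, where g = "\<lambda>u. if j = k then u else 0"])
    fix s assume "s \<in> homog_keys j"
    then obtain x b i m where s: "s = (x, b)" "x \<in> mgr N i" "b \<in> agr B m" "i + int m = j"
      by (auto simp: homog_keys_def)
    then show "cg (hproj k (frag_of s)) (if j = k then frag_of s else 0)"
      using hproj_homog[OF s(2,3), of k] by (auto split: if_splits)
  qed (simp add: frag_additive_def)
  show "additive_map T T (tmap A N B (hproj k))" for k
    by (rule two_base_changes.additive_map_tmap[OF two_self resp_hproj])
  show "tmap A N B (hproj k) y = y" if "y \<in> mgr T k" for y k
    using that hp[of _ k k]
    by (elim mgr_T_cases) (simp add: two_base_changes.tmap_cl[OF two_self resp_hproj] cl_eq_iff)
  show "tmap A N B (hproj k) y = \<zero>\<^bsub>T\<^esub>" if "y \<in> mgr T j" "j \<noteq> k" for y k j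
    using that hp[of _ j k]
    by (elim mgr_T_cases) (simp add: two_base_changes.tmap_cl[OF two_self resp_hproj] cl_eq_iff T_zero)
qed (rule T_decomposes)

lemma rmult_homog:
  assumes "Poly_Mapping.keys u \<subseteq> homog_keys k" "c \<in> agr B n"
  shows "Poly_Mapping.keys (rmult c u) \<subseteq> homog_keys (k + int n)"
proof -
  have "rmult c u \<in> {v. Poly_Mapping.keys v \<subseteq> homog_keys (k + int n)}"
  proof (rule frag_additive_into[OF assms(1) frag_additive_rmult])
    fix s assume "s \<in> homog_keys k"
    then obtain x b i m where s: "s = (x, b)" "x \<in> mgr N i" "b \<in> agr B m" "i + int m = k"
      by (auto simp: homog_keys_def)
    then have "b \<otimes>\<^bsub>B\<^esub> c \<in> agr B (m + n)" using B.mult_agr assms(2) by blast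
    then show "rmult c (frag_of s) \<in> {v. Poly_Mapping.keys v \<subseteq> homog_keys (k + int n)}"
      using s by (auto simp: homog_keys_def intro!: exI[of _ i] exI[of _ "m + n"])
  qed (simp_all add: keys_diff_sub)
  then show ?thesis by simp
qed

text \<open>The representative may have to be changed: for \<open>b\<close> of degree 0 the
  differential of \<open>x \<otimes> b\<close> contains a summand with right factor zero, whose key
  is not listed in degree \<open>k - 1\<close> because degrees in \<open>B\<close> are natural
  numbers.\<close>

lemma fdiff_homog:
  assumes "Poly_Mapping.keys u \<subseteq> homog_keys k" 
  shows "\<exists>v. cg (fdiff u) v \<and> Poly_Mapping.keys v \<subseteq> homog_keys (k - 1)"
proof -
  have "fdiff u \<in> {w. \<exists>v. cg w v \<and> Poly_Mapping.keys v \<subseteq> homog_keys (k - 1)}"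
  proof (rule frag_additive_into[OF assms(1) frag_additive_fdiff])
    fix s assume "s \<in> homog_keys k"
    then obtain x b i m where s: "s = (x, b)" "x \<in> mgr N i" "b \<in> agr B m" "i + int m = k"
      by (auto simp: homog_keys_def)
    have c: "x \<in> carrier N" using s N.gr.homog_closed by auto
    have 1: "(mdiff N x, b) \<in> homog_keys (k - 1)"
      using s N.mdiff_mgr[OF s(2)] by (auto simp: homog_keys_def intro!: exI[of _ "i - 1"] exI[of _ m])
    show "fdiff (frag_of s) \<in> {w. \<exists>v. cg w v \<and> Poly_Mapping.keys v \<subseteq> homog_keys (k - 1)}"
    proof (cases m)
      case 0
      then have "adiff B b = \<zero>\<^bsub>B\<^esub>" using s B.adiff_agr_0 by simp
      then have "fdiff (frag_of s) = frag_of (mdiff N x, b) + frag_of (tN x, \<zero>\<^bsub>B\<^esub>)" using s by simp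
      also have "cg \<dots> (frag_of (mdiff N x, b) + 0)"
        using c by (intro cg_add cg_refl cg_zero_right) simp
      finally have "cg (fdiff (frag_of s)) (frag_of (mdiff N x, b) + 0)" .
      then show ?thesis using 1 by auto
    next
      case (Suc j)
      then have "(tN x, adiff B b) \<in> homog_keys (k - 1)"
        using s N.gr.twist_mem[OF s(2)] B.adiff_agr_Suc[of b j]
        by (auto simp: homog_keys_def intro!: exI[of _ i] exI[of _ j])
      then have "Poly_Mapping.keys (fdiff (frag_of s)) \<subseteq> homog_keys (k - 1)"
        using s 1 by (simp, intro keys_add_sub) auto
      then show ?thesis by (auto intro: exI[of _ "fdiff (frag_of s)"])
    qed
  next
    fix a b assume "a \<in> {w. \<exists>v. cg w v \<and> Poly_Mapping.keys v \<subseteq> homog_keys (k - 1)}"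
      "b \<in> {w. \<exists>v. cg w v \<and> Poly_Mapping.keys v \<subseteq> homog_keys (k - 1)}"
    then show "a - b \<in> {w. \<exists>v. cg w v \<and> Poly_Mapping.keys v \<subseteq> homog_keys (k - 1)}"
      using cg_diff keys_diff_sub by blast
  qed (auto intro!: exI[of _ 0])
  then show ?thesis by simp
qed

text \<open>The pure terms contain a square of a differential, and the two mixed terms cancel by
  \<open>mdiff_twist\<close>.\<close>

lemma fdiff_fdiff: "u \<in> FF \<Longrightarrow> cg (fdiff (fdiff u)) 0"
proof (rule cg_agree_FF[where f = "\<lambda>u. fdiff (fdiff u)" and g = "\<lambda>u. 0"])
  fix x b assume h: "x \<in> carrier N" "b \<in> carrier B"
  have "fdiff (fdiff (frag_of (x, b))) = (frag_of (\<zero>\<^bsub>N\<^esub>, b) + frag_of (x, \<zero>\<^bsub>B\<^esub>)) +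
     (frag_of (\<ominus>\<^bsub>N\<^esub> tN (mdiff N x), adiff B b) + frag_of (tN (mdiff N x), adiff B b))"
    using h by (simp add: frag_additive_add mdiff_twist N.mdiff_mdiff B.adiff_adiff algebra_simps)
  also have "cg \<dots> ((0 + 0) + (- frag_of (tN (mdiff N x), adiff B b) + frag_of (tN (mdiff N x), adiff B b)))"
    using h by (intro cg_add cg_zero_left cg_zero_right cg_neg_left cg_refl) (auto simp: B.adiff_closed N.mdiff_closed)
  finally show "cg (fdiff (fdiff (frag_of (x, b)))) 0" by simp
qed (simp_all add: frag_diffs)

text \<open>The sign of degree \<open>k\<close> is the product of the twists of both factors, so the
  computation is done on keys of total degree \<open>k\<close>.\<close>

lemma fdiff_rmult:
  assumes "Poly_Mapping.keys u \<subseteq> homog_keys k" "c \<in> carrier B"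
  shows "cg (fdiff (rmult c u)) (rmult c (fdiff u) + fsg k (rmult (adiff B c) u))"
proof (rule cg_agree[OF assms(1)])
  fix s assume "s \<in> homog_keys k"
  then obtain x b i m where s: "s = (x, b)" "x \<in> mgr N i" "b \<in> agr B m" "i + int m = k"
    by (auto simp: homog_keys_def)
  have h: "x \<in> carrier N" "b \<in> carrier B" "adiff B b \<in> carrier B" "adiff B c \<in> carrier B"
    using s N.gr.homog_closed B.agr_closed B.adiff_closed assms(2) by auto
  have "fdiff (rmult c (frag_of s)) = frag_of (mdiff N x, b \<otimes>\<^bsub>B\<^esub> c) +
     frag_of (tN x, adiff B b \<otimes>\<^bsub>B\<^esub> c \<oplus>\<^bsub>B\<^esub> tB b \<otimes>\<^bsub>B\<^esub> adiff B c)"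
    using s h assms by (simp add: B.adiff_mult_general)
  also have "cg \<dots> (frag_of (mdiff N x, b \<otimes>\<^bsub>B\<^esub> c) + (frag_of (tN x, adiff B b \<otimes>\<^bsub>B\<^esub> c) + frag_of (tN x, tB b \<otimes>\<^bsub>B\<^esub> adiff B c)))"
    using h assms by (intro cg_add cg_refl cg_add_right) auto
  also have "cg \<dots> (frag_of (mdiff N x, b \<otimes>\<^bsub>B\<^esub> c) + (frag_of (tN x, adiff B b \<otimes>\<^bsub>B\<^esub> c) + fsg k (frag_of (x, b \<otimes>\<^bsub>B\<^esub> adiff B c))))"
  proof (intro cg_add cg_refl)
    have "cg (frag_of (tN x, tB b \<otimes>\<^bsub>B\<^esub> adiff B c)) (fsg i (frag_of (x, tB b \<otimes>\<^bsub>B\<^esub> adiff B c)))"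
      using h by (simp add: N.gr.twist_homog[OF s(2)] cg_sg_left)
    also have "fsg i (frag_of (x, tB b \<otimes>\<^bsub>B\<^esub> adiff B c)) = fsg i (frag_of (x, sg B m (b \<otimes>\<^bsub>B\<^esub> adiff B c)))"
      using h by (simp add: B.gr.twist_homog[OF s(3)] B.sg_lmult)
    also have "cg \<dots> (fsg i (fsg m (frag_of (x, b \<otimes>\<^bsub>B\<^esub> adiff B c))))"
      using h by (intro cg_fsg cg_sg_right) auto
    also have "\<dots> = fsg k (frag_of (x, b \<otimes>\<^bsub>B\<^esub> adiff B c))"
      using s(4) by (auto simp: fsg_def)
    finally show "cg (frag_of (tN x, tB b \<otimes>\<^bsub>B\<^esub> adiff B c)) (fsg k (frag_of (x, b \<otimes>\<^bsub>B\<^esub> adiff B c)))" .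
  qed
  finally show "cg (fdiff (rmult c (frag_of s))) (rmult c (fdiff (frag_of s)) + fsg k (rmult (adiff B c) (frag_of s)))"
    using s by (simp add: frag_additive_add add.assoc)
qed (simp_all add: frag_diffs)

lemma rmult_add:
  assumes "u \<in> FF" "b \<in> carrier B" "c \<in> carrier B"
  shows "cg (rmult (b \<oplus>\<^bsub>B\<^esub> c) u) (rmult b u + rmult c u)"
  by (rule cg_agree_FF[OF assms(1)])
     (use assms in \<open>simp_all add: cg_add_right B.r_distr frag_diffs\<close>)

lemma rmult_mult:
  assumes "u \<in> FF" "b \<in> carrier B" "c \<in> carrier B"
  shows "cg (rmult (b \<otimes>\<^bsub>B\<^esub> c) u) (rmult c (rmult b u))"
  by (rule cg_agree_FF[OF assms(1)])
     (use assms in \<open>simp_all add: B.m_assoc frag_diffs\<close>)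

lemma rmult_one: assumes "u \<in> FF" shows "cg (rmult \<one>\<^bsub>B\<^esub> u) u"
  by (rule cg_agree_FF[OF assms(1)]) auto

lemma dg_module_T: "dg_module B T"
proof (intro dg_module.intro dg_module_axioms.intro abelian_group_T graded_T)
  fix x b assume "x \<in> carrier T" "b \<in> carrier B"
  then show "act T x b \<in> carrier T" by (elim T_cases) (simp add: act_T rmult_FF cl_closed)
next
  fix x y b assume "x \<in> carrier T" "y \<in> carrier T" "b \<in> carrier B"
  then show "act T (x \<oplus>\<^bsub>T\<^esub> y) b = act T x b \<oplus>\<^bsub>T\<^esub> act T y b"
    by (elim T_cases) (simp add: act_T T_add frags_add frag_additive_add)
next
  fix x b c assume "x \<in> carrier T" "b \<in> carrier B" "c \<in> carrier B"
  then show "act T x (b \<oplus>\<^bsub>B\<^esub> c) = act T x b \<oplus>\<^bsub>T\<^esub> act T x c"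
    and "act T x (b \<otimes>\<^bsub>B\<^esub> c) = act T (act T x b) c"
    by (elim T_cases; simp add: act_T T_add rmult_FF cl_eq_iff rmult_add rmult_mult)+
next
  fix x assume "x \<in> carrier T"
  then show "act T x \<one>\<^bsub>B\<^esub> = x"
    by (elim T_cases) (simp add: act_T cl_eq_iff rmult_one)
next
  fix x i b n assume "x \<in> mgr T i" "b \<in> agr B n"
  then show "act T x b \<in> mgr T (i + int n)"
    by (elim mgr_T_cases) (simp add: act_T B.agr_closed cl_mgr rmult_homog)
next
  fix x assume "x \<in> carrier T"
  then show "mdiff T x \<in> carrier T" by (elim T_cases) (simp add: mdiff_T fdiff_FF cl_closed)
next
  fix x y assume "x \<in> carrier T" "y \<in> carrier T"
  then show "mdiff T (x \<oplus>\<^bsub>T\<^esub> y) = mdiff T x \<oplus>\<^bsub>T\<^esub> mdiff T y"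
    by (elim T_cases) (simp add: mdiff_T T_add frags_add frag_additive_add)
next
  fix x i assume "x \<in> mgr T i"
  then obtain u where u: "Poly_Mapping.keys u \<subseteq> homog_keys i" "u \<in> FF" "x = cl u" by (rule mgr_T_cases)
  then obtain v where "cg (fdiff u) v" "Poly_Mapping.keys v \<subseteq> homog_keys (i - 1)"
    using fdiff_homog by blast
  then show "mdiff T x \<in> mgr T (i - 1)"
    using u cl_mgr[of v "i - 1"] by (simp add: mdiff_T cl_eq_iff[symmetric])
next
  fix x assume "x \<in> carrier T"
  then show "mdiff T (mdiff T x) = \<zero>\<^bsub>T\<^esub>"
    by (elim T_cases) (simp add: mdiff_T fdiff_FF T_zero cl_eq_iff fdiff_fdiff)
next
  fix x i b assume "x \<in> mgr T i" "b \<in> carrier B"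
  then show "mdiff T (act T x b) = act T (mdiff T x) b \<oplus>\<^bsub>T\<^esub> sg T i (act T x (adiff B b))"
    by (elim mgr_T_cases)
      (simp add: mdiff_T act_T rmult_FF fdiff_FF B.adiff_closed T_sg T_add cl_eq_iff fdiff_rmult)
qed

subsection \<open>The evaluation map\<close>

abbreviation "ev \<equiv> tensor_eval N"

lemma add_pow0: "add_pow N (0::int) x = \<zero>\<^bsub>N\<^esub>"
  by (simp add: add_pow_def)

lemma frag_eval_superset:
  assumes "u \<in> FF" "finite S" "Poly_Mapping.keys u \<subseteq> S" "S \<subseteq> carrier N \<times> carrier B"
  shows "frag_eval N u = (\<Oplus>\<^bsub>N\<^esub>k\<in>S. add_pow N (Poly_Mapping.lookup u k) (act N (fst k) (snd k)))"
  unfolding frag_eval_def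
  by (rule N.finsum_mono_neutral)
     (use assms add_pow0 in \<open>auto simp: in_keys_iff N.act_closed subset_iff intro!: N.add.int_pow_closed\<close>)

lemma frag_eval_closed: "u \<in> FF \<Longrightarrow> frag_eval N u \<in> carrier N"
  unfolding frag_eval_def
  by (rule N.finsum_closed) (auto simp: frags_iff subset_iff intro!: N.add.int_pow_closed N.act_closed)

lemma frag_eval_of: "x \<in> carrier N \<Longrightarrow> b \<in> carrier B \<Longrightarrow> frag_eval N (frag_of (x, b)) = act N x b"
  using frag_eval_superset[of "frag_of (x, b)" "{(x, b)}"]
  by (simp add: N.act_closed N.add.int_pow_1)

lemma frag_eval_diff:
  assumes "u \<in> FF" "v \<in> FF"
  shows "frag_eval N (u - v) = frag_eval N u \<ominus>\<^bsub>N\<^esub> frag_eval N v"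
proof -
  let ?S = "Poly_Mapping.keys u \<union> Poly_Mapping.keys v"
  let ?a = "\<lambda>k. act N (fst k) (snd k)"
  have S: "finite ?S" "?S \<subseteq> carrier N \<times> carrier B" using assms by (auto simp: frags_iff)
  have c: "?a k \<in> carrier N" if "k \<in> ?S" for k using that S(2) by (auto intro!: N.act_closed)
  have "frag_eval N (u - v) = (\<Oplus>\<^bsub>N\<^esub>k\<in>?S. add_pow N (Poly_Mapping.lookup (u - v) k) (?a k))"
    using assms S keys_diff[of u v] by (intro frag_eval_superset frags_diff) auto
  also have "\<dots> = (\<Oplus>\<^bsub>N\<^esub>k\<in>?S. add_pow N (Poly_Mapping.lookup u k) (?a k) \<oplus>\<^bsub>N\<^esub> \<ominus>\<^bsub>N\<^esub> (add_pow N (Poly_Mapping.lookup v k) (?a k)))"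
    using c by (intro N.finsum_cong') (auto simp: lookup_minus N.add.int_pow_diff intro!: N.add.int_pow_closed)
  also have "\<dots> = (\<Oplus>\<^bsub>N\<^esub>k\<in>?S. add_pow N (Poly_Mapping.lookup u k) (?a k)) \<oplus>\<^bsub>N\<^esub> (\<Oplus>\<^bsub>N\<^esub>k\<in>?S. \<ominus>\<^bsub>N\<^esub> (add_pow N (Poly_Mapping.lookup v k) (?a k)))"
    using c by (intro N.finsum_addf) (auto intro!: N.add.int_pow_closed)
  also have "(\<Oplus>\<^bsub>N\<^esub>k\<in>?S. \<ominus>\<^bsub>N\<^esub> (add_pow N (Poly_Mapping.lookup v k) (?a k))) = \<ominus>\<^bsub>N\<^esub> (\<Oplus>\<^bsub>N\<^esub>k\<in>?S. add_pow N (Poly_Mapping.lookup v k) (?a k))"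
    using c by (intro N.finsum_neg[symmetric]) (auto intro!: N.add.int_pow_closed)
  finally show ?thesis
    using assms S frag_eval_superset[of u ?S] frag_eval_superset[of v ?S] by (simp add: a_minus_def)
qed

lemma frag_eval_zero: "frag_eval N 0 = \<zero>\<^bsub>N\<^esub>"
  by (simp add: frag_eval_def)

lemma frag_eval_add:
  assumes "u \<in> FF" "v \<in> FF"
  shows "frag_eval N (u + v) = frag_eval N u \<oplus>\<^bsub>N\<^esub> frag_eval N v"
proof -
  have "frag_eval N (0 - v) = \<ominus>\<^bsub>N\<^esub> frag_eval N v"
    using assms frag_eval_diff[of 0 v] by (simp add: frag_eval_zero frag_eval_closed a_minus_def)
  moreover have "frag_eval N (u - (0 - v)) = frag_eval N u \<ominus>\<^bsub>N\<^esub> frag_eval N (0 - v)"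
    using assms by (intro frag_eval_diff) auto
  ultimately show ?thesis using assms by (simp add: a_minus_def frag_eval_closed)
qed

lemma frag_eval_Rl: "r \<in> Rl \<Longrightarrow> frag_eval N r = \<zero>\<^bsub>N\<^esub>"
proof -
  assume "r \<in> Rl"
  then have "r \<in> FF \<and> frag_eval N r = \<zero>\<^bsub>N\<^esub>"
  proof (induction rule: Rl_induct)
    case (add_left x y b)
    then show ?case
      by (simp add: frags_diff frag_eval_diff frag_eval_of N.act_add_left N.act_closed N.add_minus_minus)
  next
    case (add_right x b c)
    then show ?case
      by (simp add: frags_diff frag_eval_diff frag_eval_of N.act_add_right N.act_closed N.add_minus_minus)
  next
    case (balanced x a b)
    then show ?case
      by (simp add: frags_diff frag_eval_diff frag_eval_of N.act_mult N.act_closed carrier_sub)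
         (simp add: a_minus_def N.act_closed N.r_neg carrier_sub)
  next
    case (diff u v)
    then show ?case by (simp add: frags_diff frag_eval_diff a_minus_def)
  qed (simp add: frag_eval_zero)
  then show ?thesis by simp
qed

text \<open>Relations evaluate to zero, hence the image of a coset is a singleton and
  \<open>the_elem\<close> picks the intended value.\<close>

lemma ev_cl: "u \<in> FF \<Longrightarrow> ev (cl u) = frag_eval N u"
proof -
  assume u: "u \<in> FF"
  have "frag_eval N ` cl u = {frag_eval N u}"
  proof (intro equalityI subsetI)
    fix x assume "x \<in> frag_eval N ` cl u"
    then show "x \<in> {frag_eval N u}"
      using u Rl_FF by (auto simp: cl_set frag_eval_add frag_eval_Rl frag_eval_closed)
  next
    fix x assume "x \<in> {frag_eval N u}"
    moreover have "u \<in> cl u" by (auto simp: cl_set intro!: exI[of _ 0])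
    ultimately show "x \<in> frag_eval N ` cl u" by auto
  qed
  then show ?thesis by (simp add: tensor_eval_def)
qed

lemma T_induct [consumes 1, case_names tensor minus]:
  assumes "y \<in> carrier T"
    and "\<And>x b. x \<in> carrier N \<Longrightarrow> b \<in> carrier B \<Longrightarrow> P (cl (frag_of (x, b)))"
    and "\<And>y z. y \<in> carrier T \<Longrightarrow> z \<in> carrier T \<Longrightarrow> P y \<Longrightarrow> P z \<Longrightarrow> P (y \<ominus>\<^bsub>T\<^esub> z)"
  shows "P y"
proof -
  \<comment> \<open>Zero is obtained as the difference of two equal pure tensors.\<close>
  have z: "P \<zero>\<^bsub>T\<^esub>"
    using assms(3)[OF _ _ assms(2) assms(2), of "\<zero>\<^bsub>N\<^esub>" "\<zero>\<^bsub>B\<^esub>" "\<zero>\<^bsub>N\<^esub>" "\<zero>\<^bsub>B\<^esub>"]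
    by (simp add: cl_closed T_minus T_zero)
  have "Poly_Mapping.keys u \<subseteq> carrier N \<times> carrier B \<Longrightarrow> u \<in> FF \<and> P (cl u)" for u
  proof (induction u rule: frag_induction)
    case (diff u v)
    then show ?case
      using assms(3)[of "cl u" "cl v"] by (simp add: T_minus cl_closed frags_diff)
  qed (use assms(2) z in \<open>auto simp: T_zero\<close>)
  then show ?thesis using assms(1) by (elim T_cases) (auto simp: frags_iff)
qed

lemma additive_map_ev: "additive_map T N ev"
  by (rule additive_mapI)
     (auto elim!: T_cases simp: ev_cl T_add frags_add frag_eval_add frag_eval_closed)

lemma ev_tensor: "x \<in> carrier N \<Longrightarrow> b \<in> carrier B \<Longrightarrow> ev (cl (frag_of (x, b))) = act N x b"
  by (simp add: ev_cl frag_eval_of)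

lemma dg_hom_ev: "dg_hom B T N ev"
  unfolding dg_hom_def
proof (intro conjI ballI allI)
  show "ev \<in> carrier T \<rightarrow> carrier N" using additive_map_ev by (auto simp: additive_map_def)
  show "ev (x \<oplus>\<^bsub>T\<^esub> y) = ev x \<oplus>\<^bsub>N\<^esub> ev y" if "x \<in> carrier T" "y \<in> carrier T" for x y
    using that additive_map_ev by (simp add: additive_map_def)
  interpret TM: dg_module_over R B T
    by (intro dg_module_over.intro B.dg_algebra_axioms dg_module_T)
  show "ev (act T y c) = act N (ev y) c" if "y \<in> carrier T" "c \<in> carrier B" for y c
    using that(1)
  proof (induction rule: T_induct)
    case (tensor x b)
    then show ?case using that(2) by (simp add: act_T ev_tensor N.act_mult)
  next
    case (minus y z)
    then show ?case
      using that(2) additive_map_minus[OF abelian_group_T abN additive_map_ev]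
        additive_map_minus[OF abelian_group_T abelian_group_T TM.additive_map_act_left]
        additive_map_minus[OF abN abN additive_map_act_left] additive_map_closed[OF additive_map_ev]
      by (simp add: TM.N.act_closed)
  qed
  show "ev (mdiff T y) = mdiff N (ev y)" if "y \<in> carrier T" for y
    using that(1)
  proof (induction rule: T_induct)
    case (tensor x b)
    then show ?case
      by (simp add: mdiff_T ev_tensor ev_cl frags_add frag_eval_add frag_eval_of N.mdiff_closed
          B.adiff_closed mdiff_act_general)
  next
    case (minus y z)
    then show ?case
      using additive_map_minus[OF abelian_group_T abN additive_map_ev]
        additive_map_minus[OF abelian_group_T abelian_group_T TM.additive_map_mdiff]
        additive_map_minus[OF abN abN additive_map_mdiff] additive_map_closed[OF additive_map_ev]
      by (simp add: TM.N.mdiff_closed)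
  qed
  show "ev ` mgr T k \<subseteq> mgr N k" for k
  proof (intro image_subsetI)
    fix y assume "y \<in> mgr T k"
    then obtain u where u: "Poly_Mapping.keys u \<subseteq> homog_keys k" "u \<in> FF" "y = cl u" by (rule mgr_T_cases)
    have "u \<in> FF \<and> frag_eval N u \<in> mgr N k"
      using u(1)
    proof (induction u rule: frag_induction)
      case (one s)
      then obtain x b i m where s: "s = (x, b)" "x \<in> mgr N i" "b \<in> agr B m" "i + int m = k"
        by (auto simp: homog_keys_def)
      then show ?case
        using N.act_mgr[OF s(2,3)] N.gr.homog_closed B.agr_closed by (simp add: frag_eval_of)
    next
      case (diff u v)
      then show ?case
        by (simp add: frags_diff frag_eval_diff a_minus_def N.gr.homog_add N.gr.homog_neg)
    qed (simp add: frag_eval_zero)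
    then show "ev y \<in> mgr N k" using u by (simp add: ev_cl)
  qed
qed

text \<open>\<open>B\<close> is non-negatively graded, so the left factor of a homogeneous pure
  tensor has at most the degree of the tensor; below the bound of \<open>N\<close> it is
  zero.\<close>

lemma bounded_below_T:
  assumes "bounded_below N" shows "bounded_below T"
proof -
  obtain k where k: "\<And>i. i < k \<Longrightarrow> mgr N i = {\<zero>\<^bsub>N\<^esub>}" using assms by (auto simp: bounded_below_def)
  have "mgr T i = {\<zero>\<^bsub>T\<^esub>}" if "i < k" for i
  proof -
    have "y = \<zero>\<^bsub>T\<^esub>" if "y \<in> mgr T i" for y
    proof -
      obtain u where u: "Poly_Mapping.keys u \<subseteq> homog_keys i" "u \<in> FF" "y = cl u"
        using \<open>y \<in> mgr T i\<close> by (rule mgr_T_cases)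
      have "cg u 0"
      proof (rule cg_agree[OF u(1) frag_additive_id frag_additive_zero_fun])
        fix s assume "s \<in> homog_keys i"
        then obtain x b j m where s: "s = (x, b)" "x \<in> mgr N j" "b \<in> agr B m" "j + int m = i"
          by (auto simp: homog_keys_def)
        then have "x = \<zero>\<^bsub>N\<^esub>" using k[of j] \<open>i < k\<close> by auto
        then show "cg (frag_of s) 0" using s B.agr_closed by (simp add: cg_zero_left)
      qed
      then show ?thesis using u by (simp add: T_zero cl_eq_iff)
    qed
    then show ?thesis using additive_subgroup.zero_closed[OF homog_subgroup_T] by auto
  qed
  then show ?thesis by (auto simp: bounded_below_def)
qed

end


section \<open>Bases\<close>

text \<open>Coefficients come from an abelian group and the scaling \<open>sc\<close> is arbitrary,
  so that right bases of an algebra, left bases, and bases of a module are instances of one notion.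
  The basis is a family and not a set: over the zero ring distinct indices may carry the same
  element.\<close>

definition represents ::
  "('s, 'y) ring_scheme \<Rightarrow> ('m, 'x) ring_scheme \<Rightarrow> ('m \<Rightarrow> 's \<Rightarrow> 'm) \<Rightarrow> ('i \<Rightarrow> 'm) \<Rightarrow> 'i set \<Rightarrow> 'm \<Rightarrow> ('i \<Rightarrow> 's) \<Rightarrow> bool" where
  "represents S G sc u I y c \<longleftrightarrow> (\<forall>i. c i \<in> carrier S) \<and> (\<forall>i. i \<notin> I \<longrightarrow> c i = \<zero>\<^bsub>S\<^esub>) \<and>
        finite {i. c i \<noteq> \<zero>\<^bsub>S\<^esub>} \<and> y = (\<Oplus>\<^bsub>G\<^esub>i\<in>{i. c i \<noteq> \<zero>\<^bsub>S\<^esub>}. sc (u i) (c i))"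

definition basis_of ::
  "('s, 'y) ring_scheme \<Rightarrow> ('m, 'x) ring_scheme \<Rightarrow> ('m \<Rightarrow> 's \<Rightarrow> 'm) \<Rightarrow> ('i \<Rightarrow> 'm) \<Rightarrow> 'i set \<Rightarrow> bool" where
  "basis_of S G sc u I \<longleftrightarrow> (\<forall>y\<in>carrier G. \<exists>!c. represents S G sc u I y c)"

locale free_basis = S: abelian_group S + G: abelian_group G
  for S :: "('s, 'y) ring_scheme" and G :: "('m, 'x) ring_scheme"
    and sc :: "'m \<Rightarrow> 's \<Rightarrow> 'm" and u :: "'i \<Rightarrow> 'm" and I :: "'i set" +
  assumes sc_additive: "i \<in> I \<Longrightarrow> additive_map S G (sc (u i))"
    and basis: "basis_of S G sc u I"
begin

definition crd :: "'m \<Rightarrow> 'i \<Rightarrow> 's" where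
  "crd y = (THE c. represents S G sc u I y c)"

lemma abS: "abelian_group S" ..
lemma abG: "abelian_group G" ..

lemma sc_closed: "i \<in> I \<Longrightarrow> c \<in> carrier S \<Longrightarrow> sc (u i) c \<in> carrier G"
  by (rule additive_map_closed[OF sc_additive])

lemma sc_add: "i \<in> I \<Longrightarrow> c \<in> carrier S \<Longrightarrow> d \<in> carrier S \<Longrightarrow> sc (u i) (c \<oplus>\<^bsub>S\<^esub> d) = sc (u i) c \<oplus>\<^bsub>G\<^esub> sc (u i) d"
  by (rule additive_map_add[OF sc_additive])

lemma sc_zero: "i \<in> I \<Longrightarrow> sc (u i) \<zero>\<^bsub>S\<^esub> = \<zero>\<^bsub>G\<^esub>"
  by (rule additive_map_zero[OF abS abG sc_additive])

lemma crd_all: "y \<in> carrier G \<Longrightarrow> represents S G sc u I y (crd y)"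
  unfolding crd_def using basis theI'[of "represents S G sc u I y"] by (simp add: basis_of_def)

lemma crd_closed [simp]: "y \<in> carrier G \<Longrightarrow> crd y i \<in> carrier S"
  and crd_outside: "y \<in> carrier G \<Longrightarrow> i \<notin> I \<Longrightarrow> crd y i = \<zero>\<^bsub>S\<^esub>"
  and finite_crd: "y \<in> carrier G \<Longrightarrow> finite {i. crd y i \<noteq> \<zero>\<^bsub>S\<^esub>}"
  using crd_all[of y] by (auto simp: represents_def)

lemma crd_sub: "y \<in> carrier G \<Longrightarrow> {i. crd y i \<noteq> \<zero>\<^bsub>S\<^esub>} \<subseteq> I"
  using crd_outside by blast

lemma crd_finsum:
  assumes "y \<in> carrier G" "finite K" "{i. crd y i \<noteq> \<zero>\<^bsub>S\<^esub>} \<subseteq> K" "K \<subseteq> I"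
  shows "y = (\<Oplus>\<^bsub>G\<^esub>i\<in>K. sc (u i) (crd y i))"
proof -
  have "y = (\<Oplus>\<^bsub>G\<^esub>i\<in>{i. crd y i \<noteq> \<zero>\<^bsub>S\<^esub>}. sc (u i) (crd y i))" using crd_all[OF assms(1)] by (simp add: represents_def)
  also have "\<dots> = (\<Oplus>\<^bsub>G\<^esub>i\<in>K. sc (u i) (crd y i))"
    by (rule G.finsum_mono_neutral) (use assms in \<open>auto simp: sc_zero subset_iff intro!: sc_closed\<close>)
  finally show ?thesis .
qed

lemma crd_eqI:
  assumes "y = (\<Oplus>\<^bsub>G\<^esub>i\<in>K. sc (u i) (c i))" "finite K" "K \<subseteq> I" "\<And>i. i \<in> K \<Longrightarrow> c i \<in> carrier S"
  shows "crd y i = (if i \<in> K then c i else \<zero>\<^bsub>S\<^esub>)"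
proof -
  let ?c = "\<lambda>i. if i \<in> K then c i else \<zero>\<^bsub>S\<^esub>"
  have y: "y \<in> carrier G" unfolding assms(1)
    by (rule G.finsum_closed) (use assms in \<open>auto intro!: sc_closed\<close>)
  have "(\<Oplus>\<^bsub>G\<^esub>i\<in>{i. ?c i \<noteq> \<zero>\<^bsub>S\<^esub>}. sc (u i) (?c i)) = (\<Oplus>\<^bsub>G\<^esub>i\<in>K. sc (u i) (?c i))"
    by (rule G.finsum_mono_neutral) (use assms(2-4) in \<open>auto simp: sc_zero subset_iff intro!: sc_closed split: if_splits\<close>)
  also have "\<dots> = y" unfolding assms(1)
    by (rule G.finsum_cong') (use assms(2-4) in \<open>auto intro!: sc_closed\<close>)
  finally have "y = (\<Oplus>\<^bsub>G\<^esub>i\<in>{i. ?c i \<noteq> \<zero>\<^bsub>S\<^esub>}. sc (u i) (?c i))" by simp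
  moreover have "finite {i. ?c i \<noteq> \<zero>\<^bsub>S\<^esub>}"
    by (rule finite_subset[OF _ assms(2)]) auto
  ultimately have "represents S G sc u I y ?c"
    using assms(3,4) by (auto simp: represents_def)
  then have "crd y = ?c"
    unfolding crd_def using basis y by (intro the1_equality) (auto simp: basis_of_def)
  then show ?thesis by simp
qed

lemma crd_sc: "i \<in> I \<Longrightarrow> c \<in> carrier S \<Longrightarrow> crd (sc (u i) c) j = (if j = i then c else \<zero>\<^bsub>S\<^esub>)"
  using crd_eqI[where y = "sc (u i) c" and K = "{i}" and c = "\<lambda>_. c" and i = j]
  by (simp add: sc_closed)

lemma crd_add:
  assumes "y \<in> carrier G" "z \<in> carrier G" shows "crd (y \<oplus>\<^bsub>G\<^esub> z) i = crd y i \<oplus>\<^bsub>S\<^esub> crd z i"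
proof -
  let ?K = "{i. crd y i \<noteq> \<zero>\<^bsub>S\<^esub>} \<union> {i. crd z i \<noteq> \<zero>\<^bsub>S\<^esub>}"
  have K: "finite ?K" "?K \<subseteq> I" using assms crd_sub finite_crd by auto
  have "y \<oplus>\<^bsub>G\<^esub> z = (\<Oplus>\<^bsub>G\<^esub>i\<in>?K. sc (u i) (crd y i)) \<oplus>\<^bsub>G\<^esub> (\<Oplus>\<^bsub>G\<^esub>i\<in>?K. sc (u i) (crd z i))"
    using crd_finsum[OF assms(1) K(1) _ K(2)] crd_finsum[OF assms(2) K(1) _ K(2)] by simp
  also have "\<dots> = (\<Oplus>\<^bsub>G\<^esub>i\<in>?K. sc (u i) (crd y i) \<oplus>\<^bsub>G\<^esub> sc (u i) (crd z i))"
    using K assms by (intro G.finsum_addf[symmetric]) (auto intro!: sc_closed)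
  also have "\<dots> = (\<Oplus>\<^bsub>G\<^esub>i\<in>?K. sc (u i) (crd y i \<oplus>\<^bsub>S\<^esub> crd z i))"
    using K(2) assms by (intro G.finsum_cong' refl) (auto simp: sc_add subset_iff intro!: sc_closed)
  finally have "crd (y \<oplus>\<^bsub>G\<^esub> z) i = (if i \<in> ?K then crd y i \<oplus>\<^bsub>S\<^esub> crd z i else \<zero>\<^bsub>S\<^esub>)"
    by (rule crd_eqI) (use K assms in auto)
  then show ?thesis by auto
qed

lemma additive_map_crd: "additive_map G S (\<lambda>y. crd y i)"
  by (auto simp: additive_map_def crd_add)

lemma free_induct [consumes 1, case_names zero gen add]:
  assumes "y \<in> carrier G" "P \<zero>\<^bsub>G\<^esub>"
    and "\<And>i c. i \<in> I \<Longrightarrow> c \<in> carrier S \<Longrightarrow> P (sc (u i) c)"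
    and "\<And>x y. \<lbrakk>x \<in> carrier G; y \<in> carrier G; P x; P y\<rbrakk> \<Longrightarrow> P (x \<oplus>\<^bsub>G\<^esub> y)"
  shows "P y"
proof -
  have P: "P (\<Oplus>\<^bsub>G\<^esub>i\<in>K. sc (u i) (crd y i))" if "finite K" "K \<subseteq> I" for K
    using that
  proof (induction K)
    case (insert k K)
    then show ?case
      using assms(1)
      by (subst G.finsum_insert) (auto intro!: assms(3,4) sc_closed G.finsum_closed)
  qed (use assms in simp)
  show ?thesis
    using P[OF finite_crd[OF assms(1)] crd_sub[OF assms(1)]]
      crd_finsum[OF assms(1) finite_crd[OF assms(1)] order_refl crd_sub[OF assms(1)], symmetric]
    by simp
qed

text \<open>A map that is diagonal with respect to the basis acts on each coordinate separately. The
  intended map is the projection to a degree, which acts on the coordinate at a basis element as a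
  projection to the complementary degree.\<close>

lemma crd_map:
  assumes "additive_map G G \<phi>" "\<And>i. i \<in> I \<Longrightarrow> additive_map S S (\<psi> i)"
    and "\<And>i c. i \<in> I \<Longrightarrow> c \<in> carrier S \<Longrightarrow> \<phi> (sc (u i) c) = sc (u i) (\<psi> i c)"
    and "y \<in> carrier G" "i \<in> I"
  shows "crd (\<phi> y) i = \<psi> i (crd y i)"
  using assms(4)
proof (induction rule: free_induct)
  case zero
  then show ?case
    using additive_map_zero[OF abG abG assms(1)] additive_map_zero[OF abG abS additive_map_crd]
      additive_map_zero[OF abS abS assms(2)[OF assms(5)]] by simp
next
  case (gen j c)
  then show ?case
    using assms(3,5) additive_map_zero[OF abS abS assms(2)[OF assms(5)]]
      additive_map_closed[OF assms(2)[OF gen(1)] gen(2)]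
    by (simp add: crd_sc)
next
  case (add x y)
  then show ?case
    using additive_map_add[OF assms(1)] additive_map_add[OF assms(2)[OF assms(5)]]
      additive_map_closed[OF assms(1)] by (simp add: crd_add)
qed

text \<open>Only additivity of each \<open>f i\<close> is required for this extension, which admits
  maps that twist the coefficients by signs.\<close>

definition linext :: "('h, 'w) ring_scheme \<Rightarrow> ('i \<Rightarrow> 's \<Rightarrow> 'h) \<Rightarrow> 'm \<Rightarrow> 'h" where
  "linext H f y = (\<Oplus>\<^bsub>H\<^esub>i\<in>{i. crd y i \<noteq> \<zero>\<^bsub>S\<^esub>}. f i (crd y i))"

lemma linext_finsum:
  assumes "abelian_group H" "\<And>i. i \<in> I \<Longrightarrow> additive_map S H (f i)"
    and "y \<in> carrier G" "finite K" "{i. crd y i \<noteq> \<zero>\<^bsub>S\<^esub>} \<subseteq> K" "K \<subseteq> I"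
  shows "linext H f y = (\<Oplus>\<^bsub>H\<^esub>i\<in>K. f i (crd y i))"
proof -
  interpret H: abelian_group H by fact
  show ?thesis
    unfolding linext_def
    by (rule H.finsum_mono_neutral)
       (use assms in \<open>auto simp: additive_map_zero[OF abS assms(1,2)] subset_iff intro!: additive_map_closed[OF assms(2)]\<close>)
qed

lemma additive_map_linext:
  assumes "abelian_group H" "\<And>i. i \<in> I \<Longrightarrow> additive_map S H (f i)"
  shows "additive_map G H (linext H f)"
proof (rule additive_mapI)
  interpret H: abelian_group H by fact
  fix y assume y: "y \<in> carrier G"
  show "linext H f y \<in> carrier H"
    unfolding linext_def
    by (rule H.finsum_closed) (use y crd_sub[OF y] in \<open>auto intro!: additive_map_closed[OF assms(2)]\<close>)
  fix z assume z: "z \<in> carrier G"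
  let ?K = "{i. crd y i \<noteq> \<zero>\<^bsub>S\<^esub>} \<union> {i. crd z i \<noteq> \<zero>\<^bsub>S\<^esub>}"
  have K: "finite ?K" "?K \<subseteq> I" using y z crd_sub finite_crd by auto
  have "linext H f (y \<oplus>\<^bsub>G\<^esub> z) = (\<Oplus>\<^bsub>H\<^esub>i\<in>?K. f i (crd (y \<oplus>\<^bsub>G\<^esub> z) i))"
    using y z K by (intro linext_finsum assms) (auto simp: crd_add)
  also have "\<dots> = (\<Oplus>\<^bsub>H\<^esub>i\<in>?K. f i (crd y i) \<oplus>\<^bsub>H\<^esub> f i (crd z i))"
    using y z K(2) assms(2)
    by (intro H.finsum_cong' refl) (auto simp: crd_add additive_map_add[OF assms(2)] subset_iff intro!: additive_map_closed[OF assms(2)])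
  also have "\<dots> = (\<Oplus>\<^bsub>H\<^esub>i\<in>?K. f i (crd y i)) \<oplus>\<^bsub>H\<^esub> (\<Oplus>\<^bsub>H\<^esub>i\<in>?K. f i (crd z i))"
    using y z K(2) by (intro H.finsum_addf) (auto intro!: additive_map_closed[OF assms(2)])
  also have "\<dots> = linext H f y \<oplus>\<^bsub>H\<^esub> linext H f z"
    using linext_finsum[OF assms y K(1) _ K(2)] linext_finsum[OF assms z K(1) _ K(2)] by simp
  finally show "linext H f (y \<oplus>\<^bsub>G\<^esub> z) = linext H f y \<oplus>\<^bsub>H\<^esub> linext H f z" .
qed

lemma linext_sc:
  assumes "abelian_group H" "\<And>i. i \<in> I \<Longrightarrow> additive_map S H (f i)" "i \<in> I" "c \<in> carrier S"
  shows "linext H f (sc (u i) c) = f i c"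
proof -
  interpret H: abelian_group H by fact
  show ?thesis
    by (subst linext_finsum[where K = "{i}", OF assms(1,2) sc_closed[OF assms(3,4)]])
       (use assms(3,4) additive_map_closed[OF assms(2)[OF assms(3)]] in \<open>auto simp: crd_sc\<close>)
qed

lemma additive_map_eq_on_gens:
  assumes "abelian_group H" "additive_map G H \<phi>" "additive_map G H \<psi>"
    and "\<And>i c. i \<in> I \<Longrightarrow> c \<in> carrier S \<Longrightarrow> \<phi> (sc (u i) c) = \<psi> (sc (u i) c)" "y \<in> carrier G"
  shows "\<phi> y = \<psi> y"
  using assms(5)
  by (induction rule: free_induct)
     (use assms in \<open>auto simp: additive_map_zero[OF abG] additive_map_def\<close>)

end

text \<open>Uniqueness of the coordinates follows from independence, applied to the difference of
  two representations over the union of their supports.\<close>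

lemma free_basisI:
  assumes "abelian_group S" "abelian_group G" "\<And>i. i \<in> I \<Longrightarrow> additive_map S G (sc (u i))"
    and span: "\<And>y. y \<in> carrier G \<Longrightarrow> \<exists>K c. finite K \<and> K \<subseteq> I \<and> c \<in> K \<rightarrow> carrier S \<and> y = (\<Oplus>\<^bsub>G\<^esub>i\<in>K. sc (u i) (c i))"
    and indep: "\<And>K c. \<lbrakk>finite K; K \<subseteq> I; c \<in> K \<rightarrow> carrier S; (\<Oplus>\<^bsub>G\<^esub>i\<in>K. sc (u i) (c i)) = \<zero>\<^bsub>G\<^esub>\<rbrakk> \<Longrightarrow> \<forall>i\<in>K. c i = \<zero>\<^bsub>S\<^esub>"
  shows "free_basis S G sc u I"
proof -
  interpret S: abelian_group S by fact
  interpret G: abelian_group G by fact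
  have cl: "sc (u i) c \<in> carrier G" if "i \<in> I" "c \<in> carrier S" for i c
    by (rule additive_map_closed[OF assms(3)]) fact+
  have z: "sc (u i) \<zero>\<^bsub>S\<^esub> = \<zero>\<^bsub>G\<^esub>" if "i \<in> I" for i
    by (rule additive_map_zero[OF assms(1-3)]) fact
  have "basis_of S G sc u I"
    unfolding basis_of_def
  proof (intro ballI ex_ex1I)
    fix y assume "y \<in> carrier G"
    then obtain K c where K: "finite K" "K \<subseteq> I" "c \<in> K \<rightarrow> carrier S" "y = (\<Oplus>\<^bsub>G\<^esub>i\<in>K. sc (u i) (c i))"
      using span by blast
    let ?c = "\<lambda>i. if i \<in> K then c i else \<zero>\<^bsub>S\<^esub>"
    have "(\<Oplus>\<^bsub>G\<^esub>i\<in>{i. ?c i \<noteq> \<zero>\<^bsub>S\<^esub>}. sc (u i) (?c i)) = (\<Oplus>\<^bsub>G\<^esub>i\<in>K. sc (u i) (?c i))"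
      by (rule G.finsum_mono_neutral) (use K(1-3) z cl in \<open>auto simp: subset_iff Pi_iff split: if_splits\<close>)
    also have "\<dots> = y" unfolding K(4)
      by (rule G.finsum_cong') (use K(1-3) cl in auto)
    finally have "y = (\<Oplus>\<^bsub>G\<^esub>i\<in>{i. ?c i \<noteq> \<zero>\<^bsub>S\<^esub>}. sc (u i) (?c i))" by simp
    moreover have "finite {i. ?c i \<noteq> \<zero>\<^bsub>S\<^esub>}" by (rule finite_subset[OF _ K(1)]) auto
    ultimately show "\<exists>c. represents S G sc u I y c"
      using K(2,3) by (intro exI[of _ ?c]) (auto simp: represents_def)
  next
    fix y c d
    assume "represents S G sc u I y c" "represents S G sc u I y d"
    note c = this(1)[unfolded represents_def] and d = this(2)[unfolded represents_def]
    let ?K = "{i. c i \<noteq> \<zero>\<^bsub>S\<^esub>} \<union> {i. d i \<noteq> \<zero>\<^bsub>S\<^esub>}"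
    have K: "finite ?K" "?K \<subseteq> I" using c d by auto
    have cc: "c i \<in> carrier S" "d i \<in> carrier S" for i using c d by auto
    have "(\<Oplus>\<^bsub>G\<^esub>i\<in>{i. c i \<noteq> \<zero>\<^bsub>S\<^esub>}. sc (u i) (c i)) = (\<Oplus>\<^bsub>G\<^esub>i\<in>?K. sc (u i) (c i))"
      by (rule G.finsum_mono_neutral) (use K cl z cc in \<open>auto simp: subset_iff\<close>)
    then have 1: "y = (\<Oplus>\<^bsub>G\<^esub>i\<in>?K. sc (u i) (c i))" using c by simp
    have "(\<Oplus>\<^bsub>G\<^esub>i\<in>{i. d i \<noteq> \<zero>\<^bsub>S\<^esub>}. sc (u i) (d i)) = (\<Oplus>\<^bsub>G\<^esub>i\<in>?K. sc (u i) (d i))"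
      by (rule G.finsum_mono_neutral) (use K cl z cc in \<open>auto simp: subset_iff\<close>)
    then have 2: "y = (\<Oplus>\<^bsub>G\<^esub>i\<in>?K. sc (u i) (d i))" using d by simp
    have y: "y \<in> carrier G" unfolding 1 by (rule G.finsum_closed) (use K cl cc in auto)
    have "(\<Oplus>\<^bsub>G\<^esub>i\<in>?K. sc (u i) (c i \<ominus>\<^bsub>S\<^esub> d i)) = (\<Oplus>\<^bsub>G\<^esub>i\<in>?K. sc (u i) (c i) \<oplus>\<^bsub>G\<^esub> \<ominus>\<^bsub>G\<^esub> sc (u i) (d i))"
      using K(2) cc cl additive_map_minus[OF assms(1-3)]
      by (intro G.finsum_cong' refl) (auto simp: a_minus_def subset_iff)
    also have "\<dots> = (\<Oplus>\<^bsub>G\<^esub>i\<in>?K. sc (u i) (c i)) \<oplus>\<^bsub>G\<^esub> (\<Oplus>\<^bsub>G\<^esub>i\<in>?K. \<ominus>\<^bsub>G\<^esub> sc (u i) (d i))"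
      using K(2) cc cl by (intro G.finsum_addf) auto
    also have "(\<Oplus>\<^bsub>G\<^esub>i\<in>?K. \<ominus>\<^bsub>G\<^esub> sc (u i) (d i)) = \<ominus>\<^bsub>G\<^esub> (\<Oplus>\<^bsub>G\<^esub>i\<in>?K. sc (u i) (d i))"
      using K(2) cc cl by (intro G.finsum_neg[symmetric]) auto
    also have "(\<Oplus>\<^bsub>G\<^esub>i\<in>?K. sc (u i) (c i)) \<oplus>\<^bsub>G\<^esub> \<ominus>\<^bsub>G\<^esub> (\<Oplus>\<^bsub>G\<^esub>i\<in>?K. sc (u i) (d i)) = \<zero>\<^bsub>G\<^esub>"
      unfolding 1[symmetric] 2[symmetric] using y by (simp add: G.r_neg)
    finally have "\<forall>i\<in>?K. c i \<ominus>\<^bsub>S\<^esub> d i = \<zero>\<^bsub>S\<^esub>"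
      by (intro indep K) (use cc in auto)
    then have "c i = d i" if "i \<in> ?K" for i using that cc S.minus_zero_eq by blast
    then show "c = d" by (intro ext) (metis (mono_tags, lifting) UnI1 UnI2 mem_Collect_eq)
  qed
  then show ?thesis using assms(1-3) by unfold_locales auto
qed

context free_basis begin

lemma indep:
  assumes "finite K" "K \<subseteq> I" "c \<in> K \<rightarrow> carrier S" "(\<Oplus>\<^bsub>G\<^esub>i\<in>K. sc (u i) (c i)) = \<zero>\<^bsub>G\<^esub>" "i \<in> K"
  shows "c i = \<zero>\<^bsub>S\<^esub>"
proof -
  have "crd \<zero>\<^bsub>G\<^esub> i = (if i \<in> K then c i else \<zero>\<^bsub>S\<^esub>)"
    by (rule crd_eqI) (use assms in auto)
  then show ?thesis using assms(5) additive_map_zero[OF abG abS additive_map_crd] by simp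
qed

lemma reindex:
  assumes "bij_betw f J I"
  shows "free_basis S G sc (\<lambda>j. u (f j)) J"
proof (rule free_basisI[OF abS abG])
  have inj: "inj_on f J" and im: "f ` J = I" and fJ: "\<And>j. j \<in> J \<Longrightarrow> f j \<in> I"
    using assms by (auto simp: bij_betw_def)
  show "additive_map S G (sc (u (f j)))" if "j \<in> J" for j using that fJ sc_additive by auto
  fix y assume y: "y \<in> carrier G"
  let ?K = "{i. crd y i \<noteq> \<zero>\<^bsub>S\<^esub>}"
  let ?L = "inv_into J f ` ?K"
  have K: "finite ?K" "?K \<subseteq> I" using y crd_sub finite_crd by auto
  have L: "finite ?L" "?L \<subseteq> J" "f ` ?L = ?K"
    using K im inv_into_into[of _ f J] by (auto simp: image_comp f_inv_into_f subset_iff)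
  have "y = (\<Oplus>\<^bsub>G\<^esub>i\<in>f ` ?L. sc (u i) (crd y i))"
    using crd_finsum[OF y K(1) order_refl K(2)] L(3) by simp
  also have "\<dots> = (\<Oplus>\<^bsub>G\<^esub>j\<in>?L. sc (u (f j)) (crd y (f j)))"
    using y K L(3) inj_on_subset[OF inj L(2)] by (intro G.finsum_reindex) (auto intro!: sc_closed)
  finally show "\<exists>K c. finite K \<and> K \<subseteq> J \<and> c \<in> K \<rightarrow> carrier S \<and> y = (\<Oplus>\<^bsub>G\<^esub>i\<in>K. sc (u (f i)) (c i))"
    using L y by (intro exI[of _ ?L] exI[of _ "\<lambda>j. crd y (f j)"]) auto
next
  have inj: "inj_on f J" and fJ: "\<And>j. j \<in> J \<Longrightarrow> f j \<in> I" using assms by (auto simp: bij_betw_def)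
  fix K c assume K: "finite K" "K \<subseteq> J" "c \<in> K \<rightarrow> carrier S" "(\<Oplus>\<^bsub>G\<^esub>i\<in>K. sc (u (f i)) (c i)) = \<zero>\<^bsub>G\<^esub>"
  have injK: "inj_on f K" using inj K(2) inj_on_subset by blast
  have "(\<Oplus>\<^bsub>G\<^esub>i\<in>f ` K. sc (u i) (c (inv_into K f i))) = (\<Oplus>\<^bsub>G\<^esub>i\<in>K. sc (u (f i)) (c (inv_into K f (f i))))"
    using K(1-3) fJ injK by (intro G.finsum_reindex) (auto simp: inv_into_f_f intro!: sc_closed)
  also have "\<dots> = (\<Oplus>\<^bsub>G\<^esub>i\<in>K. sc (u (f i)) (c i))"
    using K(1-3) fJ injK by (intro G.finsum_cong') (auto simp: inv_into_f_f intro!: sc_closed)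
  finally have "(\<Oplus>\<^bsub>G\<^esub>i\<in>f ` K. sc (u i) (c (inv_into K f i))) = \<zero>\<^bsub>G\<^esub>" using K(4) by simp
  then have "c (inv_into K f (f i)) = \<zero>\<^bsub>S\<^esub>" if "i \<in> K" for i
    by (intro indep[of "f ` K" "\<lambda>i. c (inv_into K f i)"]) (use that K(1-3) fJ injK in \<open>auto simp: inv_into_f_f\<close>)
  then show "\<forall>i\<in>K. c i = \<zero>\<^bsub>S\<^esub>" using injK by (auto simp: inv_into_f_f)
qed

end

text \<open>Bases multiply in a tower: coordinates over \<open>C\<close> are expanded over
  \<open>A\<close>. The products enter only as a family \<open>w\<close> with the stated
  compatibility, so the lemma serves left bases, right bases and modules alike.\<close>

lemma free_basis_trans:
  assumes "free_basis C G sc u I" "free_basis A C sc' p J"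
    and ad: "\<And>i j. i \<in> I \<Longrightarrow> j \<in> J \<Longrightarrow> additive_map A G (sc (w i j))"
    and eq: "\<And>i j a. \<lbrakk>i \<in> I; j \<in> J; a \<in> carrier A\<rbrakk> \<Longrightarrow> sc (u i) (sc' (p j) a) = sc (w i j) a"
  shows "free_basis A G sc (\<lambda>(i, j). w i j) (I \<times> J)"
proof -
  interpret G: free_basis C G sc u I by fact
  interpret C: free_basis A C sc' p J by fact
  have wcl: "sc (w i j) a \<in> carrier G" if "i \<in> I" "j \<in> J" "a \<in> carrier A" for i j a
    by (rule additive_map_closed[OF ad]) fact+
  have wz: "sc (w i j) \<zero>\<^bsub>A\<^esub> = \<zero>\<^bsub>G\<^esub>" if "i \<in> I" "j \<in> J" for i j
    by (rule additive_map_zero[OF C.abS G.abG ad]) fact+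
  have dist: "sc (u i) (\<Oplus>\<^bsub>C\<^esub>j\<in>L. sc' (p j) (a j)) = (\<Oplus>\<^bsub>G\<^esub>j\<in>L. sc (w i j) (a j))"
    if "i \<in> I" "L \<subseteq> J" "a \<in> L \<rightarrow> carrier A" for i L a
  proof -
    have "sc (u i) (\<Oplus>\<^bsub>C\<^esub>j\<in>L. sc' (p j) (a j)) = (\<Oplus>\<^bsub>G\<^esub>j\<in>L. sc (u i) (sc' (p j) (a j)))"
      using that by (intro additive_map_finsum[OF G.abS G.abG G.sc_additive]) (auto intro!: C.sc_closed)
    also have "\<dots> = (\<Oplus>\<^bsub>G\<^esub>j\<in>L. sc (w i j) (a j))"
      using that by (intro G.G.finsum_cong' refl) (auto simp: eq subset_iff Pi_iff intro!: wcl)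
    finally show ?thesis .
  qed
  show ?thesis
  proof (rule free_basisI[OF C.abS G.abG])
    show "additive_map A G (sc (case k of (i, j) \<Rightarrow> w i j))" if "k \<in> I \<times> J" for k
      using that ad by auto
  next
    fix y assume y: "y \<in> carrier G"
    let ?K = "{i. G.crd y i \<noteq> \<zero>\<^bsub>C\<^esub>}"
    let ?a = "\<lambda>i j. C.crd (G.crd y i) j"
    let ?L = "\<Union>i\<in>?K. {j. ?a i j \<noteq> \<zero>\<^bsub>A\<^esub>}"
    have K: "finite ?K" "?K \<subseteq> I" using y G.crd_sub G.finite_crd by auto
    have L: "finite ?L" "?L \<subseteq> J" using y K C.finite_crd[OF G.crd_closed] C.crd_sub[OF G.crd_closed] by blast+
    have "y = (\<Oplus>\<^bsub>G\<^esub>i\<in>?K. sc (u i) (G.crd y i))"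
      by (rule G.crd_finsum[OF y K(1) order_refl K(2)])
    also have "\<dots> = (\<Oplus>\<^bsub>G\<^esub>i\<in>?K. \<Oplus>\<^bsub>G\<^esub>j\<in>?L. sc (w i j) (?a i j))"
    proof (intro G.G.finsum_cong' refl)
      show "(\<lambda>i. \<Oplus>\<^bsub>G\<^esub>j\<in>?L. sc (w i j) (?a i j)) \<in> ?K \<rightarrow> carrier G"
        using K L y by (auto intro!: G.G.finsum_closed wcl)
      fix i assume i: "i \<in> ?K"
      have "G.crd y i = (\<Oplus>\<^bsub>C\<^esub>j\<in>?L. sc' (p j) (?a i j))"
        using i L y by (intro C.crd_finsum) auto
      then show "sc (u i) (G.crd y i) = (\<Oplus>\<^bsub>G\<^esub>j\<in>?L. sc (w i j) (?a i j))"
        using dist[of i ?L "?a i"] i K(2) L(2) y by (simp add: Pi_def subset_iff)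
    qed
    also have "\<dots> = finsum G (\<lambda>(i, j). sc (w i j) (?a i j)) (?K \<times> ?L)"
      using K L y by (intro G.G.finsum_Sigma) (auto intro!: wcl)
    finally have "y = (\<Oplus>\<^bsub>G\<^esub>k\<in>?K \<times> ?L. sc (case k of (i, j) \<Rightarrow> w i j) (?a (fst k) (snd k)))"
      by (simp add: case_prod_unfold)
    then show "\<exists>K c. finite K \<and> K \<subseteq> I \<times> J \<and> c \<in> K \<rightarrow> carrier A \<and>
        y = (\<Oplus>\<^bsub>G\<^esub>k\<in>K. sc (case k of (i, j) \<Rightarrow> w i j) (c k))"
      using K L y by (intro exI[of _ "?K \<times> ?L"] exI[of _ "\<lambda>k. ?a (fst k) (snd k)"]) auto
  next
    fix K c assume K: "finite K" "K \<subseteq> I \<times> J" "c \<in> K \<rightarrow> carrier A"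
      "(\<Oplus>\<^bsub>G\<^esub>k\<in>K. sc (case k of (i, j) \<Rightarrow> w i j) (c k)) = \<zero>\<^bsub>G\<^esub>"
    let ?K1 = "fst ` K" and ?K2 = "snd ` K"
    \<comment> \<open>Extension by zero to the rectangle \<open>?K1 \<times> ?K2\<close>, which
      turns the sum over \<open>K\<close> into an iterated one.\<close>
    let ?c = "\<lambda>i j. if (i, j) \<in> K then c (i, j) else \<zero>\<^bsub>A\<^esub>"
    have fin: "finite ?K1" "finite ?K2" "?K1 \<subseteq> I" "?K2 \<subseteq> J" using K by auto
    have cc: "?c i j \<in> carrier A" for i j using K(3) by auto
    have "(\<Oplus>\<^bsub>G\<^esub>k\<in>K. sc (case k of (i, j) \<Rightarrow> w i j) (?c (fst k) (snd k)))
       = (\<Oplus>\<^bsub>G\<^esub>k\<in>K. sc (case k of (i, j) \<Rightarrow> w i j) (c k))"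
      using K(1-3) by (intro G.G.finsum_cong' refl) (auto intro!: wcl simp: Pi_iff)
    then have "\<zero>\<^bsub>G\<^esub> = (\<Oplus>\<^bsub>G\<^esub>k\<in>K. sc (case k of (i, j) \<Rightarrow> w i j) (?c (fst k) (snd k)))"
      using K(4) by simp
    also have "\<dots> = (\<Oplus>\<^bsub>G\<^esub>k\<in>?K1 \<times> ?K2. sc (case k of (i, j) \<Rightarrow> w i j) (?c (fst k) (snd k)))"
    proof (rule G.G.finsum_mono_neutral)
      show "K \<subseteq> ?K1 \<times> ?K2" by force
      show "(\<lambda>k. sc (case k of (i, j) \<Rightarrow> w i j) (?c (fst k) (snd k))) \<in> ?K1 \<times> ?K2 \<rightarrow> carrier G"
        using fin K(3) by (auto intro!: wcl)
      show "sc (case k of (i, j) \<Rightarrow> w i j) (?c (fst k) (snd k)) = \<zero>\<^bsub>G\<^esub>" if "k \<in> ?K1 \<times> ?K2 - K" for k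
        using that fin wz by (auto simp: subset_iff)
    qed (use fin in auto)
    also have "\<dots> = finsum G (\<lambda>(i, j). sc (w i j) (?c i j)) (?K1 \<times> ?K2)"
      by (simp add: case_prod_unfold)
    also have "\<dots> = (\<Oplus>\<^bsub>G\<^esub>i\<in>?K1. \<Oplus>\<^bsub>G\<^esub>j\<in>?K2. sc (w i j) (?c i j))"
      using fin K(3) by (intro G.G.finsum_Sigma[symmetric]) (auto intro!: wcl)
    also have "\<dots> = (\<Oplus>\<^bsub>G\<^esub>i\<in>?K1. sc (u i) (\<Oplus>\<^bsub>C\<^esub>j\<in>?K2. sc' (p j) (?c i j)))"
    proof (intro G.G.finsum_cong' refl)
      show "(\<lambda>i. sc (u i) (\<Oplus>\<^bsub>C\<^esub>j\<in>?K2. sc' (p j) (?c i j))) \<in> ?K1 \<rightarrow> carrier G"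
        using fin cc by (auto intro!: G.sc_closed G.S.finsum_closed C.sc_closed)
      show "(\<Oplus>\<^bsub>G\<^esub>j\<in>?K2. sc (w i j) (?c i j)) = sc (u i) (\<Oplus>\<^bsub>C\<^esub>j\<in>?K2. sc' (p j) (?c i j))" if "i \<in> ?K1" for i
        using dist[of i ?K2 "?c i"] that fin cc by auto
    qed
    finally have "\<forall>i\<in>?K1. (\<Oplus>\<^bsub>C\<^esub>j\<in>?K2. sc' (p j) (?c i j)) = \<zero>\<^bsub>C\<^esub>"
      using fin cc by (intro ballI G.indep[of ?K1]) (auto intro!: G.S.finsum_closed C.sc_closed)
    then have "?c i j = \<zero>\<^bsub>A\<^esub>" if "i \<in> ?K1" "j \<in> ?K2" for i j
      using that fin cc by (intro C.indep[of ?K2 "?c i" j]) auto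
    then show "\<forall>k\<in>K. c k = \<zero>\<^bsub>A\<^esub>" by force
  qed
qed


section \<open>The Hom complex\<close>

locale hom_complex = N: dg_module_over R B N + T: dg_module_over R B T
  for R :: "('r, 'x) ring_scheme" and B :: "('r, 'b) dg_alg"
    and N :: "('b, 'n) dg_mod" and T :: "('b, 't) dg_mod"
begin

abbreviation "H \<equiv> Hom_deg B N T"

lemma Hom_closed: "f \<in> H q \<Longrightarrow> x \<in> carrier N \<Longrightarrow> f x \<in> carrier T"
  and Hom_add: "f \<in> H q \<Longrightarrow> x \<in> carrier N \<Longrightarrow> y \<in> carrier N \<Longrightarrow> f (x \<oplus>\<^bsub>N\<^esub> y) = f x \<oplus>\<^bsub>T\<^esub> f y"
  and Hom_act: "f \<in> H q \<Longrightarrow> x \<in> carrier N \<Longrightarrow> b \<in> carrier B \<Longrightarrow> f (act N x b) = act T (f x) b"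
  and Hom_mgr: "f \<in> H q \<Longrightarrow> x \<in> mgr N i \<Longrightarrow> f x \<in> mgr T (i + q)"
  and Hom_ext: "f \<in> H q \<Longrightarrow> x \<notin> carrier N \<Longrightarrow> f x = undefined"
  by (auto simp: Hom_deg_def PiE_iff extensional_def image_subset_iff)

lemma HomI:
  assumes "additive_map N T f" "\<And>x b. x \<in> carrier N \<Longrightarrow> b \<in> carrier B \<Longrightarrow> f (act N x b) = act T (f x) b"
    and "\<And>x i. x \<in> mgr N i \<Longrightarrow> f x \<in> mgr T (i + q)"
  shows "(\<lambda>x\<in>carrier N. f x) \<in> H q"
  using assms N.N.act_closed N.N.gr.homog_closed
  by (auto simp: Hom_deg_def additive_map_def)

lemma Hom_additive: "f \<in> H q \<Longrightarrow> additive_map N T f"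
  by (rule additive_mapI) (auto simp: Hom_closed Hom_add)

lemma Hom_eqI:
  assumes "f \<in> H q" "g \<in> H q'" "\<And>x. x \<in> carrier N \<Longrightarrow> f x = g x"
  shows "f = g"
proof
  show "f x = g x" for x using assms by (cases "x \<in> carrier N") (auto simp: Hom_ext)
qed

text \<open>A map of degree \<open>q\<close> shifts every parity by \<open>q\<close>. This sign
  makes the terms containing \<open>adiff B b\<close> cancel when the boundary of a linear map is
  shown to be linear.\<close>

lemma Hom_twist:
  assumes "f \<in> H q" "x \<in> carrier N"
  shows "T.tN (f x) = sg T q (f (N.tN x))"
  using assms(2)
proof (induction rule: N.N.gr.graded_induct)
  case (homog i x)
  then have x: "x \<in> carrier N" by (rule N.N.gr.homog_closed)
  have "sg T q (f (N.tN x)) = sg T q (sg T i (f x))"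
    using additive_map_sg_commute[OF N.abN T.abN Hom_additive[OF assms(1)] x, of i]
    by (simp add: N.N.gr.twist_homog[OF homog])
  also have "\<dots> = sg T (i + q) (f x)"
    using assms(1) x by (simp add: T.N.sg_sg Hom_closed add.commute)
  finally show ?case using T.N.gr.twist_homog[OF Hom_mgr[OF assms(1) homog]] by simp
next
  case (add x y)
  then show ?case
    using assms(1) by (simp add: Hom_add T.N.gr.twist_add N.N.gr.twist_add Hom_closed T.N.sg_add)
qed

lemma Hom_diff_eq: "x \<in> carrier N \<Longrightarrow> Hom_diff N T p f x = mdiff T (f x) \<ominus>\<^bsub>T\<^esub> sg T p (f (mdiff N x))"
  by (simp add: Hom_diff_def)

text \<open>Linearity is the point: both Leibniz expansions contain the twisted value of
  \<open>f\<close> acted on by \<open>adiff B b\<close>, with signs that agree by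
  \<open>Hom_twist\<close>, so these terms cancel. Writing the degree as \<open>q + 1\<close>
  matches \<open>Hom_boundaries\<close>.\<close>

lemma Hom_diff_mem:
  assumes "f \<in> H (q + 1)" shows "Hom_diff N T (q + 1) f \<in> H q"
  unfolding Hom_diff_def
proof (rule HomI)
  have cl: "f x \<in> carrier T" "f (mdiff N x) \<in> carrier T" if "x \<in> carrier N" for x
    using that assms by (auto simp: Hom_closed N.N.mdiff_closed)
  have 1: "additive_map N T (\<lambda>x. mdiff T (f x))"
    by (rule additive_map_comp[OF Hom_additive[OF assms] T.additive_map_mdiff])
  have 2: "additive_map N T (\<lambda>x. sg T (q + 1) (f (mdiff N x)))"
    by (rule additive_map_comp[OF additive_map_comp[OF N.additive_map_mdiff Hom_additive[OF assms]] T.N.additive_map_sg])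
  show "additive_map N T (\<lambda>x. mdiff T (f x) \<ominus>\<^bsub>T\<^esub> sg T (q + 1) (f (mdiff N x)))"
    using additive_map_add[OF 1] additive_map_add[OF 2] cl
    by (intro additive_mapI)
       (auto simp: a_minus_def T.N.mdiff_closed T.N.minus_add T.N.a_ac)
  fix x b assume h: "x \<in> carrier N" "b \<in> carrier B"
  have "mdiff T (f (act N x b)) \<ominus>\<^bsub>T\<^esub> sg T (q + 1) (f (mdiff N (act N x b)))
      = (act T (mdiff T (f x)) b \<oplus>\<^bsub>T\<^esub> act T (T.tN (f x)) (adiff B b)) \<ominus>\<^bsub>T\<^esub>
        (act T (sg T (q + 1) (f (mdiff N x))) b \<oplus>\<^bsub>T\<^esub> act T (sg T (q + 1) (f (N.tN x))) (adiff B b))"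
    using h assms cl
    by (simp add: Hom_act T.mdiff_act_general N.mdiff_act_general Hom_add Hom_closed N.N.mdiff_closed
        N.N.act_closed N.B.adiff_closed T.N.sg_add T.act_sg_left T.N.act_closed)
  also have "\<dots> = act T (mdiff T (f x)) b \<ominus>\<^bsub>T\<^esub> act T (sg T (q + 1) (f (mdiff N x))) b"
    using h assms cl Hom_twist[OF assms h(1)] Hom_closed[OF assms, of "N.tN x"]
    by (simp add: a_minus_def T.N.minus_add N.B.adiff_closed T.N.mdiff_closed T.N.act_closed T.N.a_ac)
       (simp add: T.N.act_closed N.B.adiff_closed T.N.mdiff_closed T.N.r_neg T.N.a_assoc[symmetric] T.N.l_neg)
  also have "\<dots> = act T (mdiff T (f x) \<ominus>\<^bsub>T\<^esub> sg T (q + 1) (f (mdiff N x))) b"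
    using h cl additive_map_minus[OF T.abN T.abN T.additive_map_act_left[OF h(2)]]
    by (simp add: T.N.mdiff_closed)
  finally show "mdiff T (f (act N x b)) \<ominus>\<^bsub>T\<^esub> sg T (q + 1) (f (mdiff N (act N x b))) =
     act T (mdiff T (f x) \<ominus>\<^bsub>T\<^esub> sg T (q + 1) (f (mdiff N x))) b" .
next
  fix x i assume x: "x \<in> mgr N i"
  have "mdiff T (f x) \<in> mgr T (i + q)"
    using T.N.mdiff_mgr[OF Hom_mgr[OF assms x]] by (simp add: algebra_simps)
  moreover have "f (mdiff N x) \<in> mgr T (i + q)"
    using Hom_mgr[OF assms N.N.mdiff_mgr[OF x]] by (simp add: algebra_simps)
  ultimately show "mdiff T (f x) \<ominus>\<^bsub>T\<^esub> sg T (q + 1) (f (mdiff N x)) \<in> mgr T (i + q)"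
    by (simp add: a_minus_def T.N.gr.homog_add T.N.gr.homog_neg T.N.gr.homog_sg)
qed

lemma Hom_minus:
  assumes "f \<in> H q" "g \<in> H q" shows "(\<lambda>x\<in>carrier N. f x \<ominus>\<^bsub>T\<^esub> g x) \<in> H q"
proof (rule HomI)
  have cl: "f x \<in> carrier T" "g x \<in> carrier T" if "x \<in> carrier N" for x
    using that assms by (auto simp: Hom_closed)
  show "additive_map N T (\<lambda>x. f x \<ominus>\<^bsub>T\<^esub> g x)"
    using assms cl by (intro additive_mapI) (auto simp: a_minus_def Hom_add T.N.minus_add T.N.a_ac)
  show "f (act N x b) \<ominus>\<^bsub>T\<^esub> g (act N x b) = act T (f x \<ominus>\<^bsub>T\<^esub> g x) b"
    if "x \<in> carrier N" "b \<in> carrier B" for x b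
    using that assms cl additive_map_minus[OF T.abN T.abN T.additive_map_act_left[OF that(2)]]
    by (simp add: Hom_act)
  show "f x \<ominus>\<^bsub>T\<^esub> g x \<in> mgr T (i + q)" if "x \<in> mgr N i" for x i
    using that assms by (simp add: a_minus_def T.N.gr.homog_add T.N.gr.homog_neg Hom_mgr)
qed

text \<open>Cycles are maps commuting with the differentials up to the sign of their degree. In
  degree 0 they are the DG homomorphisms, made extensional outside the carrier.\<close>

lemma cycle_iff:
  "f \<in> Hom_cycles B N T q \<longleftrightarrow> f \<in> H q \<and> (\<forall>x\<in>carrier N. mdiff T (f x) = sg T q (f (mdiff N x)))"
proof -
  have "Hom_diff N T q f = \<one>\<^bsub>Hom_group B N T (q - 1)\<^esub> \<longleftrightarrow>
      (\<forall>x\<in>carrier N. mdiff T (f x) = sg T q (f (mdiff N x)))" if "f \<in> H q"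
  proof -
    have "Hom_diff N T q f = \<one>\<^bsub>Hom_group B N T (q - 1)\<^esub> \<longleftrightarrow>
      (\<forall>x\<in>carrier N. mdiff T (f x) \<ominus>\<^bsub>T\<^esub> sg T q (f (mdiff N x)) = \<zero>\<^bsub>T\<^esub>)"
      by (auto simp: Hom_diff_def Hom_group_def restrict_def fun_eq_iff)
    also have "\<dots> \<longleftrightarrow> (\<forall>x\<in>carrier N. mdiff T (f x) = sg T q (f (mdiff N x)))"
    proof (intro ball_cong refl iffI)
      fix x assume "x \<in> carrier N"
      then have c: "mdiff T (f x) \<in> carrier T" "sg T q (f (mdiff N x)) \<in> carrier T"
        using that by (auto simp: Hom_closed N.N.mdiff_closed T.N.mdiff_closed)
      show "mdiff T (f x) = sg T q (f (mdiff N x))"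
        if "mdiff T (f x) \<ominus>\<^bsub>T\<^esub> sg T q (f (mdiff N x)) = \<zero>\<^bsub>T\<^esub>"
        by (rule T.N.minus_zero_eq[OF c that])
      show "mdiff T (f x) \<ominus>\<^bsub>T\<^esub> sg T q (f (mdiff N x)) = \<zero>\<^bsub>T\<^esub>"
        if "mdiff T (f x) = sg T q (f (mdiff N x))"
        using c that by (simp add: a_minus_def T.N.r_neg)
    qed
    finally show ?thesis .
  qed
  then show ?thesis by (auto simp: Hom_cycles_def)
qed

text \<open>On both sides only the term with a differential before and after \<open>h\<close>
  survives; the remaining sign is that \<open>q\<close> and \<open>q + 1\<close> have opposite
  parity.\<close>

lemma boundary_cycle:
  assumes "h \<in> H (q + 1)" shows "Hom_diff N T (q + 1) h \<in> Hom_cycles B N T q"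
  unfolding cycle_iff
proof (intro conjI ballI Hom_diff_mem[OF assms])
  fix x assume x: "x \<in> carrier N"
  let ?y = "h (mdiff N x)"
  have c: "?y \<in> carrier T" "mdiff T ?y \<in> carrier T" "h x \<in> carrier T" "mdiff N x \<in> carrier N"
    using x assms by (auto simp: Hom_closed N.N.mdiff_closed T.N.mdiff_closed)
  have h0: "h \<zero>\<^bsub>N\<^esub> = \<zero>\<^bsub>T\<^esub>"
    by (rule additive_map_zero[OF N.abN T.abN Hom_additive[OF assms]])
  have 1: "mdiff T (Hom_diff N T (q + 1) h x) = \<ominus>\<^bsub>T\<^esub> sg T (q + 1) (mdiff T ?y)"
    using x c additive_map_minus[OF T.abN T.abN T.additive_map_mdiff]
    by (simp add: Hom_diff_eq T.N.mdiff_closed T.N.mdiff_mdiff T.mdiff_sg) (simp add: a_minus_def T.N.mdiff_closed)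
  have 2: "Hom_diff N T (q + 1) h (mdiff N x) = mdiff T ?y"
    using x c by (simp add: Hom_diff_eq N.N.mdiff_mdiff h0) (simp add: a_minus_def)
  show "mdiff T (Hom_diff N T (q + 1) h x) = sg T q (Hom_diff N T (q + 1) h (mdiff N x))"
    unfolding 1 2 using c by (simp add: sg_def)
qed

lemma cycle_minus:
  assumes "f \<in> Hom_cycles B N T q" "g \<in> Hom_cycles B N T q"
  shows "(\<lambda>x\<in>carrier N. f x \<ominus>\<^bsub>T\<^esub> g x) \<in> Hom_cycles B N T q"
proof -
  have fg: "f \<in> H q" "g \<in> H q" using assms by (auto simp: cycle_iff)
  have "mdiff T (f x \<ominus>\<^bsub>T\<^esub> g x) = sg T q (f (mdiff N x) \<ominus>\<^bsub>T\<^esub> g (mdiff N x))" if x: "x \<in> carrier N" for x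
  proof -
    have "mdiff T (f x \<ominus>\<^bsub>T\<^esub> g x) = mdiff T (f x) \<ominus>\<^bsub>T\<^esub> mdiff T (g x)"
      using x fg by (intro additive_map_minus[OF T.abN T.abN T.additive_map_mdiff]) (auto simp: Hom_closed)
    also have "\<dots> = sg T q (f (mdiff N x)) \<ominus>\<^bsub>T\<^esub> sg T q (g (mdiff N x))"
      using assms x by (simp add: cycle_iff)
    also have "\<dots> = sg T q (f (mdiff N x) \<ominus>\<^bsub>T\<^esub> g (mdiff N x))"
      using x fg by (intro additive_map_minus[OF T.abN T.abN T.N.additive_map_sg, symmetric])
        (auto simp: Hom_closed N.N.mdiff_closed)
    finally show ?thesis .
  qed
  then show ?thesis
    using Hom_minus[OF fg] by (auto simp: cycle_iff N.N.mdiff_closed)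
qed

end

text \<open>Degree \<open>q\<close> of the Hom complex is \<open>Ext\<close> in degree
  \<open>- q\<close>, so this is the vanishing of all positive \<open>Ext\<close>. It is phrased by
  inclusion to avoid quotient groups.\<close>

definition acyclic_below :: "('r, 'b) dg_alg \<Rightarrow> ('b, 'm) dg_mod \<Rightarrow> ('b, 'n) dg_mod \<Rightarrow> bool" where
  "acyclic_below B N T \<longleftrightarrow> (\<forall>q<0. Hom_cycles B N T q \<subseteq> Hom_boundaries B N T q)"

section \<open>Filtered lifting\<close>

text \<open>\<open>T\<close> carries the filtration \<open>F\<^sub>k = {y. \<Theta>\<^sub>i y = 0 for i < k}\<close>; the map \<open>\<Theta>\<^sub>k\<close> identifies
  \<open>F\<^sub>k / F\<^sub>k\<^sub>+\<^sub>1\<close> with a shift of \<open>T'\<close> for \<open>k \<in> I\<close> and \<open>F\<^sub>k = F\<^sub>k\<^sub>+\<^sub>1\<close> otherwise. The operators \<open>E\<^sub>k\<close>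
  witness that \<open>\<Theta>\<^sub>k\<close> is a morphism of DG modules up to sign on \<open>F\<^sub>k\<close>, though not on all of \<open>T\<close>.\<close>

locale filtered_lifting =
  N: dg_module_over R B N + T: dg_module_over R B T + T': dg_module_over R B T'
  for R :: "('r, 'x) ring_scheme" and B :: "('r, 'b) dg_alg"
    and N :: "('b, 'n) dg_mod" and T :: "('b, 't) dg_mod" and T' :: "('b, 's) dg_mod" +
  fixes e :: nat and I :: "nat set" and E :: "nat \<Rightarrow> 't \<Rightarrow> 't" and \<Theta> :: "nat \<Rightarrow> 't \<Rightarrow> 's"
    and s :: "'s \<Rightarrow> 't" and u :: "'i \<Rightarrow> 'n" and J :: "'i set" and deg :: "'i \<Rightarrow> int"
  assumes e_pos: "0 < e"
    and bounded: "bounded_below T"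
    and E_additive: "additive_map T T (E k)"
    and E_act: "y \<in> carrier T \<Longrightarrow> b \<in> carrier B \<Longrightarrow> E k (act T y b) = act T (E k y) b"
    and E_mgr: "y \<in> mgr T j \<Longrightarrow> E k y \<in> mgr T (j + int (k * e))"
    and E_diff: "y \<in> carrier T \<Longrightarrow> mdiff T (E k y) = sg T (k * e) (E k (mdiff T y))"
    and Th_additive: "additive_map T T' (\<Theta> k)"
    and Th_mgr: "y \<in> mgr T j \<Longrightarrow> \<Theta> k y \<in> mgr T' (j - int (k * e))"
    and Th0_hom: "dg_hom B T T' (\<Theta> 0)"
    and s_closed: "z \<in> carrier T' \<Longrightarrow> s z \<in> carrier T"
    and s_mgr: "z \<in> mgr T' j \<Longrightarrow> s z \<in> mgr T j"
    and s_zero: "s \<zero>\<^bsub>T'\<^esub> = \<zero>\<^bsub>T\<^esub>"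
    and Th0_s: "z \<in> carrier T' \<Longrightarrow> \<Theta> 0 (s z) = z"
    and Th_E_same: "k \<in> I \<Longrightarrow> y \<in> carrier T \<Longrightarrow> \<Theta> k (E k y) = \<Theta> 0 y"
    and Th_E_less: "k < m \<Longrightarrow> y \<in> carrier T \<Longrightarrow> \<Theta> k (E m y) = \<zero>\<^bsub>T'\<^esub>"
    and E_trivial: "k \<notin> I \<Longrightarrow> y \<in> carrier T \<Longrightarrow> E k y = \<zero>\<^bsub>T\<^esub>"
    and zero_I: "0 \<in> I"
    and taylor: "y \<in> carrier T \<Longrightarrow> \<exists>M. y = (\<Oplus>\<^bsub>T\<^esub>m\<in>{..<M}. E m (s (\<Theta> m y)))"
    and basis: "free_basis B N (act N) u J"
    and basis_mgr: "i \<in> J \<Longrightarrow> u i \<in> mgr N (deg i)"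
begin

sublocale NT: hom_complex R B N T ..
sublocale NT': hom_complex R B N T' ..
sublocale fb: free_basis B N "act N" u J by (rule basis)

lemma E_closed: "y \<in> carrier T \<Longrightarrow> E k y \<in> carrier T"
  by (rule additive_map_closed[OF E_additive])
lemma Th_closed: "y \<in> carrier T \<Longrightarrow> \<Theta> k y \<in> carrier T'"
  by (rule additive_map_closed[OF Th_additive])
lemma Th_zero [simp]: "\<Theta> k \<zero>\<^bsub>T\<^esub> = \<zero>\<^bsub>T'\<^esub>"
  by (rule additive_map_zero[OF T.abN T'.abN Th_additive])
lemma E_zero [simp]: "E k \<zero>\<^bsub>T\<^esub> = \<zero>\<^bsub>T\<^esub>"
  by (rule additive_map_zero[OF T.abN T.abN E_additive])

lemma Th_sg: "y \<in> carrier T \<Longrightarrow> \<Theta> k (sg T l y) = sg T' l (\<Theta> k y)"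
  by (rule additive_map_sg_commute[OF T.abN T'.abN Th_additive])

section \<open>The filtration and the maps on its subquotients\<close>

definition filt :: "nat \<Rightarrow> 't set" where
  "filt k = {y \<in> carrier T. \<forall>i<k. \<Theta> i y = \<zero>\<^bsub>T'\<^esub>}"

text \<open>In the Taylor expansion the terms of order below \<open>k\<close> vanish, as
  \<open>s\<close> and the operators map zero to zero.\<close>

lemma filt_taylor:
  assumes "y \<in> filt k" shows "\<exists>M. y = (\<Oplus>\<^bsub>T\<^esub>m\<in>{k..<M}. E m (s (\<Theta> m y)))"
proof -
  have y: "y \<in> carrier T" using assms by (simp add: filt_def)
  have cl: "E m (s (\<Theta> m y)) \<in> carrier T" for m
    using y by (intro E_closed s_closed Th_closed)
  obtain M where M: "y = (\<Oplus>\<^bsub>T\<^esub>m\<in>{..<M}. E m (s (\<Theta> m y)))" using taylor[OF y] by blast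
  have "(\<Oplus>\<^bsub>T\<^esub>m\<in>{k..<M}. E m (s (\<Theta> m y))) = (\<Oplus>\<^bsub>T\<^esub>m\<in>{..<M}. E m (s (\<Theta> m y)))"
    by (rule T.N.finsum_mono_neutral) (use assms cl s_zero in \<open>auto simp: filt_def\<close>)
  then show ?thesis using M by (intro exI[of _ M]) simp
qed

text \<open>By the Taylor formula the images of the \<open>E m\<close> with \<open>m \<ge> k\<close> generate \<open>F\<^sub>k\<close>, so it suffices to
  control an operator on these images.\<close>

lemma filt_operator:
  assumes y: "y \<in> filt k" and \<phi>: "additive_map T T \<phi>"
    and \<psi>: "\<And>m z. z \<in> carrier T \<Longrightarrow> \<psi> m z \<in> carrier T"
    and eq: "\<And>m z. z \<in> carrier T \<Longrightarrow> \<phi> (E m z) = E m (\<psi> m z)"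
  shows "\<phi> y \<in> filt k" and "k \<in> I \<Longrightarrow> \<Theta> k (\<phi> y) = \<Theta> 0 (\<psi> k (s (\<Theta> k y)))"
    and "k \<notin> I \<Longrightarrow> \<Theta> k (\<phi> y) = \<zero>\<^bsub>T'\<^esub>"
proof -
  let ?z = "\<lambda>m. s (\<Theta> m y)"
  have yc: "y \<in> carrier T" using y by (simp add: filt_def)
  have z: "?z m \<in> carrier T" for m using yc by (intro s_closed Th_closed)
  have cl: "E m (\<psi> m (?z m)) \<in> carrier T" for m by (intro E_closed \<psi> z)
  obtain M where M: "y = (\<Oplus>\<^bsub>T\<^esub>m\<in>{k..<M}. E m (?z m))" using filt_taylor[OF y] by blast
  have "\<phi> (\<Oplus>\<^bsub>T\<^esub>m\<in>{k..<M}. E m (?z m)) = (\<Oplus>\<^bsub>T\<^esub>m\<in>{k..<M}. \<phi> (E m (?z m)))"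
    by (intro additive_map_finsum[OF T.abN T.abN \<phi>]) (auto intro: E_closed z)
  also have "\<dots> = (\<Oplus>\<^bsub>T\<^esub>m\<in>{k..<M}. E m (\<psi> m (?z m)))" by (simp add: eq z)
  finally have \<phi>y: "\<phi> y = (\<Oplus>\<^bsub>T\<^esub>m\<in>{k..<M}. E m (\<psi> m (?z m)))" using M by simp
  have Th: "\<Theta> i (\<phi> y) = (\<Oplus>\<^bsub>T'\<^esub>m\<in>{k..<M}. \<Theta> i (E m (\<psi> m (?z m))))" for i
    unfolding \<phi>y by (intro additive_map_finsum[OF T.abN T'.abN Th_additive]) (auto intro: cl)
  have "\<Theta> i (\<phi> y) = \<zero>\<^bsub>T'\<^esub>" if "i < k" for i
    unfolding Th using that by (intro T'.N.add.finprod_one_eqI) (auto intro!: Th_E_less \<psi> z)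
  then show "\<phi> y \<in> filt k" using additive_map_closed[OF \<phi> yc] by (simp add: filt_def)
  \<comment> \<open>Of the summands of order at least \<open>k\<close>, only the one of order
    \<open>k\<close> survives under \<open>\<Theta> k\<close>.\<close>
  have top: "\<Theta> k (\<phi> y) = \<Theta> k (E k (\<psi> k (?z k)))" if "k < M"
  proof -
    have "(\<Oplus>\<^bsub>T'\<^esub>m\<in>{k}. \<Theta> k (E m (\<psi> m (?z m)))) = (\<Oplus>\<^bsub>T'\<^esub>m\<in>{k..<M}. \<Theta> k (E m (\<psi> m (?z m))))"
      by (rule T'.N.finsum_mono_neutral) (use that in \<open>auto intro!: Th_E_less \<psi> z Th_closed cl\<close>)
    then show ?thesis using Th by (simp add: Th_closed cl)
  qed
  have low: "\<Theta> k y = \<zero>\<^bsub>T'\<^esub>" "\<phi> y = \<zero>\<^bsub>T\<^esub>" if "\<not> k < M"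
  proof -
    have "{k..<M} = {}" using that by simp
    then have "y = \<zero>\<^bsub>T\<^esub>" using M by (metis T.N.finsum_empty)
    then show "\<Theta> k y = \<zero>\<^bsub>T'\<^esub>" "\<phi> y = \<zero>\<^bsub>T\<^esub>"
      using additive_map_zero[OF T.abN T.abN \<phi>] by simp_all
  qed
  show "\<Theta> k (\<phi> y) = \<zero>\<^bsub>T'\<^esub>" if "k \<notin> I"
    using that top low by (cases "k < M") (auto simp: E_trivial \<psi> z)
  show "\<Theta> k (\<phi> y) = \<Theta> 0 (\<psi> k (s (\<Theta> k y)))" if "k \<in> I"
  proof (cases "k < M")
    case True
    then show ?thesis using that top by (simp add: Th_E_same \<psi> z)
  next
    case False
    have "\<phi> (E 0 \<zero>\<^bsub>T\<^esub>) = E 0 (\<psi> 0 \<zero>\<^bsub>T\<^esub>)" by (simp add: eq del: E_zero)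
    \<comment> \<open>\<open>\<psi> k\<close> is not assumed to be additive, so that its value at
      zero is harmless has to be read off from \<open>\<phi>\<close>, which is additive.\<close>
    have "\<Theta> k (E k (\<psi> k \<zero>\<^bsub>T\<^esub>)) = \<Theta> k (\<phi> (E k \<zero>\<^bsub>T\<^esub>))" by (simp add: eq del: E_zero)
    also have "\<dots> = \<zero>\<^bsub>T'\<^esub>" using additive_map_zero[OF T.abN T.abN \<phi>] by simp
    finally have "\<Theta> 0 (\<psi> k \<zero>\<^bsub>T\<^esub>) = \<zero>\<^bsub>T'\<^esub>" using that by (simp add: Th_E_same \<psi>)
    then show ?thesis using low[OF False] by (simp add: s_zero)
  qed
qed

text \<open>The identity is an admissible operator in \<open>filt_operator\<close>, and for
  \<open>k\<close> outside \<open>I\<close> that lemma makes \<open>\<Theta> k\<close> vanish on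
  \<open>filt k\<close>.\<close>

lemma filt_trivial: assumes "y \<in> filt k" "k \<notin> I" shows "y \<in> filt (Suc k)"
proof -
  have "additive_map T T (\<lambda>y. y)" by (simp add: additive_map_def)
  then have "\<Theta> k y = \<zero>\<^bsub>T'\<^esub>"
    using filt_operator(3)[OF assms(1), of "\<lambda>y. y" "\<lambda>m z. z"] assms(2) by simp
  then show ?thesis using assms(1) by (auto simp: filt_def less_Suc_eq)
qed

lemma Th0_act: "y \<in> carrier T \<Longrightarrow> b \<in> carrier B \<Longrightarrow> \<Theta> 0 (act T y b) = act T' (\<Theta> 0 y) b"
  and Th0_diff: "y \<in> carrier T \<Longrightarrow> \<Theta> 0 (mdiff T y) = mdiff T' (\<Theta> 0 y)"
  using Th0_hom by (auto simp: dg_hom_def)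

text \<open>Linearity of \<open>\<Theta> k\<close> on \<open>filt k\<close> is inherited from the
  operators \<open>E m\<close>, which commute with the action, and from \<open>\<Theta> 0\<close>,
  which is a homomorphism on all of \<open>T\<close>.\<close>

lemma filt_act:
  assumes "y \<in> filt k" "b \<in> carrier B" "k \<in> I" shows "\<Theta> k (act T y b) = act T' (\<Theta> k y) b"
proof -
  have yc: "\<Theta> k y \<in> carrier T'" using assms by (auto simp: filt_def intro: Th_closed)
  have "\<Theta> k (act T y b) = \<Theta> 0 (act T (s (\<Theta> k y)) b)"
    using assms by (intro filt_operator(2)[OF assms(1), where \<psi> = "\<lambda>m z. act T z b"])
      (auto intro: T.additive_map_act_left T.N.act_closed simp: E_act)
  then show ?thesis using yc assms(2) by (simp add: Th0_act s_closed Th0_s)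
qed

text \<open>The same argument for the differential. Moving it past \<open>E m\<close> costs the sign
  of degree \<open>m * e\<close>, which is absorbed into \<open>\<psi>\<close>; at
  \<open>m = k\<close> it is the sign in the conclusion.\<close>

lemma filt_diff:
  assumes "y \<in> filt k" shows "mdiff T y \<in> filt k"
    and "k \<in> I \<Longrightarrow> \<Theta> k (mdiff T y) = sg T' (k * e) (mdiff T' (\<Theta> k y))"
proof -
  have yc: "\<Theta> k y \<in> carrier T'" using assms by (auto simp: filt_def intro: Th_closed)
  note op = filt_operator[OF assms, of "mdiff T" "\<lambda>m z. sg T (m * e) (mdiff T z)"]
  have eq: "mdiff T (E m z) = E m (sg T (m * e) (mdiff T z))" if "z \<in> carrier T" for m z
    using that additive_map_sg_commute[OF T.abN T.abN E_additive, where k = "m * e"]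
    by (simp add: E_diff T.N.mdiff_closed)
  show "mdiff T y \<in> filt k"
    using op(1) eq by (simp add: T.additive_map_mdiff T.N.mdiff_closed)
  assume "k \<in> I"
  then have "\<Theta> k (mdiff T y) = \<Theta> 0 (sg T (k * e) (mdiff T (s (\<Theta> k y))))"
    using op(2) eq by (simp add: T.additive_map_mdiff T.N.mdiff_closed)
  also have "\<dots> = sg T' (k * e) (mdiff T' (\<Theta> k y))"
    using yc
    by (simp add: Th_sg Th0_diff T.N.mdiff_closed s_closed Th0_s)
  finally show "\<Theta> k (mdiff T y) = sg T' (k * e) (mdiff T' (\<Theta> k y))" .
qed

text \<open>\<open>N\<close> is free as a graded module, so a lift is determined by choosing
  \<open>s (h' (u i))\<close> as the image of the basis element \<open>u i\<close>. The
  differentials are ignored; correcting for them is the task of the homotopies.\<close>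

lemma Hom_lift:
  assumes "h' \<in> Hom_deg B N T' q"
  shows "\<exists>h\<in>Hom_deg B N T q. \<forall>x\<in>carrier N. \<Theta> 0 (h x) = h' x"
proof -
  define f where "f = (\<lambda>i b. act T (s (h' (u i))) b)"
  have uc: "u i \<in> carrier N" if "i \<in> J" for i using basis_mgr[OF that] N.N.gr.homog_closed by blast
  have g: "s (h' (u i)) \<in> mgr T (deg i + q)" "s (h' (u i)) \<in> carrier T" if "i \<in> J" for i
    using s_mgr[OF NT'.Hom_mgr[OF assms basis_mgr[OF that]]] T.N.gr.homog_closed by blast+
  have fa: "additive_map B T (f i)" if "i \<in> J" for i
    unfolding f_def using g[OF that] by (intro T.additive_map_act_right)
  let ?h = "fb.linext T f"
  have ha: "additive_map N T ?h" by (rule fb.additive_map_linext[OF T.abN fa])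
  have hs: "?h (act N (u i) b) = act T (s (h' (u i))) b" if "i \<in> J" "b \<in> carrier B" for i b
    using fb.linext_sc[OF T.abN fa that] by (simp add: f_def)
  have lin: "?h (act N x b) = act T (?h x) b" if "x \<in> carrier N" "b \<in> carrier B" for x b
  proof (rule fb.additive_map_eq_on_gens[OF T.abN _ _ _ that(1)])
    show "additive_map N T (\<lambda>x. ?h (act N x b))"
      by (rule additive_map_comp[OF N.additive_map_act_left[OF that(2)] ha])
    show "additive_map N T (\<lambda>x. act T (?h x) b)"
      by (rule additive_map_comp[OF ha T.additive_map_act_left[OF that(2)]])
    show "?h (act N (act N (u i) c) b) = act T (?h (act N (u i) c)) b" if "i \<in> J" "c \<in> carrier B" for i c
      using that \<open>b \<in> carrier B\<close> g[OF that(1)] uc[OF that(1)]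
      by (simp add: hs N.N.act_mult[symmetric] T.N.act_mult[symmetric])
  qed
  have deg: "?h x \<in> mgr T (k + q)" if x: "x \<in> mgr N k" for x k
  proof -
    have xc: "x \<in> carrier N" using x N.N.gr.homog_closed by blast
    \<comment> \<open>Degrees are checked by commuting the extension with the projections, first on
      multiples of basis elements and there on homogeneous coefficients.\<close>
    have "hcomp T (mgr T) (k + q) (?h y) = ?h (hcomp N (mgr N) k y)" if "y \<in> carrier N" for y
    proof (rule fb.additive_map_eq_on_gens[OF T.abN _ _ _ that])
      show "additive_map N T (\<lambda>y. hcomp T (mgr T) (k + q) (?h y))"
        by (rule additive_map_comp[OF ha T.N.gr.additive_map_hcomp])
      show "additive_map N T (\<lambda>y. ?h (hcomp N (mgr N) k y))"
        by (rule additive_map_comp[OF N.N.gr.additive_map_hcomp ha])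
      fix i b assume i: "i \<in> J" and "b \<in> carrier B"
      have am: "additive_map B T (\<lambda>b. hcomp T (mgr T) (k + q) (?h (act N (u i) b)))"
        "additive_map B T (\<lambda>b. ?h (hcomp N (mgr N) k (act N (u i) b)))"
        by (intro additive_map_comp[OF additive_map_comp[OF N.additive_map_act_right[OF uc[OF i]] ha] T.N.gr.additive_map_hcomp]
            additive_map_comp[OF additive_map_comp[OF N.additive_map_act_right[OF uc[OF i]] N.N.gr.additive_map_hcomp] ha])+
      show "hcomp T (mgr T) (k + q) (?h (act N (u i) b)) = ?h (hcomp N (mgr N) k (act N (u i) b))"
      proof (rule N.B.gr.additive_map_eqI[OF am _ \<open>b \<in> carrier B\<close>])
        fix n b assume b: "b \<in> agr B n"
        have bc: "b \<in> carrier B" using b N.B.agr_closed by blast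
        have 1: "act N (u i) b \<in> mgr N (deg i + int n)" by (rule N.N.act_mgr[OF basis_mgr[OF i] b])
        have 2: "act T (s (h' (u i))) b \<in> mgr T (deg i + q + int n)" by (rule T.N.act_mgr[OF g(1)[OF i] b])
        show "hcomp T (mgr T) (k + q) (?h (act N (u i) b)) = ?h (hcomp N (mgr N) k (act N (u i) b))"
          using additive_map_zero[OF N.abN T.abN ha]
          by (auto simp: hs[OF i bc] N.N.gr.hcomp_homog[OF 1] T.N.gr.hcomp_homog[OF 2])
      qed
    qed
    from this[OF xc] have "hcomp T (mgr T) (k + q) (?h x) = ?h x"
      using N.N.gr.hcomp_homog[OF x, of k] by simp
    then show ?thesis
      using additive_map_closed[OF ha xc] by (intro T.N.gr.hcomp_eq_selfD)
  qed
  have "(\<lambda>x\<in>carrier N. ?h x) \<in> Hom_deg B N T q"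
    by (rule NT.HomI[OF ha lin deg])
  moreover have "\<Theta> 0 (?h x) = h' x" if "x \<in> carrier N" for x
  proof (rule fb.additive_map_eq_on_gens[OF T'.abN _ NT'.Hom_additive[OF assms] _ that])
    show "additive_map N T' (\<lambda>x. \<Theta> 0 (?h x))" by (rule additive_map_comp[OF ha Th_additive])
    show "\<Theta> 0 (?h (act N (u i) c)) = h' (act N (u i) c)" if "i \<in> J" "c \<in> carrier B" for i c
      using that g[OF that(1)] uc[OF that(1)] assms
      by (simp add: hs Th0_act NT'.Hom_closed Th0_s NT'.Hom_act)
  qed
  ultimately show ?thesis by (intro bexI) auto
qed

text \<open>Composition with \<open>\<Theta> k\<close> turns \<open>f\<close> into a cycle with
  values in \<open>T'\<close> of degree \<open>q - k * e\<close>, which is negative by assumption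
  and hence bounds some \<open>h'\<close>. Lifting \<open>h'\<close> along \<open>\<Theta> 0\<close>
  and applying \<open>E k\<close> gives a map whose boundary agrees with \<open>f\<close> under
  \<open>\<Theta> k\<close>. The last clause records where the lift vanishes for degree reasons; it
  is what makes infinitely many such corrections summable.\<close>

lemma push_cycle:
  assumes acyc: "acyclic_below B N T'" and f: "f \<in> Hom_cycles B N T q"
    and F: "\<And>x. x \<in> carrier N \<Longrightarrow> f x \<in> filt k" and q: "q < int (k * e)"
    and b: "\<And>i. i < b \<Longrightarrow> mgr T i = {\<zero>\<^bsub>T\<^esub>}"
  shows "\<exists>h\<in>Hom_deg B N T (q + 1).
     (\<forall>x\<in>carrier N. f x \<ominus>\<^bsub>T\<^esub> Hom_diff N T (q + 1) h x \<in> filt (Suc k)) \<and>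
     (\<forall>x\<in>carrier N. h x \<in> filt k) \<and>
     (\<forall>j. \<forall>x\<in>mgr N j. j + q + 1 - int (k * e) < b \<longrightarrow> h x = \<zero>\<^bsub>T\<^esub>)"
proof (cases "k \<in> I")
  case False
  \<comment> \<open>In this case every element of \<open>filt k\<close> already lies in
    \<open>filt (Suc k)\<close>, so nothing has to be corrected.\<close>
  let ?h = "\<lambda>x\<in>carrier N. \<zero>\<^bsub>T\<^esub>"
  have "?h \<in> Hom_deg B N T (q + 1)"
    by (rule NT.HomI) (auto simp: additive_map_def)
  moreover have "f x \<ominus>\<^bsub>T\<^esub> Hom_diff N T (q + 1) ?h x \<in> filt (Suc k)" if "x \<in> carrier N" for x
    using that filt_trivial[OF F[OF that] False] F[OF that]
    by (simp add: NT.Hom_diff_eq N.N.mdiff_closed filt_def a_minus_def)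
  ultimately show ?thesis
    using N.N.gr.homog_closed by (intro bexI[of _ ?h]) (auto simp: filt_def)
next
  case True
  let ?q = "q - int (k * e)"
  have fH: "f \<in> Hom_deg B N T q" and fc: "\<And>x. x \<in> carrier N \<Longrightarrow> mdiff T (f x) = sg T q (f (mdiff N x))"
    using f by (auto simp: NT.cycle_iff)
  have par: "sg T' (k * e) (sg T' q y) = sg T' ?q y" if "y \<in> carrier T'" for y
    using that by (auto simp: sg_def)
  let ?g = "\<lambda>x\<in>carrier N. \<Theta> k (f x)"
  have "?g \<in> Hom_deg B N T' ?q"
  proof (rule NT'.HomI)
    show "additive_map N T' (\<lambda>x. \<Theta> k (f x))"
      by (rule additive_map_comp[OF NT.Hom_additive[OF fH] Th_additive])
    show "\<Theta> k (f (act N x c)) = act T' (\<Theta> k (f x)) c" if "x \<in> carrier N" "c \<in> carrier B" for x c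
      using that fH F[OF that(1)] True by (simp add: NT.Hom_act filt_act)
    show "\<Theta> k (f x) \<in> mgr T' (i + ?q)" if "x \<in> mgr N i" for x i
      using Th_mgr[OF NT.Hom_mgr[OF fH that], of k] by (simp add: algebra_simps)
  qed
  moreover have "mdiff T' (\<Theta> k (f x)) = sg T' ?q (\<Theta> k (f (mdiff N x)))" if "x \<in> carrier N" for x
  proof -
    have cl: "\<Theta> k (f x) \<in> carrier T'" "f (mdiff N x) \<in> carrier T" "\<Theta> k (f (mdiff N x)) \<in> carrier T'"
      using that fH by (auto simp: NT.Hom_closed Th_closed N.N.mdiff_closed)
    have "sg T' (k * e) (mdiff T' (\<Theta> k (f x))) = \<Theta> k (mdiff T (f x))"
      using filt_diff(2)[OF F[OF that] True] by simp
    also have "\<dots> = sg T' q (\<Theta> k (f (mdiff N x)))"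
      using cl fc[OF that] by (simp add: Th_sg)
    finally have "sg T' (k * e) (sg T' (k * e) (mdiff T' (\<Theta> k (f x)))) = sg T' ?q (\<Theta> k (f (mdiff N x)))"
      using cl par by simp
    then show ?thesis using cl by (simp add: T'.N.mdiff_closed)
  qed
  ultimately have "?g \<in> Hom_cycles B N T' ?q"
    by (simp add: NT'.cycle_iff N.N.mdiff_closed)
  moreover have "?q < 0" using q by simp
  ultimately have "?g \<in> Hom_boundaries B N T' ?q" using acyc unfolding acyclic_below_def by blast
  then obtain h' where h': "h' \<in> Hom_deg B N T' (?q + 1)" "Hom_diff N T' (?q + 1) h' = ?g"
    by (auto simp: Hom_boundaries_def)
  obtain h0 where h0: "h0 \<in> Hom_deg B N T (?q + 1)" "\<And>x. x \<in> carrier N \<Longrightarrow> \<Theta> 0 (h0 x) = h' x"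
    using Hom_lift[OF h'(1)] by blast
  have h0c: "h0 x \<in> carrier T" if "x \<in> carrier N" for x using that h0(1) by (simp add: NT.Hom_closed)
  \<comment> \<open>The sign cancels the one in \<open>E_diff\<close>, so that the differential of
    \<open>?f x\<close> is \<open>E k\<close> applied to that of \<open>h0 x\<close>.\<close>
  let ?f = "\<lambda>x. sg T (k * e) (E k (h0 x))"
  let ?h = "\<lambda>x\<in>carrier N. ?f x"
  have hH: "?h \<in> Hom_deg B N T (q + 1)"
  proof (rule NT.HomI)
    show "additive_map N T ?f"
      by (rule additive_map_comp[OF additive_map_comp[OF NT.Hom_additive[OF h0(1)] E_additive] T.N.additive_map_sg])
    show "?f (act N x c) = act T (?f x) c" if "x \<in> carrier N" "c \<in> carrier B" for x c
      using that h0c by (simp add: NT.Hom_act[OF h0(1)] E_act E_closed T.act_sg_left)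
    show "?f x \<in> mgr T (i + (q + 1))" if "x \<in> mgr N i" for x i
      using T.N.gr.homog_sg[OF E_mgr[OF NT.Hom_mgr[OF h0(1) that], of k], of "k * e"] by (simp add: algebra_simps)
  qed
  have filt_sg: "sg T (k * e) y \<in> filt k" if "y \<in> filt k" for y
    using that by (auto simp: filt_def Th_sg)
  have hF: "?f x \<in> filt k" if "x \<in> carrier N" for x
    using that h0c by (intro filt_sg) (auto simp: filt_def E_closed Th_E_less)
  have minus_filt: "y \<ominus>\<^bsub>T\<^esub> z \<in> filt j" if "y \<in> filt j" "z \<in> filt j" for y z j
    using that additive_map_minus[OF T.abN T'.abN Th_additive] by (auto simp: filt_def a_minus_def)
  have res: "f x \<ominus>\<^bsub>T\<^esub> Hom_diff N T (q + 1) ?h x \<in> filt (Suc k)" if x: "x \<in> carrier N" for x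
  proof -
    have dx: "mdiff N x \<in> carrier N" using x by (rule N.N.mdiff_closed)
    have c: "E k (h0 x) \<in> carrier T" "E k (h0 (mdiff N x)) \<in> carrier T" "h0 x \<in> carrier T" "h0 (mdiff N x) \<in> carrier T"
      "h' x \<in> carrier T'" "h' (mdiff N x) \<in> carrier T'" "mdiff T (h0 x) \<in> carrier T"
      using x dx h0c h'(1) by (auto simp: E_closed NT'.Hom_closed T.N.mdiff_closed)
    have sgn: "filt k \<noteq> {} \<Longrightarrow> sg T (q + 1) y \<in> filt k" if "y \<in> filt k" for y
      using that by (auto simp: filt_def Th_sg)
    have D: "Hom_diff N T (q + 1) ?h x = mdiff T (?f x) \<ominus>\<^bsub>T\<^esub> sg T (q + 1) (?f (mdiff N x))"
      using x dx by (simp add: NT.Hom_diff_eq)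
    have DF: "Hom_diff N T (q + 1) ?h x \<in> filt k"
      unfolding D using filt_diff(1)[OF hF[OF x]] hF[OF dx] sgn by (intro minus_filt) auto
    have m1: "mdiff T (?f x) = E k (mdiff T (h0 x))"
      using c by (simp add: T.mdiff_sg E_diff E_closed)
    have "\<Theta> k (Hom_diff N T (q + 1) ?h x) = \<Theta> k (mdiff T (?f x)) \<ominus>\<^bsub>T'\<^esub> \<Theta> k (sg T (q + 1) (?f (mdiff N x)))"
      unfolding D using c by (intro additive_map_minus[OF T.abN T'.abN Th_additive]) (auto simp: m1 E_closed)
    also have "\<Theta> k (mdiff T (?f x)) = mdiff T' (h' x)"
      using c True x by (simp add: m1 Th_E_same Th0_diff h0)
    also have "\<Theta> k (sg T (q + 1) (?f (mdiff N x))) = sg T' (q + 1) (sg T' (k * e) (h' (mdiff N x)))"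
      using c True dx by (simp add: Th_sg Th_E_same h0)
    \<comment> \<open>The degrees \<open>q + 1 + k * e\<close> and \<open>q + 1 - k * e\<close> have
      the same parity.\<close>
    also have "\<dots> = sg T' (?q + 1) (h' (mdiff N x))"
      using c by (auto simp: sg_def)
    also have "mdiff T' (h' x) \<ominus>\<^bsub>T'\<^esub> sg T' (?q + 1) (h' (mdiff N x)) = \<Theta> k (f x)"
      using fun_cong[OF h'(2), of x] x by (simp add: NT'.Hom_diff_eq)
    finally have eq: "\<Theta> k (Hom_diff N T (q + 1) ?h x) = \<Theta> k (f x)" .
    have fx: "f x \<in> carrier T" and Dc: "Hom_diff N T (q + 1) ?h x \<in> carrier T"
      using F[OF x] DF by (auto simp: filt_def)
    have "\<Theta> k (f x \<ominus>\<^bsub>T\<^esub> Hom_diff N T (q + 1) ?h x) = \<zero>\<^bsub>T'\<^esub>"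
      using eq fx Dc additive_map_minus[OF T.abN T'.abN Th_additive fx Dc]
      by (simp add: a_minus_def Th_closed T'.N.r_neg)
    then show ?thesis using minus_filt[OF F[OF x] DF] by (auto simp: filt_def less_Suc_eq)
  qed
  \<comment> \<open>Before \<open>E k\<close> is applied, the lift \<open>h0\<close> takes values in
    a degree lower by \<open>k * e\<close>; below the bound \<open>b\<close> it vanishes, and
    \<open>E k\<close> preserves zero.\<close>
  have van: "?h x = \<zero>\<^bsub>T\<^esub>" if "x \<in> mgr N j" "j + q + 1 - int (k * e) < b" for j x
  proof -
    have "h0 x \<in> mgr T (j + (?q + 1))" by (rule NT.Hom_mgr[OF h0(1) that(1)])
    moreover have "j + (?q + 1) < b" using that(2) by simp
    ultimately have "h0 x = \<zero>\<^bsub>T\<^esub>" using b by blast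
    then show ?thesis using N.N.gr.homog_closed[OF that(1)] by simp
  qed
  show ?thesis
    using hH hF res van by (intro bexI[of _ ?h]) auto
qed

text \<open>Iterates \<open>push_cycle\<close>: the \<open>n\<close>-th remainder lies in
  \<open>filt (k + n)\<close>, and the homotopies are added up. The sum is finite on each element
  because the homotopies vanish there from some step on. The final remainder lies in every step of
  the filtration and is zero by the Taylor formula. That the total homotopy stays in
  \<open>filt k\<close> matters when a lift is corrected without changing it under
  \<open>\<Theta> 0\<close>.\<close>

lemma kill_cycle:
  assumes acyc: "acyclic_below B N T'" and f: "f \<in> Hom_cycles B N T q"
    and F: "\<And>x. x \<in> carrier N \<Longrightarrow> f x \<in> filt k" and q: "q < int (k * e)"
  shows "\<exists>h\<in>Hom_deg B N T (q + 1). Hom_diff N T (q + 1) h = f \<and> (\<forall>x\<in>carrier N. h x \<in> filt k)"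
proof -
  obtain b where b: "\<And>i. i < b \<Longrightarrow> mgr T i = {\<zero>\<^bsub>T\<^esub>}" using bounded by (auto simp: bounded_below_def)
  let ?d = "\<lambda>h. Hom_diff N T (q + 1) h"
  let ?P = "\<lambda>n f. f \<in> Hom_cycles B N T q \<and> (\<forall>x\<in>carrier N. f x \<in> filt (k + n))"
  let ?R = "\<lambda>n f h. h \<in> Hom_deg B N T (q + 1) \<and>
     (\<forall>x\<in>carrier N. f x \<ominus>\<^bsub>T\<^esub> ?d h x \<in> filt (Suc (k + n))) \<and>
     (\<forall>x\<in>carrier N. h x \<in> filt (k + n)) \<and>
     (\<forall>j. \<forall>x\<in>mgr N j. j + q + 1 - int ((k + n) * e) < b \<longrightarrow> h x = \<zero>\<^bsub>T\<^esub>)"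
  have ex: "\<exists>h. ?R n f h" if "?P n f" for n f
  proof -
    have "q < int ((k + n) * e)" using q by (rule order.strict_trans2) (simp add: algebra_simps)
    then show ?thesis using push_cycle[OF acyc, of f q "k + n" b] that b by blast
  qed
  define hh where "hh n f = (SOME h. ?R n f h)" for n f
  have hh: "?R n f (hh n f)" if "?P n f" for n f
    unfolding hh_def by (rule someI_ex[OF ex[OF that]])
  \<comment> \<open>The remainders, each obtained by subtracting the boundary of the homotopy chosen
    for the previous one.\<close>
  define fs where "fs = rec_nat f (\<lambda>n g. \<lambda>x\<in>carrier N. g x \<ominus>\<^bsub>T\<^esub> ?d (hh n g) x)"
  have fs0: "fs 0 = f" and fsS: "fs (Suc n) = (\<lambda>x\<in>carrier N. fs n x \<ominus>\<^bsub>T\<^esub> ?d (hh n (fs n)) x)" for n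
    by (simp_all add: fs_def)
  have P: "?P n (fs n)" for n
  proof (induction n)
    case 0
    then show ?case using f F by (simp add: fs0)
  next
    case (Suc n)
    have R: "?R n (fs n) (hh n (fs n))" by (rule hh[OF Suc])
    have "fs (Suc n) \<in> Hom_cycles B N T q"
      unfolding fsS using Suc R by (intro NT.cycle_minus NT.boundary_cycle) auto
    moreover have "\<forall>x\<in>carrier N. fs (Suc n) x \<in> filt (k + Suc n)" unfolding fsS using R by simp
    ultimately show ?case by blast
  qed
  define hs where "hs n = hh n (fs n)" for n
  have R: "?R n (fs n) (hs n)" for n unfolding hs_def by (rule hh[OF P])
  have hsH: "hs n \<in> Hom_deg B N T (q + 1)" for n using R by blast
  have hsc: "hs n x \<in> carrier T" if "x \<in> carrier N" for n x by (rule NT.Hom_closed[OF hsH that])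
  have fsc: "fs n x \<in> carrier T" if "x \<in> carrier N" for n x
    using P[of n] that by (auto simp: filt_def)
  have dc: "?d (hs n) x \<in> carrier T" if "x \<in> carrier N" for n x
    by (rule NT.Hom_closed[OF NT.Hom_diff_mem[OF hsH] that])
  have fin: "\<exists>n0. \<forall>n\<ge>n0. hs n x = \<zero>\<^bsub>T\<^esub>" if "x \<in> carrier N" for x
    using that
  proof (induction rule: N.N.gr.graded_induct)
    case (homog j x)
    \<comment> \<open>Since \<open>e\<close> is positive, \<open>(k + n) * e\<close> is at least
      \<open>n\<close>; so \<open>n\<close> greater than \<open>j + q + 1 - b\<close> suffices for
      the vanishing clause of \<open>push_cycle\<close>.\<close>
    have "hs n x = \<zero>\<^bsub>T\<^esub>" if "n \<ge> nat (j + q + 2 - b)" for n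
    proof -
      have "j + q + 1 - b < int n" using that by linarith
      also have "n \<le> (k + n) * e" using e_pos by (cases e) auto
      then have "int n \<le> int ((k + n) * e)" by (simp only: of_nat_le_iff)
      finally have "j + q + 1 - int ((k + n) * e) < b" by simp
      then show ?thesis using R[of n] homog by blast
    qed
    then show ?case by blast
  next
    case (add x y)
    then obtain m1 m2 where "\<forall>n\<ge>m1. hs n x = \<zero>\<^bsub>T\<^esub>" "\<forall>n\<ge>m2. hs n y = \<zero>\<^bsub>T\<^esub>" by blast
    then have "\<forall>n\<ge>max m1 m2. hs n (x \<oplus>\<^bsub>N\<^esub> y) = \<zero>\<^bsub>T\<^esub>"
      using add by (simp add: NT.Hom_add[OF hsH])
    then show ?case by blast
  qed
  \<comment> \<open>The index set depends on \<open>x\<close> and is finite only for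
    \<open>x\<close> in the carrier. For comparisons it is replaced by a common initial
    segment.\<close>
  define ht where "ht x = (\<Oplus>\<^bsub>T\<^esub>n\<in>{n. hs n x \<noteq> \<zero>\<^bsub>T\<^esub>}. hs n x)" for x
  have ht: "ht x = (\<Oplus>\<^bsub>T\<^esub>n\<in>{..<M}. hs n x)" if "x \<in> carrier N" "\<forall>n\<ge>M. hs n x = \<zero>\<^bsub>T\<^esub>" for x M
    unfolding ht_def using that hsc
    by (intro T.N.finsum_mono_neutral) (auto simp: not_le[symmetric])
  have common: "\<exists>M. (\<forall>n\<ge>M. hs n x = \<zero>\<^bsub>T\<^esub>) \<and> (\<forall>n\<ge>M. hs n y = \<zero>\<^bsub>T\<^esub>)"
    if "x \<in> carrier N" "y \<in> carrier N" for x y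
  proof -
    from fin[OF that(1)] obtain m1 where "\<forall>n\<ge>m1. hs n x = \<zero>\<^bsub>T\<^esub>" by blast
    moreover from fin[OF that(2)] obtain m2 where "\<forall>n\<ge>m2. hs n y = \<zero>\<^bsub>T\<^esub>" by blast
    ultimately show ?thesis by (intro exI[of _ "max m1 m2"]) auto
  qed
  have htH: "(\<lambda>x\<in>carrier N. ht x) \<in> Hom_deg B N T (q + 1)"
  proof (rule NT.HomI)
    show "additive_map N T ht"
    proof (rule additive_mapI)
      fix x y assume x: "x \<in> carrier N" and y: "y \<in> carrier N"
      obtain M where M: "\<forall>n\<ge>M. hs n x = \<zero>\<^bsub>T\<^esub>" "\<forall>n\<ge>M. hs n y = \<zero>\<^bsub>T\<^esub>"
        using common[OF x y] by blast
      then have "\<forall>n\<ge>M. hs n (x \<oplus>\<^bsub>N\<^esub> y) = \<zero>\<^bsub>T\<^esub>" using x y by (simp add: NT.Hom_add[OF hsH])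
      then show "ht (x \<oplus>\<^bsub>N\<^esub> y) = ht x \<oplus>\<^bsub>T\<^esub> ht y"
        using x y M hsc by (simp add: ht[of _ M] NT.Hom_add[OF hsH] T.N.finsum_addf)
    next
      fix x assume "x \<in> carrier N"
      then show "ht x \<in> carrier T" unfolding ht_def by (intro T.N.finsum_closed) (auto intro: hsc)
    qed
    fix x c assume x: "x \<in> carrier N" and c: "c \<in> carrier B"
    obtain M where M: "\<forall>n\<ge>M. hs n x = \<zero>\<^bsub>T\<^esub>" using fin[OF x] by blast
    then have "\<forall>n\<ge>M. hs n (act N x c) = \<zero>\<^bsub>T\<^esub>" using x c by (simp add: NT.Hom_act[OF hsH])
    then show "ht (act N x c) = act T (ht x) c"
      using x c M hsc
      by (simp add: ht[of _ M] N.N.act_closed NT.Hom_act[OF hsH]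
          additive_map_finsum[OF T.abN T.abN T.additive_map_act_left[OF c]])
  next
    fix x i assume "x \<in> mgr N i"
    then show "ht x \<in> mgr T (i + (q + 1))"
      unfolding ht_def
      by (intro additive_subgroup_finsum[OF T.abN T.N.gr.homog_subgroup]) (auto intro: NT.Hom_mgr[OF hsH])
  qed
  have htF: "ht x \<in> filt k" if "x \<in> carrier N" for x
  proof -
    have c: "(\<lambda>n. hs n x) \<in> {n. hs n x \<noteq> \<zero>\<^bsub>T\<^esub>} \<rightarrow> carrier T" using hsc[OF that] by auto
    have "\<Theta> i (ht x) = (\<Oplus>\<^bsub>T'\<^esub>n\<in>{n. hs n x \<noteq> \<zero>\<^bsub>T\<^esub>}. \<Theta> i (hs n x))" for i
      unfolding ht_def by (rule additive_map_finsum[OF T.abN T'.abN Th_additive c])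
    moreover have "\<Theta> i (hs n x) = \<zero>\<^bsub>T'\<^esub>" if "i < k" for i n
      using R[of n] \<open>x \<in> carrier N\<close> that by (auto simp: filt_def)
    ultimately have "\<Theta> i (ht x) = \<zero>\<^bsub>T'\<^esub>" if "i < k" for i
      using that by (simp add: T'.N.add.finprod_one_eqI)
    moreover have "ht x \<in> carrier T" unfolding ht_def using c by (rule T.N.finsum_closed)
    ultimately show ?thesis by (simp add: filt_def)
  qed
  have part: "f x = fs n x \<oplus>\<^bsub>T\<^esub> (\<Oplus>\<^bsub>T\<^esub>m\<in>{..<n}. ?d (hs m) x)" if x: "x \<in> carrier N" for x n
  proof (induction n)
    case 0
    then show ?case using fsc[OF x, of 0] by (simp add: fs0)
  next
    case (Suc n)
    have "fs n x = fs (Suc n) x \<oplus>\<^bsub>T\<^esub> ?d (hs n) x"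
      using x fsc[OF x, of n] dc[OF x, of n]
      by (simp add: fsS hs_def[symmetric] a_minus_def T.N.a_assoc T.N.l_neg)
    moreover have "(\<Oplus>\<^bsub>T\<^esub>m\<in>{..<Suc n}. ?d (hs m) x) = ?d (hs n) x \<oplus>\<^bsub>T\<^esub> (\<Oplus>\<^bsub>T\<^esub>m\<in>{..<n}. ?d (hs m) x)"
      using dc[OF x] by (simp add: lessThan_Suc T.N.finsum_insert)
    ultimately show ?case
      using Suc.IH fsc[OF x] dc[OF x] by (simp add: T.N.a_assoc)
  qed
  have "?d (\<lambda>x\<in>carrier N. ht x) x = f x" if x: "x \<in> carrier N" for x
  proof -
    have dx: "mdiff N x \<in> carrier N" using x by (rule N.N.mdiff_closed)
    obtain M where M: "\<forall>n\<ge>M. hs n x = \<zero>\<^bsub>T\<^esub>" "\<forall>n\<ge>M. hs n (mdiff N x) = \<zero>\<^bsub>T\<^esub>"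
      using common[OF x dx] by blast
    have eq: "?d (\<lambda>x\<in>carrier N. ht x) x = (\<Oplus>\<^bsub>T\<^esub>m\<in>{..<n}. ?d (hs m) x)" if "n \<ge> M" for n
    proof -
      have Mn: "\<forall>m\<ge>n. hs m x = \<zero>\<^bsub>T\<^esub>" "\<forall>m\<ge>n. hs m (mdiff N x) = \<zero>\<^bsub>T\<^esub>" using M that by auto
      have "mdiff T (ht x) = (\<Oplus>\<^bsub>T\<^esub>m\<in>{..<n}. mdiff T (hs m x))"
        unfolding ht[OF x Mn(1)] using hsc[OF x]
        by (intro additive_map_finsum[OF T.abN T.abN T.additive_map_mdiff]) auto
      moreover have "\<ominus>\<^bsub>T\<^esub> sg T (q + 1) (ht (mdiff N x)) = (\<Oplus>\<^bsub>T\<^esub>m\<in>{..<n}. \<ominus>\<^bsub>T\<^esub> sg T (q + 1) (hs m (mdiff N x)))"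
      proof -
        have "sg T (q + 1) (ht (mdiff N x)) = (\<Oplus>\<^bsub>T\<^esub>m\<in>{..<n}. sg T (q + 1) (hs m (mdiff N x)))"
          unfolding ht[OF dx Mn(2)] using hsc[OF dx]
          by (intro additive_map_finsum[OF T.abN T.abN T.N.additive_map_sg]) auto
        then show ?thesis using hsc[OF dx] by (simp add: T.N.finsum_neg)
      qed
      ultimately show ?thesis
        using x dx hsc[OF x] hsc[OF dx]
        by (simp add: NT.Hom_diff_eq a_minus_def T.N.finsum_addf T.N.mdiff_closed)
    qed
    \<comment> \<open>The total remainder coincides with the \<open>n\<close>-th one for all large
      \<open>n\<close>, and therefore lies in arbitrarily deep steps of the filtration.\<close>
    have r: "f x \<ominus>\<^bsub>T\<^esub> ?d (\<lambda>x\<in>carrier N. ht x) x = fs n x" if "n \<ge> M" for n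
    proof -
      have "(\<Oplus>\<^bsub>T\<^esub>m\<in>{..<n}. ?d (hs m) x) \<in> carrier T" using dc[OF x] by (intro T.N.finsum_closed) auto
      then show ?thesis
        using part[OF x, of n] fsc[OF x, of n] unfolding eq[OF that]
        by (simp add: a_minus_def T.N.a_assoc T.N.r_neg)
    qed
    let ?r = "f x \<ominus>\<^bsub>T\<^esub> ?d (\<lambda>x\<in>carrier N. ht x) x"
    have rc: "?r \<in> carrier T" using r[of M] fsc[OF x] by simp
    have "\<Theta> i ?r = \<zero>\<^bsub>T'\<^esub>" for i
    proof -
      have "?r = fs (max M (Suc i)) x" by (rule r) simp
      moreover have "fs (max M (Suc i)) x \<in> filt (k + max M (Suc i))" using P x by blast
      ultimately show ?thesis by (auto simp: filt_def)
    qed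
    \<comment> \<open>An element killed by every \<open>\<Theta> i\<close> has a Taylor expansion
      with zero terms only.\<close>
    then have "?r = \<zero>\<^bsub>T\<^esub>"
      using taylor[OF rc] by (auto simp: s_zero)
    moreover have "f x \<in> carrier T" "?d (\<lambda>x\<in>carrier N. ht x) x \<in> carrier T"
      using fsc[OF x, of 0] NT.Hom_closed[OF NT.Hom_diff_mem[OF htH] x] by (auto simp: fs0)
    ultimately show ?thesis using T.N.minus_zero_eq by metis
  qed
  moreover have "f \<in> Hom_deg B N T q" using f by (simp add: NT.cycle_iff)
  ultimately have "?d (\<lambda>x\<in>carrier N. ht x) = f"
    by (intro NT.Hom_eqI[OF NT.Hom_diff_mem[OF htH]]) auto
  then show ?thesis using htH htF by (intro bexI[OF _ htH]) simp
qed

text \<open>The case \<open>k = 0\<close> of \<open>kill_cycle\<close>, where \<open>filt 0\<close>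
  is the whole module and the degree condition reads \<open>q < 0\<close>.\<close>

theorem acyclic_lift: "acyclic_below B N T' \<Longrightarrow> acyclic_below B N T"
  unfolding acyclic_below_def[of B N T]
proof (intro allI impI subsetI)
  fix q :: int and f
  assume a: "acyclic_below B N T'" "q < 0" "f \<in> Hom_cycles B N T q"
  have "f x \<in> filt 0" if "x \<in> carrier N" for x
    using a(3) that NT.Hom_closed[of f q x] by (simp add: filt_def NT.cycle_iff)
  then show "f \<in> Hom_boundaries B N T q"
    using kill_cycle[OF a(1,3), of 0] a(2) by (auto simp: Hom_boundaries_def image_iff)
qed

text \<open>A graded lift \<open>g\<close> of \<open>f\<close> need not be a cycle, but its boundary
  is a cycle of degree -1 with values in \<open>filt 1\<close>. By \<open>kill_cycle\<close> it also
  bounds some \<open>h\<close> with values in \<open>filt 1\<close>, and \<open>g - h\<close> is a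
  cycle with the same image under \<open>\<Theta> 0\<close>.\<close>

theorem cycle_lift:
  assumes "acyclic_below B N T'" "f \<in> Hom_cycles B N T' 0"
  shows "\<exists>g\<in>Hom_cycles B N T 0. \<forall>x\<in>carrier N. \<Theta> 0 (g x) = f x"
proof -
  have fH: "f \<in> Hom_deg B N T' 0" using assms(2) by (simp add: NT'.cycle_iff)
  \<comment> \<open>Degree 0 is written as \<open>- 1 + 1\<close> to match the statements about
    boundaries in degree -1.\<close>
  obtain g where g: "g \<in> Hom_deg B N T (- 1 + 1)" "\<And>x. x \<in> carrier N \<Longrightarrow> \<Theta> 0 (g x) = f x"
    using Hom_lift[OF fH] by auto
  let ?d = "Hom_diff N T (- 1 + 1) g"
  have dcyc: "?d \<in> Hom_cycles B N T (- 1)" by (rule NT.boundary_cycle[OF g(1)])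
  \<comment> \<open>\<open>\<Theta> 0\<close> commutes with the differentials and \<open>f\<close>
    is a cycle, so \<open>\<Theta> 0\<close> of the boundary is zero.\<close>
  have "?d x \<in> filt 1" if x: "x \<in> carrier N" for x
  proof -
    have c: "g x \<in> carrier T" "g (mdiff N x) \<in> carrier T" "f (mdiff N x) \<in> carrier T'"
      using x g(1) fH by (auto simp: NT.Hom_closed NT'.Hom_closed N.N.mdiff_closed)
    have "\<Theta> 0 (?d x) = \<Theta> 0 (mdiff T (g x)) \<ominus>\<^bsub>T'\<^esub> \<Theta> 0 (g (mdiff N x))"
      using x c additive_map_minus[OF T.abN T'.abN Th_additive]
      by (simp add: NT.Hom_diff_eq sg_def T.N.mdiff_closed)
    also have "\<dots> = f (mdiff N x) \<ominus>\<^bsub>T'\<^esub> f (mdiff N x)"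
      using x c g(2) assms(2) by (simp add: Th0_diff N.N.mdiff_closed NT'.cycle_iff sg_def)
    also have "\<dots> = \<zero>\<^bsub>T'\<^esub>" using c by (simp add: a_minus_def T'.N.r_neg)
    finally show ?thesis using NT.Hom_closed[of ?d "-1" x] dcyc x by (simp add: filt_def NT.cycle_iff)
  qed
  then obtain h where h: "h \<in> Hom_deg B N T (- 1 + 1)" "Hom_diff N T (- 1 + 1) h = ?d"
      "\<And>x. x \<in> carrier N \<Longrightarrow> h x \<in> filt 1"
    using kill_cycle[OF assms(1) dcyc, of 1] by auto
  let ?g = "\<lambda>x\<in>carrier N. g x \<ominus>\<^bsub>T\<^esub> h x"
  have "?g \<in> Hom_deg B N T 0" using NT.Hom_minus[OF g(1) h(1)] by simp
  moreover have "mdiff T (g x \<ominus>\<^bsub>T\<^esub> h x) = g (mdiff N x) \<ominus>\<^bsub>T\<^esub> h (mdiff N x)" if x: "x \<in> carrier N" for x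
  proof -
    have c: "g x \<in> carrier T" "g (mdiff N x) \<in> carrier T" "h x \<in> carrier T" "h (mdiff N x) \<in> carrier T"
      "mdiff T (g x) \<in> carrier T" "mdiff T (h x) \<in> carrier T"
      using x g(1) h(1) by (auto simp: NT.Hom_closed N.N.mdiff_closed T.N.mdiff_closed)
    have "mdiff T (h x) \<ominus>\<^bsub>T\<^esub> h (mdiff N x) = mdiff T (g x) \<ominus>\<^bsub>T\<^esub> g (mdiff N x)"
      using fun_cong[OF h(2), of x] x by (simp add: NT.Hom_diff_eq sg_def)
    then have "mdiff T (g x) \<ominus>\<^bsub>T\<^esub> mdiff T (h x) = g (mdiff N x) \<ominus>\<^bsub>T\<^esub> h (mdiff N x)"
      by (rule T.N.minus_eq_minus_swap[OF c(6) c(4) c(5) c(2)])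
    then show ?thesis
      using c additive_map_minus[OF T.abN T.abN T.additive_map_mdiff] by simp
  qed
  ultimately have "?g \<in> Hom_cycles B N T 0"
    by (simp add: NT.cycle_iff sg_def N.N.mdiff_closed)
  moreover have "\<Theta> 0 (g x \<ominus>\<^bsub>T\<^esub> h x) = f x" if x: "x \<in> carrier N" for x
  proof -
    have c: "g x \<in> carrier T" "h x \<in> carrier T" "\<Theta> 0 (h x) = \<zero>\<^bsub>T'\<^esub>" "f x \<in> carrier T'"
      using x g(1) h fH by (auto simp: NT.Hom_closed NT'.Hom_closed filt_def)
    then show ?thesis
      using additive_map_minus[OF T.abN T'.abN Th_additive c(1,2)] g(2)[OF x] by (simp add: a_minus_def)
  qed
  ultimately show ?thesis by (intro bexI[of _ ?g]) auto
qed

end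


section \<open>Adjoining one variable\<close>

text \<open>\<open>C\<close> is free over \<open>A\<close> on \<open>p\<close> and \<open>B\<close> is free over \<open>C\<close> on \<open>v\<close>, as left modules. The element
  \<open>q k m\<close> of \<open>C\<close> plays the role of the \<open>k\<close>-th (Hasse) derivative of \<open>p m\<close>.\<close>

locale ext_step = two_base_changes R A C B N
  for R :: "('r, 'x) ring_scheme" and A C B :: "('r, 'b) dg_alg" and N :: "('b, 'n) dg_mod" +
  fixes e :: nat and p :: "nat \<Rightarrow> 'b" and P :: "nat set" and v :: "nat \<Rightarrow> 'b" and J :: "nat set"
    and vdeg :: "nat \<Rightarrow> nat" and q :: "nat \<Rightarrow> nat \<Rightarrow> 'b"
  assumes sub_AC: "dg_subalgebra R A C"
    and e_pos: "0 < e"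
    and basis_C: "free_basis A C (\<lambda>x a. a \<otimes>\<^bsub>C\<^esub> x) p P"
    and basis_B: "free_basis C B (\<lambda>x c. c \<otimes>\<^bsub>B\<^esub> x) v J"
    and p_agr: "m \<in> P \<Longrightarrow> p m \<in> agr C (m * e)"
    and v_agr: "j \<in> J \<Longrightarrow> v j \<in> agr B (vdeg j)"
    and q_agr: "m \<in> P \<Longrightarrow> k \<le> m \<Longrightarrow> q k m \<in> agr C ((m - k) * e)"
    and q_big: "m \<in> P \<Longrightarrow> m < k \<Longrightarrow> q k m = \<zero>\<^bsub>C\<^esub>"
    and q_0: "m \<in> P \<Longrightarrow> q 0 m = p m"
    and zero_P: "0 \<in> P" and p_0: "p 0 = \<one>\<^bsub>C\<^esub>"
begin

sublocale AC: dg_sub R A C by (rule dg_subI[OF sub_AC])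
sublocale bC: free_basis A C "\<lambda>x a. a \<otimes>\<^bsub>C\<^esub> x" p P by (rule basis_C)
sublocale bB: free_basis C B "\<lambda>x c. c \<otimes>\<^bsub>B\<^esub> x" v J by (rule basis_B)

lemma p_C: "m \<in> P \<Longrightarrow> p m \<in> carrier C" using p_agr S'.A.agr_closed by blast
lemma p_B: "m \<in> P \<Longrightarrow> p m \<in> carrier B" using p_C S'.carrier_sub by blast
lemma v_B: "j \<in> J \<Longrightarrow> v j \<in> carrier B" using v_agr S.B.agr_closed by blast
lemma q_C: "m \<in> P \<Longrightarrow> q k m \<in> carrier C"
  using q_agr[of m k] q_big[of m k] S'.A.agr_closed by (cases "k \<le> m") auto
lemma q_B: "m \<in> P \<Longrightarrow> q k m \<in> carrier B" using q_C S'.carrier_sub by blast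

lemma agr_C_B: "c \<in> agr C n \<Longrightarrow> c \<in> agr B n" by (simp add: S'.agr_sub)

text \<open>In the products \<open>p m\<close> stands next to the left coefficients, so that it can
  be moved across a tensor sign over \<open>C\<close>.\<close>

sublocale bAB: free_basis A B "\<lambda>x a. a \<otimes>\<^bsub>B\<^esub> x" "\<lambda>(j, m). p m \<otimes>\<^bsub>B\<^esub> v j" "J \<times> P"
proof (rule free_basis_trans[OF basis_B basis_C])
  fix j m assume j: "j \<in> J" "m \<in> P"
  show "additive_map A B (\<lambda>a. a \<otimes>\<^bsub>B\<^esub> (p m \<otimes>\<^bsub>B\<^esub> v j))"
    using j by (auto simp: additive_map_def S.carrier_sub p_B v_B S.add_sub S.B.l_distr)
  show "(a \<otimes>\<^bsub>C\<^esub> p m) \<otimes>\<^bsub>B\<^esub> v j = a \<otimes>\<^bsub>B\<^esub> (p m \<otimes>\<^bsub>B\<^esub> v j)" if "a \<in> carrier A" for a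
    using j that AC.carrier_sub by (simp add: S'.mult_sub p_C p_B v_B S.carrier_sub S.B.m_assoc)
qed

definition ten :: "'n \<Rightarrow> 'b \<Rightarrow> (('n \<times> 'b) \<Rightarrow>\<^sub>0 int) set" where "ten x b = tcl A N B (frag_of (x, b))"
definition ten' :: "'n \<Rightarrow> 'b \<Rightarrow> (('n \<times> 'b) \<Rightarrow>\<^sub>0 int) set" where "ten' x b = tcl C N B (frag_of (x, b))"

lemma ten_closed: "x \<in> carrier N \<Longrightarrow> b \<in> carrier B \<Longrightarrow> ten x b \<in> carrier S.T"
  by (simp add: ten_def S.cl_closed)

lemma ten'_closed: "x \<in> carrier N \<Longrightarrow> b \<in> carrier B \<Longrightarrow> ten' x b \<in> carrier S'.T"
  by (simp add: ten'_def S'.cl_closed)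

lemma ten_add_right: "x \<in> carrier N \<Longrightarrow> b \<in> carrier B \<Longrightarrow> c \<in> carrier B \<Longrightarrow> ten x (b \<oplus>\<^bsub>B\<^esub> c) = ten x b \<oplus>\<^bsub>S.T\<^esub> ten x c"
  by (simp add: ten_def S.T_add S.cl_eq_iff S.cg_add_right)

lemma ten_add_left: "x \<in> carrier N \<Longrightarrow> y \<in> carrier N \<Longrightarrow> b \<in> carrier B \<Longrightarrow> ten (x \<oplus>\<^bsub>N\<^esub> y) b = ten x b \<oplus>\<^bsub>S.T\<^esub> ten y b"
  by (simp add: ten_def S.T_add S.cl_eq_iff S.cg_add_left)

lemma ten_balanced: "x \<in> carrier N \<Longrightarrow> a \<in> carrier A \<Longrightarrow> b \<in> carrier B \<Longrightarrow> ten (act N x a) b = ten x (a \<otimes>\<^bsub>B\<^esub> b)"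
  by (simp add: ten_def S.cl_eq_iff S.cg_balanced)

lemma ten'_add_right: "x \<in> carrier N \<Longrightarrow> b \<in> carrier B \<Longrightarrow> c \<in> carrier B \<Longrightarrow> ten' x (b \<oplus>\<^bsub>B\<^esub> c) = ten' x b \<oplus>\<^bsub>S'.T\<^esub> ten' x c"
  by (simp add: ten'_def S'.T_add S'.cl_eq_iff S'.cg_add_right)

lemma ten'_add_left: "x \<in> carrier N \<Longrightarrow> y \<in> carrier N \<Longrightarrow> b \<in> carrier B \<Longrightarrow> ten' (x \<oplus>\<^bsub>N\<^esub> y) b = ten' x b \<oplus>\<^bsub>S'.T\<^esub> ten' y b"
  by (simp add: ten'_def S'.T_add S'.cl_eq_iff S'.cg_add_left)

lemma ten'_balanced: "x \<in> carrier N \<Longrightarrow> a \<in> carrier C \<Longrightarrow> b \<in> carrier B \<Longrightarrow> ten' (act N x a) b = ten' x (a \<otimes>\<^bsub>B\<^esub> b)"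
  by (simp add: ten'_def S'.cl_eq_iff S'.cg_balanced)

lemma ten_mgr: "x \<in> mgr N i \<Longrightarrow> b \<in> agr B n \<Longrightarrow> ten x b \<in> mgr S.T (i + int n)"
  by (simp add: ten_def S.frag_of_mgr)

lemma ten'_mgr: "x \<in> mgr N i \<Longrightarrow> b \<in> agr B n \<Longrightarrow> ten' x b \<in> mgr S'.T (i + int n)"
  by (simp add: ten'_def S'.frag_of_mgr)

end

text \<open>Sums suffice because the negative of a pure tensor is again a pure tensor.\<close>

lemma (in base_change) T_induct_add [consumes 1, case_names tensor add]:
  assumes "y \<in> carrier T"
    and "\<And>x b. x \<in> carrier N \<Longrightarrow> b \<in> carrier B \<Longrightarrow> Q (cl (frag_of (x, b)))"
    and "\<And>y z. y \<in> carrier T \<Longrightarrow> z \<in> carrier T \<Longrightarrow> Q y \<Longrightarrow> Q z \<Longrightarrow> Q (y \<oplus>\<^bsub>T\<^esub> z)"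
  shows "Q y"
proof -
  have "Q y \<and> Q (\<ominus>\<^bsub>T\<^esub> y)"
    using assms(1)
  proof (induction rule: T_induct)
    case (tensor x b)
    have "\<ominus>\<^bsub>T\<^esub> cl (frag_of (x, b)) = cl (frag_of (\<ominus>\<^bsub>N\<^esub> x, b))"
      using tensor cg_sym[OF cg_neg_left[of x b]] by (simp add: T_uminus cl_eq_iff)
    then show ?case using assms(2) tensor by simp
  next
    case (minus y z)
    then show ?case using assms(3) by (simp add: a_minus_def T.minus_add)
  qed
  then show ?thesis ..
qed

section \<open>Induction over generators of the two tensor products\<close>

context ext_step begin

text \<open>The right factor is expanded in the basis over \<open>A\<close>, and the coefficients
  from \<open>A\<close> are moved to the left factor. Thus only basis products remain on the right,
  and \<open>x\<close> may be taken homogeneous.\<close>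

lemma gen_induct [consumes 1, case_names zero gen add]:
  assumes "y \<in> carrier S.T" "Q \<zero>\<^bsub>S.T\<^esub>"
    and gen: "\<And>i x m j. x \<in> mgr N i \<Longrightarrow> m \<in> P \<Longrightarrow> j \<in> J \<Longrightarrow> Q (ten x (p m \<otimes>\<^bsub>B\<^esub> v j))"
    and add: "\<And>y z. y \<in> carrier S.T \<Longrightarrow> z \<in> carrier S.T \<Longrightarrow> Q y \<Longrightarrow> Q z \<Longrightarrow> Q (y \<oplus>\<^bsub>S.T\<^esub> z)"
  shows "Q y"
  using assms(1)
proof (induction rule: S.T_induct_add)
  case (tensor x b)
  have "Q (ten x b)" using tensor(2)
  proof (induction rule: bAB.free_induct)
    case zero
    have "ten x \<zero>\<^bsub>B\<^esub> = \<zero>\<^bsub>S.T\<^esub>"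
      using tensor by (simp add: ten_def S.T_zero S.cl_eq_iff S.cg_zero_right)
    then show ?case using assms(2) by simp
  next
    case (gen jm a)
    obtain j m where jm: "jm = (j, m)" "j \<in> J" "m \<in> P" using gen by auto
    have "Q (ten z (p m \<otimes>\<^bsub>B\<^esub> v j))" if "z \<in> carrier N" for z
      using that
    proof (induction rule: S.N.gr.graded_induct)
      case (homog i z)
      then show ?case using assms(3) jm by blast
    next
      case (add y z)
      then show ?case
        using jm by (simp add: ten_add_left p_B v_B assms(4) ten_closed)
    qed
    from this[of "act N x a"] show ?case
      using tensor gen jm by (simp add: ten_balanced p_B v_B S.N.act_closed S.carrier_sub)
  next
    case (add b c)
    then show ?case using tensor by (simp add: ten_add_right assms(4) ten_closed)
  qed
  then show ?case by (simp add: ten_def)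
qed (rule add)

lemma gen'_induct [consumes 1, case_names zero gen add]:
  assumes "y \<in> carrier S'.T" "Q \<zero>\<^bsub>S'.T\<^esub>"
    and gen: "\<And>i x j. x \<in> mgr N i \<Longrightarrow> j \<in> J \<Longrightarrow> Q (ten' x (v j))"
    and add: "\<And>y z. y \<in> carrier S'.T \<Longrightarrow> z \<in> carrier S'.T \<Longrightarrow> Q y \<Longrightarrow> Q z \<Longrightarrow> Q (y \<oplus>\<^bsub>S'.T\<^esub> z)"
  shows "Q y"
  using assms(1)
proof (induction rule: S'.T_induct_add)
  case (tensor x b)
  have "Q (ten' x b)" using tensor(2)
  proof (induction rule: bB.free_induct)
    case zero
    have "ten' x \<zero>\<^bsub>B\<^esub> = \<zero>\<^bsub>S'.T\<^esub>"
      using tensor by (simp add: ten'_def S'.T_zero S'.cl_eq_iff S'.cg_zero_right)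
    then show ?case using assms(2) by simp
  next
    case (gen j c)
    have "Q (ten' z (v j))" if "z \<in> carrier N" for z
      using that
    proof (induction rule: S.N.gr.graded_induct)
      case (homog i z)
      then show ?case using assms(3) gen by blast
    next
      case (add y z)
      then show ?case
        using gen by (simp add: ten'_add_left v_B assms(4) ten'_closed)
    qed
    from this[of "act N x c"] show ?case
      using tensor gen by (simp add: ten'_balanced v_B S.N.act_closed S'.carrier_sub)
  next
    case (add b c)
    then show ?case using tensor by (simp add: ten'_add_right assms(4) ten'_closed)
  qed
  then show ?case by (simp add: ten'_def)
qed (rule add)

section \<open>Hasse derivatives, the maps they induce, and the section\<close>

abbreviation "tw k \<equiv> twn B (agr B) (k * e)"
abbreviation "twN k \<equiv> twn N (mgr N) (k * e)"

text \<open>The variables adjoined after \<open>X\<close> enter only through \<open>v j\<close> and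
  are treated as constants of the derivation. The coefficient is twisted as it is passed by an
  operator of degree \<open>- k * e\<close>.\<close>

definition "dgen k jm a = (case jm of (j, m) \<Rightarrow> tw k a \<otimes>\<^bsub>B\<^esub> (q k m \<otimes>\<^bsub>B\<^esub> v j))"
definition "der k = bAB.linext B (dgen k)"

lemma dgen_additive: "jm \<in> J \<times> P \<Longrightarrow> additive_map A B (dgen k jm)"
  by (cases jm) (auto simp: dgen_def additive_map_def S.add_sub S.carrier_sub S.B.gr.twn_add S.B.l_distr q_B v_B)

lemma der_additive: "additive_map B B (der k)"
  unfolding der_def by (rule bAB.additive_map_linext[OF S.abB dgen_additive])

lemma der_closed [simp]: "b \<in> carrier B \<Longrightarrow> der k b \<in> carrier B"
  by (rule additive_map_closed[OF der_additive])

lemma der_gen: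
  "a \<in> carrier A \<Longrightarrow> j \<in> J \<Longrightarrow> m \<in> P \<Longrightarrow> der k (a \<otimes>\<^bsub>B\<^esub> (p m \<otimes>\<^bsub>B\<^esub> v j)) = tw k a \<otimes>\<^bsub>B\<^esub> (q k m \<otimes>\<^bsub>B\<^esub> v j)"
  using bAB.linext_sc[where i = "(j, m)" and f = "dgen k", OF S.abB dgen_additive] by (simp add: der_def dgen_def)

lemma tw_one [simp]: "tw k \<one>\<^bsub>B\<^esub> = \<one>\<^bsub>B\<^esub>"
  by (simp add: twn_def)

lemma der_pv: "j \<in> J \<Longrightarrow> m \<in> P \<Longrightarrow> der k (p m \<otimes>\<^bsub>B\<^esub> v j) = q k m \<otimes>\<^bsub>B\<^esub> v j"
  using der_gen[OF S.A.one_closed, of j m k] by (simp add: p_B v_B q_B S.one_sub)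

text \<open>Semilinearity from the left over \<open>A\<close> is exactly what makes the induced map
  on tensors balanced.\<close>

lemma der_mult:
  assumes a: "a \<in> carrier A" and b: "b \<in> carrier B" shows "der k (a \<otimes>\<^bsub>B\<^esub> b) = tw k a \<otimes>\<^bsub>B\<^esub> der k b"
proof (rule bAB.additive_map_eq_on_gens[OF S.abB _ _ _ b])
  have aB: "a \<in> carrier B" using a S.carrier_sub by blast
  show "additive_map B B (\<lambda>b. der k (a \<otimes>\<^bsub>B\<^esub> b))"
    by (rule additive_map_comp[OF S.B.additive_map_lmult[OF aB] der_additive])
  show "additive_map B B (\<lambda>b. tw k a \<otimes>\<^bsub>B\<^esub> der k b)"
    using aB by (intro additive_map_comp[OF der_additive S.B.additive_map_lmult]) simp
  fix jm c assume "jm \<in> J \<times> P" and c: "c \<in> carrier A"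
  then obtain j m where jm: "jm = (j, m)" "j \<in> J" "m \<in> P" by auto
  have "der k ((a \<otimes>\<^bsub>B\<^esub> c) \<otimes>\<^bsub>B\<^esub> (p m \<otimes>\<^bsub>B\<^esub> v j)) = tw k (a \<otimes>\<^bsub>B\<^esub> c) \<otimes>\<^bsub>B\<^esub> (q k m \<otimes>\<^bsub>B\<^esub> v j)"
    using a c jm by (intro der_gen) (auto simp: S.mult_closed_sub)
  then show "der k (a \<otimes>\<^bsub>B\<^esub> (c \<otimes>\<^bsub>B\<^esub> (case jm of (j, m) \<Rightarrow> p m \<otimes>\<^bsub>B\<^esub> v j))) =
     tw k a \<otimes>\<^bsub>B\<^esub> der k (c \<otimes>\<^bsub>B\<^esub> (case jm of (j, m) \<Rightarrow> p m \<otimes>\<^bsub>B\<^esub> v j))"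
    using aB c jm by (simp add: der_gen S.B.m_assoc p_B v_B q_B S.carrier_sub S.B.twn_mult)
qed

lemma der_0: "b \<in> carrier B \<Longrightarrow> der 0 b = b"
proof (rule bAB.additive_map_eq_on_gens[OF S.abB der_additive])
  show "additive_map B B (\<lambda>b. b)" by (simp add: additive_map_def)
  show "der 0 (c \<otimes>\<^bsub>B\<^esub> (case jm of (j, m) \<Rightarrow> p m \<otimes>\<^bsub>B\<^esub> v j)) = c \<otimes>\<^bsub>B\<^esub> (case jm of (j, m) \<Rightarrow> p m \<otimes>\<^bsub>B\<^esub> v j)"
    if "jm \<in> J \<times> P" "c \<in> carrier A" for jm c
    using that by (auto simp: der_gen q_0 twn_def)
qed

text \<open>The derivative acts on the right factor and twists \<open>x\<close> in passing
  it.\<close>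

definition "fTh k = frag_extend (\<lambda>(x, b). frag_of (twN k x, der k b))"
definition "Th k = tmap C N B (fTh k)"

lemma fTh_of [simp]: "fTh k (frag_of (x, b)) = frag_of (twN k x, der k b)"
  by (simp add: fTh_def)

lemma twN_act: "x \<in> carrier N \<Longrightarrow> b \<in> carrier B \<Longrightarrow> twN k (act N x b) = act N (twN k x) (tw k b)"
  by (simp add: twn_def S.twist_act)

lemma resp_fTh: "resp (fTh k)"
proof (rule respI)
  show "frag_additive (fTh k)" by (simp add: fTh_def)
  fix x b assume x: "x \<in> carrier N" and b: "b \<in> carrier B"
  then show "fTh k (frag_of (x, b)) \<in> frags N B" by simp
  show "S'.cg (fTh k (frag_of (x \<oplus>\<^bsub>N\<^esub> y, b))) (fTh k (frag_of (x, b)) + fTh k (frag_of (y, b)))"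
    if "y \<in> carrier N" for y
    using x b that by (simp add: S.N.gr.twn_add S'.cg_add_left)
  show "S'.cg (fTh k (frag_of (x, b \<oplus>\<^bsub>B\<^esub> c))) (fTh k (frag_of (x, b)) + fTh k (frag_of (x, c)))"
    if "c \<in> carrier B" for c
    using x b that by (simp add: additive_map_add[OF der_additive] S'.cg_add_right)
  show "S'.cg (fTh k (frag_of (act N x a, b))) (fTh k (frag_of (x, a \<otimes>\<^bsub>B\<^esub> b)))" if a: "a \<in> carrier A" for a
  proof -
    have "tw k a \<in> carrier C" using S.twn_closed_sub[OF a] AC.carrier_sub by blast
    then show ?thesis using x a b by (simp add: twN_act S.carrier_sub der_mult S'.cg_balanced)
  qed
qed

lemma Th_additive: "additive_map S.T S'.T (Th k)"
  unfolding Th_def by (rule additive_map_tmap[OF resp_fTh])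

lemma Th_ten: "x \<in> carrier N \<Longrightarrow> b \<in> carrier B \<Longrightarrow> Th k (ten x b) = ten' (twN k x) (der k b)"
  by (simp add: Th_def ten_def ten'_def tmap_cl[OF resp_fTh])

lemma Th_gen:
  assumes "x \<in> carrier N" "m \<in> P" "j \<in> J"
  shows "Th k (ten x (p m \<otimes>\<^bsub>B\<^esub> v j)) = ten' (act N (twN k x) (q k m)) (v j)"
  using assms by (simp add: Th_ten der_pv p_B v_B ten'_balanced q_C)

lemma T_zero_mem: "\<zero>\<^bsub>S.T\<^esub> \<in> mgr S.T k"
  by (rule additive_subgroup.zero_closed[OF S.homog_subgroup_T])

lemma Th_gen_big:
  assumes "x \<in> carrier N" "m \<in> P" "j \<in> J" "m < k"
  shows "Th k (ten x (p m \<otimes>\<^bsub>B\<^esub> v j)) = \<zero>\<^bsub>S'.T\<^esub>"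
proof -
  have "ten' \<zero>\<^bsub>N\<^esub> (v j) = \<zero>\<^bsub>S'.T\<^esub>"
    using assms by (simp add: ten'_def S'.T_zero S'.cl_eq_iff S'.cg_zero_left v_B)
  then show ?thesis using assms by (simp add: Th_gen q_big S'.zero_sub)
qed

text \<open>\<open>sec\<close> is an additive section of \<open>\<Theta>\<^sub>0\<close> that need not commute with the differentials.\<close>

definition "sgen x = bB.linext S.T (\<lambda>j c. ten (act N x c) (v j))"
text \<open>\<open>tmap\<close> starts from maps of free abelian groups, so a representative of
  \<open>sgen x b\<close> is chosen for each pure tensor. On cosets the choice disappears.\<close>

definition "fs = frag_extend (\<lambda>(x, b). SOME u. u \<in> frags N B \<and> tcl A N B u = sgen x b)"
definition "sec = tmap A N B fs"

lemma sgen_aux: "x \<in> carrier N \<Longrightarrow> j \<in> J \<Longrightarrow> additive_map C S.T (\<lambda>c. ten (act N x c) (v j))"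
  by (auto simp: additive_map_def ten_closed S.N.act_closed S'.carrier_sub v_B S'.add_sub S.N.act_add_right ten_add_left)

lemma sgen_additive: "x \<in> carrier N \<Longrightarrow> additive_map B S.T (sgen x)"
  unfolding sgen_def by (rule bB.additive_map_linext[OF S.abelian_group_T sgen_aux])

lemma sgen_gen: "x \<in> carrier N \<Longrightarrow> j \<in> J \<Longrightarrow> c \<in> carrier C \<Longrightarrow> sgen x (c \<otimes>\<^bsub>B\<^esub> v j) = ten (act N x c) (v j)"
  unfolding sgen_def using bB.linext_sc[OF S.abelian_group_T sgen_aux] by simp

lemma fs_of:
  assumes "x \<in> carrier N" "b \<in> carrier B"
  shows "fs (frag_of (x, b)) \<in> frags N B" "tcl A N B (fs (frag_of (x, b))) = sgen x b"
proof -
  have "sgen x b \<in> carrier S.T" by (rule additive_map_closed[OF sgen_additive assms(2)]) fact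
  then have "\<exists>u. u \<in> frags N B \<and> tcl A N B u = sgen x b" by (elim S.T_cases) auto
  from someI_ex[OF this] show "fs (frag_of (x, b)) \<in> frags N B" "tcl A N B (fs (frag_of (x, b))) = sgen x b"
    by (simp_all add: fs_def)
qed

lemma two_rev: "two_base_changes R C A B N"
  by (intro two_base_changes.intro S.base_change_axioms S'.base_change_axioms)

text \<open>Representatives are arbitrary, so each relation is checked after passing to classes,
  where it becomes an equation between values of \<open>sgen\<close>. Additivity in \<open>x\<close>
  and balancing over \<open>C\<close> are compared on the basis \<open>v\<close> of \<open>B\<close>
  over \<open>C\<close>.\<close>

lemma resp_fs: "two_base_changes.resp C A B N fs"
proof (rule two_base_changes.respI[OF two_rev])
  show "frag_additive fs" by (simp add: fs_def)
  fix x b assume x: "x \<in> carrier N" and b: "b \<in> carrier B"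
  show "fs (frag_of (x, b)) \<in> frags N B" by (rule fs_of[OF x b])
  show "S.cg (fs (frag_of (x \<oplus>\<^bsub>N\<^esub> y, b))) (fs (frag_of (x, b)) + fs (frag_of (y, b)))" if y: "y \<in> carrier N" for y
  proof -
    have "sgen (x \<oplus>\<^bsub>N\<^esub> y) b = sgen x b \<oplus>\<^bsub>S.T\<^esub> sgen y b"
    proof (rule bB.additive_map_eq_on_gens[OF S.abelian_group_T _ _ _ b])
      show "additive_map B S.T (sgen (x \<oplus>\<^bsub>N\<^esub> y))" using x y by (intro sgen_additive) simp
      show "additive_map B S.T (\<lambda>b. sgen x b \<oplus>\<^bsub>S.T\<^esub> sgen y b)"
        using additive_map_closed[OF sgen_additive[OF x]] additive_map_closed[OF sgen_additive[OF y]]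
          additive_map_add[OF sgen_additive[OF x]] additive_map_add[OF sgen_additive[OF y]]
        by (intro additive_mapI) (auto simp: S.T.a_ac)
      show "sgen (x \<oplus>\<^bsub>N\<^esub> y) (c \<otimes>\<^bsub>B\<^esub> v j) = sgen x (c \<otimes>\<^bsub>B\<^esub> v j) \<oplus>\<^bsub>S.T\<^esub> sgen y (c \<otimes>\<^bsub>B\<^esub> v j)"
        if "j \<in> J" "c \<in> carrier C" for j c
        using that x y by (simp add: sgen_gen S.N.act_add_left S'.carrier_sub S.N.act_closed ten_add_left v_B)
    qed
    then show ?thesis using x y b fs_of by (simp add: S.cl_eq_iff[symmetric] S.T_add[symmetric])
  qed
  show "S.cg (fs (frag_of (x, b \<oplus>\<^bsub>B\<^esub> c))) (fs (frag_of (x, b)) + fs (frag_of (x, c)))" if c: "c \<in> carrier B" for c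
    using x b c fs_of additive_map_add[OF sgen_additive[OF x] b c]
    by (simp add: S.cl_eq_iff[symmetric] S.T_add[symmetric])
  show "S.cg (fs (frag_of (act N x c, b))) (fs (frag_of (x, c \<otimes>\<^bsub>B\<^esub> b)))" if c: "c \<in> carrier C" for c
  proof -
    have cB: "c \<in> carrier B" using c S'.carrier_sub by blast
    have xc: "act N x c \<in> carrier N" using x cB by (rule S.N.act_closed)
    have "sgen (act N x c) b = sgen x (c \<otimes>\<^bsub>B\<^esub> b)"
    proof (rule bB.additive_map_eq_on_gens[OF S.abelian_group_T sgen_additive[OF xc] _ _ b])
      show "additive_map B S.T (\<lambda>b. sgen x (c \<otimes>\<^bsub>B\<^esub> b))"
        by (rule additive_map_comp[OF S.B.additive_map_lmult[OF cB] sgen_additive[OF x]])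
      show "sgen (act N x c) (d \<otimes>\<^bsub>B\<^esub> v j) = sgen x (c \<otimes>\<^bsub>B\<^esub> (d \<otimes>\<^bsub>B\<^esub> v j))"
        if j: "j \<in> J" and d: "d \<in> carrier C" for j d
      proof -
        have dB: "d \<in> carrier B" using d S'.carrier_sub by blast
        have "sgen x ((c \<otimes>\<^bsub>B\<^esub> d) \<otimes>\<^bsub>B\<^esub> v j) = ten (act N x (c \<otimes>\<^bsub>B\<^esub> d)) (v j)"
          using x j c d by (intro sgen_gen) (auto simp: S'.mult_closed_sub)
        then show ?thesis
          using x xc j d cB dB v_B[OF j] by (simp add: sgen_gen S.N.act_mult S.B.m_assoc)
      qed
    qed
    then show ?thesis using x xc b cB fs_of by (simp add: S.cl_eq_iff[symmetric])
  qed
qed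

lemma sec_additive: "additive_map S'.T S.T sec"
  unfolding sec_def by (rule two_base_changes.additive_map_tmap[OF two_rev resp_fs])

lemma sec_gen:
  assumes "x \<in> carrier N" "j \<in> J" shows "sec (ten' x (v j)) = ten x (v j)"
proof -
  have "sec (ten' x (v j)) = sgen x (v j)"
    using assms fs_of[OF assms(1) v_B[OF assms(2)]]
    by (simp add: sec_def ten'_def two_base_changes.tmap_cl[OF two_rev resp_fs] v_B)
  also have "\<dots> = ten x (v j)"
    using sgen_gen[OF assms S'.A.one_closed] assms by (simp add: S'.one_sub v_B S.N.act_one)
  finally show ?thesis .
qed

lemma sec_closed: "z \<in> carrier S'.T \<Longrightarrow> sec z \<in> carrier S.T"
  by (rule additive_map_closed[OF sec_additive])

lemma sec_zero: "sec \<zero>\<^bsub>S'.T\<^esub> = \<zero>\<^bsub>S.T\<^esub>"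
  by (rule additive_map_zero[OF S'.abelian_group_T S.abelian_group_T sec_additive])

lemma Th0_sec: "z \<in> carrier S'.T \<Longrightarrow> Th 0 (sec z) = z"
proof (induction rule: gen'_induct)
  case zero
  then show ?case
    using additive_map_zero[OF S.abelian_group_T S'.abelian_group_T Th_additive] by (simp add: sec_zero)
next
  case (gen i x j)
  have x: "x \<in> carrier N" using gen S.N.gr.homog_closed by blast
  have "Th 0 (ten x (v j)) = ten' (twN 0 x) (der 0 (v j))"
    using x gen(2) by (intro Th_ten v_B)
  then show ?case using x gen by (simp add: sec_gen der_0 v_B twn_def)
next
  case (add y z)
  then show ?case
    by (simp add: additive_map_add[OF sec_additive] additive_map_add[OF Th_additive] sec_closed)
qed

section \<open>Degrees and comparison with the canonical map\<close>

sublocale TM: dg_module_over R B S.T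
  by (intro dg_module_over.intro S.B.dg_algebra_axioms S.dg_module_T)
sublocale TM': dg_module_over R B S'.T
  by (intro dg_module_over.intro S.B.dg_algebra_axioms S'.dg_module_T)

lemma sec_mgr: assumes z: "z \<in> mgr S'.T k" shows "sec z \<in> mgr S.T k"
proof -
  have zc: "z \<in> carrier S'.T" by (rule TM'.N.gr.homog_closed[OF z])
  have "hcomp S.T (mgr S.T) k (sec y) = sec (hcomp S'.T (mgr S'.T) k y)" if "y \<in> carrier S'.T" for y
    using that
  proof (induction rule: gen'_induct)
    case zero
    then show ?case using TM.N.gr.hcomp_homog[OF TM.N.gr.homog_zero, of k] TM'.N.gr.hcomp_homog[OF TM'.N.gr.homog_zero, of k]
      by (simp add: sec_zero)
  next
    case (gen i x j)
    have x: "x \<in> carrier N" using gen S.N.gr.homog_closed by blast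
    show ?case
      using TM.N.gr.hcomp_homog[OF ten_mgr[OF gen(1) v_agr[OF gen(2)]], of k]
        TM'.N.gr.hcomp_homog[OF ten'_mgr[OF gen(1) v_agr[OF gen(2)]], of k]
      by (simp add: sec_gen x gen sec_zero)
  next
    case (add y z)
    then show ?case
      by (simp add: additive_map_add[OF sec_additive] sec_closed TM.N.gr.hcomp_add TM'.N.gr.hcomp_add)
  qed
  from this[OF zc] have "hcomp S.T (mgr S.T) k (sec z) = sec z"
    using TM'.N.gr.hcomp_homog[OF z, of k] by simp
  then show ?thesis by (rule TM.N.gr.hcomp_eq_selfD[OF sec_closed[OF zc]])
qed

text \<open>The map is compared with the projections on generators, where both degrees are known
  explicitly.\<close>

lemma homog_map:
  assumes \<phi>: "additive_map S.T G \<phi>" and G: "graded_group G D"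
    and gen: "\<And>i x m j. x \<in> mgr N i \<Longrightarrow> m \<in> P \<Longrightarrow> j \<in> J \<Longrightarrow> \<phi> (ten x (p m \<otimes>\<^bsub>B\<^esub> v j)) \<in> D (i + int (m * e + vdeg j) + d)"
    and y: "y \<in> mgr S.T k"
  shows "\<phi> y \<in> D (k + d)"
proof -
  interpret G: graded_group G D by fact
  have yc: "y \<in> carrier S.T" by (rule TM.N.gr.homog_closed[OF y])
  have z: "\<phi> \<zero>\<^bsub>S.T\<^esub> = \<zero>\<^bsub>G\<^esub>" by (rule additive_map_zero[OF S.abelian_group_T G.abelian_group_axioms \<phi>])
  have "hcomp G D (k + d) (\<phi> y) = \<phi> (hcomp S.T (mgr S.T) k y)" if "y \<in> carrier S.T" for y
    using that
  proof (induction rule: gen_induct)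
    case zero
    then show ?case using TM.N.gr.hcomp_homog[OF TM.N.gr.homog_zero, of k] G.hcomp_homog[OF G.homog_zero, of "k + d"]
      by (simp add: z)
  next
    case (gen i x m j)
    have pv: "p m \<otimes>\<^bsub>B\<^esub> v j \<in> agr B (m * e + vdeg j)"
      using gen by (intro S.B.mult_agr agr_C_B p_agr v_agr)
    show ?case
      using TM.N.gr.hcomp_homog[OF ten_mgr[OF gen(1) pv], of k]
        G.hcomp_homog[OF assms(3)[OF gen], of "k + d"]
      by (auto simp: z)
  next
    case (add y z)
    then show ?case
      by (simp add: additive_map_add[OF \<phi>] additive_map_closed[OF \<phi>] TM.N.gr.hcomp_add G.hcomp_add)
  qed
  from this[OF yc] have "hcomp G D (k + d) (\<phi> y) = \<phi> y"
    using TM.N.gr.hcomp_homog[OF y, of k] by simp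
  then show ?thesis by (rule G.hcomp_eq_selfD[OF additive_map_closed[OF \<phi> yc]])
qed

lemma Th_mgr: assumes "y \<in> mgr S.T k" shows "Th l y \<in> mgr S'.T (k - int (l * e))"
proof -
  have "Th l y \<in> mgr S'.T (k + - int (l * e))"
  proof (rule homog_map[OF Th_additive _ _ assms])
    show "graded_group S'.T (mgr S'.T)" by (rule TM'.N.gr.graded_group_axioms)
    fix i x m j assume g: "x \<in> mgr N i" "m \<in> P" "j \<in> J"
    have x: "x \<in> carrier N" using g S.N.gr.homog_closed by blast
    show "Th l (ten x (p m \<otimes>\<^bsub>B\<^esub> v j)) \<in> mgr S'.T (i + int (m * e + vdeg j) + - int (l * e))"
    proof (cases "m < l")
      case True
      then show ?thesis using g x by (simp add: Th_gen_big T_zero_mem)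
    next
      case False
      have "q l m \<otimes>\<^bsub>B\<^esub> v j \<in> agr B ((m - l) * e + vdeg j)"
        using g False by (intro S.B.mult_agr agr_C_B q_agr v_agr) auto
      then have "ten' (twN l x) (q l m \<otimes>\<^bsub>B\<^esub> v j) \<in> mgr S'.T (i + int ((m - l) * e + vdeg j))"
        by (intro ten'_mgr S.N.gr.twn_mem g)
      moreover have "int ((m - l) * e) = int (m * e) - int (l * e)"
        using False by (simp add: diff_mult_distrib of_nat_diff mult_le_mono1)
      then have "i + int ((m - l) * e + vdeg j) = i + int (m * e + vdeg j) + - int (l * e)" by linarith
      moreover have "Th l (ten x (p m \<otimes>\<^bsub>B\<^esub> v j)) = ten' (twN l x) (q l m \<otimes>\<^bsub>B\<^esub> v j)"
        using g x by (simp add: Th_ten der_pv p_B v_B)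
      ultimately show ?thesis by metis
    qed
  qed
  then show ?thesis by simp
qed

text \<open>The derivative of order 0 is the identity, so on representatives \<open>Th 0\<close>
  changes nothing: it is the canonical map to the tensor product over the larger algebra.\<close>

lemma Th0_hom: "dg_hom B S.T S'.T (Th 0)"
proof -
  have Th0: "Th 0 (tcl A N B u) = tcl C N B u" if "u \<in> frags N B" for u
  proof -
    have "S'.cg (fTh 0 u) u"
      by (rule S'.cg_agree_FF[OF that]) (auto simp: fTh_def der_0 twn_def)
    then show ?thesis using that by (simp add: Th_def tmap_cl[OF resp_fTh] S'.cl_eq_iff)
  qed
  show ?thesis
    unfolding dg_hom_def
  proof (intro conjI ballI allI)
    show "Th 0 \<in> carrier S.T \<rightarrow> carrier S'.T" using Th_additive[of 0] by (simp add: additive_map_def)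
    show "Th 0 (x \<oplus>\<^bsub>S.T\<^esub> y) = Th 0 x \<oplus>\<^bsub>S'.T\<^esub> Th 0 y" if "x \<in> carrier S.T" "y \<in> carrier S.T" for x y
      using that by (rule additive_map_add[OF Th_additive])
    show "Th 0 (act S.T x b) = act S'.T (Th 0 x) b" if "x \<in> carrier S.T" "b \<in> carrier B" for x b
      using that S.rmult_FF
      by (elim S.T_cases) (simp add: S.act_T S'.act_T Th0 S.rmult_def S'.rmult_def)
    show "Th 0 (mdiff S.T x) = mdiff S'.T (Th 0 x)" if "x \<in> carrier S.T" for x
      using that S.fdiff_FF
      by (elim S.T_cases) (simp add: S.mdiff_T S'.mdiff_T Th0 S.fdiff_def S'.fdiff_def)
    show "Th 0 ` mgr S.T k \<subseteq> mgr S'.T k" for k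
      using Th_mgr[of _ k 0] by auto
  qed
qed

text \<open>The evaluation map factors through the tensor product over \<open>C\<close>. Hence a
  lift along \<open>Th 0\<close> of a splitting over \<open>C\<close> is a splitting over
  \<open>A\<close>.\<close>

lemma ev_Th0: "y \<in> carrier S.T \<Longrightarrow> tensor_eval N (Th 0 y) = tensor_eval N y"
proof (induction rule: gen_induct)
  case zero
  show ?case
    using additive_map_zero[OF S.abelian_group_T S'.abelian_group_T Th_additive]
      additive_map_zero[OF S'.abelian_group_T S.abN S'.additive_map_ev]
      additive_map_zero[OF S.abelian_group_T S.abN S.additive_map_ev] by simp
next
  case (gen i x m j)
  have x: "x \<in> carrier N" using gen S.N.gr.homog_closed by blast
  have "Th 0 (ten x (p m \<otimes>\<^bsub>B\<^esub> v j)) = ten' x (p m \<otimes>\<^bsub>B\<^esub> v j)"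
    using gen x by (simp add: Th_ten p_B v_B der_0) (simp add: twn_def)
  then show ?case
    using gen x S.ev_tensor[of x "p m \<otimes>\<^bsub>B\<^esub> v j"] S'.ev_tensor[of x "p m \<otimes>\<^bsub>B\<^esub> v j"]
    by (simp add: ten_def ten'_def p_B v_B)
next
  case (add y z)
  then show ?case
    by (simp add: additive_map_add[OF Th_additive] additive_map_add[OF S.additive_map_ev]
        additive_map_add[OF S'.additive_map_ev] additive_map_closed[OF Th_additive])
qed

end


section \<open>From operators on representatives to the filtered setting\<close>

context ext_step begin

abbreviation "resA \<equiv> two_base_changes.resp A A B N"

text \<open>Reduces the requirements of \<open>filtered_lifting\<close> to pure tensors for
  linearity and differentials, and to the generators \<open>x \<otimes> p m v j\<close> for the
  relations with the derivatives. Both kinds of variables are handled by supplying only the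
  operators \<open>f\<close>.\<close>

lemma ops_filtered_lifting:
  assumes f_resp: "\<And>k. resA (f k)"
    and f_rmult: "\<And>k x b c. \<lbrakk>x \<in> carrier N; b \<in> carrier B; c \<in> carrier B\<rbrakk>
      \<Longrightarrow> S.cg (f k (frag_of (x, b \<otimes>\<^bsub>B\<^esub> c))) (S.rmult c (f k (frag_of (x, b))))"
    and f_diff: "\<And>k x b. \<lbrakk>x \<in> carrier N; b \<in> carrier B\<rbrakk>
      \<Longrightarrow> S.cg (S.fdiff (f k (frag_of (x, b)))) (fsg (k * e) (f k (S.fdiff (frag_of (x, b)))))"
    and f_keys: "\<And>k x b i n. \<lbrakk>x \<in> mgr N i; b \<in> agr B n\<rbrakk>
      \<Longrightarrow> Poly_Mapping.keys (f k (frag_of (x, b))) \<subseteq> S.homog_keys (i + int n + int (k * e))"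
    and same: "\<And>k x m j. \<lbrakk>k \<in> I; x \<in> carrier N; m \<in> P; j \<in> J\<rbrakk>
      \<Longrightarrow> Th k (tmap A N B (f k) (ten x (p m \<otimes>\<^bsub>B\<^esub> v j))) = Th 0 (ten x (p m \<otimes>\<^bsub>B\<^esub> v j))"
    and less: "\<And>k l x m j. \<lbrakk>k < l; x \<in> carrier N; m \<in> P; j \<in> J\<rbrakk>
      \<Longrightarrow> Th k (tmap A N B (f l) (ten x (p m \<otimes>\<^bsub>B\<^esub> v j))) = \<zero>\<^bsub>S'.T\<^esub>"
    and triv: "\<And>k x m j. \<lbrakk>k \<notin> I; x \<in> carrier N; m \<in> P; j \<in> J\<rbrakk>
      \<Longrightarrow> tmap A N B (f k) (ten x (p m \<otimes>\<^bsub>B\<^esub> v j)) = \<zero>\<^bsub>S.T\<^esub>"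
    and zero_I: "0 \<in> I"
    and taylor: "\<And>x m j. \<lbrakk>x \<in> carrier N; m \<in> P; j \<in> J\<rbrakk> \<Longrightarrow> \<exists>M0. \<forall>M\<ge>M0. ten x (p m \<otimes>\<^bsub>B\<^esub> v j)
       = (\<Oplus>\<^bsub>S.T\<^esub>k\<in>{..<M}. tmap A N B (f k) (sec (Th k (ten x (p m \<otimes>\<^bsub>B\<^esub> v j)))))"
    and bb: "bounded_below N" and u: "free_basis B N (act N) u Ju" "\<And>i. i \<in> Ju \<Longrightarrow> u i \<in> mgr N (udeg i)"
  shows "filtered_lifting R B N S.T S'.T e I (\<lambda>k. tmap A N B (f k)) Th sec u Ju udeg"
proof -
  let ?E = "\<lambda>k. tmap A N B (f k)"
  have tm: "?E k (tcl A N B w) = tcl A N B (f k w)" if "w \<in> frags N B" for k w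
    by (rule two_base_changes.tmap_cl[OF S.two_self f_resp that])
  have fa: "frag_additive (f k)" for k
    using f_resp[of k] by (simp add: two_base_changes.resp_def[OF S.two_self])
  have fF: "f k w \<in> frags N B" if "w \<in> frags N B" for k w
    by (rule two_base_changes.resp_FF[OF S.two_self f_resp that])
  have add: "additive_map S.T S.T (?E k)" for k
    by (rule two_base_changes.additive_map_tmap[OF S.two_self f_resp])
  have ThE: "additive_map S.T S'.T (\<lambda>y. Th k (?E l y))" for k l
    by (rule additive_map_comp[OF add Th_additive])
  have z: "?E k \<zero>\<^bsub>S.T\<^esub> = \<zero>\<^bsub>S.T\<^esub>" "Th k \<zero>\<^bsub>S.T\<^esub> = \<zero>\<^bsub>S'.T\<^esub>" for k
    using additive_map_zero[OF S.abelian_group_T S.abelian_group_T add]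
      additive_map_zero[OF S.abelian_group_T S'.abelian_group_T Th_additive] by auto
  have xc: "x \<in> carrier N" if "x \<in> mgr N i" for x i using that S.N.gr.homog_closed by blast
  show ?thesis
  proof (intro filtered_lifting.intro filtered_lifting_axioms.intro S.dg_module_over_axioms
      TM.dg_module_over_axioms TM'.dg_module_over_axioms e_pos add Th_additive Th_mgr Th0_hom
      sec_closed sec_mgr sec_zero Th0_sec zero_I u)
    show "bounded_below S.T" by (rule S.bounded_below_T[OF bb])
    show "?E k (act S.T y b) = act S.T (?E k y) b" if "y \<in> carrier S.T" "b \<in> carrier B" for k y b
    proof -
      obtain w where w: "w \<in> frags N B" "y = tcl A N B w" using \<open>y \<in> carrier S.T\<close> by (rule S.T_cases)
      have "S.cg (f k (S.rmult b w)) (S.rmult b (f k w))"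
        by (rule S.cg_agree_FF[OF w(1)])
           (use that(2) f_rmult fa in \<open>auto simp: S.frag_diffs frag_additive_diff[OF fa]\<close>)
      then show ?thesis
        using w that(2) by (simp add: S.act_T tm fF S.rmult_FF S.cl_eq_iff)
    qed
    show "mdiff S.T (?E k y) = sg S.T (k * e) (?E k (mdiff S.T y))" if "y \<in> carrier S.T" for k y
    proof -
      obtain w where w: "w \<in> frags N B" "y = tcl A N B w" using \<open>y \<in> carrier S.T\<close> by (rule S.T_cases)
      have "S.cg (S.fdiff (f k w)) (fsg (k * e) (f k (S.fdiff w)))"
        by (rule S.cg_agree_FF[OF w(1), where f = "\<lambda>u. S.fdiff (f k u)" and g = "\<lambda>u. fsg (k * e) (f k (S.fdiff u))", OF _ _ f_diff])
           (auto simp: S.frag_diffs frag_additive_diff[OF fa])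
      then show ?thesis
        using w by (simp add: S.mdiff_T tm fF S.fdiff_FF S.T_sg S.cl_eq_iff)
    qed
    show "?E k y \<in> mgr S.T (l + int (k * e))" if "y \<in> mgr S.T l" for k y l
    proof -
      obtain w where w: "Poly_Mapping.keys w \<subseteq> S.homog_keys l" "w \<in> frags N B" "y = tcl A N B w"
        using \<open>y \<in> mgr S.T l\<close> by (rule S.mgr_T_cases)
      have "f k w \<in> {u. Poly_Mapping.keys u \<subseteq> S.homog_keys (l + int (k * e))}"
      proof (rule frag_additive_into[OF w(1) fa])
        fix s assume "s \<in> S.homog_keys l"
        then obtain x b i n where "s = (x, b)" "x \<in> mgr N i" "b \<in> agr B n" "i + int n = l"
          by (auto simp: S.homog_keys_def)
        then show "f k (frag_of s) \<in> {u. Poly_Mapping.keys u \<subseteq> S.homog_keys (l + int (k * e))}"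
          using f_keys[of x i b n k] by simp
      qed (simp_all add: S.keys_diff_sub)
      then show ?thesis using w by (simp add: tm S.cl_mgr)
    qed
    show "Th k (?E k y) = Th 0 y" if "k \<in> I" "y \<in> carrier S.T" for k y
      using that(2)
      by (induction rule: gen_induct)
         (use that(1) same xc in \<open>auto simp: z additive_map_add[OF ThE] additive_map_add[OF Th_additive]\<close>)
    show "Th k (?E m y) = \<zero>\<^bsub>S'.T\<^esub>" if "k < m" "y \<in> carrier S.T" for k m y
      using that(2)
      by (induction rule: gen_induct)
         (use that(1) less xc in \<open>auto simp: z additive_map_add[OF ThE]\<close>)
    show "?E k y = \<zero>\<^bsub>S.T\<^esub>" if "k \<notin> I" "y \<in> carrier S.T" for k y
      using that(2)
      by (induction rule: gen_induct)
         (use that(1) triv xc in \<open>auto simp: z additive_map_add[OF add]\<close>)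
    have ETs: "?E k (sec (Th k y)) \<in> carrier S.T" if "y \<in> carrier S.T" for k y
      using that by (intro additive_map_closed[OF add] sec_closed additive_map_closed[OF Th_additive])
    \<comment> \<open>The expansion is claimed for all large \<open>M\<close>, so that those of two
      summands can be cut off at a common place and added.\<close>
    have "\<exists>M0. \<forall>M\<ge>M0. y = (\<Oplus>\<^bsub>S.T\<^esub>k\<in>{..<M}. ?E k (sec (Th k y)))" if "y \<in> carrier S.T" for y
      using that
    proof (induction rule: gen_induct)
      case zero
      have "(\<Oplus>\<^bsub>S.T\<^esub>k\<in>{..<M}. ?E k (sec (Th k \<zero>\<^bsub>S.T\<^esub>))) = \<zero>\<^bsub>S.T\<^esub>" for M
        by (intro S.T.add.finprod_one_eqI) (simp add: z sec_zero)
      then show ?case by simp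
    next
      case (gen i x m j)
      then show ?case using taylor xc by blast
    next
      case (add y w)
      then obtain m1 m2 where m: "\<forall>M\<ge>m1. y = (\<Oplus>\<^bsub>S.T\<^esub>k\<in>{..<M}. ?E k (sec (Th k y)))"
        "\<forall>M\<ge>m2. w = (\<Oplus>\<^bsub>S.T\<^esub>k\<in>{..<M}. ?E k (sec (Th k w)))" by blast
      have "y \<oplus>\<^bsub>S.T\<^esub> w = (\<Oplus>\<^bsub>S.T\<^esub>k\<in>{..<M}. ?E k (sec (Th k (y \<oplus>\<^bsub>S.T\<^esub> w))))" if "M \<ge> max m1 m2" for M
      proof -
        have "?E k (sec (Th k (y \<oplus>\<^bsub>S.T\<^esub> w))) = ?E k (sec (Th k y)) \<oplus>\<^bsub>S.T\<^esub> ?E k (sec (Th k w))" for k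
          using add(1,2) additive_map_closed[OF Th_additive]
          by (simp add: additive_map_add[OF Th_additive] additive_map_add[OF sec_additive]
              additive_map_add[OF \<open>additive_map S.T S.T (?E k)\<close>] sec_closed)
        then have "(\<Oplus>\<^bsub>S.T\<^esub>k\<in>{..<M}. ?E k (sec (Th k (y \<oplus>\<^bsub>S.T\<^esub> w)))) =
            (\<Oplus>\<^bsub>S.T\<^esub>k\<in>{..<M}. ?E k (sec (Th k y))) \<oplus>\<^bsub>S.T\<^esub> (\<Oplus>\<^bsub>S.T\<^esub>k\<in>{..<M}. ?E k (sec (Th k w)))"
          using add(1,2) ETs by (simp add: S.T.finsum_addf)
        then show ?thesis using m that by simp
      qed
      then show ?case by blast
    qed
    then show "\<exists>M. y = (\<Oplus>\<^bsub>S.T\<^esub>k\<in>{..<M}. ?E k (sec (Th k y)))" if "y \<in> carrier S.T" for y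
      using that by blast
  qed
qed

end

subsection \<open>Odd variables\<close>

locale odd_step = ext_step R A C B N e p P v J vdeg q
  for R :: "('r, 'x) ring_scheme" and A C B :: "('r, 'b) dg_alg" and N :: "('b, 'n) dg_mod"
    and e p P v J vdeg q +
  fixes X
  assumes odd_e: "odd e" and X_agr: "X \<in> agr C e" and t_A: "adiff C X \<in> carrier A"
    and P_eq: "P = {0, 1}" and p_1: "p 1 = X" and q_1_1: "q 1 1 = \<one>\<^bsub>C\<^esub>"
begin

lemma X_C: "X \<in> carrier C" using X_agr S'.A.agr_closed by blast
lemma X_B [simp]: "X \<in> carrier B" using X_C S'.carrier_sub by blast
lemma X_agr_B: "X \<in> agr B e" using X_agr by (rule agr_C_B)

lemma t_sub: "adiff B X \<in> carrier A" using t_A X_C S'.adiff_sub by simp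
lemma t_B [simp]: "adiff B X \<in> carrier B" using t_sub S.carrier_sub by blast

lemma twist_X: "S.tB X = \<ominus>\<^bsub>B\<^esub> X"
  using S.B.gr.twist_homog[OF X_agr_B] odd_e by (simp add: sg_def)

lemma X_comm: "a \<in> carrier B \<Longrightarrow> S.tB a \<otimes>\<^bsub>B\<^esub> X = X \<otimes>\<^bsub>B\<^esub> a"
  using S.B.mult_homog_right[OF _ X_agr_B, of "S.tB a"] odd_e by (simp add: twn_def)

lemma X_sq: "X \<otimes>\<^bsub>B\<^esub> X = \<zero>\<^bsub>B\<^esub>" by (rule S.B.odd_square[OF X_agr_B odd_e])

text \<open>The operator of order 1 is multiplication by 1 \<otimes> X - X \<otimes> 1. It passes
  \<open>x\<close> with odd degree, hence the twist. Its square is zero because \<open>X\<close> has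
  square zero, and higher orders are set to zero.\<close>

definition "fE (k::nat) = (if k = 0 then (\<lambda>u. u) else if k = 1 then
   frag_extend (\<lambda>(x, b). frag_of (S.tN x, X \<otimes>\<^bsub>B\<^esub> b) - frag_of (act N (S.tN x) X, b)) else (\<lambda>u. 0))"

lemma fE_simps [simp]: "fE 0 = (\<lambda>u. u)" "fE (Suc (Suc k)) = (\<lambda>u. 0)"
  "fE (Suc 0) (frag_of (x, b)) = frag_of (S.tN x, X \<otimes>\<^bsub>B\<^esub> b) - frag_of (act N (S.tN x) X, b)"
  by (auto simp: fE_def)

lemma fE_additive: "frag_additive (fE k)"
  by (simp add: fE_def)

text \<open>For balancing, both summands use that \<open>X\<close> passes \<open>a\<close> at the
  cost of a twist, as \<open>X_comm\<close> states: once inside the right factor, once inside the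
  left.\<close>

lemma resp_fE: "resA (fE k)"
proof (rule two_base_changes.respI[OF S.two_self fE_additive])
  consider "k = 0" | "k = Suc 0" | l where "k = Suc (Suc l)" by (metis not0_implies_Suc)
  note cases = this
  fix x b assume x: "x \<in> carrier N" and b: "b \<in> carrier B"
  show "fE k (frag_of (x, b)) \<in> frags N B"
    by (cases rule: cases) (use x b in \<open>auto intro!: frags_diff simp: S.N.act_closed\<close>)
  show "S.cg (fE k (frag_of (x \<oplus>\<^bsub>N\<^esub> y, b))) (fE k (frag_of (x, b)) + fE k (frag_of (y, b)))" if y: "y \<in> carrier N" for y
  proof (cases rule: cases)
    case 2
    have "S.cg (frag_of (S.tN x \<oplus>\<^bsub>N\<^esub> S.tN y, X \<otimes>\<^bsub>B\<^esub> b) - frag_of (act N (S.tN x) X \<oplus>\<^bsub>N\<^esub> act N (S.tN y) X, b))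
     ((frag_of (S.tN x, X \<otimes>\<^bsub>B\<^esub> b) + frag_of (S.tN y, X \<otimes>\<^bsub>B\<^esub> b)) - (frag_of (act N (S.tN x) X, b) + frag_of (act N (S.tN y) X, b)))"
      using x y b by (intro S.cg_diff S.cg_add_left) (auto simp: S.N.act_closed)
    then show ?thesis using 2 x y b by (simp add: S.N.gr.twist_add S.N.act_add_left algebra_simps)
  qed (use x y b in \<open>auto simp: S.cg_add_left\<close>)
  show "S.cg (fE k (frag_of (x, b \<oplus>\<^bsub>B\<^esub> c))) (fE k (frag_of (x, b)) + fE k (frag_of (x, c)))" if c: "c \<in> carrier B" for c
  proof (cases rule: cases)
    case 2
    have "S.cg (frag_of (S.tN x, X \<otimes>\<^bsub>B\<^esub> b \<oplus>\<^bsub>B\<^esub> X \<otimes>\<^bsub>B\<^esub> c) - frag_of (act N (S.tN x) X, b \<oplus>\<^bsub>B\<^esub> c))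
     ((frag_of (S.tN x, X \<otimes>\<^bsub>B\<^esub> b) + frag_of (S.tN x, X \<otimes>\<^bsub>B\<^esub> c)) - (frag_of (act N (S.tN x) X, b) + frag_of (act N (S.tN x) X, c)))"
      using x b c by (intro S.cg_diff S.cg_add_right) (auto simp: S.N.act_closed)
    then show ?thesis using 2 x b c by (simp add: S.B.r_distr algebra_simps)
  qed (use x b c in \<open>auto simp: S.cg_add_right\<close>)
  show "S.cg (fE k (frag_of (act N x a, b))) (fE k (frag_of (x, a \<otimes>\<^bsub>B\<^esub> b)))" if a: "a \<in> carrier A" for a
  proof (cases rule: cases)
    case 2
    have aB: "a \<in> carrier B" and ta: "S.tB a \<in> carrier A" "S.tB a \<in> carrier B"
      using a S.carrier_sub S.twist_closed_sub by auto
    have "S.cg (frag_of (act N (S.tN x) (S.tB a), X \<otimes>\<^bsub>B\<^esub> b)) (frag_of (S.tN x, S.tB a \<otimes>\<^bsub>B\<^esub> (X \<otimes>\<^bsub>B\<^esub> b)))"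
      using x b ta by (intro S.cg_balanced) auto
    also have "S.tB a \<otimes>\<^bsub>B\<^esub> (X \<otimes>\<^bsub>B\<^esub> b) = X \<otimes>\<^bsub>B\<^esub> (a \<otimes>\<^bsub>B\<^esub> b)"
      using aB b ta X_comm[OF aB] by (simp add: S.B.m_assoc[symmetric])
    finally have 1: "S.cg (frag_of (act N (S.tN x) (S.tB a), X \<otimes>\<^bsub>B\<^esub> b)) (frag_of (S.tN x, X \<otimes>\<^bsub>B\<^esub> (a \<otimes>\<^bsub>B\<^esub> b)))" .
    have "act N (act N (S.tN x) (S.tB a)) X = act N (act N (S.tN x) X) a"
      using x aB ta X_comm[OF aB] by (simp add: S.N.act_mult[symmetric])
    then have 2: "S.cg (frag_of (act N (act N (S.tN x) (S.tB a)) X, b)) (frag_of (act N (S.tN x) X, a \<otimes>\<^bsub>B\<^esub> b))"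
      using x a b S.cg_balanced[of "act N (S.tN x) X" a b] by (simp add: S.N.act_closed)
    show ?thesis using \<open>k = Suc 0\<close> x b aB S.cg_diff[OF 1 2] by (simp add: S.twist_act)
  qed (use x a b in \<open>auto simp: S.cg_balanced\<close>)
qed

text \<open>The terms containing the differential \<open>?t\<close> of \<open>X\<close> are
  \<open>x \<otimes> ?t b\<close> and \<open>x ?t \<otimes> b\<close>. They cancel in the difference
  because \<open>?t\<close> lies in \<open>A\<close>; the rest matches up to the sign of odd
  degree.\<close>

lemma fE_diff:
  assumes x: "x \<in> carrier N" and b: "b \<in> carrier B"
  shows "S.cg (S.fdiff (fE k (frag_of (x, b)))) (fsg (k * e) (fE k (S.fdiff (frag_of (x, b)))))"
proof -
  consider "k = 0" | "k = Suc 0" | l where "k = Suc (Suc l)" by (metis not0_implies_Suc)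
  then show ?thesis
  proof cases
    case 2
    let ?t = "adiff B X" and ?y = "S.tN (mdiff N x)"
    have c: "?y \<in> carrier N" "mdiff N x \<in> carrier N" "adiff B b \<in> carrier B" "S.tN x \<in> carrier N"
      using x b by (auto simp: S.N.mdiff_closed S.B.adiff_closed)
    have 1: "S.fdiff (frag_of (S.tN x, X \<otimes>\<^bsub>B\<^esub> b)) = frag_of (\<ominus>\<^bsub>N\<^esub> ?y, X \<otimes>\<^bsub>B\<^esub> b) + frag_of (x, ?t \<otimes>\<^bsub>B\<^esub> b \<oplus>\<^bsub>B\<^esub> \<ominus>\<^bsub>B\<^esub> (X \<otimes>\<^bsub>B\<^esub> adiff B b))"
      using x b c by (simp add: S.mdiff_twist S.B.adiff_mult_general twist_X S.B.l_minus)
    have "S.cg \<dots> (- frag_of (?y, X \<otimes>\<^bsub>B\<^esub> b) + (frag_of (x, ?t \<otimes>\<^bsub>B\<^esub> b) + frag_of (x, \<ominus>\<^bsub>B\<^esub> (X \<otimes>\<^bsub>B\<^esub> adiff B b))))"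
      using x b c by (intro S.cg_add S.cg_neg_left S.cg_add_right) auto
    also have "S.cg \<dots> (- frag_of (?y, X \<otimes>\<^bsub>B\<^esub> b) + (frag_of (x, ?t \<otimes>\<^bsub>B\<^esub> b) + - frag_of (x, X \<otimes>\<^bsub>B\<^esub> adiff B b)))"
      using x b c by (intro S.cg_add S.cg_refl S.cg_neg_right) auto
    finally have A1: "S.cg (S.fdiff (frag_of (S.tN x, X \<otimes>\<^bsub>B\<^esub> b)))
      (- frag_of (?y, X \<otimes>\<^bsub>B\<^esub> b) + (frag_of (x, ?t \<otimes>\<^bsub>B\<^esub> b) + - frag_of (x, X \<otimes>\<^bsub>B\<^esub> adiff B b)))"
      unfolding 1 .
    have ny: "act N (\<ominus>\<^bsub>N\<^esub> ?y) X = \<ominus>\<^bsub>N\<^esub> act N ?y X"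
      by (rule additive_map_neg[OF S.abN S.abN S.additive_map_act_left[OF X_B] c(1)])
    have nx: "act N x (\<ominus>\<^bsub>B\<^esub> X) = \<ominus>\<^bsub>N\<^esub> act N x X"
      by (rule additive_map_neg[OF S.abB S.abN S.additive_map_act_right[OF x] X_B])
    have 2: "S.fdiff (frag_of (act N (S.tN x) X, b)) = frag_of (\<ominus>\<^bsub>N\<^esub> act N ?y X \<oplus>\<^bsub>N\<^esub> act N x ?t, b) + frag_of (\<ominus>\<^bsub>N\<^esub> act N x X, adiff B b)"
      using x c by (simp add: S.mdiff_act_general S.mdiff_twist S.twist_act twist_X ny nx)
    have "S.cg \<dots> ((frag_of (\<ominus>\<^bsub>N\<^esub> act N ?y X, b) + frag_of (act N x ?t, b)) + - frag_of (act N x X, adiff B b))"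
      using x b c by (intro S.cg_add S.cg_neg_left S.cg_add_left) (auto simp: S.N.act_closed)
    also have "S.cg \<dots> ((- frag_of (act N ?y X, b) + frag_of (x, ?t \<otimes>\<^bsub>B\<^esub> b)) + - frag_of (act N x X, adiff B b))"
      using x b c t_sub by (intro S.cg_add S.cg_refl S.cg_neg_left S.cg_balanced) (auto simp: S.N.act_closed)
    finally have A2: "S.cg (S.fdiff (frag_of (act N (S.tN x) X, b)))
      ((- frag_of (act N ?y X, b) + frag_of (x, ?t \<otimes>\<^bsub>B\<^esub> b)) + - frag_of (act N x X, adiff B b))"
      unfolding 2 .
    have "fsg (1 * e) (fE (Suc 0) (S.fdiff (frag_of (x, b)))) =
      (- frag_of (?y, X \<otimes>\<^bsub>B\<^esub> b) + (frag_of (x, ?t \<otimes>\<^bsub>B\<^esub> b) + - frag_of (x, X \<otimes>\<^bsub>B\<^esub> adiff B b))) -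
      ((- frag_of (act N ?y X, b) + frag_of (x, ?t \<otimes>\<^bsub>B\<^esub> b)) + - frag_of (act N x X, adiff B b))"
      using x b c odd_e by (simp add: fsg_def frag_additive_add[OF fE_additive] algebra_simps)
    then show ?thesis
      using \<open>k = Suc 0\<close> S.cg_diff[OF A1 A2] by (simp add: S.fdiff_diff)
  qed (auto simp: frag_additive_zero fsg_def)
qed

lemma fE_keys:
  assumes x: "x \<in> mgr N i" and b: "b \<in> agr B n"
  shows "Poly_Mapping.keys (fE k (frag_of (x, b))) \<subseteq> S.homog_keys (i + int n + int (k * e))"
proof -
  consider "k = 0" | "k = Suc 0" | l where "k = Suc (Suc l)" by (metis not0_implies_Suc)
  then show ?thesis
  proof cases
    case 1
    then show ?thesis using x b by (auto simp: S.homog_keys_def)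
  next
    case 2
    have "(S.tN x, X \<otimes>\<^bsub>B\<^esub> b) \<in> S.homog_keys (i + int n + int e)"
      using S.N.gr.twist_mem[OF x] S.B.mult_agr[OF X_agr_B b]
      by (auto simp: S.homog_keys_def intro!: exI[of _ i] exI[of _ "e + n"])
    moreover have "(act N (S.tN x) X, b) \<in> S.homog_keys (i + int n + int e)"
      using S.N.act_mgr[OF S.N.gr.twist_mem[OF x] X_agr_B] b
      by (auto simp: S.homog_keys_def intro!: exI[of _ "i + int e"] exI[of _ n])
    ultimately show ?thesis using 2 by (simp, intro S.keys_diff_sub) auto
  qed simp
qed

text \<open>On basis products the derivative of order 1 kills \<open>v j\<close> and sends
  \<open>X v j\<close> to \<open>v j\<close>. All the requirements become direct computations with
  these two cases.\<close>

lemma odd_filtered_lifting: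
  assumes "bounded_below N" "free_basis B N (act N) u Ju" "\<And>i. i \<in> Ju \<Longrightarrow> u i \<in> mgr N (udeg i)"
  shows "filtered_lifting R B N S.T S'.T e {0, 1} (\<lambda>k. tmap A N B (fE k)) Th sec u Ju udeg"
proof (rule ops_filtered_lifting[OF resp_fE _ fE_diff fE_keys _ _ _ _ _ assms])
  have tm: "tmap A N B (fE k) (tcl A N B w) = tcl A N B (fE k w)" if "w \<in> frags N B" for k w
    by (rule two_base_changes.tmap_cl[OF S.two_self resp_fE that])
  have E0: "tmap A N B (fE 0) y = y" if "y \<in> carrier S.T" for y
    using that tm[of _ 0] by (elim S.T_cases) simp
  have E2: "tmap A N B (fE (Suc (Suc k))) y = \<zero>\<^bsub>S.T\<^esub>" if "y \<in> carrier S.T" for y k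
    using that tm[of _ "Suc (Suc k)"] by (elim S.T_cases) (simp add: S.T_zero)
  have E1: "tmap A N B (fE (Suc 0)) (ten x b) = ten (S.tN x) (X \<otimes>\<^bsub>B\<^esub> b) \<ominus>\<^bsub>S.T\<^esub> ten (act N (S.tN x) X) b"
    if "x \<in> carrier N" "b \<in> carrier B" for x b
    using that by (simp add: ten_def tm S.T_minus S.N.act_closed)
  have ThE1: "Th k (tmap A N B (fE (Suc 0)) (ten x b)) =
      ten' (twN k (S.tN x)) (der k (X \<otimes>\<^bsub>B\<^esub> b)) \<ominus>\<^bsub>S'.T\<^esub> ten' (twN k (act N (S.tN x) X)) (der k b)"
    if "x \<in> carrier N" "b \<in> carrier B" for x b k
    using that additive_map_minus[OF S.abelian_group_T S'.abelian_group_T Th_additive]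
    by (simp add: E1 Th_ten ten_closed S.N.act_closed)
  have tw1: "twn N (mgr N) e x = S.tN x" "twn N (mgr N) 0 x = x" for x
    using odd_e by (auto simp: twn_def)
  have tz: "ten' \<zero>\<^bsub>N\<^esub> b = \<zero>\<^bsub>S'.T\<^esub>" "ten \<zero>\<^bsub>N\<^esub> b = \<zero>\<^bsub>S.T\<^esub>" if "b \<in> carrier B" for b
    using that by (auto simp: ten'_def ten_def S.T_zero S'.T_zero S'.cl_eq_iff S.cl_eq_iff S'.cg_zero_left S.cg_zero_left)
  have tz': "ten' x \<zero>\<^bsub>B\<^esub> = \<zero>\<^bsub>S'.T\<^esub>" if "x \<in> carrier N" for x
    using that by (auto simp: ten'_def S'.T_zero S'.cl_eq_iff S'.cg_zero_right)
  have one: "\<one>\<^bsub>C\<^esub> = \<one>\<^bsub>B\<^esub>" "\<zero>\<^bsub>C\<^esub> = \<zero>\<^bsub>B\<^esub>" by (rule S'.one_sub S'.zero_sub)+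
  have der1: "der (Suc 0) (v j) = \<zero>\<^bsub>B\<^esub>" "der (Suc 0) (X \<otimes>\<^bsub>B\<^esub> v j) = v j" if "j \<in> J" for j
    using that der_pv[of j 0 1] der_pv[of j 1 1] v_B[OF that] q_big[of 0 1] p_0 p_1 q_1_1
    by (simp_all add: one P_eq)
  have selfminus: "y \<ominus>\<^bsub>S'.T\<^esub> y = \<zero>\<^bsub>S'.T\<^esub>" if "y \<in> carrier S'.T" for y
    using that by (simp add: a_minus_def S'.T.r_neg)
  \<comment> \<open>Over \<open>C\<close> the variable passes through the tensor sign, so 1
    \<otimes> X - X \<otimes> 1 acts as zero after the canonical map.\<close>
  have E10: "Th 0 (tmap A N B (fE (Suc 0)) (ten x b)) = \<zero>\<^bsub>S'.T\<^esub>" if "x \<in> carrier N" "b \<in> carrier B" for x b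
    using that by (simp add: ThE1 tw1 der_0 ten'_balanced X_C selfminus ten'_closed)
  show "S.cg (fE k (frag_of (x, b \<otimes>\<^bsub>B\<^esub> c))) (S.rmult c (fE k (frag_of (x, b))))"
    if "x \<in> carrier N" "b \<in> carrier B" "c \<in> carrier B" for k x b c
  proof -
    consider "k = 0" | "k = Suc 0" | l where "k = Suc (Suc l)" by (metis not0_implies_Suc)
    then show ?thesis
      by cases (use that in \<open>simp_all add: S.rmult_diff S.B.m_assoc frag_additive_zero\<close>)
  qed
  fix x m j assume x: "x \<in> carrier N" and m: "m \<in> P" and j: "j \<in> J"
  let ?p = "p m"
  have p0: "p 0 = \<one>\<^bsub>B\<^esub>" using p_0 by (simp add: one)
  have pm: "p m = (if m = 0 then \<one>\<^bsub>B\<^esub> else X)"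
    using m p_0 p_1 by (auto simp: P_eq one)
  have vj: "v j \<in> carrier B" by (rule v_B[OF j])
  have pc: "?p \<otimes>\<^bsub>B\<^esub> v j \<in> carrier B" using vj by (simp add: pm p0)
  have tc: "ten x (?p \<otimes>\<^bsub>B\<^esub> v j) \<in> carrier S.T" by (rule ten_closed[OF x pc])
  show "Th k (tmap A N B (fE k) (ten x (?p \<otimes>\<^bsub>B\<^esub> v j))) = Th 0 (ten x (?p \<otimes>\<^bsub>B\<^esub> v j))" if "k \<in> {0, 1}" for k
  proof (cases "k = 0")
    case True
    then show ?thesis using E0[OF tc] by simp
  next
    case False
    then have k: "k = Suc 0" using that by simp
    show ?thesis
    proof (cases "m = 0")
      case True
      have "Th (Suc 0) (tmap A N B (fE (Suc 0)) (ten x (v j))) = ten' x (v j) \<ominus>\<^bsub>S'.T\<^esub> \<zero>\<^bsub>S'.T\<^esub>"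
        using x vj j by (simp add: ThE1 tw1 der1 tz' S.N.act_closed)
      also have "\<dots> = Th 0 (ten x (v j))" using x vj by (simp add: a_minus_def Th_ten tw1 der_0 ten'_closed)
      finally show ?thesis using True k vj by (simp add: pm p0)
    next
      case False
      \<comment> \<open>The first summand of the operator vanishes on \<open>X v j\<close>. The
        second carries a minus sign, and twisting \<open>X\<close> supplies another one.\<close>
      have XX: "X \<otimes>\<^bsub>B\<^esub> (X \<otimes>\<^bsub>B\<^esub> v j) = \<zero>\<^bsub>B\<^esub>" using vj X_sq by (simp add: S.B.m_assoc[symmetric])
      have d0: "der k \<zero>\<^bsub>B\<^esub> = \<zero>\<^bsub>B\<^esub>" for k by (rule additive_map_zero[OF S.abB S.abB der_additive])
      have nx: "act N x (\<ominus>\<^bsub>B\<^esub> X) = \<ominus>\<^bsub>N\<^esub> act N x X"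
        by (rule additive_map_neg[OF S.abB S.abN S.additive_map_act_right[OF x] X_B])
      have nt: "ten' (\<ominus>\<^bsub>N\<^esub> y) (v j) = \<ominus>\<^bsub>S'.T\<^esub> ten' y (v j)" if "y \<in> carrier N" for y
        using that vj by (simp add: ten'_def S'.T_uminus S'.cl_eq_iff S'.cg_neg_left)
      have "Th (Suc 0) (tmap A N B (fE (Suc 0)) (ten x (X \<otimes>\<^bsub>B\<^esub> v j))) =
         \<zero>\<^bsub>S'.T\<^esub> \<ominus>\<^bsub>S'.T\<^esub> \<ominus>\<^bsub>S'.T\<^esub> ten' (act N x X) (v j)"
        using x vj j by (simp add: ThE1 tw1 der1 XX d0 tz' S.twist_act twist_X nx nt S.N.act_closed)
      also have "\<dots> = Th 0 (ten x (X \<otimes>\<^bsub>B\<^esub> v j))"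
        using x vj by (simp add: a_minus_def Th_ten tw1 der_0 ten'_closed ten'_balanced X_C)
      finally show ?thesis using False k by (simp add: pm p0)
    qed
  qed
  show "Th k (tmap A N B (fE l) (ten x (?p \<otimes>\<^bsub>B\<^esub> v j))) = \<zero>\<^bsub>S'.T\<^esub>" if "k < l" for k l
  proof -
    have Thz: "Th k \<zero>\<^bsub>S.T\<^esub> = \<zero>\<^bsub>S'.T\<^esub>"
      by (rule additive_map_zero[OF S.abelian_group_T S'.abelian_group_T Th_additive])
    consider "l = Suc 0" | l' where "l = Suc (Suc l')" using \<open>k < l\<close> by (metis not0_implies_Suc not_less_zero)
    then show ?thesis
      by cases (use \<open>k < l\<close> E10[OF x pc] E2[OF tc] Thz in auto)
  qed
  show "tmap A N B (fE k) (ten x (?p \<otimes>\<^bsub>B\<^esub> v j)) = \<zero>\<^bsub>S.T\<^esub>" if "k \<notin> {0, 1}" for k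
  proof -
    have "k = Suc (Suc (k - 2))" using \<open>k \<notin> {0, 1}\<close> by auto
    then obtain l where "k = Suc (Suc l)" by blast
    then show ?thesis using E2[OF tc] by simp
  qed
  show "\<exists>M0. \<forall>M\<ge>M0. ten x (?p \<otimes>\<^bsub>B\<^esub> v j) = (\<Oplus>\<^bsub>S.T\<^esub>k\<in>{..<M}. tmap A N B (fE k) (sec (Th k (ten x (?p \<otimes>\<^bsub>B\<^esub> v j)))))"
  \<comment> \<open>Only the operators of orders 0 and 1 are nonzero, so the expansion is complete
    from length 2 on.\<close>
  proof (intro exI[of _ 2] allI impI)
    fix M :: nat assume M: "2 \<le> M"
    let ?y = "ten x (?p \<otimes>\<^bsub>B\<^esub> v j)"
    let ?g = "\<lambda>k. tmap A N B (fE k) (sec (Th k ?y))"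
    have sc: "sec (Th k ?y) \<in> carrier S.T" for k by (intro sec_closed additive_map_closed[OF Th_additive] tc)
    have gc: "?g k \<in> carrier S.T" for k
      using two_base_changes.additive_map_tmap[OF S.two_self resp_fE] sc by (rule additive_map_closed)
    have "(\<Oplus>\<^bsub>S.T\<^esub>k\<in>{0, Suc 0}. ?g k) = (\<Oplus>\<^bsub>S.T\<^esub>k\<in>{..<M}. ?g k)"
    proof (rule S.T.finsum_mono_neutral)
      fix k assume "k \<in> {..<M} - {0, Suc 0}"
      then have "k = Suc (Suc (k - 2))" by auto
      then obtain l where "k = Suc (Suc l)" by blast
      then show "?g k = \<zero>\<^bsub>S.T\<^esub>" using E2[OF sc] by simp
    qed (use M gc in auto)
    moreover have "(\<Oplus>\<^bsub>S.T\<^esub>k\<in>{0, Suc 0}. ?g k) = ?g 0 \<oplus>\<^bsub>S.T\<^esub> ?g (Suc 0)"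
      using gc[of 0] gc[of "Suc 0"] by (subst S.T.finsum_insert) auto
    moreover have "?g 0 \<oplus>\<^bsub>S.T\<^esub> ?g (Suc 0) = ?y"
    proof (cases "m = 0")
      case True
      have y: "?y = ten x (v j)" using True vj by (simp add: pm p0)
      have "Th 0 ?y = ten' x (v j)" using x vj by (simp add: y Th_ten tw1 der_0)
      then have g0: "?g 0 = ten x (v j)" using E0[of "ten x (v j)"] x j vj by (simp add: sec_gen ten_closed)
      have "Th (Suc 0) ?y = \<zero>\<^bsub>S'.T\<^esub>" using x vj j by (simp add: y Th_ten tw1 der1 tz')
      then have "?g (Suc 0) = \<zero>\<^bsub>S.T\<^esub>"
        using additive_map_zero[OF S.abelian_group_T S.abelian_group_T two_base_changes.additive_map_tmap[OF S.two_self resp_fE]]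
        by (simp add: sec_zero)
      then show ?thesis unfolding g0 using x vj by (simp add: y ten_closed)
    next
      case False
      have y: "?y = ten x (X \<otimes>\<^bsub>B\<^esub> v j)" using False by (simp add: pm p0)
      have "Th 0 ?y = ten' (act N x X) (v j)"
        using x vj by (simp add: y Th_ten tw1 der_0 ten'_balanced X_C)
      then have g0: "?g 0 = ten (act N x X) (v j)" using E0[of "ten (act N x X) (v j)"] x j vj by (simp add: sec_gen ten_closed S.N.act_closed)
      have "Th (Suc 0) ?y = ten' (S.tN x) (v j)" using x vj j by (simp add: y Th_ten tw1 der1)
      then have g1: "?g (Suc 0) = ten x (X \<otimes>\<^bsub>B\<^esub> v j) \<ominus>\<^bsub>S.T\<^esub> ten (act N x X) (v j)"
        using x vj j by (simp add: sec_gen E1)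
      \<comment> \<open>Here the Taylor formula is the identity x \<otimes> Xv = xX \<otimes> v + (x
        \<otimes> Xv - xX \<otimes> v).\<close>
      show ?thesis
        unfolding g0 g1 using x vj
        by (simp add: y a_minus_def S.T.a_ac S.T.r_neg S.T.r_neg1 ten_closed S.N.act_closed)
    qed
    ultimately show "?y = (\<Oplus>\<^bsub>S.T\<^esub>k\<in>{..<M}. ?g k)" by simp
  qed
qed simp_all

end


subsection \<open>Even variables\<close>

lemma additive_map_pow:
  assumes "abelian_group G" "abelian_group H" "additive_map G H f" "x \<in> carrier G"
  shows "f (add_pow G (n::nat) x) = add_pow H n (f x)"
proof -
  interpret G: abelian_group G by fact
  interpret H: abelian_group H by fact
  show ?thesis
    using assms(3,4)
    by (induction n) (auto simp: additive_map_zero[OF assms(1-3)] additive_map_add[OF assms(3)])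
qed

lemma frag_additive_of_cmul:
  assumes "frag_additive f" shows "f (frag_cmul c u) = frag_cmul c (f u)"
proof -
  have n: "f (frag_cmul (int n) u) = frag_cmul (int n) (f u)" for n
    by (induction n)
       (simp_all add: frag_additive_zero[OF assms] frag_additive_add[OF assms] frag_cmul_distrib)
  show ?thesis
  proof (cases c rule: int_cases2)
    case (nonpos m)
    have "f (- frag_cmul (int m) u) = - frag_cmul (int m) (f u)"
      using n[of m] frag_additive_minus[OF assms] by metis
    then show ?thesis using nonpos by simp
  qed (use n in simp)
qed

lemma frag_cmul_sum_coeffs: "(\<Sum>i\<in>K. frag_cmul (c i) u) = frag_cmul (\<Sum>i\<in>K. c i) u"
  by (induction K rule: infinite_finite_induct) (auto simp: frag_cmul_distrib)

context base_change begin

lemma cg_pow_right: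
  assumes "x \<in> carrier N" "b \<in> carrier B"
  shows "cg (frag_of (x, add_pow B (n::nat) b)) (frag_cmul (int n) (frag_of (x, b)))"
proof (induction n)
  case 0
  then show ?case using assms by (simp add: cg_zero_right)
next
  case (Suc n)
  have "cg (frag_of (x, add_pow B n b \<oplus>\<^bsub>B\<^esub> b)) (frag_of (x, add_pow B n b) + frag_of (x, b))"
    using assms by (intro cg_add_right) auto
  also have "cg \<dots> (frag_cmul (int n) (frag_of (x, b)) + frag_of (x, b))"
    by (intro cg_add Suc cg_refl)
  finally show ?case by (simp add: frag_cmul_distrib add.commute)
qed

lemma cg_pow_left:
  assumes "x \<in> carrier N" "b \<in> carrier B"
  shows "cg (frag_of (add_pow N (n::nat) x, b)) (frag_cmul (int n) (frag_of (x, b)))"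
proof (induction n)
  case 0
  then show ?case using assms by (simp add: cg_zero_left)
next
  case (Suc n)
  have "cg (frag_of (add_pow N n x \<oplus>\<^bsub>N\<^esub> x, b)) (frag_of (add_pow N n x, b) + frag_of (x, b))"
    using assms by (intro cg_add_left) auto
  also have "cg \<dots> (frag_cmul (int n) (frag_of (x, b)) + frag_of (x, b))"
    by (intro cg_add Suc cg_refl)
  finally show ?case by (simp add: frag_cmul_distrib add.commute)
qed

end

text \<open>Divided powers and ordinary powers are treated together: products are
  \<open>p i \<cdot> p j = \<mu> i j \<cdot> p (i + j)\<close>, Hasse derivatives of \<open>p m\<close> are \<open>\<kappa> k (m - k) \<cdot> p (m - k)\<close>, and
  \<open>d (p i) = \<lambda> i \<cdot> p (i - 1) t\<close>. The operator \<open>E m\<close> is multiplication by the \<open>m\<close>-th (divided) power of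
  \<open>1 \<otimes> X - X \<otimes> 1\<close>.\<close>

locale even_step = ext_step R A C B N e p P v J vdeg q
  for R :: "('r, 'x) ring_scheme" and A C B :: "('r, 'b) dg_alg" and N :: "('b, 'n) dg_mod"
    and e p P v J vdeg q +
  fixes \<kappa> \<mu> :: "nat \<Rightarrow> nat \<Rightarrow> nat" and lam :: "nat \<Rightarrow> nat" and t :: 'b
  assumes even_e: "even e" and P_eq: "P = UNIV" and t_A: "t \<in> carrier A"
    and q_eq: "k \<le> m \<Longrightarrow> q k m = add_pow C (\<kappa> k (m - k)) (p (m - k))"
    and p_mult: "p i \<otimes>\<^bsub>C\<^esub> p j = add_pow C (\<mu> i j) (p (i + j))"
    and p_diff: "adiff C (p (Suc i)) = add_pow C (lam (Suc i)) (p i \<otimes>\<^bsub>C\<^esub> t)"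
    and lam_0: "lam 0 = 0"
    and coeff_diff: "\<kappa> (Suc i) j * lam (Suc i) = \<kappa> i (Suc j) * lam (Suc j)"
    and coeff_E: "k \<le> m \<Longrightarrow> (\<Sum>j\<le>m. (-1) ^ (m - j) * int (\<kappa> (m - j) j) *
       (if k \<le> j + n then int (\<mu> j n * \<kappa> k (j + n - k) * \<mu> (m - j) (j + n - k)) else 0)) = (if k = m then 1 else 0)"
    and coeff_taylor: "j \<le> n \<Longrightarrow> (\<Sum>m\<in>{j..n}. (-1) ^ (m - j) * int (\<kappa> (m - j) j) *
       int (\<kappa> m (n - m) * \<mu> (n - m) (m - j))) = (if j = n then 1 else 0)"
begin

text \<open>Coefficients of the power of order \<open>m\<close> of 1 \<otimes> X - X \<otimes> 1.
  With ordinary powers the factor from \<open>\<kappa>\<close> is the binomial coefficient of the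
  binomial theorem; with divided powers it is 1.\<close>

definition cf :: "nat \<Rightarrow> nat \<Rightarrow> int" where "cf m j = (-1) ^ (m - j) * int (\<kappa> (m - j) j)"

lemma pB [simp]: "p i \<in> carrier B" and pC [simp]: "p i \<in> carrier C"
  using p_B p_C by (simp_all add: P_eq)

lemma in_P [simp]: "n \<in> P" by (simp add: P_eq)

lemma p_agr_B: "p i \<in> agr B (i * e)" using p_agr agr_C_B by (simp add: P_eq)

lemma p_comm: "a \<in> carrier B \<Longrightarrow> a \<otimes>\<^bsub>B\<^esub> p i = p i \<otimes>\<^bsub>B\<^esub> a"
  using even_e by (intro S.B.even_central[OF _ p_agr_B]) auto

lemma pow_sub: "c \<in> carrier C \<Longrightarrow> add_pow C (n::nat) c = add_pow B n c"
  using additive_map_pow[OF S'.abA S'.abB S'.additive_map_incl] .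

lemma p_mult_B: "p i \<otimes>\<^bsub>B\<^esub> p j = add_pow B (\<mu> i j) (p (i + j))"
  using p_mult[of i j] by (simp add: S'.mult_sub pow_sub)

lemma t_B [simp]: "t \<in> carrier B" using t_A S.carrier_sub by blast

lemma p_diff_B: "adiff B (p i) = (if i = 0 then \<zero>\<^bsub>B\<^esub> else add_pow B (lam i) (p (i - 1) \<otimes>\<^bsub>B\<^esub> t))"
proof (cases i)
  case 0
  then show ?thesis using p_0 S'.one_sub S.B.adiff_one by simp
next
  case (Suc j)
  have "t \<in> carrier C" using t_A AC.carrier_sub by blast
  then have "p j \<otimes>\<^bsub>C\<^esub> t = p j \<otimes>\<^bsub>B\<^esub> t" "p j \<otimes>\<^bsub>C\<^esub> t \<in> carrier C" by (simp_all add: S'.mult_sub[symmetric])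
  then show ?thesis using p_diff[of j] Suc by (simp add: S'.adiff_sub pow_sub)
qed

lemma tB_p: "S.tB (p i) = p i"
  using S.B.gr.twist_homog[OF p_agr_B] even_e by (simp add: sg_def)

lemma tw_id: "twn G D (k * e) x = x"
  using even_e by (simp add: twn_def)

definition "eterm k x b j = frag_cmul (cf k j) (frag_of (act N x (p (k - j)), p j \<otimes>\<^bsub>B\<^esub> b))"
definition "fE k = frag_extend (\<lambda>(x, b). \<Sum>j\<le>k. eterm k x b j)"

lemma fE_of [simp]: "fE k (frag_of (x, b)) = (\<Sum>j\<le>k. eterm k x b j)"
  by (simp add: fE_def)

lemma fE_additive [simp]: "frag_additive (fE k)"
  by (simp add: fE_def)

lemma frags_cmul: "u \<in> frags N B \<Longrightarrow> frag_cmul c u \<in> frags N B"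
  using keys_cmul by (auto simp: frags_iff)

lemma resp_fE: "resA (fE k)"
proof (rule two_base_changes.respI[OF S.two_self fE_additive])
  fix x b assume x: "x \<in> carrier N" and b: "b \<in> carrier B"
  show "fE k (frag_of (x, b)) \<in> frags N B"
    using x b by (auto simp: eterm_def S.N.act_closed intro!: frags_sum frags_cmul)
  show "S.cg (fE k (frag_of (x \<oplus>\<^bsub>N\<^esub> y, b))) (fE k (frag_of (x, b)) + fE k (frag_of (y, b)))" if y: "y \<in> carrier N" for y
    using x y b unfolding fE_of sum.distrib[symmetric] eterm_def frag_cmul_distrib2[symmetric]
    by (intro S.cg_sum S.cg_cmul) (auto simp: S.N.act_add_left intro!: S.cg_add_left S.N.act_closed)
  show "S.cg (fE k (frag_of (x, b \<oplus>\<^bsub>B\<^esub> c))) (fE k (frag_of (x, b)) + fE k (frag_of (x, c)))" if c: "c \<in> carrier B" for c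
    using x b c unfolding fE_of sum.distrib[symmetric] eterm_def frag_cmul_distrib2[symmetric]
    by (intro S.cg_sum S.cg_cmul) (auto simp: S.B.r_distr intro!: S.cg_add_right S.N.act_closed)
  show "S.cg (fE k (frag_of (act N x a, b))) (fE k (frag_of (x, a \<otimes>\<^bsub>B\<^esub> b)))" if a: "a \<in> carrier A" for a
    unfolding fE_of eterm_def
  proof (intro S.cg_sum S.cg_cmul)
    fix j
    have aB: "a \<in> carrier B" using a S.carrier_sub by blast
    have "act N (act N x a) (p (k - j)) = act N (act N x (p (k - j))) a"
      using x aB p_comm[OF aB] by (simp add: S.N.act_mult[symmetric])
    moreover have "a \<otimes>\<^bsub>B\<^esub> (p j \<otimes>\<^bsub>B\<^esub> b) = p j \<otimes>\<^bsub>B\<^esub> (a \<otimes>\<^bsub>B\<^esub> b)"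
      using b aB p_comm[OF aB] by (simp add: S.B.m_assoc[symmetric])
    ultimately show "S.cg (frag_of (act N (act N x a) (p (k - j)), p j \<otimes>\<^bsub>B\<^esub> b))
       (frag_of (act N x (p (k - j)), p j \<otimes>\<^bsub>B\<^esub> (a \<otimes>\<^bsub>B\<^esub> b)))"
      using S.cg_balanced[of "act N x (p (k - j))" a "p j \<otimes>\<^bsub>B\<^esub> b"] x a b by (simp add: S.N.act_closed)
  qed
qed

lemma fE_rmult:
  assumes "x \<in> carrier N" "b \<in> carrier B" "c \<in> carrier B"
  shows "fE k (frag_of (x, b \<otimes>\<^bsub>B\<^esub> c)) = S.rmult c (fE k (frag_of (x, b)))"
  using assms by (simp add: eterm_def frag_additive_sum[OF S.frag_additive_rmult]
      frag_additive_of_cmul[OF S.frag_additive_rmult] S.B.m_assoc)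

text \<open>The Leibniz rule, with the two terms containing \<open>t\<close> isolated. In both,
  \<open>t\<close> is brought to the left end of the right factor, across the tensor sign in one and
  past a central element in the other, so that they become comparable. For \<open>i = 0\<close> or
  \<open>j = 0\<close> the truncated index is harmless because \<open>lam 0 = 0\<close>.\<close>

lemma fdiff_tensor:
  assumes x: "x \<in> carrier N" and b: "b \<in> carrier B"
  defines "G \<equiv> \<lambda>i j. frag_of (act N (S.tN x) (p i), t \<otimes>\<^bsub>B\<^esub> (p j \<otimes>\<^bsub>B\<^esub> b))"
  shows "S.cg (S.fdiff (frag_of (act N x (p i), p j \<otimes>\<^bsub>B\<^esub> b)))
    ((frag_of (act N (mdiff N x) (p i), p j \<otimes>\<^bsub>B\<^esub> b) + frag_of (act N (S.tN x) (p i), p j \<otimes>\<^bsub>B\<^esub> adiff B b)) +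
     (frag_cmul (int (lam i)) (G (i - 1) j) + frag_cmul (int (lam j)) (G i (j - 1))))"
proof -
  let ?y = "S.tN x"
  have c: "mdiff N x \<in> carrier N" "?y \<in> carrier N" "adiff B b \<in> carrier B" "adiff B (p i) \<in> carrier B" "adiff B (p j) \<in> carrier B"
    using x b by (auto simp: S.N.mdiff_closed S.B.adiff_closed)
  have 1: "S.cg (frag_of (act N ?y (adiff B (p i)), p j \<otimes>\<^bsub>B\<^esub> b)) (frag_cmul (int (lam i)) (G (i - 1) j))"
  proof (cases "i = 0")
    case True
    then show ?thesis using c b by (simp add: p_diff_B lam_0 S.cg_zero_left)
  next
    case False
    let ?z = "act N (act N ?y (p (i - 1))) t"
    have z: "?z \<in> carrier N" using c by (simp add: S.N.act_closed)
    have "act N ?y (add_pow B (lam i) (p (i - 1) \<otimes>\<^bsub>B\<^esub> t)) = add_pow N (lam i) (act N ?y (p (i - 1) \<otimes>\<^bsub>B\<^esub> t))"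
      using c by (intro additive_map_pow[OF S.abB S.abN S.additive_map_act_right]) auto
    also have "act N ?y (p (i - 1) \<otimes>\<^bsub>B\<^esub> t) = ?z" using c by (intro S.N.act_mult) auto
    finally have "S.cg (frag_of (act N ?y (adiff B (p i)), p j \<otimes>\<^bsub>B\<^esub> b)) (frag_cmul (int (lam i)) (frag_of (?z, p j \<otimes>\<^bsub>B\<^esub> b)))"
      using False b S.cg_pow_left[OF z, of "p j \<otimes>\<^bsub>B\<^esub> b" "lam i"] by (simp add: p_diff_B)
    also have "S.cg \<dots> (frag_cmul (int (lam i)) (G (i - 1) j))"
      unfolding G_def using c b t_A by (intro S.cg_cmul S.cg_balanced) (auto intro: S.N.act_closed)
    finally show ?thesis .
  qed
  have 2: "S.cg (frag_of (act N ?y (p i), adiff B (p j) \<otimes>\<^bsub>B\<^esub> b)) (frag_cmul (int (lam j)) (G i (j - 1)))"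
  proof (cases "j = 0")
    case True
    then show ?thesis using c b by (simp add: p_diff_B lam_0 S.cg_zero_right S.N.act_closed)
  next
    case False
    have "(add_pow B (lam j) (p (j - 1) \<otimes>\<^bsub>B\<^esub> t)) \<otimes>\<^bsub>B\<^esub> b = add_pow B (lam j) ((p (j - 1) \<otimes>\<^bsub>B\<^esub> t) \<otimes>\<^bsub>B\<^esub> b)"
      using b by (intro additive_map_pow[OF S.abB S.abB S.B.additive_map_rmult]) auto
    also have "(p (j - 1) \<otimes>\<^bsub>B\<^esub> t) \<otimes>\<^bsub>B\<^esub> b = (t \<otimes>\<^bsub>B\<^esub> p (j - 1)) \<otimes>\<^bsub>B\<^esub> b"
      by (simp only: p_comm[OF t_B])
    also have "\<dots> = t \<otimes>\<^bsub>B\<^esub> (p (j - 1) \<otimes>\<^bsub>B\<^esub> b)" using b by (intro S.B.m_assoc) auto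
    finally have "adiff B (p j) \<otimes>\<^bsub>B\<^esub> b = add_pow B (lam j) (t \<otimes>\<^bsub>B\<^esub> (p (j - 1) \<otimes>\<^bsub>B\<^esub> b))"
      using False by (simp add: p_diff_B)
    then show ?thesis unfolding G_def
      using b c S.cg_pow_right[of "act N ?y (p i)" "t \<otimes>\<^bsub>B\<^esub> (p (j - 1) \<otimes>\<^bsub>B\<^esub> b)" "lam j"] by (simp add: S.N.act_closed)
  qed
  have "S.fdiff (frag_of (act N x (p i), p j \<otimes>\<^bsub>B\<^esub> b)) =
      frag_of (act N (mdiff N x) (p i) \<oplus>\<^bsub>N\<^esub> act N ?y (adiff B (p i)), p j \<otimes>\<^bsub>B\<^esub> b) +
      frag_of (act N ?y (p i), adiff B (p j) \<otimes>\<^bsub>B\<^esub> b \<oplus>\<^bsub>B\<^esub> p j \<otimes>\<^bsub>B\<^esub> adiff B b)"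
    using x b c by (simp add: S.mdiff_act_general S.twist_act tB_p S.B.adiff_mult_general)
  also have "S.cg \<dots> ((frag_of (act N (mdiff N x) (p i), p j \<otimes>\<^bsub>B\<^esub> b) + frag_of (act N ?y (adiff B (p i)), p j \<otimes>\<^bsub>B\<^esub> b)) +
     (frag_of (act N ?y (p i), adiff B (p j) \<otimes>\<^bsub>B\<^esub> b) + frag_of (act N ?y (p i), p j \<otimes>\<^bsub>B\<^esub> adiff B b)))"
    using x b c by (intro S.cg_add S.cg_add_left S.cg_add_right) (auto intro: S.N.act_closed)
  also have "S.cg \<dots> ((frag_of (act N (mdiff N x) (p i), p j \<otimes>\<^bsub>B\<^esub> b) + frag_cmul (int (lam i)) (G (i - 1) j)) +
     (frag_cmul (int (lam j)) (G i (j - 1)) + frag_of (act N ?y (p i), p j \<otimes>\<^bsub>B\<^esub> adiff B b)))"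
    by (intro S.cg_add S.cg_refl 1 2)
  finally show ?thesis by (simp add: algebra_simps)
qed

text \<open>Expresses that 1 \<otimes> X - X \<otimes> 1 is a cycle. The terms with \<open>t\<close>
  telescope: the one from differentiating the left power in summand \<open>j\<close> cancels the one
  from the right power in summand \<open>j + 1\<close>.\<close>

lemma fE_diff:
  assumes x: "x \<in> carrier N" and b: "b \<in> carrier B"
  shows "S.cg (S.fdiff (fE k (frag_of (x, b)))) (fsg (k * e) (fE k (S.fdiff (frag_of (x, b)))))"
proof -
  define G where "G = (\<lambda>i j. frag_of (act N (S.tN x) (p i), t \<otimes>\<^bsub>B\<^esub> (p j \<otimes>\<^bsub>B\<^esub> b)))"
  let ?a = "\<lambda>j. frag_cmul (cf k j * int (lam (k - j))) (G (k - j - 1) j)"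
  let ?b = "\<lambda>j. frag_cmul (cf k j * int (lam j)) (G (k - j) (j - 1))"
  have "S.fdiff (fE k (frag_of (x, b))) = (\<Sum>j\<le>k. frag_cmul (cf k j) (S.fdiff (frag_of (act N x (p (k - j)), p j \<otimes>\<^bsub>B\<^esub> b))))"
    by (simp add: eterm_def frag_additive_sum[OF S.frag_additive_fdiff] frag_additive_of_cmul[OF S.frag_additive_fdiff] del: S.fdiff_of)
  also have "S.cg \<dots> (\<Sum>j\<le>k. frag_cmul (cf k j)
    ((frag_of (act N (mdiff N x) (p (k - j)), p j \<otimes>\<^bsub>B\<^esub> b) + frag_of (act N (S.tN x) (p (k - j)), p j \<otimes>\<^bsub>B\<^esub> adiff B b)) +
     (frag_cmul (int (lam (k - j))) (G (k - j - 1) j) + frag_cmul (int (lam j)) (G (k - j) (j - 1)))))"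
    unfolding G_def by (intro S.cg_sum S.cg_cmul fdiff_tensor[OF x b])
  also have "\<dots> = fE k (S.fdiff (frag_of (x, b))) + (sum ?a {..k} + sum ?b {..k})"
    by (simp add: frag_cmul_distrib2 sum.distrib eterm_def frag_additive_add[OF fE_additive])
  also have "sum ?a {..k} + sum ?b {..k} = 0"
  proof (cases k)
    case 0
    then show ?thesis by (simp add: lam_0)
  next
    case (Suc l)
    \<comment> \<open>The signs of consecutive summands are opposite and the absolute values agree
      by \<open>coeff_diff\<close>.\<close>
    have "?a j + ?b (Suc j) = 0" if "j \<le> l" for j
    proof -
      have kj: "k - j = Suc (l - j)" "k - Suc j = l - j" using Suc that by auto
      have "int (\<kappa> (Suc (l - j)) j) * int (lam (Suc (l - j))) = int (\<kappa> (l - j) (Suc j)) * int (lam (Suc j))"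
        unfolding of_nat_mult[symmetric] by (simp only: coeff_diff)
      then have "cf k j * int (lam (k - j)) + cf k (Suc j) * int (lam (Suc j)) = 0"
        unfolding cf_def kj by (simp add: mult.assoc)
      then show ?thesis by (simp add: kj frag_cmul_distrib[symmetric])
    qed
    then have "(\<Sum>j\<le>l. ?a j + ?b (Suc j)) = 0" by simp
    moreover have "sum ?a {..k} = sum ?a {..l}" unfolding Suc by (simp add: lam_0)
    moreover have "sum ?b {..k} = (\<Sum>j\<le>l. ?b (Suc j))"
      unfolding Suc sum.atMost_Suc_shift by (simp add: lam_0)
    ultimately show ?thesis by (simp add: sum.distrib)
  qed
  finally show ?thesis using even_e by (simp add: fsg_def)
qed

lemma fE_keys:
  assumes x: "x \<in> mgr N i" and b: "b \<in> agr B n"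
  shows "Poly_Mapping.keys (fE k (frag_of (x, b))) \<subseteq> S.homog_keys (i + int n + int (k * e))"
proof -
  have eterm: "Poly_Mapping.keys (eterm k x b j) \<subseteq> S.homog_keys (i + int n + int (k * e))" if "j \<le> k" for j
  proof -
    have 1: "act N x (p (k - j)) \<in> mgr N (i + int ((k - j) * e))" by (rule S.N.act_mgr[OF x p_agr_B])
    have 2: "p j \<otimes>\<^bsub>B\<^esub> b \<in> agr B (j * e + n)" by (rule S.B.mult_agr[OF p_agr_B b])
    have "(k - j) * e + j * e = k * e" using that by (simp add: add_mult_distrib[symmetric])
    then have "i + int ((k - j) * e) + int (j * e + n) = i + int n + int (k * e)" by linarith
    then have "(act N x (p (k - j)), p j \<otimes>\<^bsub>B\<^esub> b) \<in> S.homog_keys (i + int n + int (k * e))"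
      unfolding S.homog_keys_def using 1 2 by blast
    then show ?thesis unfolding eterm_def using keys_cmul[of "cf k j"] by fastforce
  qed
  have sum: "Poly_Mapping.keys (sum f K) \<subseteq> Z" if "\<And>j. j \<in> K \<Longrightarrow> Poly_Mapping.keys (f j) \<subseteq> Z"
    for f :: "nat \<Rightarrow> ('n \<times> 'b) \<Rightarrow>\<^sub>0 int" and K Z
    using that
  proof (induction K rule: infinite_finite_induct)
    case (insert j K)
    then show ?case by (simp add: S.keys_add_sub)
  qed simp_all
  show ?thesis unfolding fE_of by (rule sum) (simp add: eterm del: of_nat_mult)
qed

lemma p_mult_v:
  assumes "j \<in> J" shows "p i \<otimes>\<^bsub>B\<^esub> (p n \<otimes>\<^bsub>B\<^esub> v j) = add_pow B (\<mu> i n) (p (i + n) \<otimes>\<^bsub>B\<^esub> v j)"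
proof -
  have "p i \<otimes>\<^bsub>B\<^esub> (p n \<otimes>\<^bsub>B\<^esub> v j) = (p i \<otimes>\<^bsub>B\<^esub> p n) \<otimes>\<^bsub>B\<^esub> v j"
    using v_B[OF assms] by (simp add: S.B.m_assoc)
  also have "\<dots> = add_pow B (\<mu> i n) (p (i + n)) \<otimes>\<^bsub>B\<^esub> v j" by (simp only: p_mult_B)
  also have "\<dots> = add_pow B (\<mu> i n) (p (i + n) \<otimes>\<^bsub>B\<^esub> v j)"
    by (rule additive_map_pow[OF S.abB S.abB S.B.additive_map_rmult[OF v_B[OF assms]] pB])
  finally show ?thesis .
qed

lemma der_p:
  assumes "j \<in> J"
  shows "der k (p i \<otimes>\<^bsub>B\<^esub> (p n \<otimes>\<^bsub>B\<^esub> v j)) = (if k \<le> i + n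
    then add_pow B (\<mu> i n * \<kappa> k (i + n - k)) (p (i + n - k) \<otimes>\<^bsub>B\<^esub> v j) else \<zero>\<^bsub>B\<^esub>)"
proof -
  have v: "v j \<in> carrier B" using assms by (rule v_B)
  have "der k (p i \<otimes>\<^bsub>B\<^esub> (p n \<otimes>\<^bsub>B\<^esub> v j)) = der k (add_pow B (\<mu> i n) (p (i + n) \<otimes>\<^bsub>B\<^esub> v j))"
    by (simp only: p_mult_v[OF assms])
  also have "\<dots> = add_pow B (\<mu> i n) (der k (p (i + n) \<otimes>\<^bsub>B\<^esub> v j))"
    using v by (intro additive_map_pow[OF S.abB S.abB der_additive]) simp
  also have "der k (p (i + n) \<otimes>\<^bsub>B\<^esub> v j) = q k (i + n) \<otimes>\<^bsub>B\<^esub> v j"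
    using assms by (simp add: der_pv)
  also have "add_pow B (\<mu> i n) (q k (i + n) \<otimes>\<^bsub>B\<^esub> v j) = (if k \<le> i + n
    then add_pow B (\<mu> i n * \<kappa> k (i + n - k)) (p (i + n - k) \<otimes>\<^bsub>B\<^esub> v j) else \<zero>\<^bsub>B\<^esub>)"
  proof (cases "k \<le> i + n")
    case True
    have "add_pow B (\<kappa> k (i + n - k)) (p (i + n - k)) \<otimes>\<^bsub>B\<^esub> v j = add_pow B (\<kappa> k (i + n - k)) (p (i + n - k) \<otimes>\<^bsub>B\<^esub> v j)"
      by (rule additive_map_pow[OF S.abB S.abB S.B.additive_map_rmult[OF v] pB])
    then show ?thesis using True v by (simp add: q_eq pow_sub S.B.add.nat_pow_pow mult.commute)
  next
    case False
    then show ?thesis using v q_big[of "i + n" k] by (simp add: P_eq S'.zero_sub)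
  qed
  finally show ?thesis .
qed

text \<open>Over \<open>C\<close> all powers of \<open>X\<close> can be collected in the left
  factor, where they multiply to a multiple of \<open>p (m + n - k)\<close>. What remains is a
  scalar, which \<open>coeff_E\<close> evaluates to 1 or 0.\<close>

lemma Th_E_gen:
  assumes x: "x \<in> carrier N" and j: "j \<in> J" and km: "k \<le> m"
  shows "Th k (tmap A N B (fE m) (ten x (p n \<otimes>\<^bsub>B\<^esub> v j))) =
    (if k = m then Th 0 (ten x (p n \<otimes>\<^bsub>B\<^esub> v j)) else \<zero>\<^bsub>S'.T\<^esub>)"
proof -
  have v: "v j \<in> carrier B" using j by (rule v_B)
  let ?b = "p n \<otimes>\<^bsub>B\<^esub> v j"
  let ?y = "frag_of (act N x (p (m + n - k)), v j)"
  let ?z = "\<lambda>i. if k \<le> i + n then int (\<mu> i n * \<kappa> k (i + n - k) * \<mu> (m - i) (i + n - k)) else 0"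
  have b: "?b \<in> carrier B" using v by simp
  have xb: "frag_of (x, ?b) \<in> frags N B" using x b by simp
  have cl: "fE m (frag_of (x, ?b)) \<in> frags N B"
    by (rule two_base_changes.resp_FF[OF S.two_self resp_fE xb])
  have "Th k (tmap A N B (fE m) (ten x ?b)) = tcl C N B (fTh k (fE m (frag_of (x, ?b))))"
    unfolding ten_def two_base_changes.tmap_cl[OF S.two_self resp_fE xb] Th_def
    by (rule tmap_cl[OF resp_fTh cl])
  also have "fTh k (fE m (frag_of (x, ?b))) = (\<Sum>i\<le>m. frag_cmul (cf m i) (frag_of (act N x (p (m - i)), der k (p i \<otimes>\<^bsub>B\<^esub> ?b))))"
  proof -
    have "frag_additive (fTh k)" using resp_fTh by (simp add: resp_def)
    then show ?thesis by (simp add: eterm_def frag_additive_sum frag_additive_of_cmul tw_id)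
  qed
  also have "tcl C N B \<dots> = tcl C N B (\<Sum>i\<le>m. frag_cmul (cf m i) (frag_cmul (?z i) ?y))"
    unfolding S'.cl_eq_iff
  proof (intro S'.cg_sum S'.cg_cmul)
    fix i assume i: "i \<in> {..m}"
    show "S'.cg (frag_of (act N x (p (m - i)), der k (p i \<otimes>\<^bsub>B\<^esub> ?b))) (frag_cmul (?z i) ?y)"
    proof (cases "k \<le> i + n")
      case True
      let ?c = "\<mu> i n * \<kappa> k (i + n - k)" and ?r = "i + n - k"
      have s: "m - i + ?r = m + n - k" using True i by simp
      have xp: "act N x (p (m - i)) \<in> carrier N" using x by (simp add: S.N.act_closed)
      have "S'.cg (frag_of (act N x (p (m - i)), add_pow B ?c (p ?r \<otimes>\<^bsub>B\<^esub> v j)))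
         (frag_cmul (int ?c) (frag_of (act N x (p (m - i)), p ?r \<otimes>\<^bsub>B\<^esub> v j)))"
        using xp v by (intro S'.cg_pow_right) auto
      also have "S'.cg \<dots> (frag_cmul (int ?c) (frag_of (act N (act N x (p (m - i))) (p ?r), v j)))"
        using xp v by (intro S'.cg_cmul S'.cg_sym[OF S'.cg_balanced]) auto
      also have "act N (act N x (p (m - i))) (p ?r) = act N x (p (m - i) \<otimes>\<^bsub>B\<^esub> p ?r)"
        using x by (simp add: S.N.act_mult)
      also have "\<dots> = act N x (add_pow B (\<mu> (m - i) ?r) (p (m + n - k)))"
        unfolding p_mult_B s ..
      also have "\<dots> = add_pow N (\<mu> (m - i) ?r) (act N x (p (m + n - k)))"
        by (rule additive_map_pow[OF S.abB S.abN S.additive_map_act_right[OF x] pB])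
      also have "S'.cg (frag_cmul (int ?c) (frag_of (add_pow N (\<mu> (m - i) ?r) (act N x (p (m + n - k))), v j)))
         (frag_cmul (int ?c) (frag_cmul (int (\<mu> (m - i) ?r)) ?y))"
        using x v by (intro S'.cg_cmul S'.cg_pow_left) (auto intro: S.N.act_closed)
      finally show ?thesis using True j by (simp add: der_p)
    next
      case False
      then show ?thesis using x j by (simp add: der_p S'.cg_zero_right S.N.act_closed)
    qed
  qed
  also have "(\<Sum>i\<le>m. frag_cmul (cf m i) (frag_cmul (?z i) ?y)) = frag_cmul (if k = m then 1 else 0) ?y"
    unfolding frag_cmul_cmul frag_cmul_sum_coeffs cf_def coeff_E[OF km, of n] ..
  finally have *: "Th k (tmap A N B (fE m) (ten x ?b)) = tcl C N B (frag_cmul (if k = m then 1 else 0) ?y)" .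
  have Th0: "Th 0 (ten x ?b) = ten' (act N x (p n)) (v j)"
    using x v b tw_id[of N "mgr N" 0 x] by (simp add: Th_ten der_0 ten'_balanced)
  show ?thesis
  proof (cases "k = m")
    case True
    then show ?thesis unfolding * Th0 by (simp add: ten'_def)
  next
    case False
    then show ?thesis unfolding * by (simp add: S'.T_zero)
  qed
qed

text \<open>Both sides are combinations of \<open>x p (n - i) \<otimes> p i v j\<close>. The
  coefficient on the right is a sum over the orders \<open>k\<close>, which
  \<open>coeff_taylor\<close> evaluates to 1 for \<open>i = n\<close> and to 0 otherwise.\<close>

lemma taylor_gen:
  assumes x: "x \<in> carrier N" and j: "j \<in> J" and M: "n < M"
  shows "ten x (p n \<otimes>\<^bsub>B\<^esub> v j) = (\<Oplus>\<^bsub>S.T\<^esub>k\<in>{..<M}. tmap A N B (fE k) (sec (Th k (ten x (p n \<otimes>\<^bsub>B\<^esub> v j)))))"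
proof -
  have v: "v j \<in> carrier B" using j by (rule v_B)
  let ?y = "ten x (p n \<otimes>\<^bsub>B\<^esub> v j)"
  let ?g = "\<lambda>i. frag_of (act N x (p (n - i)), p i \<otimes>\<^bsub>B\<^esub> v j)"
  \<comment> \<open>The coefficient contributed by the Taylor term of order \<open>m\<close>. It is
    set to zero for \<open>i > m\<close>, so that the double sum becomes rectangular and can be
    exchanged.\<close>
  define w where "w = (\<lambda>m i. if i \<le> m then cf m i * int (\<kappa> m (n - m) * \<mu> (n - m) (m - i)) else 0)"
  have gF: "?g i \<in> frags N B" for i using x v by (simp add: S.N.act_closed)
  have Ek: "tmap A N B (fE m) (sec (Th m ?y)) = (if m \<le> n then tcl A N B (\<Sum>i\<le>m. frag_cmul (w m i) (?g i)) else \<zero>\<^bsub>S.T\<^esub>)" for m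
  proof (cases "m \<le> n")
    case True
    let ?c = "\<kappa> m (n - m)"
    have qB: "q m n \<in> carrier B" by (rule q_B) (simp add: P_eq)
    have xq: "act N x (q m n) \<in> carrier N" using x qB by (rule S.N.act_closed)
    have xqv: "frag_of (act N x (q m n), v j) \<in> frags N B" using xq v by simp
    have "sec (Th m ?y) = ten (act N x (q m n)) (v j)"
      using x j xq by (simp add: Th_gen sec_gen tw_id)
    then have "tmap A N B (fE m) (sec (Th m ?y)) = tcl A N B (fE m (frag_of (act N x (q m n), v j)))"
      using two_base_changes.tmap_cl[OF S.two_self resp_fE xqv] by (simp only: ten_def)
    also have "\<dots> = tcl A N B (\<Sum>i\<le>m. frag_cmul (w m i) (?g i))"
      unfolding S.cl_eq_iff fE_of eterm_def
    proof (intro S.cg_sum)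
      fix i assume i: "i \<in> {..m}"
      let ?d = "\<mu> (n - m) (m - i)"
      have s: "n - m + (m - i) = n - i" using i True by simp
      have "q m n \<otimes>\<^bsub>B\<^esub> p (m - i) = add_pow B ?c (p (n - m)) \<otimes>\<^bsub>B\<^esub> p (m - i)"
        using True by (simp add: q_eq pow_sub)
      also have "\<dots> = add_pow B ?c (p (n - m) \<otimes>\<^bsub>B\<^esub> p (m - i))"
        by (rule additive_map_pow[OF S.abB S.abB S.B.additive_map_rmult[OF pB] pB])
      also have "\<dots> = add_pow B (?c * ?d) (p (n - i))"
        unfolding p_mult_B s by (simp add: S.B.add.nat_pow_pow mult.commute)
      finally have qp: "q m n \<otimes>\<^bsub>B\<^esub> p (m - i) = add_pow B (?c * ?d) (p (n - i))" .
      have "act N (act N x (q m n)) (p (m - i)) = act N x (q m n \<otimes>\<^bsub>B\<^esub> p (m - i))"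
        using x qB by (simp add: S.N.act_mult)
      also have "\<dots> = add_pow N (?c * ?d) (act N x (p (n - i)))"
        unfolding qp by (rule additive_map_pow[OF S.abB S.abN S.additive_map_act_right[OF x] pB])
      finally have "S.cg (frag_of (act N (act N x (q m n)) (p (m - i)), p i \<otimes>\<^bsub>B\<^esub> v j))
          (frag_cmul (int (?c * ?d)) (?g i))"
        using x v S.cg_pow_left[of "act N x (p (n - i))" "p i \<otimes>\<^bsub>B\<^esub> v j" "?c * ?d"]
        by (simp add: S.N.act_closed)
      then have "S.cg (frag_cmul (cf m i) (frag_of (act N (act N x (q m n)) (p (m - i)), p i \<otimes>\<^bsub>B\<^esub> v j)))
          (frag_cmul (cf m i) (frag_cmul (int (?c * ?d)) (?g i)))"
        by (rule S.cg_cmul)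
      then show "S.cg (frag_cmul (cf m i) (frag_of (act N (act N x (q m n)) (p (m - i)), p i \<otimes>\<^bsub>B\<^esub> v j)))
          (frag_cmul (w m i) (?g i))"
        using i by (simp add: w_def)
    qed
    finally show ?thesis using True by simp
  next
    case False
    then have "Th m ?y = \<zero>\<^bsub>S'.T\<^esub>" using x j by (intro Th_gen_big) (auto simp: P_eq)
    then show ?thesis
      using False additive_map_zero[OF S.abelian_group_T S.abelian_group_T two_base_changes.additive_map_tmap[OF S.two_self resp_fE]]
      by (simp add: sec_zero)
  qed
  have wF: "(\<Sum>i\<le>m. frag_cmul (w m i) (?g i)) \<in> frags N B" for m
    by (intro frags_sum frags_cmul gF)
  have "(\<Oplus>\<^bsub>S.T\<^esub>k\<in>{..<M}. tmap A N B (fE k) (sec (Th k ?y))) = (\<Oplus>\<^bsub>S.T\<^esub>k\<in>{..n}. tcl A N B (\<Sum>i\<le>k. frag_cmul (w k i) (?g i)))"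
    unfolding Ek
    by (rule S.T.add.finprod_mono_neutral_cong_right) (use M wF S.cl_closed in auto)
  also have "\<dots> = tcl A N B (\<Sum>k\<le>n. \<Sum>i\<le>k. frag_cmul (w k i) (?g i))"
    by (rule S.T_finsum) (auto intro: wF)
  also have "(\<Sum>k\<le>n. \<Sum>i\<le>k. frag_cmul (w k i) (?g i)) = (\<Sum>k\<le>n. \<Sum>i\<le>n. frag_cmul (w k i) (?g i))"
    by (intro sum.cong refl sum.mono_neutral_left) (auto simp: w_def)
  also have "\<dots> = (\<Sum>i\<le>n. frag_cmul (\<Sum>k\<le>n. w k i) (?g i))"
    by (subst sum.swap) (simp add: frag_cmul_sum_coeffs)
  also have "\<dots> = (\<Sum>i\<le>n. frag_cmul (if i = n then 1 else 0) (?g i))"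
  proof (intro sum.cong refl arg_cong2[where f = frag_cmul])
    fix i assume i: "i \<in> {..n}"
    have "(\<Sum>k\<le>n. w k i) = (\<Sum>k\<in>{i..n}. w k i)"
      by (rule sum.mono_neutral_right) (auto simp: w_def)
    also have "\<dots> = (\<Sum>m\<in>{i..n}. (-1) ^ (m - i) * int (\<kappa> (m - i) i) * int (\<kappa> m (n - m) * \<mu> (n - m) (m - i)))"
      by (intro sum.cong) (auto simp: w_def cf_def)
    also have "\<dots> = (if i = n then 1 else 0)" by (rule coeff_taylor) (use i in simp)
    finally show "(\<Sum>k\<le>n. w k i) = (if i = n then 1 else 0)" .
  qed
  also have "\<dots> = (\<Sum>i\<le>n. if i = n then ?g i else 0)" by (intro sum.cong) auto
  also have "\<dots> = ?g n" by simp
  also have "tcl A N B (?g n) = ?y"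
    using x p_0 S'.one_sub by (simp add: ten_def S.N.act_one)
  finally show ?thesis by simp
qed

lemma even_filtered_lifting:
  assumes "bounded_below N" "free_basis B N (act N) u Ju" "\<And>i. i \<in> Ju \<Longrightarrow> u i \<in> mgr N (udeg i)"
  shows "filtered_lifting R B N S.T S'.T e UNIV (\<lambda>k. tmap A N B (fE k)) Th sec u Ju udeg"
proof (rule ops_filtered_lifting[OF resp_fE _ fE_diff fE_keys _ _ _ _ _ assms])
  show "S.cg (fE k (frag_of (x, b \<otimes>\<^bsub>B\<^esub> c))) (S.rmult c (fE k (frag_of (x, b))))"
    if "x \<in> carrier N" "b \<in> carrier B" "c \<in> carrier B" for k x b c
    using that by (simp add: fE_rmult del: fE_of)
  fix x m j assume x: "x \<in> carrier N" and j: "j \<in> J"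
  show "Th k (tmap A N B (fE k) (ten x (p m \<otimes>\<^bsub>B\<^esub> v j))) = Th 0 (ten x (p m \<otimes>\<^bsub>B\<^esub> v j))" for k
    using Th_E_gen[OF x j, of k k] by simp
  show "Th k (tmap A N B (fE l) (ten x (p m \<otimes>\<^bsub>B\<^esub> v j))) = \<zero>\<^bsub>S'.T\<^esub>" if "k < l" for k l
    using Th_E_gen[OF x j, of k l] that by simp
  show "\<exists>M0. \<forall>M\<ge>M0. ten x (p m \<otimes>\<^bsub>B\<^esub> v j) =
      (\<Oplus>\<^bsub>S.T\<^esub>k\<in>{..<M}. tmap A N B (fE k) (sec (Th k (ten x (p m \<otimes>\<^bsub>B\<^esub> v j)))))"
    by (intro exI[of _ "Suc m"] allI impI taylor_gen x j) simp
qed simp_all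

end


subsection \<open>Binomial identities\<close>

text \<open>The sum is the coefficient of z^m in (1 - z)^M times (1 - z)^(-(n + 1)). The two cases
  on the right are a negative and a non-negative exponent of 1 - z.\<close>

lemma alternating_choose_divided:
  "(\<Sum>i\<le>m. (-1) ^ i * int (M choose i) * int ((m - i + n) choose n)) =
     (if M \<le> n then int ((n - M + m) choose m) else (-1) ^ m * int ((M - n - 1) choose m))"
proof (induction M arbitrary: m)
  case 0
  have "(\<Sum>i\<le>m. (-1) ^ i * int (0 choose i) * int ((m - i + n) choose n)) =
     (\<Sum>i\<le>m. if i = 0 then int ((m + n) choose n) else 0)"
    by (intro sum.cong) auto
  also have "\<dots> = int ((n + m) choose m)"
    using binomial_symmetric[of m "n + m"] by (simp add: add.commute)
  finally show ?case by simp
next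
  case (Suc M)
  let ?f = "\<lambda>M m. \<Sum>i\<le>m. (-1) ^ i * int (M choose i) * int ((m - i + n) choose n)"
  show ?case
  proof (cases m)
    case 0
    then show ?thesis by simp
  next
    case m: (Suc l)
    have "?f (Suc M) (Suc l) = int ((Suc l + n) choose n) +
       (\<Sum>i\<le>l. (-1) ^ Suc i * int (Suc M choose Suc i) * int ((l - i + n) choose n))"
      by (subst sum.atMost_Suc_shift) simp
    also have "(\<Sum>i\<le>l. (-1) ^ Suc i * int (Suc M choose Suc i) * int ((l - i + n) choose n)) =
       (\<Sum>i\<le>l. (-1) ^ Suc i * int (M choose Suc i) * int ((l - i + n) choose n)) - ?f M l"
      unfolding sum_subtractf[symmetric] by (intro sum.cong) (auto simp: algebra_simps)
    also have "int ((Suc l + n) choose n) + ((\<Sum>i\<le>l. (-1) ^ Suc i * int (M choose Suc i) * int ((l - i + n) choose n)) - ?f M l)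
       = ?f M (Suc l) - ?f M l"
      by (subst sum.atMost_Suc_shift[of _ l]) simp
    \<comment> \<open>Pascal's rule in \<open>M\<close>, that is, multiplication of the generating
      function by 1 - z.\<close>
    finally have rec: "?f (Suc M) (Suc l) = ?f M (Suc l) - ?f M l" .
    consider "Suc M \<le> n" | "M = n" | "n < M" by linarith
    then show ?thesis
    proof cases
      case 1
      then obtain d where "n = Suc M + d" using le_Suc_ex by blast
      then show ?thesis using rec Suc.IH[of "Suc l"] Suc.IH[of l] unfolding m by simp
    next
      case 2
      then show ?thesis using rec Suc.IH[of "Suc l"] Suc.IH[of l] unfolding m by simp
    next
      case 3
      then obtain d where "M = Suc n + d" using less_imp_Suc_add by auto
      then show ?thesis using rec Suc.IH[of "Suc l"] Suc.IH[of l] unfolding m by (simp add: algebra_simps)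
    qed
  qed
qed

text \<open>The left side is the finite difference of order \<open>m\<close>, at \<open>n\<close>,
  of the function sending \<open>y\<close> to \<open>y choose k\<close>; each difference lowers
  \<open>k\<close> by one.\<close>

lemma alternating_choose_ordinary:
  "(\<Sum>j\<le>m. (-1) ^ (m - j) * int (m choose j) * int ((j + n) choose k)) =
     (if m \<le> k then int (n choose (k - m)) else 0)"
proof (induction m arbitrary: n)
  case 0
  then show ?case by simp
next
  case (Suc m)
  let ?g = "\<lambda>m n. \<Sum>j\<le>m. (-1) ^ (m - j) * int (m choose j) * int ((j + n) choose k)"
  let ?h = "\<lambda>j. (-1) ^ (m - Suc j) * int (m choose Suc j) * int ((Suc j + n) choose k)"
  have "?g (Suc m) n = (-1) ^ Suc m * int (n choose k) +
     (\<Sum>j\<le>m. (-1) ^ (m - j) * int (Suc m choose Suc j) * int ((j + Suc n) choose k))"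
    by (subst sum.atMost_Suc_shift) simp
  also have "(\<Sum>j\<le>m. (-1) ^ (m - j) * int (Suc m choose Suc j) * int ((j + Suc n) choose k)) =
     ?g m (Suc n) + (\<Sum>j\<le>m. (-1) ^ (m - j) * int (m choose Suc j) * int ((Suc j + n) choose k))"
    unfolding sum.distrib[symmetric] by (intro sum.cong) (auto simp: algebra_simps)
  also have "(\<Sum>j\<le>m. (-1) ^ (m - j) * int (m choose Suc j) * int ((Suc j + n) choose k)) =
     (\<Sum>j<m. (-1) ^ (m - j) * int (m choose Suc j) * int ((Suc j + n) choose k))"
    by (rule sum.mono_neutral_right) (auto simp: not_less)
  also have "\<dots> = (\<Sum>j<m. - ?h j)"
  proof (rule sum.cong)
    fix j assume "j \<in> {..<m}"
    then have "m - j = Suc (m - Suc j)" by auto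
    then show "(-1) ^ (m - j) * int (m choose Suc j) * int ((Suc j + n) choose k) = - ?h j" by simp
  qed simp
  also have "\<dots> = - (?g m n - (-1) ^ m * int (n choose k))"
  proof (cases m)
    case l: (Suc l)
    have "?g (Suc l) n = (-1) ^ Suc l * int (n choose k) +
       (\<Sum>j\<le>l. (-1) ^ (Suc l - Suc j) * int (Suc l choose Suc j) * int ((Suc j + n) choose k))"
      by (subst sum.atMost_Suc_shift) simp
    then show ?thesis unfolding l sum_negf by (simp add: lessThan_Suc_atMost)
  qed simp
  finally have rec: "?g (Suc m) n = ?g m (Suc n) - ?g m n" by simp
  consider "m < k" | "m = k" | "k < m" by linarith
  then show ?case
  proof cases
    case 1
    then obtain d where "k = Suc m + d" using less_imp_Suc_add by auto
    then show ?thesis using rec Suc.IH[of n] Suc.IH[of "Suc n"] by simp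
  qed (use rec Suc.IH[of n] Suc.IH[of "Suc n"] in simp_all)
qed

text \<open>The binomial expansion of (1 - 1)^(n - j).\<close>

lemma alternating_choose_shift:
  assumes "j \<le> n"
  shows "(\<Sum>m\<in>{j..n}. (-1) ^ (m - j) * int ((n - j) choose (m - j))) = (if j = n then 1 else 0)"
proof -
  have "(\<Sum>m\<in>{j..n}. (-1) ^ (m - j) * int ((n - j) choose (m - j))) = (\<Sum>i\<le>n - j. (-1) ^ i * int ((n - j) choose i))"
    by (rule sum.reindex_bij_witness[where i = "\<lambda>i. i + j" and j = "\<lambda>m. m - j"]) (use assms in auto)
  also have "\<dots> = (if j = n then 1 else 0)"
    using choose_alternating_sum[of "n - j", where 'a = int] assms by auto
  finally show ?thesis .
qed

text \<open>After reversing the summation this is \<open>alternating_choose_divided\<close> with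
  \<open>M = m + n - k\<close>. For \<open>k = m\<close> the exponent of 1 - z is -1; for
  \<open>k < m\<close> it is \<open>m - k - 1\<close>, too small to have a coefficient of order
  \<open>m\<close>.\<close>

lemma divided_coeff_E:
  assumes "k \<le> m"
  shows "(\<Sum>j\<le>m. (-1) ^ (m - j) * (if k \<le> j + n then int (((j + n) choose j) * ((m - j + (j + n - k)) choose (m - j))) else 0))
     = (if k = m then 1 else (0::int))"
proof -
  have "(\<Sum>j\<le>m. (-1) ^ (m - j) * (if k \<le> j + n then int (((j + n) choose j) * ((m - j + (j + n - k)) choose (m - j))) else 0))
    = (\<Sum>i\<le>m. (-1) ^ i * int ((m + n - k) choose i) * int ((m - i + n) choose n))"
  proof (rule sum.reindex_bij_witness[where i = "\<lambda>i. m - i" and j = "\<lambda>j. m - j"])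
    fix j assume j: "j \<in> {..m}"
    have b: "(j + n) choose j = (j + n) choose n" using binomial_symmetric[of n "j + n"] by simp
    show "(-1) ^ (m - j) * int ((m + n - k) choose (m - j)) * int ((m - (m - j) + n) choose n) =
       (-1) ^ (m - j) * (if k \<le> j + n then int (((j + n) choose j) * ((m - j + (j + n - k)) choose (m - j))) else 0)"
    proof (cases "k \<le> j + n")
      case True
      then have "m - j + (j + n - k) = m + n - k" "m - (m - j) = j" using j by auto
      then show ?thesis using True b by simp
    next
      case False
      \<comment> \<open>For \<open>j + n < k\<close> the upper index is smaller than
        \<open>m - j\<close>, so the term missing on one side is zero on the other.\<close>
      then have "(m + n - k) choose (m - j) = 0" using assms j by (intro binomial_eq_0) auto
      then show ?thesis using False by simp
    qed
  qed auto
  also have "\<dots> = (if k = m then 1 else 0)"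
    unfolding alternating_choose_divided using assms by auto
  finally show ?thesis .
qed

text \<open>A finite difference of order \<open>m\<close> of a polynomial of degree
  \<open>k\<close>, which vanishes for \<open>k < m\<close> and equals 1 for
  \<open>k = m\<close>.\<close>

lemma ordinary_coeff_E:
  assumes "k \<le> m"
  shows "(\<Sum>j\<le>m. (-1) ^ (m - j) * int ((m - j + j) choose (m - j)) * (if k \<le> j + n then int ((k + (j + n - k)) choose k) else 0))
     = (if k = m then 1 else (0::int))"
proof -
  have "(\<Sum>j\<le>m. (-1) ^ (m - j) * int ((m - j + j) choose (m - j)) * (if k \<le> j + n then int ((k + (j + n - k)) choose k) else 0))
    = (\<Sum>j\<le>m. (-1) ^ (m - j) * int (m choose j) * int ((j + n) choose k))"
  proof (rule sum.cong)
    fix j assume "j \<in> {..m}"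
    then have "m choose (m - j) = m choose j" "m - j + j = m" using binomial_symmetric[of j m] by auto
    then show "(-1) ^ (m - j) * int ((m - j + j) choose (m - j)) * (if k \<le> j + n then int ((k + (j + n - k)) choose k) else 0) =
      (-1) ^ (m - j) * int (m choose j) * int ((j + n) choose k)" by auto
  qed simp
  also have "\<dots> = (if k = m then 1 else 0)"
    unfolding alternating_choose_ordinary using assms by auto
  finally show ?thesis .
qed

lemma divided_coeff_taylor:
  assumes "j \<le> n"
  shows "(\<Sum>m\<in>{j..n}. (-1) ^ (m - j) * int ((n - m + (m - j)) choose (n - m))) = (if j = n then 1 else (0::int))"
proof -
  have "(\<Sum>m\<in>{j..n}. (-1) ^ (m - j) * int ((n - m + (m - j)) choose (n - m))) = (\<Sum>m\<in>{j..n}. (-1) ^ (m - j) * int ((n - j) choose (m - j)))"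
  proof (rule sum.cong)
    fix m assume "m \<in> {j..n}"
    then have "n - m + (m - j) = n - j" "(n - j) choose (n - m) = (n - j) choose (m - j)"
      using binomial_symmetric[of "m - j" "n - j"] by auto
    then show "(-1) ^ (m - j) * int ((n - m + (m - j)) choose (n - m)) = (-1) ^ (m - j) * int ((n - j) choose (m - j))" by simp
  qed simp
  then show ?thesis using alternating_choose_shift[OF assms] by simp
qed

text \<open>Choosing \<open>m\<close> out of \<open>n\<close> and then \<open>j\<close> out of
  \<open>m\<close> is the same as choosing \<open>j\<close> first; with this factor pulled out, an
  alternating sum over a full row remains.\<close>

lemma ordinary_coeff_taylor:
  assumes "j \<le> n"
  shows "(\<Sum>m\<in>{j..n}. (-1) ^ (m - j) * int ((m - j + j) choose (m - j)) * int ((m + (n - m)) choose m)) = (if j = n then 1 else (0::int))"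
proof -
  have "(\<Sum>m\<in>{j..n}. (-1) ^ (m - j) * int ((m - j + j) choose (m - j)) * int ((m + (n - m)) choose m)) =
    (\<Sum>m\<in>{j..n}. int (n choose j) * ((-1) ^ (m - j) * int ((n - j) choose (m - j))))"
  proof (rule sum.cong)
    fix m assume m: "m \<in> {j..n}"
    then have "m choose (m - j) = m choose j" using binomial_symmetric[of j m] by auto
    moreover have "(n choose m) * (m choose j) = (n choose j) * ((n - j) choose (m - j))"
      using m by (intro choose_mult) auto
    then have "int (n choose m) * int (m choose j) = int (n choose j) * int ((n - j) choose (m - j))"
      by (simp only: of_nat_mult[symmetric])
    ultimately show "(-1) ^ (m - j) * int ((m - j + j) choose (m - j)) * int ((m + (n - m)) choose m) =
      int (n choose j) * ((-1) ^ (m - j) * int ((n - j) choose (m - j)))" using m by (simp add: algebra_simps)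
  qed simp
  also have "\<dots> = (if j = n then 1 else 0)"
    unfolding sum_distrib_left[symmetric] alternating_choose_shift[OF assms] by simp
  finally show ?thesis .
qed


section \<open>The tower of extensions\<close>

lemma (in graded_group) homog_pow: "x \<in> C i \<Longrightarrow> add_pow G (n::nat) x \<in> C i"
  by (induction n) (auto simp: homog_add homog_zero)

lemma (in free_basis) basis_cong:
  assumes "\<And>i. i \<in> I \<Longrightarrow> u' i = u i" shows "free_basis S G sc u' I"
proof (rule free_basisI[OF abS abG])
  show "additive_map S G (sc (u' i))" if "i \<in> I" for i using that assms sc_additive by simp
  have eq: "(\<Oplus>\<^bsub>G\<^esub>i\<in>K. sc (u' i) (c i)) = (\<Oplus>\<^bsub>G\<^esub>i\<in>K. sc (u i) (c i))" if "K \<subseteq> I" "c \<in> K \<rightarrow> carrier S" for K c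
    using that assms by (intro G.finsum_cong' refl) (auto simp: subset_iff intro!: sc_closed)
  show "\<exists>K c. finite K \<and> K \<subseteq> I \<and> c \<in> K \<rightarrow> carrier S \<and> y = (\<Oplus>\<^bsub>G\<^esub>i\<in>K. sc (u' i) (c i))" if y: "y \<in> carrier G" for y
  proof (intro exI conjI)
    show "finite {i. crd y i \<noteq> \<zero>\<^bsub>S\<^esub>}" "{i. crd y i \<noteq> \<zero>\<^bsub>S\<^esub>} \<subseteq> I" "crd y \<in> {i. crd y i \<noteq> \<zero>\<^bsub>S\<^esub>} \<rightarrow> carrier S"
      using y crd_sub finite_crd by auto
    then show "y = (\<Oplus>\<^bsub>G\<^esub>i\<in>{i. crd y i \<noteq> \<zero>\<^bsub>S\<^esub>}. sc (u' i) (crd y i))"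
      using crd_finsum[OF y, of "{i. crd y i \<noteq> \<zero>\<^bsub>S\<^esub>}"] eq by simp
  qed
  show "\<forall>i\<in>K. c i = \<zero>\<^bsub>S\<^esub>" if "finite K" "K \<subseteq> I" "c \<in> K \<rightarrow> carrier S" "(\<Oplus>\<^bsub>G\<^esub>i\<in>K. sc (u' i) (c i)) = \<zero>\<^bsub>G\<^esub>" for K c
    using indep[OF that(1-3)] that eq by simp
qed

text \<open>If \<open>1 = 0\<close> in \<open>B\<close>, then \<open>u\<close> need not be injective and the basis has to be replaced by \<open>{}\<close>.\<close>

lemma (in dg_module_over) basis_as_set:
  assumes fb: "free_basis B N (act N) u I" and hom: "\<And>i. i \<in> I \<Longrightarrow> \<exists>k. u i \<in> mgr N k"
  shows "\<exists>F\<subseteq>(\<Union>i. mgr N i). free_basis B N (act N) (\<lambda>x. x) F"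
proof (cases "\<one>\<^bsub>B\<^esub> = \<zero>\<^bsub>B\<^esub>")
  case True
  have "x = \<zero>\<^bsub>N\<^esub>" if "x \<in> carrier N" for x
    using N.act_one[OF that] act_zero_right[OF that] True by simp
  then have "free_basis B N (act N) (\<lambda>x. x) {}"
    by (intro free_basisI[OF abB abN]) (auto intro!: exI[of _ "{}"])
  then show ?thesis by blast
next
  case False
  interpret fb: free_basis B N "act N" u I by (rule fb)
  have uc: "u i \<in> carrier N" if "i \<in> I" for i using hom[OF that] N.gr.homog_closed by blast
  have inj: "inj_on u I"
  proof (rule inj_onI, rule ccontr)
    fix i j assume ij: "i \<in> I" "j \<in> I" "u i = u j" "i \<noteq> j"
    have "fb.crd (act N (u i) \<one>\<^bsub>B\<^esub>) i = fb.crd (act N (u j) \<one>\<^bsub>B\<^esub>) i" by (simp only: ij(3))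
    also have "\<dots> = \<zero>\<^bsub>B\<^esub>" using fb.crd_sc[OF ij(2) B.one_closed, of i] ij(4) by simp
    finally show False using fb.crd_sc[OF ij(1) B.one_closed, of i] False by simp
  qed
  let ?f = "inv_into I u"
  have "bij_betw ?f (u ` I) I" using inj by (simp add: bij_betw_inv_into inj_on_imp_bij_betw)
  then interpret fb': free_basis B N "act N" "\<lambda>j. u (?f j)" "u ` I" by (rule fb.reindex)
  have "free_basis B N (act N) (\<lambda>x. x) (u ` I)"
    by (rule fb'.basis_cong) (simp add: f_inv_into_f)
  moreover have "u ` I \<subseteq> (\<Union>i. mgr N i)" using hom by auto
  ultimately show ?thesis by blast
qed

text \<open>Extracts from semifreeness the homogeneous basis along which graded maps are
  lifted.\<close>

lemma (in dg_module_over) semifree_basis: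
  assumes "semifree B N" shows "\<exists>F\<subseteq>(\<Union>i. mgr N i). free_basis B N (act N) (\<lambda>x. x) F"
proof -
  obtain F where F: "F \<subseteq> (\<Union>i. mgr N i)" "right_independent B N F" "right_span B N F = carrier N"
    using assms by (auto simp: semifree_def)
  have Fc: "x \<in> carrier N" if "x \<in> F" for x using that F(1) N.gr.homog_closed by blast
  have "free_basis B N (act N) (\<lambda>x. x) F"
  proof (rule free_basisI[OF abB abN])
    show "additive_map B N (act N x)" if "x \<in> F" for x using additive_map_act_right[OF Fc[OF that]] by simp
    show "\<exists>K c. finite K \<and> K \<subseteq> F \<and> c \<in> K \<rightarrow> carrier B \<and> y = (\<Oplus>\<^bsub>N\<^esub>i\<in>K. act N i (c i))" if "y \<in> carrier N" for y
      using that unfolding F(3)[symmetric] right_span_def by blast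
    show "\<forall>i\<in>K. c i = \<zero>\<^bsub>B\<^esub>" if "finite K" "K \<subseteq> F" "c \<in> K \<rightarrow> carrier B" "(\<Oplus>\<^bsub>N\<^esub>i\<in>K. act N i (c i)) = \<zero>\<^bsub>N\<^esub>" for K c
      using F(2) that unfolding right_independent_def by blast
  qed
  then show ?thesis using F(1) by blast
qed

text \<open>Ordering a homogeneous basis by degree makes a bounded below module semifree, since the
  differential lowers degrees.\<close>

lemma (in dg_module_over) semifreeI:
  assumes fb: "free_basis B N (act N) (\<lambda>x. x) F" and F: "F \<subseteq> (\<Union>i. mgr N i)" and bb: "bounded_below N"
  shows "semifree B N"
proof -
  interpret fb: free_basis B N "act N" "\<lambda>x. x" F by (rule fb)
  obtain k where k: "\<And>i. i < k \<Longrightarrow> mgr N i = {\<zero>\<^bsub>N\<^esub>}" using bb by (auto simp: bounded_below_def)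
  have "\<exists>i. i \<ge> k \<and> f \<in> mgr N i" if f: "f \<in> F" for f
  proof -
    obtain i where i: "f \<in> mgr N i" using F f by blast
    show ?thesis
    proof (cases "i < k")
      case True
      \<comment> \<open>A basis element below the bound is zero and therefore also has degree
        \<open>k\<close>. The function \<open>d\<close> can thus be chosen bounded below, which
        well-foundedness requires.\<close>
      then have "f = \<zero>\<^bsub>N\<^esub>" using k i by blast
      then show ?thesis by (intro exI[of _ k]) simp
    next
      case False
      then show ?thesis using i by (intro exI[of _ i]) simp
    qed
  qed
  then obtain d where d: "\<And>f. f \<in> F \<Longrightarrow> d f \<ge> k \<and> f \<in> mgr N (d f)" by metis
  have Fc: "f \<in> carrier N" if "f \<in> F" for f using d[OF that] N.gr.homog_closed by blast
  obtain W where W: "well_order_on F W" using well_order_on by blast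
  \<comment> \<open>Degree first, with ties broken by an arbitrary well-order of the basis.\<close>
  define r where "r = {(x, y). x \<in> F \<and> y \<in> F \<and> (d x < d y \<or> d x = d y \<and> (x, y) \<in> W)}"
  have lin: "refl_on F W" "trans W" "antisym W" "total_on F W" "wf (W - Id)"
    using W by (auto simp: well_order_on_def linear_order_on_def partial_order_on_def preorder_on_def)
  have "well_order_on F r"
    unfolding well_order_on_def linear_order_on_def partial_order_on_def preorder_on_def
  proof (intro conjI)
    show "refl_on F r" using lin(1) by (auto simp: r_def refl_on_def)
    show "r \<subseteq> F \<times> F" by (auto simp: r_def)
    show "trans r" using lin(2) unfolding trans_def r_def by (auto; blast)
    show "antisym r" using lin(3) unfolding antisym_def r_def by auto
    show "total_on F r" using lin(4) unfolding total_on_def r_def by fastforce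
    have "r - Id \<subseteq> inv_image (less_than <*lex*> (W - Id)) (\<lambda>x. (nat (d x - k), x))"
      using d unfolding r_def by fastforce
    moreover have "wf (inv_image (less_than <*lex*> (W - Id)) (\<lambda>x. (nat (d x - k), x)))"
      by (intro wf_inv_image wf_lex_prod wf_less_than lin(5))
    ultimately show "wf (r - Id)" by (rule wf_subset[rotated])
  qed
  moreover have "right_independent B N F"
    unfolding right_independent_def using fb.indep by blast
  moreover have span: "y \<in> right_span B N E" if "y \<in> carrier N" "{f. fb.crd y f \<noteq> \<zero>\<^bsub>B\<^esub>} \<subseteq> E" "E \<subseteq> F" for y E
  proof -
    have "y = (\<Oplus>\<^bsub>N\<^esub>f\<in>{f. fb.crd y f \<noteq> \<zero>\<^bsub>B\<^esub>}. act N f (fb.crd y f))"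
      by (rule fb.crd_finsum) (use that fb.finite_crd fb.crd_sub in auto)
    then show ?thesis
      unfolding right_span_def using that fb.finite_crd[OF that(1)]
      by (intro CollectI exI[of _ "{f. fb.crd y f \<noteq> \<zero>\<^bsub>B\<^esub>}"] exI[of _ "fb.crd y"]) auto
  qed
  moreover have "right_span B N F = carrier N"
  proof
    show "carrier N \<subseteq> right_span B N F" using span fb.crd_sub by blast
    show "right_span B N F \<subseteq> carrier N"
      unfolding right_span_def using Fc by (auto intro!: N.finsum_closed N.act_closed)
  qed
  moreover have "mdiff N f \<in> right_span B N {g \<in> F. (g, f) \<in> r \<and> g \<noteq> f}" if f: "f \<in> F" for f
  proof (rule span)
    have m: "mdiff N f \<in> mgr N (d f - 1)" using N.mdiff_mgr d[OF f] by blast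
    show mc: "mdiff N f \<in> carrier N" using m N.gr.homog_closed by blast
    show "{g. fb.crd (mdiff N f) g \<noteq> \<zero>\<^bsub>B\<^esub>} \<subseteq> {g \<in> F. (g, f) \<in> r \<and> g \<noteq> f}"
    proof
      fix g assume "g \<in> {g. fb.crd (mdiff N f) g \<noteq> \<zero>\<^bsub>B\<^esub>}"
      then have ne: "fb.crd (mdiff N f) g \<noteq> \<zero>\<^bsub>B\<^esub>" and g: "g \<in> F" using fb.crd_sub[OF mc] by auto
      let ?k = "d f - 1"
      \<comment> \<open>The component of \<open>act N g b\<close> in degree \<open>?k\<close> only
        sees the part of \<open>b\<close> in degree \<open>?k - d g\<close>, and nothing if this is
        negative. So a nonzero coordinate of the differential at \<open>g\<close> forces
        \<open>d g \<le> ?k\<close>.\<close>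
      let ?\<psi> = "\<lambda>g b. if d g \<le> ?k then hcomp B (agr B) (nat (?k - d g)) b else \<zero>\<^bsub>B\<^esub>"
      have ps: "additive_map B B (?\<psi> g)" for g
        using B.gr.additive_map_hcomp by (cases "d g \<le> ?k") (auto simp: additive_map_def)
      have "fb.crd (hcomp N (mgr N) ?k (mdiff N f)) g = ?\<psi> g (fb.crd (mdiff N f) g)"
      proof (rule fb.crd_map[OF N.gr.additive_map_hcomp ps _ mc g])
        fix g b assume g: "g \<in> F" and b: "b \<in> carrier B"
        have gc: "g \<in> carrier N" by (rule Fc[OF g])
        show "hcomp N (mgr N) ?k (act N g b) = act N g (?\<psi> g b)"
        proof (rule B.gr.additive_map_eqI[OF _ _ _ b])
          show "additive_map B N (\<lambda>b. hcomp N (mgr N) ?k (act N g b))"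
            by (rule additive_map_comp[OF additive_map_act_right[OF gc] N.gr.additive_map_hcomp])
          show "additive_map B N (\<lambda>b. act N g (?\<psi> g b))"
            by (rule additive_map_comp[OF ps additive_map_act_right[OF gc]])
          fix n b assume b: "b \<in> agr B n"
          have "act N g b \<in> mgr N (d g + int n)" using N.act_mgr b d[OF g] by blast
          then show "hcomp N (mgr N) ?k (act N g b) = act N g (?\<psi> g b)"
            using gc by (auto simp: N.gr.hcomp_homog B.gr.hcomp_homog[OF b])
        qed
      qed
      then have "d g \<le> ?k" using ne N.gr.hcomp_homog[OF m, of ?k] by (auto split: if_splits)
      then show "g \<in> {g \<in> F. (g, f) \<in> r \<and> g \<noteq> f}" using f g by (auto simp: r_def)
    qed
  qed auto
  ultimately show ?thesis
    unfolding semifree_def using F N.dg_module_axioms by blast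
qed

text \<open>Moving a coefficient past the homogeneous \<open>p m\<close> only twists it, and
  twisting is an involution of the subalgebra. This bridges the right bases in the definition of an
  adjunction and the left bases used for right factors of tensors.\<close>

lemma (in dg_algebra) left_basis:
  assumes fb: "free_basis S A (\<lambda>x a. x \<otimes>\<^bsub>A\<^esub> a) p P" and p: "\<And>m. m \<in> P \<Longrightarrow> p m \<in> agr A (pd m)"
    and S: "\<And>a. a \<in> carrier S \<Longrightarrow> a \<in> carrier A" "\<And>n a. a \<in> carrier S \<Longrightarrow> twn A (agr A) n a \<in> carrier S"
      "\<zero>\<^bsub>S\<^esub> = \<zero>\<^bsub>A\<^esub>" "\<And>a b. a \<in> carrier S \<Longrightarrow> b \<in> carrier S \<Longrightarrow> a \<oplus>\<^bsub>S\<^esub> b = a \<oplus>\<^bsub>A\<^esub> b"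
  shows "free_basis S A (\<lambda>x a. a \<otimes>\<^bsub>A\<^esub> x) p P"
proof -
  interpret fb: free_basis S A "\<lambda>x a. x \<otimes>\<^bsub>A\<^esub> a" p P by (rule fb)
  have pc: "p m \<in> carrier A" if "m \<in> P" for m using p[OF that] agr_closed by blast
  have comm: "a \<otimes>\<^bsub>A\<^esub> p m = p m \<otimes>\<^bsub>A\<^esub> twn A (agr A) (pd m) a" if "m \<in> P" "a \<in> carrier A" for m a
    using that p by (simp add: mult_homog_right)
  have sum: "(\<Oplus>\<^bsub>A\<^esub>m\<in>K. c m \<otimes>\<^bsub>A\<^esub> p m) = (\<Oplus>\<^bsub>A\<^esub>m\<in>K. p m \<otimes>\<^bsub>A\<^esub> twn A (agr A) (pd m) (c m))"
    if "K \<subseteq> P" "c \<in> K \<rightarrow> carrier S" for K c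
    using that S(1) pc by (intro finsum_cong' refl) (auto simp: subset_iff Pi_iff comm)
  show ?thesis
  proof (rule free_basisI[OF fb.abS fb.abG])
    show "additive_map S A (\<lambda>a. a \<otimes>\<^bsub>A\<^esub> p m)" if "m \<in> P" for m
      using pc[OF that] S by (auto simp: additive_map_def l_distr)
    show "\<exists>K c. finite K \<and> K \<subseteq> P \<and> c \<in> K \<rightarrow> carrier S \<and> y = (\<Oplus>\<^bsub>A\<^esub>m\<in>K. c m \<otimes>\<^bsub>A\<^esub> p m)" if y: "y \<in> carrier A" for y
    proof (intro exI conjI)
      let ?K = "{m. fb.crd y m \<noteq> \<zero>\<^bsub>S\<^esub>}" and ?c = "\<lambda>m. twn A (agr A) (pd m) (fb.crd y m)"
      show K: "finite ?K" "?K \<subseteq> P" and c: "?c \<in> ?K \<rightarrow> carrier S" using y fb.crd_sub fb.finite_crd S(2) by auto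
      have "y = (\<Oplus>\<^bsub>A\<^esub>m\<in>?K. p m \<otimes>\<^bsub>A\<^esub> fb.crd y m)" using fb.crd_finsum[OF y K(1) order_refl K(2)] .
      also have "\<dots> = (\<Oplus>\<^bsub>A\<^esub>m\<in>?K. ?c m \<otimes>\<^bsub>A\<^esub> p m)"
        unfolding sum[OF K(2) c] using S(1) y by simp
      finally show "y = (\<Oplus>\<^bsub>A\<^esub>m\<in>?K. ?c m \<otimes>\<^bsub>A\<^esub> p m)" .
    qed
    show "\<forall>m\<in>K. c m = \<zero>\<^bsub>S\<^esub>" if K: "finite K" "K \<subseteq> P" "c \<in> K \<rightarrow> carrier S" "(\<Oplus>\<^bsub>A\<^esub>m\<in>K. c m \<otimes>\<^bsub>A\<^esub> p m) = \<zero>\<^bsub>A\<^esub>" for K c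
    proof
      fix m assume m: "m \<in> K"
      have cm: "c m \<in> carrier A" using K(3) m S(1) by auto
      have "twn A (agr A) (pd m) (c m) = \<zero>\<^bsub>S\<^esub>"
        using fb.indep[OF K(1,2), of "\<lambda>m. twn A (agr A) (pd m) (c m)" m] K S(2) sum[OF K(2,3)] m by auto
      then have "twn A (agr A) (pd m) (twn A (agr A) (pd m) (c m)) = \<zero>\<^bsub>A\<^esub>" using S(3) by simp
      then show "c m = \<zero>\<^bsub>S\<^esub>" using cm S(3) by simp
    qed
  qed
qed

text \<open>The induction hypothesis for the descent from \<open>B\<close> to \<open>A\<close>.\<close>

definition tower_state :: "('r, 'x) ring_scheme \<Rightarrow> ('r, 'b) dg_alg \<Rightarrow> ('b, 'n) dg_mod \<Rightarrow> ('r, 'b) dg_alg \<Rightarrow> bool" where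
  "tower_state R B N A \<longleftrightarrow> dg_subalgebra R A B \<and>
     (\<exists>(v :: nat \<Rightarrow> 'b) J vdeg. free_basis A B (\<lambda>x a. a \<otimes>\<^bsub>B\<^esub> x) v J \<and> (\<forall>j\<in>J. v j \<in> agr B (vdeg j))) \<and>
     (\<exists>F\<subseteq>(\<Union>i. mgr N i). free_basis A N (act N) (\<lambda>x. x) F) \<and>
     acyclic_below B N (tensor A N B) \<and>
     (\<exists>\<rho>\<in>Hom_cycles B N (tensor A N B) 0. \<forall>x\<in>carrier N. tensor_eval N (\<rho> x) = x)"

text \<open>Both bases are recorded: the right one passes freeness of \<open>N\<close> down the
  tower, the left one passes down freeness of the top algebra.\<close>

lemma adjunction_facts:
  assumes "adjunction R A X e p C"
  defines "P \<equiv> (if even e then UNIV else {0, 1})"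
  shows "dg_subalgebra R A C" "0 < e" "X \<in> agr C e" "adiff C X \<in> carrier A"
    "p 0 = \<one>\<^bsub>C\<^esub>" "p 1 = X" "\<And>m. p m \<in> agr C (m * e)"
    "free_basis A C (\<lambda>x a. x \<otimes>\<^bsub>C\<^esub> a) p P" "free_basis A C (\<lambda>x a. a \<otimes>\<^bsub>C\<^esub> x) p P"
proof -
  show sub: "dg_subalgebra R A C" and e: "0 < e" "X \<in> agr C e" "p 0 = \<one>\<^bsub>C\<^esub>" "p 1 = X"
    and p: "\<And>m. p m \<in> agr C (m * e)"
    using assms(1) by (auto simp: adjunction_def)
  interpret AC: dg_sub R A C by (rule dg_subI[OF sub])
  show "adiff C X \<in> carrier A" using assms(1) AC.A.agr_closed by (auto simp: adjunction_def)
  have pc: "p m \<in> carrier C" for m using p AC.B.agr_closed by blast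
  have "basis_of A C (\<lambda>x a. x \<otimes>\<^bsub>C\<^esub> a) p P"
    using assms(1) unfolding adjunction_def free_right_basis_def basis_of_def represents_def P_def by simp
  moreover have "additive_map A C (\<lambda>a. p m \<otimes>\<^bsub>C\<^esub> a)" for m
    using pc by (auto simp: additive_map_def AC.carrier_sub AC.add_sub AC.B.r_distr)
  ultimately show fb: "free_basis A C (\<lambda>x a. x \<otimes>\<^bsub>C\<^esub> a) p P"
    by (intro free_basis.intro free_basis_axioms.intro AC.abA AC.abB)
  show "free_basis A C (\<lambda>x a. a \<otimes>\<^bsub>C\<^esub> x) p P"
    by (rule AC.B.left_basis[OF fb p]) (auto simp: AC.carrier_sub AC.twn_closed_sub AC.zero_sub AC.add_sub)
qed

text \<open>A splitting is a cycle of degree 0, so \<open>cycle_lift\<close> applies. It remains a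
  splitting because evaluation factors through \<open>\<Theta> 0\<close>.\<close>

lemma (in filtered_lifting) lift_state:
  assumes "acyclic_below B N T'" "\<rho> \<in> Hom_cycles B N T' 0" "\<And>x. x \<in> carrier N \<Longrightarrow> ev' (\<rho> x) = x"
    and "\<And>y. y \<in> carrier T \<Longrightarrow> ev' (\<Theta> 0 y) = ev y"
  shows "acyclic_below B N T \<and> (\<exists>\<rho>\<in>Hom_cycles B N T 0. \<forall>x\<in>carrier N. ev (\<rho> x) = x)"
proof -
  obtain g where g: "g \<in> Hom_cycles B N T 0" "\<And>x. x \<in> carrier N \<Longrightarrow> \<Theta> 0 (g x) = \<rho> x"
    using cycle_lift[OF assms(1,2)] by blast
  have "ev (g x) = x" if x: "x \<in> carrier N" for x
  proof -
    have "g x \<in> carrier T" using g(1) x NT.Hom_closed[of g 0 x] by (simp add: NT.cycle_iff)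
    then show ?thesis using assms(3)[OF x] assms(4) g(2)[OF x] by metis
  qed
  then show ?thesis using g(1) acyclic_lift[OF assms(1)] by blast
qed

text \<open>Descends one variable. The hypothesis \<open>pow\<close> treats divided and ordinary
  powers as two alternatives for an even variable; for an odd one the two kinds of adjunction
  coincide.\<close>

lemma tower_step:
  assumes adj: "adjunction R A X e p C" and N: "dg_module B N" and bb: "bounded_below N" and sf: "semifree B N"
    and st: "tower_state R B N C"
    and pow: "even e \<Longrightarrow>
      (\<forall>m l. p m \<otimes>\<^bsub>C\<^esub> p l = add_pow C ((m + l) choose m) (p (m + l))) \<and>
        (\<forall>m\<ge>1. adiff C (p m) = p (m - 1) \<otimes>\<^bsub>C\<^esub> adiff C X) \<or>
      (\<forall>m l. p m \<otimes>\<^bsub>C\<^esub> p l = p (m + l)) \<and>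
        (\<forall>m\<ge>1. adiff C (p m) = add_pow C m (p (m - 1) \<otimes>\<^bsub>C\<^esub> adiff C X))"
  shows "tower_state R B N A"
proof -
  let ?P = "if even e then UNIV else {0, 1::nat}"
  note adj = adjunction_facts[OF adj]
  have CB: "dg_subalgebra R C B" using st by (simp add: tower_state_def)
  have AB: "dg_subalgebra R A B" by (rule dg_subalgebra_trans[OF adj(1) CB])
  interpret AC: dg_sub R A C by (rule dg_subI[OF adj(1)])
  interpret CB: dg_sub R C B by (rule dg_subI[OF CB])
  interpret AB: dg_sub R A B by (rule dg_subI[OF AB])
  interpret NB: dg_module_over R B N using N by (intro dg_module_over.intro CB.B.dg_algebra_axioms)
  interpret NC: dg_module_over R C N
    by (intro dg_module_over.intro AC.B.dg_algebra_axioms CB.module_restrict[OF N])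
  interpret NA: dg_module_over R A N
    by (intro dg_module_over.intro AC.A.dg_algebra_axioms AB.module_restrict[OF N])
  interpret two: two_base_changes R A C B N
    by (intro two_base_changes.intro base_change.intro AB.dg_sub_axioms CB.dg_sub_axioms NB.dg_module_over_axioms)
  obtain v :: "nat \<Rightarrow> _" and J vdeg where v: "free_basis C B (\<lambda>x a. a \<otimes>\<^bsub>B\<^esub> x) v J" "\<And>j. j \<in> J \<Longrightarrow> v j \<in> agr B (vdeg j)"
    using st unfolding tower_state_def by blast
  obtain F where F: "F \<subseteq> (\<Union>i. mgr N i)" "free_basis C N (act N) (\<lambda>x. x) F"
    using st unfolding tower_state_def by blast
  obtain \<rho> where \<rho>: "\<rho> \<in> Hom_cycles B N (tensor C N B) 0" "\<And>x. x \<in> carrier N \<Longrightarrow> tensor_eval N (\<rho> x) = x"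
    using st unfolding tower_state_def by blast
  have ac: "acyclic_below B N (tensor C N B)" using st by (simp add: tower_state_def)
  obtain F0 where F0: "F0 \<subseteq> (\<Union>i. mgr N i)" "free_basis B N (act N) (\<lambda>x. x) F0"
    using NB.semifree_basis[OF sf] by blast
  obtain dg where dg: "\<And>f. f \<in> F0 \<Longrightarrow> f \<in> mgr N (dg f)" using F0(1) by (metis UN_E subsetD)
  have pC: "p m \<in> carrier C" for m using adj(7) AC.B.agr_closed by blast
  have pB: "p m \<in> agr B (m * e)" for m using adj(7)[of m] by (simp add: CB.agr_sub)
  have vB: "v j \<in> carrier B" if "j \<in> J" for j using v(2)[OF that] CB.B.agr_closed by blast
  have ext: "ext_step R A C B N e p ?P v J vdeg q"
    if "\<And>m k. m \<in> ?P \<Longrightarrow> k \<le> m \<Longrightarrow> q k m \<in> agr C ((m - k) * e)" "\<And>m k. m \<in> ?P \<Longrightarrow> m < k \<Longrightarrow> q k m = \<zero>\<^bsub>C\<^esub>"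
      "\<And>m. m \<in> ?P \<Longrightarrow> q 0 m = p m" for q
    using that adj v by (intro ext_step.intro ext_step_axioms.intro two.two_base_changes_axioms) auto
  have "acyclic_below B N (tensor A N B) \<and> (\<exists>\<rho>\<in>Hom_cycles B N (tensor A N B) 0. \<forall>x\<in>carrier N. tensor_eval N (\<rho> x) = x)"
  proof (cases "even e")
    case False
    \<comment> \<open>The derivative of order 1 sends 1 to 0 and \<open>X\<close> to 1.\<close>
    define q where "q = (\<lambda>(k::nat) (m::nat). if k = 0 then p m else if k = 1 \<and> m = 1 then \<one>\<^bsub>C\<^esub> else \<zero>\<^bsub>C\<^esub>)"
    have "odd_step R A C B N e p ?P v J vdeg q X"
    proof (intro odd_step.intro odd_step_axioms.intro ext)
      show "q k m \<in> agr C ((m - k) * e)" if "m \<in> ?P" "k \<le> m" for m k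
        using that False adj(7)[of m] AC.B.one_agr by (cases k) (auto simp: q_def)
    qed (use False adj in \<open>auto simp: q_def\<close>)
    then interpret o: odd_step R A C B N e p ?P v J vdeg q X .
    interpret fl: filtered_lifting R B N two.S.T two.S'.T e "{0, 1}" "\<lambda>k. tmap A N B (o.fE k)" o.Th o.sec "\<lambda>x. x" F0 dg
      by (rule o.odd_filtered_lifting[OF bb F0(2) dg])
    show ?thesis by (rule fl.lift_state[OF ac \<rho> o.ev_Th0])
  next
    case True
    \<comment> \<open>The argument common to both kinds of powers, for any coefficients satisfying
      the axioms of \<open>even_step\<close>.\<close>
    have even: ?thesis
      if q: "\<And>m k. k \<le> m \<Longrightarrow> q k m = add_pow C (\<kappa> k (m - k)) (p (m - k))" "\<And>m k. m < k \<Longrightarrow> q k m = \<zero>\<^bsub>C\<^esub>"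
        and k0: "\<And>m. \<kappa> 0 m = 1"
        and ax: "even_step_axioms A C e p UNIV q \<kappa> \<mu> lam (adiff C X)" for q \<kappa> \<mu> lam
    proof -
      have "add_pow C (Suc 0) c = c" if "c \<in> carrier C" for c using that by simp
      then have "ext_step R A C B N e p ?P v J vdeg q"
        using True k0 pC adj(7) q
        by (intro ext) (auto simp: q k0 intro!: AC.B.gr.homog_pow)
      then interpret ev: even_step R A C B N e p UNIV v J vdeg q \<kappa> \<mu> lam "adiff C X"
        using True ax by (intro even_step.intro) simp_all
      interpret fl: filtered_lifting R B N two.S.T two.S'.T e UNIV "\<lambda>k. tmap A N B (ev.fE k)" ev.Th ev.sec "\<lambda>x. x" F0 dg
        by (rule ev.even_filtered_lifting[OF bb F0(2) dg])
      show ?thesis by (rule fl.lift_state[OF ac \<rho> ev.ev_Th0])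
    qed
    define t where "t = adiff C X"
    define q where "q = (\<lambda>\<kappa> k m. if k \<le> m then add_pow C ((\<kappa> :: nat \<Rightarrow> nat \<Rightarrow> nat) k (m - k)) (p (m - k)) else \<zero>\<^bsub>C\<^esub>)"
    have tA: "t \<in> carrier A" using adj(4) by (simp add: t_def)
    have one: "add_pow C (Suc 0) c = c" if "c \<in> carrier C" for c using that by simp
    have ptC: "p m \<otimes>\<^bsub>C\<^esub> t \<in> carrier C" for m using pC tA AC.carrier_sub by simp
    from pow[OF True] show ?thesis
    proof
      assume h: "(\<forall>m l. p m \<otimes>\<^bsub>C\<^esub> p l = add_pow C ((m + l) choose m) (p (m + l))) \<and>
        (\<forall>m\<ge>1. adiff C (p m) = p (m - 1) \<otimes>\<^bsub>C\<^esub> adiff C X)"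
      \<comment> \<open>Divided powers: derivatives only lower the index, products carry a binomial
        coefficient, and the differential has coefficient 1 except at index 0.\<close>
      let ?\<kappa> = "\<lambda>_ _ :: nat. 1 :: nat" and ?\<mu> = "\<lambda>i j :: nat. (i + j) choose i"
        and ?lam = "\<lambda>i :: nat. if i = 0 then 0 else (1 :: nat)"
      have "even_step_axioms A C e p UNIV (q ?\<kappa>) ?\<kappa> ?\<mu> ?lam t"
      proof (rule even_step_axioms.intro)
        show "adiff C (p (Suc i)) = add_pow C (?lam (Suc i)) (p i \<otimes>\<^bsub>C\<^esub> t)" for i
          using h ptC[of i] one[of "p i \<otimes>\<^bsub>C\<^esub> t"] by (simp add: t_def)
        show "(\<Sum>j\<le>m. (-1) ^ (m - j) * int (?\<kappa> (m - j) j) *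
          (if k \<le> j + n then int (?\<mu> j n * ?\<kappa> k (j + n - k) * ?\<mu> (m - j) (j + n - k)) else 0)) = (if k = m then 1 else 0)"
          if "k \<le> m" for k m n using divided_coeff_E[OF that, of n] by (simp cong: if_cong)
        show "(\<Sum>m\<in>{j..n}. (-1) ^ (m - j) * int (?\<kappa> (m - j) j) * int (?\<kappa> m (n - m) * ?\<mu> (n - m) (m - j))) = (if j = n then 1 else 0)"
          if "j \<le> n" for j n using divided_coeff_taylor[OF that] by simp
      qed (use True h tA in \<open>auto simp: q_def\<close>)
      then show ?thesis by (intro even[of "q ?\<kappa>" ?\<kappa> ?\<mu> ?lam]) (auto simp: q_def t_def)
    next
      assume h: "(\<forall>m l. p m \<otimes>\<^bsub>C\<^esub> p l = p (m + l)) \<and>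
        (\<forall>m\<ge>1. adiff C (p m) = add_pow C m (p (m - 1) \<otimes>\<^bsub>C\<^esub> adiff C X))"
      \<comment> \<open>Ordinary powers: Hasse derivatives carry a binomial coefficient, products
        carry none, and the differential has the exponent as coefficient.\<close>
      let ?\<kappa> = "\<lambda>i j :: nat. (i + j) choose i" and ?\<mu> = "\<lambda>_ _ :: nat. 1 :: nat" and ?lam = "\<lambda>i :: nat. i"
      have "even_step_axioms A C e p UNIV (q ?\<kappa>) ?\<kappa> ?\<mu> ?lam t"
      proof (rule even_step_axioms.intro)
        show "p i \<otimes>\<^bsub>C\<^esub> p j = add_pow C (?\<mu> i j) (p (i + j))" for i j
          using h one[OF pC] by simp
        show "adiff C (p (Suc i)) = add_pow C (?lam (Suc i)) (p i \<otimes>\<^bsub>C\<^esub> t)" for i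
          using h[THEN conjunct2, rule_format, of "Suc i"] by (simp add: t_def del: AC.B.add.nat_pow_Suc)
        show "?\<kappa> (Suc i) j * ?lam (Suc i) = ?\<kappa> i (Suc j) * ?lam (Suc j)" for i j
          using Suc_times_binomial_add[of i j] by (simp add: mult.commute)
        show "(\<Sum>j\<le>m. (-1) ^ (m - j) * int (?\<kappa> (m - j) j) *
          (if k \<le> j + n then int (?\<mu> j n * ?\<kappa> k (j + n - k) * ?\<mu> (m - j) (j + n - k)) else 0)) = (if k = m then 1 else 0)"
          if "k \<le> m" for k m n using ordinary_coeff_E[OF that, of n] by (simp cong: if_cong)
        show "(\<Sum>m\<in>{j..n}. (-1) ^ (m - j) * int (?\<kappa> (m - j) j) * int (?\<kappa> m (n - m) * ?\<mu> (n - m) (m - j))) = (if j = n then 1 else 0)"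
          if "j \<le> n" for j n using ordinary_coeff_taylor[OF that] by simp
      qed (use True h tA in \<open>auto simp: q_def\<close>)
      then show ?thesis by (intro even[of "q ?\<kappa>" ?\<kappa> ?\<mu> ?lam]) (auto simp: q_def t_def)
    qed
  qed
  moreover have "\<exists>(v :: nat \<Rightarrow> _) J vdeg. free_basis A B (\<lambda>x a. a \<otimes>\<^bsub>B\<^esub> x) v J \<and> (\<forall>j\<in>J. v j \<in> agr B (vdeg j))"
  proof -
    have pBc: "p m \<in> carrier B" for m using pB CB.B.agr_closed by blast
    have "free_basis A B (\<lambda>x a. a \<otimes>\<^bsub>B\<^esub> x) (\<lambda>(j, m). p m \<otimes>\<^bsub>B\<^esub> v j) (J \<times> ?P)"
    proof (rule free_basis_trans[OF v(1) adj(9)])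
      show "additive_map A B (\<lambda>a. a \<otimes>\<^bsub>B\<^esub> (p m \<otimes>\<^bsub>B\<^esub> v j))" if "j \<in> J" for j m
        using vB[OF that] pBc by (auto simp: additive_map_def AB.carrier_sub AB.add_sub CB.B.l_distr)
      show "(a \<otimes>\<^bsub>C\<^esub> p m) \<otimes>\<^bsub>B\<^esub> v j = a \<otimes>\<^bsub>B\<^esub> (p m \<otimes>\<^bsub>B\<^esub> v j)" if "j \<in> J" "a \<in> carrier A" for a m j
        using vB[OF \<open>j \<in> J\<close>] \<open>a \<in> carrier A\<close> pBc pC AC.carrier_sub
        by (simp add: CB.mult_sub AB.carrier_sub CB.B.m_assoc)
    qed
    then interpret fb: free_basis A B "\<lambda>x a. a \<otimes>\<^bsub>B\<^esub> x" "\<lambda>(j, m). p m \<otimes>\<^bsub>B\<^esub> v j" "J \<times> ?P" .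
    \<comment> \<open>Pairs are encoded as natural numbers so that the index type of the basis stays
      the same throughout the descent.\<close>
    let ?I = "prod_decode -` (J \<times> ?P)" and ?u = "\<lambda>k. case prod_decode k of (j, m) \<Rightarrow> p m \<otimes>\<^bsub>B\<^esub> v j"
      and ?d = "\<lambda>k. case prod_decode k of (j, m) \<Rightarrow> m * e + vdeg j"
    have "bij_betw prod_decode ?I (J \<times> ?P)"
      by (rule bij_betwI[where g = prod_encode]) auto
    then have "free_basis A B (\<lambda>x a. a \<otimes>\<^bsub>B\<^esub> x) ?u ?I" by (rule fb.reindex)
    moreover have "\<forall>k\<in>?I. ?u k \<in> agr B (?d k)"
      using pB v(2) by (auto split: prod.splits intro!: CB.B.mult_agr)
    ultimately show ?thesis by (intro exI conjI)
  qed
  moreover have "\<exists>F\<subseteq>(\<Union>i. mgr N i). free_basis A N (act N) (\<lambda>x. x) F"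
  proof -
    have Fc: "f \<in> carrier N" if "f \<in> F" for f using that F(1) NB.N.gr.homog_closed by blast
    \<comment> \<open>Basis elements of \<open>N\<close> over \<open>C\<close> are multiplied by the
      powers of \<open>X\<close>.\<close>
    have "free_basis A N (act N) (\<lambda>(f, m). act N f (p m)) (F \<times> ?P)"
    proof (rule free_basis_trans[OF F(2) adj(8)])
      show "additive_map A N (act N (act N f (p m)))" if "f \<in> F" for f m
        using NA.additive_map_act_right NC.N.act_closed[OF Fc[OF that] pC] by blast
      show "act N f (p m \<otimes>\<^bsub>C\<^esub> a) = act N (act N f (p m)) a" if "f \<in> F" "a \<in> carrier A" for f m a
        using Fc[OF \<open>f \<in> F\<close>] \<open>a \<in> carrier A\<close> pC AC.carrier_sub by (simp add: NC.N.act_mult)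
    qed
    then show ?thesis
    proof (rule NA.basis_as_set)
      fix k assume "k \<in> F \<times> ?P"
      then obtain i where "fst k \<in> mgr N i" using F(1) by auto
      then have "act N (fst k) (p (snd k)) \<in> mgr N (i + int (snd k * e))"
        using NC.N.act_mgr adj(7) by blast
      then show "\<exists>i. (case k of (f, m) \<Rightarrow> act N f (p m)) \<in> mgr N i" by (auto split: prod.splits)
    qed
  qed
  ultimately show ?thesis using AB by (simp add: tower_state_def)
qed


section \<open>Transfer along retracts, and the start and course of the descent\<close>

lemma dg_hom_additive: "dg_hom B M N f \<Longrightarrow> additive_map M N f"
  by (simp add: dg_hom_def additive_map_def)

lemma dg_hom_comp: "dg_hom B L M f \<Longrightarrow> dg_hom B M N g \<Longrightarrow> dg_hom B L N (\<lambda>x. g (f x))"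
  unfolding dg_hom_def by (auto simp: image_subset_iff Pi_iff)

lemma dg_hom_id: "dg_hom B M M (\<lambda>x. x)"
  by (simp add: dg_hom_def)

lemma (in hom_complex) Hom_postcomp:
  assumes "dg_module B T'" "dg_hom B T T' g" "f \<in> H q"
  shows "(\<lambda>x\<in>carrier N. g (f x)) \<in> Hom_deg B N T' q"
proof -
  interpret T': dg_module B T' by fact
  interpret H': hom_complex R B N T'
    by (intro hom_complex.intro dg_module_over.intro N.dg_module_over_axioms N.B.dg_algebra_axioms T'.dg_module_axioms)
  show ?thesis
  proof (rule H'.HomI)
    show "additive_map N T' (\<lambda>x. g (f x))"
      by (rule additive_map_comp[OF Hom_additive[OF assms(3)] dg_hom_additive[OF assms(2)]])
  qed (use assms(2) Hom_act[OF assms(3)] Hom_closed[OF assms(3)] Hom_mgr[OF assms(3)] in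
      \<open>auto simp: dg_hom_def image_subset_iff\<close>)
qed

lemma (in hom_complex) Hom_diff_postcomp:
  assumes "dg_module B T'" "dg_hom B T T' g" "f \<in> H q" "x \<in> carrier N"
  shows "Hom_diff N T' q (\<lambda>x\<in>carrier N. g (f x)) x = g (Hom_diff N T q f x)"
proof -
  interpret T': dg_module B T' by fact
  have ab: "abelian_group T'" ..
  have g: "additive_map T T' g" by (rule dg_hom_additive[OF assms(2)])
  have c: "f x \<in> carrier T" "f (mdiff N x) \<in> carrier T"
    using Hom_closed[OF assms(3)] assms(4) N.N.mdiff_closed by auto
  have "g (mdiff T (f x)) = mdiff T' (g (f x))" using assms(2) c by (simp add: dg_hom_def)
  then show ?thesis
    using additive_map_minus[OF T.abN ab g, of "mdiff T (f x)" "sg T q (f (mdiff N x))"] c assms(4)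
      additive_map_sg_commute[OF T.abN ab g c(2), of q]
    by (simp add: Hom_diff_def N.N.mdiff_closed T.N.mdiff_closed)
qed

text \<open>Composing with \<open>g\<close> carries a cycle to \<open>T'\<close>, where it bounds;
  composing the homotopy with \<open>r\<close> brings it back, because \<open>r\<close> undoes
  \<open>g\<close>.\<close>

lemma (in hom_complex) acyclic_below_retract:
  assumes T': "dg_module B T'" and g: "dg_hom B T T' g" and r: "dg_hom B T' T r"
    and rg: "\<And>y. y \<in> carrier T \<Longrightarrow> r (g y) = y" and ac: "acyclic_below B N T'"
  shows "acyclic_below B N T"
  unfolding acyclic_below_def
proof (intro allI impI subsetI)
  fix q :: int and f assume q: "q < 0" and f: "f \<in> Hom_cycles B N T q"
  interpret H': hom_complex R B N T'
    by (intro hom_complex.intro dg_module_over.intro N.dg_module_over_axioms N.B.dg_algebra_axioms T')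
  have fH: "f \<in> H q" using f by (simp add: cycle_iff)
  have ga: "additive_map T T' g" by (rule dg_hom_additive[OF g])
  let ?gf = "\<lambda>x\<in>carrier N. g (f x)"
  have "mdiff T' (g (f x)) = sg T' q (g (f (mdiff N x)))" if x: "x \<in> carrier N" for x
  proof -
    have c: "f x \<in> carrier T" "f (mdiff N x) \<in> carrier T"
      using Hom_closed[OF fH] x N.N.mdiff_closed by auto
    have "mdiff T' (g (f x)) = g (mdiff T (f x))" using g c by (simp add: dg_hom_def)
    also have "\<dots> = g (sg T q (f (mdiff N x)))" using f x by (simp add: cycle_iff)
    finally show ?thesis using additive_map_sg_commute[OF T.abN H'.T.abN ga c(2), of q] by simp
  qed
  then have "?gf \<in> Hom_cycles B N T' q"
    using Hom_postcomp[OF T' g fH] by (simp add: H'.cycle_iff N.N.mdiff_closed)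
  then obtain h where h: "h \<in> Hom_deg B N T' (q + 1)" "Hom_diff N T' (q + 1) h = ?gf"
    using ac q unfolding acyclic_below_def Hom_boundaries_def by fastforce
  let ?rh = "\<lambda>x\<in>carrier N. r (h x)"
  have rh: "?rh \<in> H (q + 1)" by (rule H'.Hom_postcomp[OF T.N.dg_module_axioms r h(1)])
  have "Hom_diff N T (q + 1) ?rh = f"
  proof (rule Hom_eqI[OF Hom_diff_mem[OF rh] fH])
    fix x assume x: "x \<in> carrier N"
    have "Hom_diff N T (q + 1) ?rh x = r (Hom_diff N T' (q + 1) h x)"
      by (rule H'.Hom_diff_postcomp[OF T.N.dg_module_axioms r h(1) x])
    then show "Hom_diff N T (q + 1) ?rh x = f x" using x h(2) rg Hom_closed[OF fH x] by simp
  qed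
  then show "f \<in> Hom_boundaries B N T q" using rh by (auto simp: Hom_boundaries_def)
qed

text \<open>A trivial quotient has the boundaries as its only coset, so each cycle lies in its own
  coset and hence among the boundaries.\<close>

lemma (in hom_complex) acyclic_of_Ext:
  assumes "\<forall>i>0. trivial_group (Ext B i N T)" shows "acyclic_below B N T"
  unfolding acyclic_below_def
proof (intro allI impI subsetI)
  fix q :: int and f assume q: "q < 0" and f: "f \<in> Hom_cycles B N T q"
  have fH: "f \<in> H q" using f by (simp add: cycle_iff)
  let ?G = "(Hom_group B N T q)\<lparr>carrier := Hom_cycles B N T q\<rparr>" and ?b = "Hom_boundaries B N T q"
  let ?z = "\<lambda>x\<in>carrier N. \<zero>\<^bsub>T\<^esub>"
  have "trivial_group (Ext B (- q) N T)" using assms q by simp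
  then have "carrier (?G Mod ?b) = {?b}"
    by (simp add: Ext_def Hom_homology_def trivial_group_def)
  then have c: "?b #>\<^bsub>?G\<^esub> f = ?b" using f by (simp add: carrier_FactGroup) blast
  have "?z \<in> H (q + 1)" by (rule HomI) (auto simp: additive_map_def)
  moreover have "Hom_diff N T (q + 1) ?z = ?z"
    by (auto simp: Hom_diff_def N.N.mdiff_closed a_minus_def restrict_def)
  ultimately have "?z \<in> ?b" by (auto simp: Hom_boundaries_def intro: rev_image_eqI)
  \<comment> \<open>The cycle is written as zero plus itself to exhibit it in its coset, which needs
    the zero map to be a boundary.\<close>
  then have "(\<lambda>x\<in>carrier N. ?z x \<oplus>\<^bsub>T\<^esub> f x) \<in> ?b #>\<^bsub>?G\<^esub> f"
    unfolding r_coset_def by (intro UN_I[of ?z]) (simp_all add: Hom_group_def)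
  moreover have "(\<lambda>x\<in>carrier N. ?z x \<oplus>\<^bsub>T\<^esub> f x) = f"
    using fH by (auto simp: fun_eq_iff Hom_closed Hom_ext)
  ultimately show "f \<in> ?b" using c by simp
qed

text \<open>Sending \<open>x\<close> to \<open>x \<otimes> 1\<close> is inverse to evaluation on the
  tensor product of \<open>N\<close> with \<open>B\<close> over \<open>B\<close> itself. Thus the
  splitting exists, and acyclicity transfers from \<open>N\<close>.\<close>

lemma (in dg_module_over) tower_start:
  assumes sf: "semifree B N" and ac: "acyclic_below B N N"
  shows "tower_state R B N B"
proof -
  have BB: "dg_subalgebra R B B" by (rule dg_subalgebra_refl[OF B.dg_algebra_axioms])
  interpret S: base_change R B B N
    by (intro base_change.intro dg_subI BB dg_module_over_axioms)
  interpret NT: hom_complex R B N S.T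
    by (intro hom_complex.intro dg_module_over.intro dg_module_over_axioms B.dg_algebra_axioms S.dg_module_T)
  define \<rho> where "\<rho> = (\<lambda>x. tcl B N B (frag_of (x, \<one>\<^bsub>B\<^esub>)))"
  have \<rho>c: "\<rho> x \<in> carrier S.T" if "x \<in> carrier N" for x using that by (simp add: \<rho>_def S.cl_closed)
  have act: "\<rho> (act N x b) = tcl B N B (frag_of (x, b))" if "x \<in> carrier N" "b \<in> carrier B" for x b
    using S.cg_balanced[of x b "\<one>\<^bsub>B\<^esub>"] that by (simp add: \<rho>_def S.cl_eq_iff)
  have add: "additive_map N S.T \<rho>"
    by (rule additive_mapI[OF \<rho>c]) (simp_all add: \<rho>_def S.T_add S.cl_eq_iff S.cg_add_left)
  have \<rho>h: "dg_hom B N S.T \<rho>"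
    unfolding dg_hom_def
  proof (intro conjI ballI allI image_subsetI)
    fix x b assume "x \<in> carrier N" "b \<in> carrier B"
    then show "\<rho> (act N x b) = act S.T (\<rho> x) b" by (simp add: act) (simp add: \<rho>_def S.act_T)
  next
    fix i x assume "x \<in> mgr N i"
    then show "\<rho> x \<in> mgr S.T i" using S.frag_of_mgr[OF _ B.one_agr] by (simp add: \<rho>_def)
  next
    fix x assume x: "x \<in> carrier N"
    have "S.cg (frag_of (mdiff N x, \<one>\<^bsub>B\<^esub>) + frag_of (tN x, \<zero>\<^bsub>B\<^esub>)) (frag_of (mdiff N x, \<one>\<^bsub>B\<^esub>) + 0)"
      using x by (intro S.cg_add S.cg_refl S.cg_zero_right) simp
    then show "\<rho> (mdiff N x) = mdiff S.T (\<rho> x)"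
      using x by (simp add: \<rho>_def S.mdiff_T B.adiff_one S.cl_eq_iff S.cg_sym)
  qed (use add in \<open>auto simp: additive_map_def\<close>)
  have ev\<rho>: "tensor_eval N (\<rho> x) = x" if "x \<in> carrier N" for x
    using that by (simp add: \<rho>_def S.ev_tensor N.act_one)
  have ec: "tensor_eval N y \<in> carrier N" if "y \<in> carrier S.T" for y
    using additive_map_closed[OF S.additive_map_ev that] .
  have \<rho>ev: "\<rho> (tensor_eval N y) = y" if "y \<in> carrier S.T" for y
    using that
  proof (induction rule: S.T_induct)
    case (tensor x b)
    then show ?case by (simp add: S.ev_tensor act)
  next
    case (minus y z)
    then show ?case
      using additive_map_minus[OF S.abelian_group_T abN S.additive_map_ev, of y z]
        additive_map_minus[OF abN S.abelian_group_T add] ec by simp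
  qed
  have "(\<lambda>x\<in>carrier N. \<rho> x) \<in> Hom_deg B N S.T 0"
    by (rule NT.HomI[OF add]) (use \<rho>h in \<open>auto simp: dg_hom_def image_subset_iff\<close>)
  moreover have "mdiff S.T (\<rho> x) = \<rho> (mdiff N x)" if "x \<in> carrier N" for x
    using \<rho>h that by (simp add: dg_hom_def)
  ultimately have "(\<lambda>x\<in>carrier N. \<rho> x) \<in> Hom_cycles B N S.T 0"
    by (simp add: NT.cycle_iff N.mdiff_closed) (simp add: sg_def)
  then have "\<exists>\<rho>\<in>Hom_cycles B N S.T 0. \<forall>x\<in>carrier N. tensor_eval N (\<rho> x) = x"
    using ev\<rho> by (intro bexI) auto
  moreover have "acyclic_below B N S.T"
    by (rule NT.acyclic_below_retract[OF N.dg_module_axioms S.dg_hom_ev \<rho>h \<rho>ev ac])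
  moreover have "\<exists>(v :: nat \<Rightarrow> _) J vdeg. free_basis B B (\<lambda>x a. a \<otimes>\<^bsub>B\<^esub> x) v J \<and> (\<forall>j\<in>J. v j \<in> agr B (vdeg j))"
  proof (intro exI conjI)
    \<comment> \<open>\<open>B\<close> is free over itself on 1, indexed by 0 to fit the index type
      of \<open>tower_state\<close>.\<close>
    show "free_basis B B (\<lambda>x a. a \<otimes>\<^bsub>B\<^esub> x) (\<lambda>_. \<one>\<^bsub>B\<^esub>) {0 :: nat}"
    proof (rule free_basisI[OF abB abB])
      show "\<exists>K c. finite K \<and> K \<subseteq> {0 :: nat} \<and> c \<in> K \<rightarrow> carrier B \<and> y = (\<Oplus>\<^bsub>B\<^esub>i\<in>K. c i \<otimes>\<^bsub>B\<^esub> \<one>\<^bsub>B\<^esub>)"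
        if "y \<in> carrier B" for y
        using that by (intro exI[of _ "{0}"] exI[of _ "\<lambda>_. y"]) simp
      show "\<forall>i\<in>K. c i = \<zero>\<^bsub>B\<^esub>" if "finite K" "K \<subseteq> {0 :: nat}" "c \<in> K \<rightarrow> carrier B"
        "(\<Oplus>\<^bsub>B\<^esub>i\<in>K. c i \<otimes>\<^bsub>B\<^esub> \<one>\<^bsub>B\<^esub>) = \<zero>\<^bsub>B\<^esub>" for K c
        using that by (cases "K = {}") (auto simp: subset_singleton_iff)
    qed (auto simp: additive_map_def)
    show "\<forall>j\<in>{0}. \<one>\<^bsub>B\<^esub> \<in> agr B ((\<lambda>_. 0) j)" using B.one_agr by simp
  qed
  ultimately show ?thesis
    using BB semifree_basis[OF sf] by (simp add: tower_state_def)
qed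

text \<open>Induction downwards along the tower. The polynomial and the free case differ only in the
  multiplication rule handed to \<open>tower_step\<close>.\<close>

lemma tower_descent:
  assumes it: "iterated_ext E A n X e B" and E: "E = simple_free_ext R \<or> E = simple_poly_ext R"
    and N: "dg_module B N" "bounded_below N" "semifree B N" and start: "tower_state R B N B"
  shows "tower_state R B N A"
proof -
  obtain C where C: "C 0 = A" "C n = B" "\<And>i. i < n \<Longrightarrow> E (C i) (X i) (e i) (C (Suc i))"
    using it by (auto simp: iterated_ext_def)
  have "tower_state R B N (C 0)"
  proof (rule inc_induct[where P = "\<lambda>i. tower_state R B N (C i)" and j = n])
    show "0 \<le> n" by simp
    show "tower_state R B N (C n)" using C(2) start by simp
    fix i assume i: "i < n" and st: "tower_state R B N (C (Suc i))"
    from E show "tower_state R B N (C i)"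
    proof
      assume "E = simple_free_ext R"
      then obtain p where "adjunction R (C i) (X i) (e i) p (C (Suc i))"
        "even (e i) \<Longrightarrow> (\<forall>m l. p m \<otimes>\<^bsub>C (Suc i)\<^esub> p l = add_pow (C (Suc i)) ((m + l) choose m) (p (m + l))) \<and>
           (\<forall>m\<ge>1. adiff (C (Suc i)) (p m) = p (m - 1) \<otimes>\<^bsub>C (Suc i)\<^esub> adiff (C (Suc i)) (X i))"
        using C(3)[OF i] by (auto simp: simple_free_ext_def)
      then show ?thesis by (intro tower_step[OF _ N st]) blast+
    next
      assume "E = simple_poly_ext R"
      then have h: "adjunction R (C i) (X i) (e i) (\<lambda>m::nat. X i [^]\<^bsub>C (Suc i)\<^esub> m) (C (Suc i))"
        "even (e i) \<Longrightarrow> \<forall>m\<ge>1::nat. adiff (C (Suc i)) (X i [^]\<^bsub>C (Suc i)\<^esub> m) =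
           add_pow (C (Suc i)) m (X i [^]\<^bsub>C (Suc i)\<^esub> (m - 1) \<otimes>\<^bsub>C (Suc i)\<^esub> adiff (C (Suc i)) (X i))"
        using C(3)[OF i] by (auto simp: simple_poly_ext_def)
      note adj = adjunction_facts[OF h(1)]
      interpret D: dg_sub R "C i" "C (Suc i)" by (rule dg_subI[OF adj(1)])
      have "X i [^]\<^bsub>C (Suc i)\<^esub> m \<otimes>\<^bsub>C (Suc i)\<^esub> X i [^]\<^bsub>C (Suc i)\<^esub> l = X i [^]\<^bsub>C (Suc i)\<^esub> (m + l)" for m l :: nat
        using D.B.agr_closed[OF adj(3)] by (simp add: D.B.nat_pow_mult)
      then show ?thesis using h(2) by (intro tower_step[OF h(1) N st]) blast
    qed
  qed
  then show ?thesis using C(1) by simp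
qed

section \<open>Liftability\<close>

lemma (in dg_module_over) dg_hom_zero:
  assumes "dg_module B M" shows "dg_hom B M N (\<lambda>_. \<zero>\<^bsub>N\<^esub>)"
  by (auto simp: dg_hom_def)

lemma (in hom_complex) hcomp_dg_hom:
  assumes f: "dg_hom B N T f" and x: "x \<in> carrier N"
  shows "f (hcomp N (mgr N) i x) = hcomp T (mgr T) i (f x)"
proof (rule N.N.gr.additive_map_eqI[OF _ _ _ x])
  have fa: "additive_map N T f" by (rule dg_hom_additive[OF f])
  show "additive_map N T (\<lambda>x. f (hcomp N (mgr N) i x))"
    by (rule additive_map_comp[OF N.N.gr.additive_map_hcomp fa])
  show "additive_map N T (\<lambda>x. hcomp T (mgr T) i (f x))"
    by (rule additive_map_comp[OF fa T.N.gr.additive_map_hcomp])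
  fix j x assume x: "x \<in> mgr N j"
  then have "f x \<in> mgr T j" using f by (auto simp: dg_hom_def image_subset_iff)
  then show "f (hcomp N (mgr N) i x) = hcomp T (mgr T) i (f x)"
    using x additive_map_zero[OF N.abN T.abN fa] by (simp add: N.N.gr.hcomp_homog T.N.gr.hcomp_homog)
qed

text \<open>One lemma for both summands of a splitting: the image of an idempotent is its equalizer
  with the identity, the kernel its equalizer with zero. The grading restricts because DG
  homomorphisms commute with homogeneous components.\<close>

lemma (in hom_complex) dg_module_equalizer:
  assumes f: "dg_hom B N T f" and g: "dg_hom B N T g"
  shows "dg_module B (dg_submodule N {x \<in> carrier N. f x = g x})"
proof -
  let ?S = "{x \<in> carrier N. f x = g x}" and ?D = "dg_submodule N {x \<in> carrier N. f x = g x}"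
  have fa: "additive_map N T f" "additive_map N T g" using f g by (auto intro: dg_hom_additive)
  have D [simp]: "carrier ?D = ?S" "ring.add ?D = ring.add N" "\<zero>\<^bsub>?D\<^esub> = \<zero>\<^bsub>N\<^esub>" "act ?D = act N"
    "mgr ?D i = ?S \<inter> mgr N i" "mdiff ?D = mdiff N" for i
    by (simp_all add: dg_submodule_def)
  have z: "\<zero>\<^bsub>N\<^esub> \<in> ?S"
    using additive_map_zero[OF N.abN T.abN fa(1)] additive_map_zero[OF N.abN T.abN fa(2)] by simp
  have ng: "\<ominus>\<^bsub>N\<^esub> x \<in> ?S" if "x \<in> ?S" for x using that additive_map_neg[OF N.abN T.abN fa(1)] additive_map_neg[OF N.abN T.abN fa(2)] by simp
  have ad: "x \<oplus>\<^bsub>N\<^esub> y \<in> ?S" if "x \<in> ?S" "y \<in> ?S" for x y using that additive_map_add[OF fa(1)] additive_map_add[OF fa(2)] by simp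
  have ab: "abelian_group ?D"
  proof (rule abelian_groupI)
    show "\<exists>y\<in>carrier ?D. y \<oplus>\<^bsub>?D\<^esub> x = \<zero>\<^bsub>?D\<^esub>" if "x \<in> carrier ?D" for x
      using that ng[of x] N.N.l_neg by (intro bexI[of _ "\<ominus>\<^bsub>N\<^esub> x"]) auto
  qed (use z ad N.N.a_ac in auto)
  have incl: "additive_map ?D N (\<lambda>x. x)" by (simp add: additive_map_def)
  have neg: "\<ominus>\<^bsub>?D\<^esub> x = \<ominus>\<^bsub>N\<^esub> x" if "x \<in> ?S" for x
    using additive_map_neg[OF ab N.abN incl, of x] that by simp
  have hc: "hcomp N (mgr N) i x \<in> ?S" if "x \<in> ?S" for x i
    using that hcomp_dg_hom[OF f, of x i] hcomp_dg_hom[OF g, of x i] by simp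
  have fs: "finsum ?D h K = finsum N h K" if "h \<in> K \<rightarrow> ?S" for h and K :: "int set"
    using additive_map_finsum[OF ab N.abN incl, of h K] that by simp
  have gr: "graded_by ?D (mgr ?D)"
  proof (rule graded_byI[OF ab, where pr = "hcomp N (mgr N)"])
    show "additive_subgroup (mgr ?D i) ?D" for i
    proof (rule additive_subgroupI'[OF ab])
      show "\<zero>\<^bsub>?D\<^esub> \<in> mgr ?D i" using z by simp
      show "x \<oplus>\<^bsub>?D\<^esub> y \<in> mgr ?D i" if "x \<in> mgr ?D i" "y \<in> mgr ?D i" for x y
        using that ad N.N.gr.homog_add by simp
      show "\<ominus>\<^bsub>?D\<^esub> x \<in> mgr ?D i" if "x \<in> mgr ?D i" for x
        using that neg[of x] ng[of x] N.N.gr.homog_neg by simp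
    qed auto
    show "additive_map ?D ?D (hcomp N (mgr N) i)" for i
      using hc by (auto simp: additive_map_def N.N.gr.hcomp_add)
    show "hcomp N (mgr N) i x = x" if "x \<in> mgr ?D i" for i x
      using that N.N.gr.hcomp_homog[of x i i] by simp
    show "hcomp N (mgr N) i x = \<zero>\<^bsub>?D\<^esub>" if "x \<in> mgr ?D j" "j \<noteq> i" for i j x
      using that N.N.gr.hcomp_homog[of x j i] by simp
    show "\<exists>c. decomposes ?D (mgr ?D) x c" if x: "x \<in> carrier ?D" for x
    proof
      let ?c = "\<lambda>i. hcomp N (mgr N) i x"
      have xN: "x \<in> carrier N" using x by simp
      have "finsum ?D ?c {i. ?c i \<noteq> \<zero>\<^bsub>N\<^esub>} = finsum N ?c {i. ?c i \<noteq> \<zero>\<^bsub>N\<^esub>}"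
        by (rule fs) (use hc x in auto)
      also have "\<dots> = x" using N.N.gr.hcomp_finsum[OF xN N.N.gr.finite_hcomp[OF xN] order_refl] .
      finally show "decomposes ?D (mgr ?D) x ?c"
        using hc[of x] x N.N.gr.finite_hcomp[OF xN] N.N.gr.hcomp_mem[OF xN] by (auto simp: decomposes_def)
    qed
  qed
  have sgD: "sg ?D i x = sg N i x" if "x \<in> ?S" for i :: int and x
    using that by (simp add: sg_def neg)
  have act: "act N x b \<in> ?S" if "x \<in> ?S" "b \<in> carrier B" for x b
    using that f g N.N.act_closed by (auto simp: dg_hom_def)
  have dif: "mdiff N x \<in> ?S" if "x \<in> ?S" for x
    using that f g N.N.mdiff_closed by (auto simp: dg_hom_def)
  show ?thesis
  proof (intro dg_module.intro dg_module_axioms.intro ab gr)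
    show "mdiff ?D (act ?D x b) = act ?D (mdiff ?D x) b \<oplus>\<^bsub>?D\<^esub> sg ?D i (act ?D x (adiff B b))"
      if "x \<in> mgr ?D i" "b \<in> carrier B" for x b i
      using that act[of x "adiff B b"] by (simp add: sgD N.N.mdiff_act N.B.adiff_closed)
    show "act ?D x b \<in> carrier ?D" if "x \<in> carrier ?D" "b \<in> carrier B" for x b
      using act that by simp
    show "act ?D x b \<in> mgr ?D (i + int n)" if "x \<in> mgr ?D i" "b \<in> agr B n" for x b i n
      using act[of x b] that N.B.agr_closed N.N.act_mgr by auto
    show "mdiff ?D x \<in> carrier ?D" if "x \<in> carrier ?D" for x using dif that by simp
    show "mdiff ?D x \<in> mgr ?D (i - 1)" if "x \<in> mgr ?D i" for x i
      using dif[of x] that N.N.mdiff_mgr by simp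
  qed (simp_all add: N.N.act_add_left N.N.act_add_right N.N.act_mult N.N.act_one N.N.mdiff_add N.N.mdiff_mdiff)
qed

text \<open>The idempotent \<open>\<rho>\<close> after \<open>\<pi>\<close> splits \<open>T\<close>;
  its image is a copy of \<open>N\<close>, embedded by \<open>\<rho>\<close> with inverse
  \<open>\<pi>\<close>.\<close>

lemma (in hom_complex) direct_summand_of_split:
  assumes \<rho>: "dg_hom B N T \<rho>" and \<pi>: "dg_hom B T N \<pi>" and sp: "\<And>x. x \<in> carrier N \<Longrightarrow> \<pi> (\<rho> x) = x"
  shows "direct_summand B N T"
proof -
  interpret TT: hom_complex R B T T by (intro hom_complex.intro T.dg_module_over_axioms)
  let ?e = "\<lambda>y. \<rho> (\<pi> y)"
  let ?S = "{y \<in> carrier T. ?e y = y}" and ?S' = "{y \<in> carrier T. ?e y = \<zero>\<^bsub>T\<^esub>}"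
  have eh: "dg_hom B T T ?e" by (rule dg_hom_comp[OF \<pi> \<rho>])
  have ea: "additive_map T T ?e" by (rule dg_hom_additive[OF eh])
  have \<pi>c: "\<pi> y \<in> carrier N" if "y \<in> carrier T" for y using \<pi> that by (auto simp: dg_hom_def)
  have \<rho>c: "\<rho> x \<in> carrier T" if "x \<in> carrier N" for x using \<rho> that by (auto simp: dg_hom_def)
  have "dg_module B (dg_submodule T ?S)" by (rule TT.dg_module_equalizer[OF eh dg_hom_id])
  moreover have "dg_module B (dg_submodule T ?S')"
    by (rule TT.dg_module_equalizer[OF eh T.dg_hom_zero[OF T.N.dg_module_axioms]])
  moreover have "?S \<inter> ?S' = {\<zero>\<^bsub>T\<^esub>}" using additive_map_zero[OF T.abN T.abN ea] by auto
  moreover have "carrier T = {x \<oplus>\<^bsub>T\<^esub> y | x y. x \<in> ?S \<and> y \<in> ?S'}"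
  proof (intro equalityI subsetI)
    fix y assume y: "y \<in> carrier T"
    let ?z = "y \<ominus>\<^bsub>T\<^esub> ?e y"
    have c: "?e y \<in> carrier T" using y \<pi>c \<rho>c by simp
    have i: "?e (?e y) = ?e y" using y \<pi>c sp by simp
    have "?e ?z = \<zero>\<^bsub>T\<^esub>"
      using additive_map_minus[OF T.abN T.abN ea y c] i c by (simp add: a_minus_def T.N.r_neg)
    moreover have "y = ?e y \<oplus>\<^bsub>T\<^esub> ?z"
      using y c T.N.r_neg2[of "?e y" y] by (simp add: a_minus_def T.N.a_ac T.N.r_neg)
    ultimately show "y \<in> {x \<oplus>\<^bsub>T\<^esub> y | x y. x \<in> ?S \<and> y \<in> ?S'}" using c i y by blast
  qed auto
  moreover have "dg_hom B N (dg_submodule T ?S) \<rho>"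
    using \<rho> sp \<rho>c N.N.gr.homog_closed unfolding dg_hom_def dg_submodule_def by (auto simp: image_subset_iff)
  moreover have "bij_betw \<rho> (carrier N) ?S"
    by (rule bij_betwI[where g = \<pi>]) (use \<pi>c \<rho>c sp in auto)
  ultimately show ?thesis
    unfolding direct_summand_def by (intro exI[of _ ?S] exI[of _ ?S'] conjI exI[of _ \<rho>]) auto
qed

section \<open>Identity morphisms in the derived category\<close>

lemma (in dg_module_over) normal_boundaries:
  "boundaries N i \<lhd> (add_monoid N)\<lparr>carrier := cycles N i\<rparr>"
proof -
  let ?C = "cycles N i"
  have mm: "mgr N j \<subseteq> carrier N" for j using N.gr.homog_closed by blast
  have z: "\<zero>\<^bsub>N\<^esub> \<in> mgr N j" for j by simp
  have neg: "inv\<^bsub>add_monoid N\<^esub> x = \<ominus>\<^bsub>N\<^esub> x" for x by (simp add: a_inv_def)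
  have C: "subgroup ?C (add_monoid N)"
  proof (rule group.subgroupI[OF N.a_group])
    show "?C \<subseteq> carrier (add_monoid N)" using mm by (auto simp: cycles_def)
    show "?C \<noteq> {}" using z[of i] mdiff_zero unfolding cycles_def by blast
    show "inv\<^bsub>add_monoid N\<^esub> x \<in> ?C" if "x \<in> ?C" for x
      using that mdiff_neg[OF N.gr.homog_closed, of x i] by (auto simp: cycles_def neg N.gr.homog_neg)
    show "x \<otimes>\<^bsub>add_monoid N\<^esub> y \<in> ?C" if "x \<in> ?C" "y \<in> ?C" for x y
      using that mm by (auto simp: cycles_def N.gr.homog_add N.mdiff_add subset_iff)
  qed
  have "subgroup (boundaries N i) (add_monoid N)"
  proof (rule group.subgroupI[OF N.a_group])
    show "boundaries N i \<subseteq> carrier (add_monoid N)" using mm N.mdiff_closed by (auto simp: boundaries_def)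
    show "boundaries N i \<noteq> {}" using z[of "i + 1"] unfolding boundaries_def by blast
    show "inv\<^bsub>add_monoid N\<^esub> x \<in> boundaries N i" if "x \<in> boundaries N i" for x
    proof -
      obtain y where "y \<in> mgr N (i + 1)" "x = mdiff N y" using \<open>x \<in> boundaries N i\<close> by (auto simp: boundaries_def)
      then show ?thesis
        using mdiff_neg[OF N.gr.homog_closed, of y "i + 1"] N.gr.homog_neg[of y "i + 1"] by (auto simp: boundaries_def neg intro!: image_eqI[of _ _ "\<ominus>\<^bsub>N\<^esub> y"])
    qed
    show "x \<otimes>\<^bsub>add_monoid N\<^esub> y \<in> boundaries N i" if "x \<in> boundaries N i" "y \<in> boundaries N i" for x y
    proof -
      obtain v w where "v \<in> mgr N (i + 1)" "x = mdiff N v" "w \<in> mgr N (i + 1)" "y = mdiff N w"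
        using \<open>x \<in> boundaries N i\<close> \<open>y \<in> boundaries N i\<close> by (auto simp: boundaries_def)
      then show ?thesis
        using N.mdiff_add[OF N.gr.homog_closed N.gr.homog_closed, of v "i + 1" w "i + 1"] N.gr.homog_add[of v "i + 1" w]
        by (auto simp: boundaries_def intro!: image_eqI[of _ _ "v \<oplus>\<^bsub>N\<^esub> w"])
    qed
  qed
  moreover have "boundaries N i \<subseteq> ?C"
    using mm N.mdiff_mgr[of _ "i + 1"] N.mdiff_mdiff by (auto simp: boundaries_def cycles_def)
  ultimately have "subgroup (boundaries N i) ((add_monoid N)\<lparr>carrier := ?C\<rparr>)"
    by (intro group.subgroup_incl[OF N.a_group _ C])
  moreover have "comm_group ((add_monoid N)\<lparr>carrier := ?C\<rparr>)"
    by (rule group.group_comm_groupI[OF subgroup.subgroup_is_group[OF C N.a_group]])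
       (auto simp: cycles_def N.a_comm[OF N.gr.homog_closed N.gr.homog_closed])
  ultimately show ?thesis by (rule comm_group.subgroup_imp_normal[rotated])
qed

text \<open>The induced map multiplies a coset of the boundaries by the boundaries, which leaves it
  unchanged.\<close>

lemma (in dg_module_over) quasi_iso_id: "quasi_iso B N N id"
  unfolding quasi_iso_def
proof (intro conjI allI)
  show "dg_hom B N N id" by (simp add: dg_hom_def)
  fix i
  let ?G = "(add_monoid N)\<lparr>carrier := cycles N i\<rparr>"
  interpret normal "boundaries N i" ?G by (rule normal_boundaries)
  have h: "homology_map N i id U = U" if "U \<in> carrier (homology N i)" for U
  proof -
    have "boundaries N i <#>\<^bsub>?G\<^esub> U = U"
      using rcosets_mult_eq that by (simp add: homology_def FactGroup_def)
    then show ?thesis by (simp add: homology_map_def set_mult_def)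
  qed
  interpret H: group "homology N i" unfolding homology_def by (rule factorgroup_is_group)
  show "homology_map N i id \<in> iso (homology N i) (homology N i)"
    using h by (auto simp: iso_def hom_def bij_betw_def inj_on_def image_iff)
qed

lemma (in dg_module_over) homotopic_refl:
  assumes "f \<in> carrier N \<rightarrow> carrier N" shows "homotopic B N N f f"
proof -
  interpret NN: hom_complex R B N N by (intro hom_complex.intro dg_module_over_axioms)
  have "(\<lambda>x\<in>carrier N. \<zero>\<^bsub>N\<^esub>) \<in> Hom_deg B N N 1" by (rule NN.HomI) (auto simp: additive_map_def)
  then show ?thesis
    unfolding homotopic_def using assms
    by (intro bexI[where x = "\<lambda>x\<in>carrier N. \<zero>\<^bsub>N\<^esub>"])
       (auto simp: N.mdiff_closed a_minus_def N.r_neg Pi_iff)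
qed

text \<open>Every roof involved is the identity roof with apex \<open>X\<close>, which is why the
  type of apexes is taken to be that of \<open>X\<close>.\<close>

lemma derived_iso_refl:
  fixes X :: "('b, 'z) dg_mod"
  assumes "dg_algebra R B" "dg_module B X"
  shows "derived_iso TYPE('z) B X X"
proof -
  interpret X: dg_module_over R B X using assms by (intro dg_module_over.intro)
  have h: "homotopic B X X id id" by (rule X.homotopic_refl) simp
  have d: "dg_hom B X X id" by (simp add: dg_hom_def)
  let ?r = "(X, id, id) :: ('b, 'z, 'z, 'z) roof"
  have "is_roof B X X ?r" using assms(2) X.quasi_iso_id d by simp
  moreover have "roof_comp B X X X ?r ?r ?r"
    using assms(2) X.quasi_iso_id d h by (auto intro!: exI[of _ id])
  moreover have "roof_equiv B X X ?r (id_roof X)"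
    using assms(2) X.quasi_iso_id d h by (auto simp: id_roof_def intro!: exI[of _ X] exI[of _ id])
  ultimately show ?thesis unfolding derived_iso_def by blast
qed

text \<open>A semifree module is its own semifree resolution, so \<open>M\<close> and
  \<open>P\<close> are both \<open>N\<close> and the derived tensor product is represented by the
  ordinary one.\<close>

lemma liftable_tensor:
  fixes N :: "('b, 'n) dg_mod"
  assumes "base_change R A B N" "semifree A N"
  shows "liftable TYPE('n) TYPE((('n \<times> 'b) \<Rightarrow>\<^sub>0 int) set) A B (tensor A N B)"
proof -
  interpret base_change R A B N by fact
  have N: "dg_module A N" by (rule module_restrict[OF N.dg_module_axioms])
  interpret NA: dg_module_over R A N by (intro dg_module_over.intro A.dg_algebra_axioms N)
  show ?thesis
    unfolding liftable_def
    using N assms(2) NA.quasi_iso_id derived_iso_refl[OF B.dg_algebra_axioms dg_module_T] by blast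
qed

theorem mainTheorem1:
  fixes R :: "('r, 'x) ring_scheme"
    and A B :: "('r, 'b) dg_alg"
    and n :: nat
    and Xs :: "nat \<Rightarrow> 'b" and e :: "nat \<Rightarrow> nat"
    and N :: "('b, 'n) dg_mod"
  assumes "cring R"
    and "dg_algebra R A"
    and "0 < n"
    and "polynomial_extension R A n Xs e B \<or>
         (divided_power_dg_algebra R A \<and> free_extension R A n Xs e B)"
    and "dg_module B N" and "bounded_below N" and "semifree B N"
    and "\<forall>i>0. trivial_group (Ext B i N N)"
  shows "naively_liftable A B N \<and>
    (\<exists>L :: ('b, (('n \<times> 'b) \<Rightarrow>\<^sub>0 int) set) dg_mod.
       dg_module B L \<and>
       liftable TYPE('n) TYPE((('n \<times> 'b) \<Rightarrow>\<^sub>0 int) set) A B L \<and>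
       direct_summand B N L)"
proof -
  obtain E where E: "E = simple_free_ext R \<or> E = simple_poly_ext R" and it: "iterated_ext E A n Xs e B"
    using assms(4) unfolding polynomial_extension_def free_extension_def by blast
  \<comment> \<open>That \<open>B\<close> is a DG algebra is read off from the last adjunction,
    which exists since \<open>n\<close> is positive.\<close>
  have "\<exists>C. dg_subalgebra R C B"
  proof -
    obtain C where C: "C n = B" "\<And>i. i < n \<Longrightarrow> E (C i) (Xs i) (e i) (C (Suc i))"
      using it by (auto simp: iterated_ext_def)
    have "E (C (n - 1)) (Xs (n - 1)) (e (n - 1)) B" using C(2)[of "n - 1"] C(1) assms(3) by simp
    then show ?thesis using E unfolding simple_free_ext_def simple_poly_ext_def adjunction_def by blast
  qed
  then have B: "dg_algebra R B" by (auto simp: dg_subalgebra_def)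
  interpret N: dg_module_over R B N by (intro dg_module_over.intro B assms(5))
  interpret NN: hom_complex R B N N by (intro hom_complex.intro N.dg_module_over_axioms)
  have "tower_state R B N A"
    by (rule tower_descent[OF it E assms(5-7) N.tower_start[OF assms(7) NN.acyclic_of_Ext[OF assms(8)]]])
  then have AB: "dg_subalgebra R A B"
    and F: "\<exists>F\<subseteq>(\<Union>i. mgr N i). free_basis A N (act N) (\<lambda>x. x) F"
    and \<rho>: "\<exists>\<rho>\<in>Hom_cycles B N (tensor A N B) 0. \<forall>x\<in>carrier N. tensor_eval N (\<rho> x) = x"
    by (simp_all add: tower_state_def)
  interpret S: base_change R A B N by (intro base_change.intro dg_subI[OF AB] N.dg_module_over_axioms)
  interpret NA: dg_module_over R A N
    by (intro dg_module_over.intro S.A.dg_algebra_axioms S.module_restrict[OF assms(5)])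
  interpret NT: hom_complex R B N S.T
    by (intro hom_complex.intro dg_module_over.intro N.dg_module_over_axioms B S.dg_module_T)
  \<comment> \<open>The homogeneous basis over \<open>A\<close> carried along the tower and the
    lower bound on degrees give semifreeness over \<open>A\<close>, with an order newly chosen by
    degree.\<close>
  have sf: "semifree A N" using F NA.semifreeI assms(6) by blast
  obtain \<rho> where \<rho>: "\<rho> \<in> Hom_cycles B N S.T 0" "\<And>x. x \<in> carrier N \<Longrightarrow> tensor_eval N (\<rho> x) = x"
    using \<rho> by blast
  have "\<rho> \<in> Hom_deg B N S.T 0" "\<forall>x\<in>carrier N. mdiff S.T (\<rho> x) = \<rho> (mdiff N x)"
    using \<rho>(1) by (simp_all add: NT.cycle_iff sg_def)
  then have \<rho>h: "dg_hom B N S.T \<rho>"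
    using NT.Hom_closed NT.Hom_add NT.Hom_act NT.Hom_mgr[of \<rho> 0] by (auto simp: dg_hom_def)
  have "naively_liftable A B N" using \<rho>h \<rho>(2) by (auto simp: naively_liftable_def)
  moreover have "direct_summand B N S.T"
    by (rule NT.direct_summand_of_split[OF \<rho>h S.dg_hom_ev \<rho>(2)])
  ultimately show ?thesis
    using S.dg_module_T liftable_tensor[OF S.base_change_axioms sf] by blast
qed

end
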